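(* Let $g\ge1$ be a fixed integer. Assume $\{X_t\}$ is a Gaussian stationary process with spectral density $f(\omega)=|\omega|^{-2d}f_\star(\omega)$, $d\in(-1/2,1/2)$, with $f_\star\in\mathcal{L}(\mu,\nu)$ for some $\mu\ge1,\nu\in(0,1]$, and that for some $\Omega_0\in(0,\pi]$, $f_\star$ is three times differentiable on $[-\Omega_0,\Omega_0]$ with $f_\star'(0)=0$ and $f_\star''$, $f_\star'''$ bounded on $[-\Omega_0,\Omega_0]$. Let $m_n\to\infty$ with $m_n/n\to0$. Then \[ \mathbb{E}[\hat d_{m_n,g}]-d=-\frac{2\pi^2f_\star''(0)m_n^2}{9f_\star(0)n^2}+o\Big(\frac{m_n^2}{n^2}\Big)+O\Big(\frac{\log^3 m_n}{m_n}\Big),\qquad \mathrm{Var}(\hat d_{m_n,g})=\frac{\psi'(g)}{4m_n}+o\Big(\frac1{m_n}\Big). \]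
   Context: Sample $X_1,\dots,X_{gn}$ split into $g$ epochs of length $n$; $\omega_k=2\pi k/n$; $I_{\ell,n}(\omega)=(2\pi n)^{-1}|\sum_{t=1}^nX_{t+\ell n}e^{\mathrm{i}t\omega}|^2$, $\bar I_{g,n}=g^{-1}\sum_{\ell=0}^{g-1}I_{\ell,n}$. The estimator is $\hat d_{m,g}=\sum_{k=1}^m a_{k,n}(m)\log\bar I_{g,n}(\omega_k)$ with $a_{k,n}(m)=\big(-2\log\omega_k-\bar c_m\big)/\sum_{i=1}^m(-2\log\omega_i-\bar c_m)^2$, $\bar c_m=m^{-1}\sum_{i=1}^m(-2\log\omega_i)$. $\psi$ is the digamma function. $\mathcal{L}(\mu,\nu)$ is the set of $\phi:[-\pi,\pi]\to\mathbb{R}_+$ with $\max\phi\le\mu\phi(0)$ and, for $\omega,\omega'\ne0$, $|\phi(\omega)-\phi(\omega')|\le\mu\phi(0)|\omega-\omega'|/(|\omega|\wedge|\omega'|)$ and $|\phi(\omega)-\phi(\omega')|\le\mu\phi(0)||\omega|-|\omega'||^\nu$. *)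

theory Defs
  imports "HOL-Probability.Probability" "HOL-Library.Landau_Symbols"
begin

definition gaussian_rv :: "'a measure \<Rightarrow> ('a \<Rightarrow> real) \<Rightarrow> bool" where
  "gaussian_rv M Y \<longleftrightarrow>
     (\<exists>m \<sigma>. \<sigma> > 0 \<and> distributed M lborel Y (normal_density m \<sigma>)) \<or>
     (\<exists>m. AE x in M. Y x = m)"

definition gaussian_process :: "'a measure \<Rightarrow> (nat \<Rightarrow> 'a \<Rightarrow> real) \<Rightarrow> bool" where
  "gaussian_process M X \<longleftrightarrow>
     (\<forall>t. X t \<in> borel_measurable M) \<and>
     (\<forall>I c. finite I \<longrightarrow> gaussian_rv M (\<lambda>x. \<Sum>t\<in>I. c t * X t x))"

definition classL :: "real \<Rightarrow> real \<Rightarrow> (real \<Rightarrow> real) \<Rightarrow> bool" where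
  "classL \<mu> \<nu> \<phi> \<longleftrightarrow>
     (\<forall>\<omega>\<in>{-pi..pi}. 0 \<le> \<phi> \<omega>) \<and>
     (\<forall>\<omega>\<in>{-pi..pi}. \<phi> \<omega> \<le> \<mu> * \<phi> 0) \<and>
     (\<forall>\<omega>\<in>{-pi..pi}. \<forall>\<omega>'\<in>{-pi..pi}. \<omega> \<noteq> 0 \<longrightarrow> \<omega>' \<noteq> 0 \<longrightarrow>
        \<bar>\<phi> \<omega> - \<phi> \<omega>'\<bar> \<le> \<mu> * \<phi> 0 * \<bar>\<omega> - \<omega>'\<bar> / min \<bar>\<omega>\<bar> \<bar>\<omega>'\<bar>) \<and>
     (\<forall>\<omega>\<in>{-pi..pi}. \<forall>\<omega>'\<in>{-pi..pi}. \<omega> \<noteq> 0 \<longrightarrow> \<omega>' \<noteq> 0 \<longrightarrow>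
        \<bar>\<phi> \<omega> - \<phi> \<omega>'\<bar> \<le> \<mu> * \<phi> 0 * \<bar>\<bar>\<omega>\<bar> - \<bar>\<omega>'\<bar>\<bar> powr \<nu>)"

definition fourier_freq :: "nat \<Rightarrow> nat \<Rightarrow> real" where
  "fourier_freq n k = 2 * pi * real k / real n"

definition epoch_periodogram :: "(nat \<Rightarrow> 'a \<Rightarrow> real) \<Rightarrow> nat \<Rightarrow> nat \<Rightarrow> real \<Rightarrow> 'a \<Rightarrow> real" where
  "epoch_periodogram X n l \<omega> x =
     (cmod (\<Sum>t=1..n. complex_of_real (X (t + l * n) x) * cis (real t * \<omega>)))\<^sup>2 / (2 * pi * real n)"

definition avg_periodogram :: "(nat \<Rightarrow> 'a \<Rightarrow> real) \<Rightarrow> nat \<Rightarrow> nat \<Rightarrow> real \<Rightarrow> 'a \<Rightarrow> real" where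
  "avg_periodogram X g n \<omega> x = (\<Sum>l<g. epoch_periodogram X n l \<omega> x) / real g"

definition cbar :: "nat \<Rightarrow> nat \<Rightarrow> real" where
  "cbar n m = (\<Sum>i=1..m. - 2 * ln (fourier_freq n i)) / real m"

definition lp_weight :: "nat \<Rightarrow> nat \<Rightarrow> nat \<Rightarrow> real" where
  "lp_weight n m k = (- 2 * ln (fourier_freq n k) - cbar n m) /
                     (\<Sum>i=1..m. (- 2 * ln (fourier_freq n i) - cbar n m)\<^sup>2)"

definition d_hat :: "(nat \<Rightarrow> 'a \<Rightarrow> real) \<Rightarrow> nat \<Rightarrow> nat \<Rightarrow> nat \<Rightarrow> 'a \<Rightarrow> real" where
  "d_hat X g n m x = (\<Sum>k=1..m. lp_weight n m k * ln (avg_periodogram X g n (fourier_freq n k) x))"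

end

theory Submission
  imports Defs "HOL-Real_Asymp.Real_Asymp"
begin

text \<open>Fix a Fourier frequency and let \<open>Y\<close> be the sum of squares of the real and imaginary parts of the
  normalised discrete Fourier transforms over all epochs, a Gaussian vector \<open>Z\<close> with covariance
  matrix \<open>S\<close>. Expressing \<open>exp (- s |Z|\<^sup>2)\<close> as an average of characteristic functions over an auxiliary
  standard normal vector \<open>w\<close> gives \<open>E exp (- s Y) = E exp (- s (w, S w))\<close>. When \<open>S\<close> is within \<open>\<delta>\<close> of half
  the identity, integrating against \<open>s powr (u - 1)\<close> pins \<open>E Y powr (- u)\<close> between
  \<open>(1 \<pm> \<delta>) powr (- u) * Gamma (g - u) / Gamma g\<close>, and expanding at \<open>u = 0\<close> yields the mean and the variance
  of \<open>ln Y\<close>. For two frequencies, flipping the sign of one block of \<open>w\<close> turns the contribution of the cross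
  covariance into a hyperbolic cosine, so the covariance of the logarithms is quadratic in the
  cross covariance.

  The covariances at the frequencies \<open>k \<le> j\<close> differ from those of white noise by
  \<open>O((j / k) powr |d| * (1 + ln j) / k)\<close>: subtracting the constant spectral density \<open>f(\<omega>\<^sub>k)\<close> costs nothing
  because the tapers are exactly orthogonal, and the remainder is a relative variation of \<open>f\<close> integrated
  against two Dirichlet kernels. Summed with the regression weights, the means give the \<open>ln\<^sup>3 m / m\<close> term
  and the Taylor expansion of \<open>ln f\<^sub>\<star>\<close> gives the \<open>m\<^sup>2 / n\<^sup>2\<close> term. In the variance, the lowest
  \<open>m powr (1 - \<theta>)\<close> frequencies are negligible in mean square if \<open>\<theta> > 1/2\<close>, and above them the
  off-diagonal covariances sum to \<open>o(1 / m)\<close> if \<open>\<theta> * (1 + 2 |d|) < 1\<close>.\<close>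

section \<open>Gaussian families and Laplace transforms\<close>

text \<open>The sums of squares have no tractable density, and for the first few \<open>k\<close>
  the covariance matrix is not known to be close to half the identity, nor to be invertible; only
  inequalities between quadratic forms are at hand. Laplace transforms respect such inequalities,
  and Mellin integrals carry them to negative moments. Half the identity is the white-noise case,
  where \<open>Y\<close> is a Gamma variable of shape \<open>g\<close>; this is where digamma and
  trigamma come from. That the covariance of two logarithms is quadratic in the cross covariance is
  decisive. A linear bound of order \<open>1 / k\<close> would sum, against weights of order
  \<open>ln m / m\<close>, to \<open>1 / m\<close> times powers of \<open>ln m\<close> even for
  \<open>d = 0\<close>. Its square is at most \<open>1 / k\<close> times \<open>1 / K\<close> above
  the cut \<open>K = m powr (1 - \<theta>)\<close>, and \<open>1 / K\<close> pays for the logarithms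
  and for \<open>(j / k) powr (2 * |d|)\<close>. Below the cut only uniform moment bounds hold, so
  the weights enter through the square of their absolute sum, of order
  \<open>m powr (- 2 * \<theta>)\<close> up to logarithms. The two demands on
  \<open>\<theta>\<close> are compatible because \<open>|d| < 1/2\<close>.\<close>

abbreviation normal_vec :: "'i set \<Rightarrow> ('i \<Rightarrow> real) measure" where
  "normal_vec I \<equiv> PiM I (\<lambda>_. std_normal_distribution)"

definition quad_form :: "'i set \<Rightarrow> ('i \<Rightarrow> 'i \<Rightarrow> real) \<Rightarrow> ('i \<Rightarrow> real) \<Rightarrow> real" where
  "quad_form I S w = (\<Sum>i\<in>I. \<Sum>j\<in>I. w i * w j * S i j)"

definition sqnorm :: "'i set \<Rightarrow> ('i \<Rightarrow> real) \<Rightarrow> real" where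
  "sqnorm I w = (\<Sum>i\<in>I. (w i)\<^sup>2)"

definition centred_gaussian ::
    "'a measure \<Rightarrow> 'i set \<Rightarrow> ('i \<Rightarrow> 'a \<Rightarrow> real) \<Rightarrow> ('i \<Rightarrow> 'i \<Rightarrow> real) \<Rightarrow> bool" where
  "centred_gaussian M I Z S \<longleftrightarrow> finite I \<and> (\<forall>i\<in>I. Z i \<in> borel_measurable M) \<and>
     (\<forall>c. (CLINT x|M. iexp (\<Sum>i\<in>I. c i * Z i x)) = complex_of_real (exp (- quad_form I S c / 2)))"

lemma sqnorm_nonneg: "0 \<le> sqnorm I w"
  by (simp add: sqnorm_def sum_nonneg)

lemma prob_space_std_normal: "prob_space std_normal_distribution"
  by (rule prob_space_normal_density) simp

lemma prob_space_normal_vec: "prob_space (normal_vec I)"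
  by (intro prob_space_PiM prob_space_std_normal)

lemma product_sigma_finite_normal: "product_sigma_finite (\<lambda>_. std_normal_distribution)"
  using prob_space_std_normal by (simp add: product_sigma_finite_def prob_space_imp_sigma_finite)

lemma iexp_sum: "finite A \<Longrightarrow> iexp (\<Sum>i\<in>A. f i) = (\<Prod>i\<in>A. iexp (f i))"
  by (simp add: sum_distrib_left exp_sum)



lemma integrable_bounded_prob:
  fixes f :: "'a \<Rightarrow> 'b::{banach, second_countable_topology}"
  assumes "prob_space M" "f \<in> borel_measurable M" "\<And>x. norm (f x) \<le> B"
  shows "integrable M f"
proof -
  interpret prob_space M by fact
  show ?thesis by (rule integrable_const_bound[of _ B]) (use assms in auto)
qed

lemma iexp_measurable: "f \<in> borel_measurable M \<Longrightarrow> (\<lambda>x. iexp (f x)) \<in> borel_measurable M"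
  by measurable

lemma quad_form_measurable[measurable]:
  "(\<lambda>w. quad_form I S (\<lambda>i. \<sigma> i * w i)) \<in> borel_measurable (normal_vec I)"
  unfolding quad_form_def by measurable

text \<open>A characteristic function has modulus at most 1, so the exponent cannot be
  positive.\<close>

lemma centred_gaussian_psd:
  assumes "prob_space M" "centred_gaussian M I Z S"
  shows "0 \<le> quad_form I S c"
proof -
  interpret prob_space M by fact
  have "norm (CLINT x|M. iexp (\<Sum>i\<in>I. c i * Z i x)) \<le> (LINT x|M. 1)"
    by (rule order_trans[OF integral_norm_bound]) (simp)
  hence "exp (- quad_form I S c / 2) \<le> 1"
    using assms(2) by (simp add: centred_gaussian_def prob_space)
  thus ?thesis by simp
qed

text \<open>Writing \<open>exp (- \<sigma>\<^sup>2 z\<^sup>2 / 2)\<close> as a characteristic function of an auxiliary standard normal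
  variable turns functions of the squares into linear combinations of the \<open>Z i\<close>.\<close>
lemma gaussian_laplace:
  assumes P: "prob_space M" and G: "centred_gaussian M I Z S"
  shows "(LINT x|M. exp (- (\<Sum>i\<in>I. (\<sigma> i)\<^sup>2 * (Z i x)\<^sup>2) / 2)) =
         (LINT w|normal_vec I. exp (- quad_form I S (\<lambda>i. \<sigma> i * w i) / 2))"
proof -
  interpret M: prob_space M by fact
  interpret N: prob_space "normal_vec I" by (rule prob_space_normal_vec)
  interpret pair_sigma_finite M "normal_vec I" by unfold_locales
  interpret PP: pair_prob_space M "normal_vec I" by unfold_locales
  have fin: "finite I" and Zm[measurable]: "\<And>i. i \<in> I \<Longrightarrow> Z i \<in> borel_measurable M"
    and cf: "\<And>c. (CLINT x|M. iexp (\<Sum>i\<in>I. c i * Z i x)) = complex_of_real (exp (- quad_form I S c / 2))"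
    using G by (auto simp: centred_gaussian_def)
  \<comment> \<open>For fixed \<open>x\<close> the average over \<open>w\<close> factorises into
    characteristic functions of independent standard normal variables; for fixed \<open>w\<close>
    the exponent is a linear combination of the \<open>Z i\<close> with coefficients
    \<open>\<sigma> i * w i\<close>. Integrating in the two orders gives the two sides.\<close>
  define F where "F x w = iexp (\<Sum>i\<in>I. (\<sigma> i * w i) * Z i x)" for x and w :: "'b \<Rightarrow> real"
  have meas: "(\<lambda>(x, w). F x w) \<in> borel_measurable (M \<Otimes>\<^sub>M normal_vec I)"
    unfolding F_def split_beta by (intro iexp_measurable borel_measurable_sum) measurable
  have int: "integrable (M \<Otimes>\<^sub>M normal_vec I) (\<lambda>(x, w). F x w)"
    by (rule integrable_bounded_prob[OF _ meas, of 1]) (auto simp: F_def PP.prob_space_axioms)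
  have one: "(CLINT w|std_normal_distribution. iexp (t * w)) = complex_of_real (exp (- t\<^sup>2 / 2))" for t
    using fun_cong[OF char_std_normal_distribution, of t] by (simp add: char_def)
  have inner: "(CLINT w|normal_vec I. F x w) = complex_of_real (exp (- (\<Sum>i\<in>I. (\<sigma> i)\<^sup>2 * (Z i x)\<^sup>2) / 2))" for x
  proof -
    have "(CLINT w|normal_vec I. F x w) = (CLINT w|normal_vec I. (\<Prod>i\<in>I. iexp ((\<sigma> i * Z i x) * w i)))"
      unfolding F_def iexp_sum[OF fin] by (simp add: mult_ac)
    also have "\<dots> = (\<Prod>i\<in>I. CLINT w|std_normal_distribution. iexp ((\<sigma> i * Z i x) * w))"
      by (rule product_sigma_finite.product_integral_prod[OF product_sigma_finite_normal fin])
         (rule integrable_bounded_prob[OF prob_space_std_normal, of _ 1], auto)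
    also have "\<dots> = (\<Prod>i\<in>I. complex_of_real (exp (- ((\<sigma> i)\<^sup>2 * (Z i x)\<^sup>2) / 2)))"
      unfolding one by (simp add: power_mult_distrib)
    also have "\<dots> = complex_of_real (exp (\<Sum>i\<in>I. - ((\<sigma> i)\<^sup>2 * (Z i x)\<^sup>2) / 2))"
      by (simp add: exp_sum[OF fin])
    also have "(\<Sum>i\<in>I. - ((\<sigma> i)\<^sup>2 * (Z i x)\<^sup>2) / 2) = - (\<Sum>i\<in>I. (\<sigma> i)\<^sup>2 * (Z i x)\<^sup>2) / 2"
      by (simp add: sum_negf sum_divide_distrib)
    finally show ?thesis .
  qed
  have outer: "(CLINT x|M. F x w) = complex_of_real (exp (- quad_form I S (\<lambda>i. \<sigma> i * w i) / 2))" for w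
    unfolding F_def using cf[of "\<lambda>i. \<sigma> i * w i"] by simp
  have "(CLINT w|normal_vec I. CLINT x|M. F x w) = (CLINT x|M. CLINT w|normal_vec I. F x w)"
    by (rule Fubini_integral[OF int])
  thus ?thesis unfolding inner outer
    by (simp only: integral_complex_of_real of_real_eq_iff)
qed

section \<open>Mellin integrals and negative moments\<close>

lemma nn_integral_Gamma_scaled:
  assumes "0 < u" "0 < y"
  shows "(\<integral>\<^sup>+s. ennreal (indicator {0<..} s * s powr (u - 1) * exp (- s * y)) \<partial>lborel)
       = ennreal (Gamma u * y powr (- u))"
proof -
  have "((\<lambda>t. t powr (u - 1) / exp t) has_integral Gamma u) {0..}"
    by (rule Gamma_integral_real) fact
  hence "((\<lambda>t. if t \<in> {0..} then t powr (u - 1) / exp t else 0) has_integral Gamma u) UNIV"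
    by (simp only: has_integral_restrict_UNIV)
  hence hi: "((\<lambda>t. indicator {0<..} t * t powr (u - 1) * exp (- t)) has_integral Gamma u) UNIV"
    by (rule has_integral_spike[of "{}", rotated 2]) (auto simp: indicator_def exp_minus field_simps)
  have base: "(\<integral>\<^sup>+t. ennreal (indicator {0<..} t * t powr (u - 1) * exp (- t)) \<partial>lborel) = ennreal (Gamma u)"
    by (rule nn_integral_has_integral_lborel[OF _ _ hi]) auto
  have "(\<integral>\<^sup>+t. ennreal (indicator {0<..} t * t powr (u - 1) * exp (- t)) \<partial>lborel)
     = ennreal y * (\<integral>\<^sup>+s. ennreal (indicator {0<..} (y * s) * (y * s) powr (u - 1) * exp (- (y * s))) \<partial>lborel)"
    using assms nn_integral_real_affine[of "\<lambda>t. ennreal (indicator {0<..} t * t powr (u - 1) * exp (- t))" y 0]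
    by simp
  also have "\<dots> = ennreal y * (\<integral>\<^sup>+s. ennreal (y powr (u - 1)) * ennreal (indicator {0<..} s * s powr (u - 1) * exp (- s * y)) \<partial>lborel)"
    using assms by (intro arg_cong2[where f="(*)"] nn_integral_cong refl)
      (auto simp: indicator_def zero_less_mult_iff powr_mult ennreal_mult[symmetric] mult_ac)
  also have "\<dots> = ennreal (y powr u) * (\<integral>\<^sup>+s. ennreal (indicator {0<..} s * s powr (u - 1) * exp (- s * y)) \<partial>lborel)"
    using assms by (subst nn_integral_cmult)
      (auto simp: mult.assoc[symmetric] ennreal_mult[symmetric] powr_diff)
  finally have "ennreal (Gamma u) = \<dots>" using base by simp
  hence "ennreal (y powr (-u)) * ennreal (Gamma u) = ennreal (y powr (-u)) * (ennreal (y powr u) * (\<integral>\<^sup>+s. ennreal (indicator {0<..} s * s powr (u - 1) * exp (- s * y)) \<partial>lborel))"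
    by simp
  also have "\<dots> = (\<integral>\<^sup>+s. ennreal (indicator {0<..} s * s powr (u - 1) * exp (- s * y)) \<partial>lborel)"
    using assms by (simp add: mult.assoc[symmetric] ennreal_mult[symmetric] powr_minus)
  finally show ?thesis using assms by (simp add: ennreal_mult[symmetric] Gamma_real_pos less_imp_le mult.commute)
qed

lemma integral_std_normal_exp_square:
  assumes "0 \<le> s"
  shows "(LINT w|std_normal_distribution. exp (- s * w\<^sup>2 / 2)) = (1 + s) powr (- 1 / 2)"
proof -
  \<comment> \<open>The standard normal density times \<open>exp (- s * w\<^sup>2 / 2)\<close> is
    \<open>\<tau>\<close> times the density of a centred normal variable with standard deviation
    \<open>\<tau>\<close>.\<close>
  define \<tau> where "\<tau> = 1 / sqrt (1 + s)"
  have \<tau>: "\<tau> > 0" "\<tau>\<^sup>2 = 1 / (1 + s)" using assms by (auto simp: \<tau>_def power_divide)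
  have "(LINT w|std_normal_distribution. exp (- s * w\<^sup>2 / 2)) = (LINT w|lborel. std_normal_density w * exp (- s * w\<^sup>2 / 2))"
    by (subst integral_density) auto
  also have "\<dots> = (LINT w|lborel. \<tau> * normal_density 0 \<tau> w)"
  proof (intro Bochner_Integration.integral_cong refl)
    fix w :: real
    have "std_normal_density w * exp (- s * w\<^sup>2 / 2) = 1 / sqrt (2 * pi) * exp (- (1 + s) * w\<^sup>2 / 2)"
      unfolding std_normal_density_def by (simp add: exp_add[symmetric] field_simps)
    also have "\<dots> = \<tau> * normal_density 0 \<tau> w"
    proof -
      have "sqrt (2 * pi * \<tau>\<^sup>2) = \<tau> * sqrt (2 * pi)"
        using \<tau>(1) by (simp add: real_sqrt_mult)
      moreover have "- (w - 0)\<^sup>2 / (2 * \<tau>\<^sup>2) = - (1 + s) * w\<^sup>2 / 2"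
        using assms by (simp add: \<tau>(2) algebra_simps)
      ultimately show ?thesis unfolding normal_density_def using \<tau>(1) by simp
    qed
    finally show "std_normal_density w * exp (- s * w\<^sup>2 / 2) = \<tau> * normal_density 0 \<tau> w" .
  qed
  also have "\<dots> = \<tau>" using \<tau> by (simp add: integral_normal_density)
  also have "\<tau> = (1 + s) powr (- 1 / 2)"
  proof -
    have "(1 + s) powr (- (1 / 2)) = 1 / (1 + s) powr (1 / 2)" by (rule powr_minus_divide)
    thus ?thesis using assms by (simp add: \<tau>_def powr_half_sqrt)
  qed
  finally show ?thesis .
qed

text \<open>Coordinates outside \<open>I\<close> contribute factors 1. The larger index set
  \<open>K\<close> is allowed because the two blocks of a pair are later integrated over their
  union.\<close>

lemma integral_normal_vec_exp_sqnorm: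
  assumes "finite K" "I \<subseteq> K" "0 \<le> s"
  shows "(LINT w|normal_vec K. exp (- s * sqnorm I w / 2)) = (1 + s) powr (- (real (card I) / 2))"
proof -
  have finI: "finite I" using assms finite_subset by blast
  have "(LINT w|normal_vec K. exp (- s * sqnorm I w / 2)) = (LINT w|normal_vec K. (\<Prod>i\<in>K. if i \<in> I then exp (- s * (w i)\<^sup>2 / 2) else 1))"
  proof (intro Bochner_Integration.integral_cong refl)
    fix w
    have "(\<Prod>i\<in>K. if i \<in> I then exp (- s * (w i)\<^sup>2 / 2) else 1) = (\<Prod>i\<in>I. exp (- s * (w i)\<^sup>2 / 2))"
      using assms by (simp add: prod.If_cases Int_absorb1)
    thus "exp (- s * sqnorm I w / 2) = (\<Prod>i\<in>K. if i \<in> I then exp (- s * (w i)\<^sup>2 / 2) else 1)"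
      unfolding sqnorm_def using finI
      by (simp add: exp_sum[symmetric] sum_distrib_left sum_divide_distrib sum_negf)
  qed
  also have "\<dots> = (\<Prod>i\<in>K. LINT w|std_normal_distribution. (if i \<in> I then exp (- s * w\<^sup>2 / 2) else 1))"
    by (rule product_sigma_finite.product_integral_prod[OF product_sigma_finite_normal assms(1)])
       (rule integrable_bounded_prob[OF prob_space_std_normal, of _ 1], use assms in auto)
  also have "\<dots> = (\<Prod>i\<in>K. if i \<in> I then (1 + s) powr (- 1 / 2) else 1)"
    using integral_std_normal_exp_square[OF assms(3)] prob_space.prob_space[OF prob_space_std_normal]
    by (intro prod.cong refl) simp
  also have "\<dots> = ((1 + s) powr (- 1 / 2)) ^ card I"
    using assms by (simp add: prod.If_cases Int_absorb1)
  also have "\<dots> = (1 + s) powr (- (real (card I) / 2))"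
    using assms by (subst powr_realpow[symmetric]) (auto simp: powr_powr)
  finally show ?thesis .
qed

text \<open>The indicator removes \<open>s \<le> 0\<close>, where \<open>exp (- s * Y x)\<close> may
  be unbounded and no Laplace estimate is available, so that all Mellin integrals can run over the
  whole line.\<close>

definition mellin_kernel :: "real \<Rightarrow> real \<Rightarrow> real" where
  "mellin_kernel u s = indicator {0<..} s * s powr (u - 1)"

lemma mellin_kernel_nonneg[simp]: "0 \<le> mellin_kernel u s"
  by (simp add: mellin_kernel_def)

lemma mellin_kernel_measurable[measurable]: "mellin_kernel u \<in> borel_measurable borel"
  unfolding mellin_kernel_def[abs_def] by measurable

lemma mellin_exp:
  assumes "0 < u" "0 < y"
  shows "(\<integral>\<^sup>+s. ennreal (mellin_kernel u s * exp (- (s * y))) \<partial>lborel) = ennreal (Gamma u * y powr (- u))"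
  using nn_integral_Gamma_scaled[OF assms] by (simp add: mellin_kernel_def)

text \<open>The function \<open>(1 + c * s) powr (- b)\<close> is the Laplace transform of
  \<open>c\<close> times a Gamma variable of shape \<open>b\<close>, and
  \<open>Gamma (b - u) / Gamma b\<close> is the moment of order \<open>- u\<close> of that Gamma
  variable. The proof writes the power as a Mellin integral in a second variable \<open>v\<close>
  and exchanges the order of integration.\<close>

lemma mellin_power:
  assumes "0 < u" "u < b" "0 < c"
  shows "(\<integral>\<^sup>+s. ennreal (mellin_kernel u s * (1 + c * s) powr (- b)) \<partial>lborel)
       = ennreal (Gamma u * (Gamma (b - u) / Gamma b) * c powr (- u))" (is "?L = _")
proof -

  have b: "0 < b" and Gb: "Gamma b > 0" using assms by (auto simp: Gamma_real_pos)
  have "ennreal (Gamma b) * ?L = (\<integral>\<^sup>+s. ennreal (mellin_kernel u s) * ennreal (Gamma b * (1 + c * s) powr (- b)) \<partial>lborel)"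
    by (subst nn_integral_cmult[symmetric]) (use Gb in \<open>auto simp: ennreal_mult[symmetric] mult_ac\<close>)
  also have "\<dots> = (\<integral>\<^sup>+s. (\<integral>\<^sup>+v. ennreal (mellin_kernel u s) * ennreal (mellin_kernel b v * exp (- v * (1 + c * s))) \<partial>lborel) \<partial>lborel)"
  proof (rule nn_integral_cong)
    fix s :: real
    show "ennreal (mellin_kernel u s) * ennreal (Gamma b * (1 + c * s) powr (- b)) =
      (\<integral>\<^sup>+v. ennreal (mellin_kernel u s) * ennreal (mellin_kernel b v * exp (- v * (1 + c * s))) \<partial>lborel)"
    proof (cases "s > 0")
      case True
      have "1 + c * s > 0" using True assms by (simp add: add_pos_pos)
      thus ?thesis using mellin_exp[OF b, of "1 + c * s"] by (simp add: nn_integral_cmult)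
    qed (simp add: mellin_kernel_def)
  qed
  also have "\<dots> = (\<integral>\<^sup>+v. (\<integral>\<^sup>+s. ennreal (mellin_kernel u s) * ennreal (mellin_kernel b v * exp (- v * (1 + c * s))) \<partial>lborel) \<partial>lborel)"
    by (rule lborel_pair.Fubini'[symmetric]) measurable
  also have "\<dots> = (\<integral>\<^sup>+v. ennreal (Gamma u * c powr (- u)) * ennreal (mellin_kernel (b - u) v * exp (- v * 1)) \<partial>lborel)"
  proof (rule nn_integral_cong)
    fix v :: real
    show "(\<integral>\<^sup>+s. ennreal (mellin_kernel u s) * ennreal (mellin_kernel b v * exp (- v * (1 + c * s))) \<partial>lborel)
      = ennreal (Gamma u * c powr (- u)) * ennreal (mellin_kernel (b - u) v * exp (- v * 1))"
    proof (cases "v > 0")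
      case True
      have "(\<integral>\<^sup>+s. ennreal (mellin_kernel u s) * ennreal (mellin_kernel b v * exp (- v * (1 + c * s))) \<partial>lborel)
        = (\<integral>\<^sup>+s. ennreal (mellin_kernel b v * exp (- v)) * ennreal (mellin_kernel u s * exp (- s * (v * c))) \<partial>lborel)"
        by (intro nn_integral_cong) (auto simp: ennreal_mult[symmetric] distrib_left exp_diff exp_minus field_simps)
      also have "\<dots> = ennreal (mellin_kernel b v * exp (- v)) * ennreal (Gamma u * (v * c) powr (- u))"
        using True assms by (subst nn_integral_cmult) (auto simp: mellin_exp)
      also have "\<dots> = ennreal (Gamma u * c powr (- u)) * ennreal (mellin_kernel (b - u) v * exp (- v * 1))"
      proof -
        have "v powr (b - u - 1) = v powr (b - 1) * v powr (- u)"
          by (simp add: powr_add[symmetric] algebra_simps)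
        thus ?thesis using True assms Gamma_real_pos[of u]
          by (simp add: ennreal_mult[symmetric] mellin_kernel_def powr_mult)
      qed
      finally show ?thesis .
    qed (simp add: mellin_kernel_def)
  qed
  also have "\<dots> = ennreal (Gamma u * c powr (- u)) * ennreal (Gamma (b - u) * 1)"
    using assms mellin_exp[of "b - u" 1] by (subst nn_integral_cmult) auto
  finally have *: "ennreal (Gamma b) * ?L = ennreal (Gamma u * c powr (- u)) * ennreal (Gamma (b - u) * 1)" .
  have "?L = ennreal (1 / Gamma b) * (ennreal (Gamma b) * ?L)"
    using Gb by (simp add: mult.assoc[symmetric] ennreal_mult[symmetric])
  also have "\<dots> = ennreal (Gamma u * (Gamma (b - u) / Gamma b) * c powr (- u))"
    unfolding * using Gb Gamma_real_pos[of u] Gamma_real_pos[of "b - u"] assms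
    by (simp add: ennreal_mult[symmetric] field_simps)
  finally show ?thesis .
qed

text \<open>Tonelli's theorem for nonnegative integrals: the exchange presupposes no integrability
  of negative powers of \<open>Y\<close>, which can therefore be deduced from it.\<close>

lemma mellin_expectation:
  assumes P: "prob_space M" and Y[measurable]: "Y \<in> borel_measurable M" and Y0: "\<And>x. 0 \<le> Y x"
  shows "(\<integral>\<^sup>+x. (\<integral>\<^sup>+s. ennreal (mellin_kernel u s * exp (- s * Y x)) \<partial>lborel) \<partial>M)
       = (\<integral>\<^sup>+s. ennreal (mellin_kernel u s * (LINT x|M. exp (- s * Y x))) \<partial>lborel)"
proof -
  interpret prob_space M by fact
  interpret pair_sigma_finite lborel M ..
  have "(\<integral>\<^sup>+x. (\<integral>\<^sup>+s. ennreal (mellin_kernel u s * exp (- s * Y x)) \<partial>lborel) \<partial>M)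
      = (\<integral>\<^sup>+s. (\<integral>\<^sup>+x. ennreal (mellin_kernel u s * exp (- s * Y x)) \<partial>M) \<partial>lborel)"
    by (rule Fubini') measurable
  also have "\<dots> = (\<integral>\<^sup>+s. ennreal (mellin_kernel u s * (LINT x|M. exp (- s * Y x))) \<partial>lborel)"
  proof (rule nn_integral_cong)
    fix s :: real
    show "(\<integral>\<^sup>+x. ennreal (mellin_kernel u s * exp (- s * Y x)) \<partial>M) = ennreal (mellin_kernel u s * (LINT x|M. exp (- s * Y x)))"
    proof (cases "s > 0")
      case True
      have "integrable M (\<lambda>x. exp (- s * Y x))"
        by (rule integrable_bounded_prob[OF P, of _ 1]) (use True Y0 in \<open>auto simp: mult_nonneg_nonneg\<close>)
      thus ?thesis by (subst nn_integral_eq_integral) auto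
    qed (simp add: mellin_kernel_def)
  qed
  finally show ?thesis .
qed

text \<open>On the event \<open>Y = 0\<close> the integrand equals 1 for every \<open>s\<close>, so
  its probability is at most \<open>(1 + c * s) powr (- b)\<close>, which tends to 0. Positivity
  matters because \<open>powr\<close> and \<open>ln\<close> have default values at 0, where the
  Mellin identity fails.\<close>

lemma AE_pos_of_laplace:
  assumes P: "prob_space M" and Y[measurable]: "Y \<in> borel_measurable M" and Y0: "\<And>x. 0 \<le> Y x"
    and b: "0 < b" and c: "0 < (c::real)" and le: "\<And>s. 0 < s \<Longrightarrow> (LINT x|M. exp (- s * Y x)) \<le> (1 + c * s) powr (- b)"
  shows "AE x in M. 0 < Y x"
proof -
  interpret prob_space M by fact
  define A where "A = {x \<in> space M. Y x = 0}"
  have [measurable]: "A \<in> events" unfolding A_def by measurable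
  have *: "prob A \<le> (1 + c * real n) powr (- b)" if "n > 0" for n :: nat
  proof -
    have "prob A = (LINT x|M. indicator A x)" by simp
    also have "\<dots> \<le> (LINT x|M. exp (- real n * Y x))"
      by (intro integral_mono integrable_bounded_prob[OF P, of _ 1]) (use Y0 in \<open>auto simp: indicator_def A_def mult_nonneg_nonneg\<close>)
    also have "\<dots> \<le> (1 + c * real n) powr (- b)" using le[of "real n"] that by simp
    finally show ?thesis .
  qed
  have "(\<lambda>n. (1 + c * real n) powr (- b)) \<longlonglongrightarrow> 0"
  proof -
    have "filterlim (\<lambda>n. 1 + c * real n) at_top sequentially"
      using c by (intro filterlim_tendsto_add_at_top[OF tendsto_const]
        filterlim_tendsto_pos_mult_at_top[OF tendsto_const _ filterlim_real_sequentially]) auto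
    thus ?thesis using b by (intro tendsto_neg_powr) auto
  qed
  hence "prob A \<le> 0"
    by (rule LIMSEQ_le_const) (use * in \<open>auto intro!: exI[of _ 1]\<close>)
  hence "prob A = 0" using measure_nonneg[of M A] by linarith
  hence "AE x in M. x \<notin> A" by (subst prob_eq_0[symmetric]) auto
  thus ?thesis using AE_space by eventually_elim (use Y0 in \<open>auto simp: A_def less_le\<close>)
qed

text \<open>The Laplace transform is dominated by that of \<open>c\<close> times a Gamma variable of
  shape \<open>b\<close>. Integrating the inequality against the nonnegative kernel compares the
  negative moments, and finiteness of the bound yields integrability.\<close>

lemma neg_moment_upper:
  assumes P: "prob_space M" and Y[measurable]: "Y \<in> borel_measurable M" and Y0: "\<And>x. 0 \<le> Y x"
    and u: "0 < u" "u < b" and c: "0 < (c::real)"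
    and le: "\<And>s. 0 < s \<Longrightarrow> (LINT x|M. exp (- s * Y x)) \<le> (1 + c * s) powr (- b)"
  shows "integrable M (\<lambda>x. Y x powr (- u))"
    and "(LINT x|M. Y x powr (- u)) \<le> c powr (- u) * (Gamma (b - u) / Gamma b)"
proof -
  have pos: "AE x in M. 0 < Y x" by (rule AE_pos_of_laplace[OF P Y Y0 _ c le]) (use u in auto)
  have Gu: "Gamma u > 0" "Gamma b > 0" "Gamma (b - u) > 0" using u by (auto intro!: Gamma_real_pos)
  have "(\<integral>\<^sup>+x. ennreal (Gamma u * Y x powr (- u)) \<partial>M) = (\<integral>\<^sup>+x. (\<integral>\<^sup>+s. ennreal (mellin_kernel u s * exp (- s * Y x)) \<partial>lborel) \<partial>M)"
    by (rule nn_integral_cong_AE) (use pos in eventually_elim, simp add: mellin_exp u)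
  also have "\<dots> = (\<integral>\<^sup>+s. ennreal (mellin_kernel u s * (LINT x|M. exp (- s * Y x))) \<partial>lborel)"
    by (rule mellin_expectation[OF P Y Y0])
  also have "\<dots> \<le> (\<integral>\<^sup>+s. ennreal (mellin_kernel u s * (1 + c * s) powr (- b)) \<partial>lborel)"
  proof (intro nn_integral_mono ennreal_leI)
    fix s :: real
    show "mellin_kernel u s * (LINT x|M. exp (- s * Y x)) \<le> mellin_kernel u s * (1 + c * s) powr (- b)"
      using le[of s] by (cases "s > 0") (auto simp: mellin_kernel_def mult_left_mono)
  qed
  also have "\<dots> = ennreal (Gamma u * (Gamma (b - u) / Gamma b) * c powr (- u))"
    by (rule mellin_power[OF u c])
  finally have *: "(\<integral>\<^sup>+x. ennreal (Gamma u * Y x powr (- u)) \<partial>M) \<le> ennreal (Gamma u * (Gamma (b - u) / Gamma b) * c powr (- u))" .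
  have i1: "integrable M (\<lambda>x. Gamma u * Y x powr (- u))"
  proof (rule integrableI_bounded)
    have "(\<integral>\<^sup>+x. ennreal (norm (Gamma u * Y x powr (- u))) \<partial>M) = (\<integral>\<^sup>+x. ennreal (Gamma u * Y x powr (- u)) \<partial>M)"
      using Gu by simp
    thus "(\<integral>\<^sup>+x. ennreal (norm (Gamma u * Y x powr (- u))) \<partial>M) < \<infinity>"
      using le_less_trans[OF * ennreal_less_top] by simp
  qed simp
  from integrable_mult_right[OF i1, of "1 / Gamma u"] Gu
  show i2: "integrable M (\<lambda>x. Y x powr (- u))" by simp
  have "ennreal (LINT x|M. Gamma u * Y x powr (- u)) \<le> ennreal (Gamma u * (Gamma (b - u) / Gamma b) * c powr (- u))"
    using * Gu by (subst nn_integral_eq_integral[symmetric, OF i1]) auto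
  hence "Gamma u * (LINT x|M. Y x powr (- u)) \<le> Gamma u * ((Gamma (b - u) / Gamma b) * c powr (- u))"
    using Gu i2 by (subst (asm) ennreal_le_iff) (auto simp: mult.assoc)
  thus "(LINT x|M. Y x powr (- u)) \<le> c powr (- u) * (Gamma (b - u) / Gamma b)"
    using mult_le_cancel_left_pos[OF Gu(1)] by (simp only: mult.commute)
qed

text \<open>Positivity and integrability are assumed here because a lower bound on the Laplace
  transform gives neither.\<close>

lemma neg_moment_lower:
  assumes P: "prob_space M" and Y[measurable]: "Y \<in> borel_measurable M" and Y0: "\<And>x. 0 \<le> Y x"
    and pos: "AE x in M. 0 < Y x" and int: "integrable M (\<lambda>x. Y x powr (- u))"
    and u: "0 < u" "u < b" and c: "0 < (c::real)"
    and ge: "\<And>s. 0 < s \<Longrightarrow> (1 + c * s) powr (- b) \<le> (LINT x|M. exp (- s * Y x))"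
  shows "c powr (- u) * (Gamma (b - u) / Gamma b) \<le> (LINT x|M. Y x powr (- u))"
proof -
  have Gu: "Gamma u > 0" "Gamma b > 0" "Gamma (b - u) > 0" using u by (auto intro!: Gamma_real_pos)
  have "ennreal (Gamma u * (Gamma (b - u) / Gamma b) * c powr (- u)) = (\<integral>\<^sup>+s. ennreal (mellin_kernel u s * (1 + c * s) powr (- b)) \<partial>lborel)"
    by (rule mellin_power[OF u c, symmetric])
  also have "\<dots> \<le> (\<integral>\<^sup>+s. ennreal (mellin_kernel u s * (LINT x|M. exp (- s * Y x))) \<partial>lborel)"
  proof (intro nn_integral_mono ennreal_leI)
    fix s :: real
    show "mellin_kernel u s * (1 + c * s) powr (- b) \<le> mellin_kernel u s * (LINT x|M. exp (- s * Y x))"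
      using ge[of s] by (cases "s > 0") (auto simp: mellin_kernel_def mult_left_mono)
  qed
  also have "\<dots> = (\<integral>\<^sup>+x. (\<integral>\<^sup>+s. ennreal (mellin_kernel u s * exp (- s * Y x)) \<partial>lborel) \<partial>M)"
    by (rule mellin_expectation[OF P Y Y0, symmetric])
  also have "\<dots> = (\<integral>\<^sup>+x. ennreal (Gamma u * Y x powr (- u)) \<partial>M)"
    by (rule nn_integral_cong_AE) (use pos in eventually_elim, simp add: mellin_exp u)
  also have "\<dots> = ennreal (LINT x|M. Gamma u * Y x powr (- u))"
    using int Gu by (intro nn_integral_eq_integral) auto
  finally have "Gamma u * ((Gamma (b - u) / Gamma b) * c powr (- u)) \<le> Gamma u * (LINT x|M. Y x powr (- u))"
    using Gu by (subst (asm) ennreal_le_iff) (auto simp: mult.assoc intro!: mult_nonneg_nonneg integral_nonneg_AE)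
  thus ?thesis using mult_le_cancel_left_pos[OF Gu(1)] by (simp only: mult.commute)
qed

section \<open>Sums of squares of a Gaussian family\<close>

definition sum_squares :: "'i set \<Rightarrow> ('i \<Rightarrow> 'a \<Rightarrow> real) \<Rightarrow> 'a \<Rightarrow> real" where
  "sum_squares I Z x = (\<Sum>i\<in>I. (Z i x)\<^sup>2)"

lemma sum_squares_nonneg: "0 \<le> sum_squares I Z x"
  by (simp add: sum_squares_def sum_nonneg)

lemma sum_squares_measurable:
  "centred_gaussian M I Z S \<Longrightarrow> sum_squares I Z \<in> borel_measurable M"
  unfolding sum_squares_def[abs_def] centred_gaussian_def by (intro borel_measurable_sum borel_measurable_power) auto

lemma quad_form_scale: "quad_form I S (\<lambda>i. a * w i) = a\<^sup>2 * quad_form I S w"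
  by (simp add: quad_form_def sum_distrib_left power2_eq_square mult_ac)

text \<open>Taking every \<open>\<sigma> i\<close> equal to \<open>sqrt (2 * s)\<close> cancels the
  halves in both exponents.\<close>

lemma laplace_sum_squares:
  assumes "prob_space M" "centred_gaussian M I Z S" "0 \<le> s"
  shows "(LINT x|M. exp (- s * sum_squares I Z x)) = (LINT w|normal_vec I. exp (- s * quad_form I S w))"
  using gaussian_laplace[OF assms(1,2), of "\<lambda>_. sqrt (2 * s)"] assms(3)
  by (simp add: sum_squares_def quad_form_scale sum_distrib_left[symmetric])

lemma quad_form_measurable'[measurable]:
  "quad_form I S \<in> borel_measurable (normal_vec I)"
  using quad_form_measurable[of I S "\<lambda>_. 1"] by simp

lemma sqnorm_measurable[measurable]:
  "sqnorm I \<in> borel_measurable (normal_vec I)"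
  unfolding sqnorm_def[abs_def] by measurable

text \<open>A larger quadratic form makes \<open>exp (- s * quad_form I S w)\<close> smaller, and
  for a multiple of \<open>sqnorm\<close> the average is explicit. The factor \<open>1/2\<close>
  makes \<open>c = 1\<close> the case of half the identity, where \<open>sum_squares\<close> is a
  Gamma variable of shape \<open>card I / 2\<close>.\<close>

lemma laplace_sum_squares_le:
  assumes P: "prob_space M" and G: "centred_gaussian M I Z S" and s: "0 < s" and c: "0 < c"
    and q: "\<And>w. c * sqnorm I w / 2 \<le> quad_form I S w"
  shows "(LINT x|M. exp (- s * sum_squares I Z x)) \<le> (1 + c * s) powr (- (real (card I) / 2))"
proof -
  have fin: "finite I" using G by (simp add: centred_gaussian_def)
  have "(LINT w|normal_vec I. exp (- s * quad_form I S w)) \<le> (LINT w|normal_vec I. exp (- (c * s) * sqnorm I w / 2))"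
  proof (intro integral_mono integrable_bounded_prob[OF prob_space_normal_vec, of _ _ 1])
    fix w
    have "s * (c * sqnorm I w / 2) \<le> s * quad_form I S w" by (rule mult_left_mono[OF q]) (use s in simp)
    thus "exp (- s * quad_form I S w) \<le> exp (- (c * s) * sqnorm I w / 2)" by (simp add: mult_ac)
  qed (use s c sqnorm_nonneg[of I] centred_gaussian_psd[OF P G] in \<open>auto simp: mult_nonneg_nonneg\<close>)
  thus ?thesis using integral_normal_vec_exp_sqnorm[OF fin subset_refl, of "c * s"] s c
    by (subst laplace_sum_squares[OF P G]) auto
qed

lemma laplace_sum_squares_ge:
  assumes P: "prob_space M" and G: "centred_gaussian M I Z S" and s: "0 < s" and c: "0 < c"
    and q: "\<And>w. quad_form I S w \<le> c * sqnorm I w / 2"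
  shows "(1 + c * s) powr (- (real (card I) / 2)) \<le> (LINT x|M. exp (- s * sum_squares I Z x))"
proof -
  have fin: "finite I" using G by (simp add: centred_gaussian_def)
  have "(LINT w|normal_vec I. exp (- (c * s) * sqnorm I w / 2)) \<le> (LINT w|normal_vec I. exp (- s * quad_form I S w))"
  proof (intro integral_mono integrable_bounded_prob[OF prob_space_normal_vec, of _ _ 1])
    fix w
    have "s * quad_form I S w \<le> s * (c * sqnorm I w / 2)" by (rule mult_left_mono[OF q]) (use s in simp)
    thus "exp (- (c * s) * sqnorm I w / 2) \<le> exp (- s * quad_form I S w)" by (simp add: mult_ac)
  qed (use s c sqnorm_nonneg[of I] centred_gaussian_psd[OF P G] in \<open>auto simp: mult_nonneg_nonneg\<close>)
  thus ?thesis using integral_normal_vec_exp_sqnorm[OF fin subset_refl, of "c * s"] s c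
    by (subst laplace_sum_squares[OF P G]) auto
qed

section \<open>Moments of logarithms\<close>

text \<open>This is \<open>t \<le> exp t\<close> at \<open>t = x / (8 * p)\<close>, raised to the
  power \<open>p\<close>. The constant is \<open>24 ^ 3\<close>, the value of
  \<open>(8 * p) ^ p\<close> for \<open>p = 3\<close>.\<close>

lemma power_le_exp_eighth:
  fixes x :: real
  assumes "0 \<le> x" "p \<le> 3"
  shows "x ^ p \<le> 13824 * exp (x / 8)"
proof (cases "p = 0")
  case True
  have "1 \<le> exp (x / 8)" using assms by simp
  hence "1 \<le> 13824 * exp (x / 8)" by linarith
  thus ?thesis using True by simp
next
  case False
  have "x / (8 * real p) \<le> exp (x / (8 * real p))"
    using exp_ge_add_one_self[of "x / (8 * real p)"] by linarith
  hence "(x / (8 * real p)) ^ p \<le> exp (x / (8 * real p)) ^ p"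
    using assms by (intro power_mono) auto
  also have "\<dots> = exp (x / 8)" using False by (simp add: exp_of_nat_mult[symmetric])
  finally have "x ^ p \<le> (8 * real p) ^ p * exp (x / 8)"
    using False by (simp add: power_divide divide_le_eq mult.commute)
  also have "(8 * real p) ^ p \<le> (24::real) ^ 3"
  proof -
    have "(8 * real p) ^ p \<le> 24 ^ p" using assms by (intro power_mono) auto
    also have "\<dots> \<le> (24::real) ^ 3" using assms by (intro power_increasing) auto
    finally show ?thesis .
  qed
  finally show ?thesis by (simp add: mult_right_mono)
qed

lemma exp_minus_taylor1:
  fixes y :: real shows "\<bar>exp (- y) - 1 + y\<bar> \<le> \<bar>y\<bar>\<^sup>2 * exp \<bar>y\<bar>"
proof -
  have "exp (- y) - 1 + y = exp (- y) - (1 - y)" by simp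
  thus ?thesis using Taylor_exp_field[of "- y" 1] by (simp add: mult_ac power2_eq_square)
qed

lemma exp_minus_taylor2:
  fixes y :: real shows "\<bar>exp (- y) - 1 + y - y\<^sup>2 / 2\<bar> \<le> \<bar>y\<bar> ^ 3 * exp \<bar>y\<bar>"
proof -
  have "\<bar>exp (- y) - 1 + y - y\<^sup>2 / 2\<bar> \<le> exp \<bar>y\<bar> * \<bar>y\<bar> ^ 3 / 2"
    using Taylor_exp_field[of "- y" 2] by (simp add: numeral_eq_Suc algebra_simps)
  also have "\<dots> \<le> \<bar>y\<bar> ^ 3 * exp \<bar>y\<bar>" by simp
  finally show ?thesis .
qed

text \<open>The variable \<open>L\<close> will be the logarithm of a sum of squares. The rate
  \<open>1/4\<close> lies below \<open>1/2\<close>, the limit for negative moments of a single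
  squared Gaussian coordinate, which is all that can be relied on for small \<open>k\<close>. Half
  of the rate absorbs powers of \<open>L\<close> up to the third; the other half leaves room for
  \<open>exp (u * \<bar>L x\<bar>)\<close> with \<open>u \<le> 1/8\<close>.\<close>

locale exp_moments = prob_space M for M :: "'a measure" +
  fixes L :: "'a \<Rightarrow> real" and B :: real
  assumes L_meas[measurable]: "L \<in> borel_measurable M"
    and int_pos: "integrable M (\<lambda>x. exp (L x / 4))"
    and int_neg: "integrable M (\<lambda>x. exp (- L x / 4))"
    and bound: "expectation (\<lambda>x. exp (L x / 4)) + expectation (\<lambda>x. exp (- L x / 4)) \<le> B"
begin

lemma moment_pointwise:
  assumes "p \<le> 3" "u \<le> 1/8"
  shows "\<bar>L x\<bar> ^ p * exp (u * \<bar>L x\<bar>) \<le> 13824 * (exp (L x / 4) + exp (- L x / 4))"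
proof -
  have "\<bar>L x\<bar> ^ p * exp (u * \<bar>L x\<bar>) \<le> (13824 * exp (\<bar>L x\<bar> / 8)) * exp (\<bar>L x\<bar> / 8)"
    using assms mult_right_mono[of u "1/8" "\<bar>L x\<bar>"] by (intro mult_mono power_le_exp_eighth) auto
  also have "\<dots> = 13824 * exp (\<bar>L x\<bar> / 4)" by (simp add: exp_add[symmetric])
  also have "exp (\<bar>L x\<bar> / 4) \<le> exp (L x / 4) + exp (- L x / 4)"
    by (cases "L x \<ge> 0") auto
  finally show ?thesis by simp
qed

lemma int_moment:
  assumes "p \<le> 3" "u \<le> 1/8"
  shows "integrable M (\<lambda>x. \<bar>L x\<bar> ^ p * exp (u * \<bar>L x\<bar>))"
  by (rule Bochner_Integration.integrable_bound[of M "\<lambda>x. 13824 * (exp (L x / 4) + exp (- L x / 4))"])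
     (use int_pos int_neg moment_pointwise[OF assms] in auto)

lemma moment_le:
  assumes "p \<le> 3" "u \<le> 1/8"
  shows "expectation (\<lambda>x. \<bar>L x\<bar> ^ p * exp (u * \<bar>L x\<bar>)) \<le> 13824 * B"
proof -
  have "expectation (\<lambda>x. \<bar>L x\<bar> ^ p * exp (u * \<bar>L x\<bar>)) \<le> expectation (\<lambda>x. 13824 * (exp (L x / 4) + exp (- L x / 4)))"
    by (intro integral_mono int_moment moment_pointwise assms) (use int_pos int_neg in auto)
  also have "\<dots> \<le> 13824 * B" using int_pos int_neg bound by simp
  finally show ?thesis .
qed

lemma int_L: "integrable M L"
  using int_moment[of 1 0] by (simp add: integrable_abs_iff)

lemma int_L2: "integrable M (\<lambda>x. (L x)\<^sup>2)"
  using int_moment[of 2 0] by simp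

lemma second_moment_le: "expectation (\<lambda>x. (L x)\<^sup>2) \<le> 13824 * B"
  using moment_le[of 2 0] by simp

lemma int_exp: assumes "0 \<le> u" "u \<le> 1/8" shows "integrable M (\<lambda>x. exp (- u * L x))"
proof (rule Bochner_Integration.integrable_bound[OF int_moment[of 0 u]])
  show "AE x in M. norm (exp (- u * L x)) \<le> norm (\<bar>L x\<bar> ^ 0 * exp (u * \<bar>L x\<bar>))"
  proof (rule AE_I2)
    fix x
    have "u * (- L x) \<le> u * \<bar>L x\<bar>" using assms by (intro mult_left_mono) auto
    thus "norm (exp (- u * L x)) \<le> norm (\<bar>L x\<bar> ^ 0 * exp (u * \<bar>L x\<bar>))" by simp
  qed
qed (use assms in auto)

lemma exp_moment_taylor1:
  assumes "0 < u" "u \<le> 1/8"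
  shows "\<bar>expectation (\<lambda>x. exp (- u * L x)) - 1 + u * expectation L\<bar> \<le> u\<^sup>2 * (13824 * B)"
proof -
  have e: "expectation (\<lambda>x. exp (- u * L x)) - 1 + u * expectation L = expectation (\<lambda>x. exp (- u * L x) - 1 + u * L x)"
    using int_L int_exp[of u] assms by (simp add: prob_space)
  have "\<bar>expectation (\<lambda>x. exp (- u * L x) - 1 + u * L x)\<bar> \<le> expectation (\<lambda>x. \<bar>exp (- u * L x) - 1 + u * L x\<bar>)"
    by (rule integral_abs_bound)
  also have "\<dots> \<le> expectation (\<lambda>x. u\<^sup>2 * (\<bar>L x\<bar> ^ 2 * exp (u * \<bar>L x\<bar>)))"
  proof (intro integral_mono)
    show "integrable M (\<lambda>x. \<bar>exp (- u * L x) - 1 + u * L x\<bar>)" using int_L int_exp[of u] assms by auto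
    show "integrable M (\<lambda>x. u\<^sup>2 * (\<bar>L x\<bar> ^ 2 * exp (u * \<bar>L x\<bar>)))" 
      using assms by (intro integrable_mult_right int_moment) auto
    fix x show "\<bar>exp (- u * L x) - 1 + u * L x\<bar> \<le> u\<^sup>2 * (\<bar>L x\<bar> ^ 2 * exp (u * \<bar>L x\<bar>))"
      using exp_minus_taylor1[of "u * L x"] assms by (simp add: abs_mult power_mult_distrib mult_ac)
  qed
  also have "\<dots> \<le> u\<^sup>2 * (13824 * B)"
    using moment_le[of 2 u] assms by (simp add: mult_left_mono)
  finally show ?thesis unfolding e .
qed

lemma exp_moment_taylor2:
  assumes "0 < u" "u \<le> 1/8"
  shows "\<bar>expectation (\<lambda>x. exp (- u * L x)) - 1 + u * expectation L - u\<^sup>2 / 2 * expectation (\<lambda>x. (L x)\<^sup>2)\<bar> \<le> u ^ 3 * (13824 * B)"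
proof -
  have e: "expectation (\<lambda>x. exp (- u * L x)) - 1 + u * expectation L - u\<^sup>2 / 2 * expectation (\<lambda>x. (L x)\<^sup>2)
      = expectation (\<lambda>x. exp (- u * L x) - 1 + u * L x - u\<^sup>2 / 2 * (L x)\<^sup>2)"
    using int_L int_L2 int_exp[of u] assms by (simp add: prob_space)
  have "\<bar>expectation (\<lambda>x. exp (- u * L x) - 1 + u * L x - u\<^sup>2 / 2 * (L x)\<^sup>2)\<bar>
      \<le> expectation (\<lambda>x. \<bar>exp (- u * L x) - 1 + u * L x - u\<^sup>2 / 2 * (L x)\<^sup>2\<bar>)"
    by (rule integral_abs_bound)
  also have "\<dots> \<le> expectation (\<lambda>x. u ^ 3 * (\<bar>L x\<bar> ^ 3 * exp (u * \<bar>L x\<bar>)))"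
  proof (intro integral_mono)
    show "integrable M (\<lambda>x. \<bar>exp (- u * L x) - 1 + u * L x - u\<^sup>2 / 2 * (L x)\<^sup>2\<bar>)" using int_L int_L2 int_exp[of u] assms by auto
    show "integrable M (\<lambda>x. u ^ 3 * (\<bar>L x\<bar> ^ 3 * exp (u * \<bar>L x\<bar>)))" 
      using assms by (intro integrable_mult_right int_moment) auto
    fix x show "\<bar>exp (- u * L x) - 1 + u * L x - u\<^sup>2 / 2 * (L x)\<^sup>2\<bar> \<le> u ^ 3 * (\<bar>L x\<bar> ^ 3 * exp (u * \<bar>L x\<bar>))"
      using exp_minus_taylor2[of "u * L x"] assms by (simp add: abs_mult power_mult_distrib mult_ac)
  qed
  also have "\<dots> \<le> u ^ 3 * (13824 * B)"
    using moment_le[of 3 u] assms by (simp add: mult_left_mono)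
  finally show ?thesis unfolding e .
qed

text \<open>The mean of \<open>L\<close> is minus the derivative at 0 of the function sending
  \<open>u\<close> to the mean of \<open>exp (- u * L x)\<close>. The limit is one-sided because the
  Mellin comparison controls positive \<open>u\<close> only.\<close>

lemma exp_moment_deriv:
  "((\<lambda>u. (1 - expectation (\<lambda>x. exp (- u * L x))) / u) \<longlongrightarrow> expectation L) (at_right 0)"
proof (rule LIM_zero_cancel, rule Lim_null_comparison)
  show "eventually (\<lambda>u. norm ((1 - expectation (\<lambda>x. exp (- u * L x))) / u - expectation L) \<le> u * (13824 * B)) (at_right 0)"
    unfolding eventually_at_right_field
  proof (intro exI[of _ "1/8"] conjI allI impI)
    fix u :: real assume u: "0 < u" "u < 1/8"
    have "(1 - expectation (\<lambda>x. exp (- u * L x))) / u - expectation L = - (expectation (\<lambda>x. exp (- u * L x)) - 1 + u * expectation L) / u"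
      using u by (simp add: field_simps)
    thus "norm ((1 - expectation (\<lambda>x. exp (- u * L x))) / u - expectation L) \<le> u * (13824 * B)"
      using exp_moment_taylor1[of u] u by (simp add: power2_eq_square divide_le_eq mult_ac)
  qed simp
  show "((\<lambda>u. u * (13824 * B)) \<longlongrightarrow> 0) (at_right 0)"
    by (rule tendsto_mult_left_zero) (rule tendsto_ident_at)
qed

end

text \<open>The moment of order \<open>- u\<close> of a Gamma variable of shape \<open>b\<close> and
  scale 1, which is the exact value in the white-noise case.\<close>

definition gamma_neg_moment :: "real \<Rightarrow> real \<Rightarrow> real" where
  "gamma_neg_moment b u = Gamma (b - u) / Gamma b"

lemma gamma_neg_moment_0: "0 < b \<Longrightarrow> gamma_neg_moment b 0 = 1"
  by (simp add: gamma_neg_moment_def Gamma_real_pos less_imp_neq[symmetric])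

lemma gamma_neg_moment_deriv:
  assumes "u < b" "0 < b"
  shows "(gamma_neg_moment b has_real_derivative - (gamma_neg_moment b u * Digamma (b - u))) (at u)"
proof -
  have "b - u \<notin> \<int>\<^sub>\<le>\<^sub>0" using assms by (auto elim!: nonpos_Ints_cases)
  thus ?thesis unfolding gamma_neg_moment_def[abs_def] using Gamma_real_pos[OF assms(2)]
    by (auto intro!: derivative_eq_intros)
qed

text \<open>Here \<open>Q\<close> is the second moment of the logarithm of that Gamma variable, its
  variance \<open>Polygamma 1 b\<close> plus its squared mean. The mean value theorem gives
  \<open>h u = u * h' z\<close> with \<open>0 < z < u\<close>, so it is enough that
  \<open>h' z / z\<close> tends to 0, which is the derivative of \<open>h'\<close> at the single
  point 0.\<close>

lemma gamma_neg_moment_taylor: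
  assumes b: "0 < b"
  defines "Q \<equiv> Polygamma 1 b + (Digamma b)\<^sup>2"
  shows "((\<lambda>u. (gamma_neg_moment b u - 1 + u * Digamma b - u\<^sup>2 / 2 * Q) / u\<^sup>2) \<longlongrightarrow> 0) (at_right 0)"
proof -
  define h where "h u = gamma_neg_moment b u - 1 + u * Digamma b - u\<^sup>2 / 2 * Q" for u
  define h' where "h' u = - (gamma_neg_moment b u * Digamma (b - u)) + Digamma b - u * Q" for u
  have d1: "(h has_real_derivative h' u) (at u)" if "u < b" for u
    unfolding h_def[abs_def] h'_def by (auto intro!: derivative_eq_intros gamma_neg_moment_deriv that b)
  have nb: "b \<notin> \<int>\<^sub>\<le>\<^sub>0" using b by (auto elim!: nonpos_Ints_cases)
  have d2: "(h' has_real_derivative 0) (at 0)"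
    unfolding h'_def[abs_def] using nb b
    by (auto intro!: derivative_eq_intros DERIV_cong[OF gamma_neg_moment_deriv]
         simp: gamma_neg_moment_0 Q_def power2_eq_square)
  have h0: "h 0 = 0" "h' 0 = 0" using b by (auto simp: h_def h'_def gamma_neg_moment_0)
  have lim: "((\<lambda>u. h' u / u) \<longlongrightarrow> 0) (at 0)"
    using d2 h0 by (simp add: has_field_derivative_iff)
  have "((\<lambda>u. h u / u\<^sup>2) \<longlongrightarrow> 0) (at_right 0)"
  proof (rule tendstoI)
    fix e :: real assume e: "0 < e"
    have "eventually (\<lambda>u. dist (h' u / u) 0 < e) (at 0)" by (rule tendstoD[OF lim e])
    then obtain r where r: "0 < r" "\<And>u. u \<noteq> 0 \<Longrightarrow> dist u 0 < r \<Longrightarrow> dist (h' u / u) 0 < e"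
      unfolding eventually_at by auto
    show "eventually (\<lambda>u. dist (h u / u\<^sup>2) 0 < e) (at_right 0)"
      unfolding eventually_at_right_field
    proof (intro exI[of _ "min r b"] conjI allI impI)
      fix u :: real assume u: "0 < u" "u < min r b"
      obtain z where z: "0 < z" "z < u" "h u - h 0 = (u - 0) * h' z"
        using MVT2[of 0 u h h'] u d1 by auto
      have "\<bar>h' z\<bar> < e * z" using r(2)[of z] z u by (simp add: divide_less_eq)
      also have "\<dots> \<le> e * u" using z e by simp
      finally have "u * \<bar>h' z\<bar> < u * (e * u)" using u by simp
      moreover have "\<bar>h u\<bar> = u * \<bar>h' z\<bar>" using z(3) h0 u by (simp add: abs_mult)
      ultimately show "dist (h u / u\<^sup>2) 0 < e" using u
        by (simp add: divide_less_eq power2_eq_square mult_ac)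
    qed (use r b in auto)
  qed
  thus ?thesis by (simp add: h_def)
qed

text \<open>All three functions of \<open>u\<close> equal 1 at \<open>u = 0\<close>, so the
  inequalities pass, with reversed direction, to the difference quotients of the form
  \<open>(1 - y) / u\<close> and then to their limits.\<close>

lemma (in exp_moments) mean_log_sandwich:
  assumes b: "0 < b" and c: "0 < c" "0 < c'"
    and M: "\<And>u. 0 < u \<Longrightarrow> u < u0 \<Longrightarrow> c' powr (- u) * gamma_neg_moment b u \<le> expectation (\<lambda>x. exp (- u * L x)) \<and>
         expectation (\<lambda>x. exp (- u * L x)) \<le> c powr (- u) * gamma_neg_moment b u"
    and u0: "0 < u0"
  shows "Digamma b + ln c \<le> expectation L" "expectation L \<le> Digamma b + ln c'"
proof -
  have lim: "((\<lambda>u. (1 - a powr (- u) * gamma_neg_moment b u) / u) \<longlongrightarrow> Digamma b + ln a) (at_right 0)" if a: "0 < a" for a :: real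
  proof -
    have "((\<lambda>u. a powr (- u) * gamma_neg_moment b u) has_real_derivative - (Digamma b + ln a)) (at 0)"
      using a b by (auto intro!: derivative_eq_intros DERIV_cong[OF gamma_neg_moment_deriv] simp: gamma_neg_moment_0)
    hence "((\<lambda>u. (a powr (- u) * gamma_neg_moment b u - 1) / u) \<longlongrightarrow> - (Digamma b + ln a)) (at 0)"
      using a b by (simp add: has_field_derivative_iff gamma_neg_moment_0)
    hence *: "((\<lambda>u. (a powr (- u) * gamma_neg_moment b u - 1) / u) \<longlongrightarrow> - (Digamma b + ln a)) (at_right 0)"
      by (rule filterlim_mono) (auto simp: at_le)
    have "- ((a powr (- u) * gamma_neg_moment b u - 1) / u) = (1 - a powr (- u) * gamma_neg_moment b u) / u" for u
      by (simp only: minus_divide_left minus_diff_eq)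
    with tendsto_minus[OF *] show ?thesis by (simp only: minus_minus)
  qed
  have ev: "eventually (\<lambda>u. 0 < u \<and> u < u0) (at_right (0::real))"
    unfolding eventually_at_right_field using u0 by auto
  show "Digamma b + ln c \<le> expectation L"
  proof (rule tendsto_le[OF _ exp_moment_deriv lim[OF c(1)]])
    show "\<forall>\<^sub>F u in at_right 0. (1 - c powr (- u) * gamma_neg_moment b u) / u \<le> (1 - expectation (\<lambda>x. exp (- u * L x))) / u"
      using ev by eventually_elim (intro divide_right_mono, use M in auto)
  qed simp
  show "expectation L \<le> Digamma b + ln c'"
  proof (rule tendsto_le[OF _ lim[OF c(2)] exp_moment_deriv])
    show "\<forall>\<^sub>F u in at_right 0. (1 - expectation (\<lambda>x. exp (- u * L x))) / u \<le> (1 - c' powr (- u) * gamma_neg_moment b u) / u"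
      using ev by eventually_elim (intro divide_right_mono, use M in auto)
  qed simp
qed

text \<open>The point is uniformity: \<open>\<delta>0\<close> is fixed before the measure and before
  \<open>L\<close>, of which only the bound \<open>B\<close> enters. A single \<open>u\<close> is
  chosen so small that both Taylor remainders are negligible against \<open>u\<^sup>2\<close>;
  afterwards \<open>\<delta>0\<close> is chosen, depending on this \<open>u\<close>, so that the
  error of the sandwich is negligible too.\<close>

lemma second_moment_log_limit:
  fixes b B \<epsilon> u0 :: real
  assumes b: "0 < b" and \<epsilon>: "0 < \<epsilon>" and u0: "0 < u0" and B: "0 \<le> B"
  obtains \<delta>0 where "0 < \<delta>0" "\<delta>0 < 1"
    "\<And>(M :: 'a measure) L \<delta>. exp_moments M L B \<Longrightarrow> 0 \<le> \<delta> \<Longrightarrow> \<delta> \<le> \<delta>0 \<Longrightarrow>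
       (\<And>u. 0 < u \<Longrightarrow> u < u0 \<Longrightarrow> (1 + \<delta>) powr (- u) * gamma_neg_moment b u \<le> (LINT x|M. exp (- u * L x)) \<and>
         (LINT x|M. exp (- u * L x)) \<le> (1 - \<delta>) powr (- u) * gamma_neg_moment b u) \<Longrightarrow>
       \<bar>(LINT x|M. (L x)\<^sup>2) - (Polygamma 1 b + (Digamma b)\<^sup>2)\<bar> < \<epsilon>"
proof -
  define Q where "Q = Polygamma 1 b + (Digamma b)\<^sup>2"
  define h where "h u = gamma_neg_moment b u - 1 + u * Digamma b - u\<^sup>2 / 2 * Q" for u
  define K where "K = 13824 * B"
  have K: "0 \<le> K" using B by (simp add: K_def)
  have e1: "eventually (\<lambda>u. dist (h u / u\<^sup>2) 0 < \<epsilon> / 8) (at_right 0)"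
    unfolding h_def Q_def by (rule tendstoD[OF gamma_neg_moment_taylor[OF b]]) (use \<epsilon> in simp)
  have e2: "eventually (\<lambda>u. dist (u * K) 0 < \<epsilon> / 8) (at_right 0)"
    by (rule tendstoD[OF tendsto_mult_left_zero[OF tendsto_ident_at]]) (use \<epsilon> in simp)
  have e3: "eventually (\<lambda>u. 0 < u \<and> u < min (min u0 b) (1/8)) (at_right (0::real))"
    unfolding eventually_at_right_field using u0 b by (intro exI[of _ "min (min u0 b) (1/8)"]) auto
  from eventually_happens[OF eventually_conj[OF e1 eventually_conj[OF e2 e3]]] obtain u where
    u: "\<bar>h u / u\<^sup>2\<bar> < \<epsilon> / 8" "\<bar>u * K\<bar> < \<epsilon> / 8" "0 < u" "u < u0" "u < b" "u < 1/8"
    by auto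
  define G where "G = gamma_neg_moment b u"
  have G0: "0 \<le> G" using u b by (simp add: G_def gamma_neg_moment_def Gamma_real_pos less_imp_le)
  \<comment> \<open>\<open>E \<delta>\<close> collects the errors of the moment and of the mean at
    the fixed \<open>u\<close>. It is continuous at 0 and vanishes there, so it can be made small
    against \<open>u\<^sup>2\<close>.\<close>
  define E where "E \<delta> = G * (\<bar>(1 - \<delta>) powr (- u) - 1\<bar> + \<bar>(1 + \<delta>) powr (- u) - 1\<bar>) + u * (\<bar>ln (1 - \<delta>)\<bar> + \<bar>ln (1 + \<delta>)\<bar>)" for \<delta>
  have "isCont E 0" unfolding E_def[abs_def] by (intro continuous_intros) auto
  hence "(E \<longlongrightarrow> E 0) (at 0)" by (simp add: isCont_def)
  moreover have "E 0 = 0" by (simp add: E_def)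
  ultimately have "eventually (\<lambda>\<delta>. dist (E \<delta>) 0 < \<epsilon> * u\<^sup>2 / 8) (at 0)"
    using \<epsilon> u by (intro tendstoD) auto
  then obtain r where r: "0 < r" "\<And>\<delta>. \<delta> \<noteq> 0 \<Longrightarrow> dist \<delta> 0 < r \<Longrightarrow> dist (E \<delta>) 0 < \<epsilon> * u\<^sup>2 / 8"
    unfolding eventually_at by auto
  have r': "E \<delta> < \<epsilon> * u\<^sup>2 / 8" if "0 \<le> \<delta>" "\<delta> < r" for \<delta>
    using r(2)[of \<delta>] that \<epsilon> u \<open>E 0 = 0\<close> by (cases "\<delta> = 0") auto
  show thesis
  proof (rule that[of "min (r / 2) (1/2)"])
    fix M :: "'a measure" and L \<delta>
    assume em: "exp_moments M L B" and \<delta>: "0 \<le> \<delta>" "\<delta> \<le> min (r / 2) (1/2)"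
      and MM: "\<And>u. 0 < u \<Longrightarrow> u < u0 \<Longrightarrow> (1 + \<delta>) powr (- u) * gamma_neg_moment b u \<le> (LINT x|M. exp (- u * L x)) \<and>
         (LINT x|M. exp (- u * L x)) \<le> (1 - \<delta>) powr (- u) * gamma_neg_moment b u"
    interpret exp_moments M L B by fact
    define m where "m = expectation (\<lambda>x. exp (- u * L x))"
    have mean: "Digamma b + ln (1 - \<delta>) \<le> expectation L" "expectation L \<le> Digamma b + ln (1 + \<delta>)"
      using mean_log_sandwich[OF b _ _ MM u0] \<delta> by auto
    have a1: "\<bar>expectation L - Digamma b\<bar> \<le> \<bar>ln (1 - \<delta>)\<bar> + \<bar>ln (1 + \<delta>)\<bar>" using mean by linarith
    have "(1 + \<delta>) powr (- u) * G \<le> m" "m \<le> (1 - \<delta>) powr (- u) * G" using MM[of u] u by (auto simp: m_def G_def)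
    hence "G * ((1 + \<delta>) powr (- u) - 1) \<le> m - G" "m - G \<le> G * ((1 - \<delta>) powr (- u) - 1)"
      by (simp_all add: algebra_simps)
    hence "\<bar>m - G\<bar> \<le> \<bar>G * ((1 - \<delta>) powr (- u) - 1)\<bar> + \<bar>G * ((1 + \<delta>) powr (- u) - 1)\<bar>" by linarith
    hence a2: "\<bar>m - G\<bar> \<le> G * (\<bar>(1 - \<delta>) powr (- u) - 1\<bar> + \<bar>(1 + \<delta>) powr (- u) - 1\<bar>)"
      using G0 by (simp add: abs_mult distrib_left)
    have a12: "\<bar>m - G\<bar> + u * \<bar>expectation L - Digamma b\<bar> \<le> E \<delta>"
      unfolding E_def using u by (intro add_mono a2 mult_left_mono a1) auto
    have a3: "\<bar>m - 1 + u * expectation L - u\<^sup>2 / 2 * expectation (\<lambda>x. (L x)\<^sup>2)\<bar> \<le> u ^ 3 * K"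
      using exp_moment_taylor2[of u] u by (simp add: m_def K_def)
    have G_eq: "G = 1 - u * Digamma b + u\<^sup>2 / 2 * Q + h u" by (simp add: h_def G_def)
    \<comment> \<open>The difference of two second-order expansions at the same \<open>u\<close>,
      that of \<open>L\<close> and that of the Gamma variable, solved for the difference of the
      second moments.\<close>
    have "u\<^sup>2 / 2 * (expectation (\<lambda>x. (L x)\<^sup>2) - Q) =
        - (m - 1 + u * expectation L - u\<^sup>2 / 2 * expectation (\<lambda>x. (L x)\<^sup>2)) + (m - G) + u * (expectation L - Digamma b) + h u"
      unfolding G_eq by (simp add: algebra_simps)
    hence "\<bar>u\<^sup>2 / 2 * (expectation (\<lambda>x. (L x)\<^sup>2) - Q)\<bar> \<le> u ^ 3 * K + E \<delta> + \<bar>h u\<bar>"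
    proof -
      have tri: "\<bar>- p + q + r + s\<bar> \<le> \<bar>p\<bar> + \<bar>q\<bar> + \<bar>r\<bar> + \<bar>s\<bar>" for p q r s :: real by linarith
      assume eq: "u\<^sup>2 / 2 * (expectation (\<lambda>x. (L x)\<^sup>2) - Q) =
        - (m - 1 + u * expectation L - u\<^sup>2 / 2 * expectation (\<lambda>x. (L x)\<^sup>2)) + (m - G) + u * (expectation L - Digamma b) + h u"
      have "\<bar>u * (expectation L - Digamma b)\<bar> = u * \<bar>expectation L - Digamma b\<bar>" using u by (simp add: abs_mult)
      with a12 a3 add_mono[OF a3 a12] show ?thesis unfolding eq
        by (intro order_trans[OF tri]) simp
    qed
    also have "\<dots> < u\<^sup>2 * (\<epsilon> / 8) + \<epsilon> * u\<^sup>2 / 8 + u\<^sup>2 * (\<epsilon> / 8)"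
    proof -
      have "u ^ 3 * K = u\<^sup>2 * (u * K)" by (simp add: power3_eq_cube power2_eq_square)
      also have "\<dots> \<le> u\<^sup>2 * (\<epsilon> / 8)" using u by (intro mult_left_mono) auto
      finally have "u ^ 3 * K \<le> u\<^sup>2 * (\<epsilon> / 8)" .
      moreover have "\<bar>h u\<bar> < u\<^sup>2 * (\<epsilon> / 8)" using u(1,3) by (simp add: divide_less_eq mult.commute)
      moreover have "E \<delta> < \<epsilon> * u\<^sup>2 / 8" using r'[of \<delta>] \<delta> r by auto
      ultimately show ?thesis by linarith
    qed
    also have "\<dots> \<le> u\<^sup>2 / 2 * \<epsilon>" using \<epsilon> by simp
    finally have "u\<^sup>2 / 2 * \<bar>expectation (\<lambda>x. (L x)\<^sup>2) - Q\<bar> < u\<^sup>2 / 2 * \<epsilon>" by (simp add: abs_mult)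
    thus "\<bar>expectation (\<lambda>x. (L x)\<^sup>2) - (Polygamma 1 b + (Digamma b)\<^sup>2)\<bar> < \<epsilon>"
      using u by (simp add: Q_def mult_less_cancel_left_pos)
  qed (use r in auto)
qed

section \<open>Covariance of logarithms of Gaussian quadratic forms\<close>

text \<open>Extending the coefficients by 0 turns a linear combination over \<open>I\<close> into
  one over \<open>K\<close>.\<close>

lemma centred_gaussian_subset:
  fixes I :: "'i set"
  assumes G: "centred_gaussian M K Z S" and I: "I \<subseteq> K"
  shows "centred_gaussian M I Z S"
  unfolding centred_gaussian_def
proof (intro conjI allI ballI)
  have fin: "finite K" using G by (simp add: centred_gaussian_def)
  show "finite I" using fin I finite_subset by blast
  fix i assume "i \<in> I" thus "Z i \<in> borel_measurable M" using G I by (auto simp: centred_gaussian_def)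
next
  fix c :: "'i \<Rightarrow> real"
  have fin: "finite K" using G by (simp add: centred_gaussian_def)
  define c' where "c' i = (if i \<in> I then c i else 0)" for i
  have "(\<Sum>i\<in>K. c' i * Z i x) = (\<Sum>i\<in>I. c i * Z i x)" for x
    using fin I by (intro sum.mono_neutral_cong_right) (auto simp: c'_def)
  moreover have "quad_form K S c' = quad_form I S c"
    unfolding quad_form_def
  proof (rule sum.mono_neutral_cong_right[OF fin I])
    fix i assume "i \<in> I"
    thus "(\<Sum>j\<in>K. c' i * c' j * S i j) = (\<Sum>j\<in>I. c i * c j * S i j)"
      using fin I by (intro sum.mono_neutral_cong_right) (auto simp: c'_def)
  qed (auto simp: c'_def)
  moreover have "(CLINT x|M. iexp (\<Sum>i\<in>K. c' i * Z i x)) = complex_of_real (exp (- quad_form K S c' / 2))"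
    using G unfolding centred_gaussian_def by blast
  ultimately show "(CLINT x|M. iexp (\<Sum>i\<in>I. c i * Z i x)) = complex_of_real (exp (- quad_form I S c / 2))"
    by simp
qed

text \<open>Kept as an extended nonnegative integral instead of its closed form, which is valid for
  \<open>0 < y\<close> only, so that the double integrals below can be evaluated before positivity
  is known.\<close>

definition exp_mellin :: "real \<Rightarrow> real \<Rightarrow> ennreal" where
  "exp_mellin u y = (\<integral>\<^sup>+s. ennreal (mellin_kernel u s) * ennreal (exp (- (s * y))) \<partial>lborel)"

lemma exp_mellin_measurable[measurable]: "exp_mellin u \<in> borel_measurable borel"
  unfolding exp_mellin_def[abs_def] by measurable

lemma exp_mellin_eq: "0 < u \<Longrightarrow> 0 < y \<Longrightarrow> exp_mellin u y = ennreal (Gamma u * y powr (- u))"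
  using mellin_exp[of u y] by (simp add: exp_mellin_def ennreal_mult)

text \<open>Tonelli in three variables. The weight \<open>\<phi>\<close> is 1 for the joint negative
  moment and, for the \<open>cosh\<close> correction, a multiple of the product of the two squared
  norms.\<close>

lemma double_mellin:
  assumes P: "prob_space N" and [measurable]: "Y1 \<in> borel_measurable N" "Y2 \<in> borel_measurable N" "\<phi> \<in> borel_measurable N"
  shows "(\<integral>\<^sup>+s. \<integral>\<^sup>+t. ennreal (mellin_kernel a s) * ennreal (mellin_kernel b t) *
             (\<integral>\<^sup>+x. \<phi> x * ennreal (exp (- (s * Y1 x) - t * Y2 x)) \<partial>N) \<partial>lborel \<partial>lborel)
       = (\<integral>\<^sup>+x. \<phi> x * exp_mellin a (Y1 x) * exp_mellin b (Y2 x) \<partial>N)" (is "?L = ?R")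
proof -
  interpret prob_space N by fact
  interpret pair_sigma_finite N lborel ..
  define f where "f s t x = ennreal (mellin_kernel a s) * ennreal (mellin_kernel b t) * (\<phi> x * ennreal (exp (- (s * Y1 x) - t * Y2 x)))" for s t x
  have "?L = (\<integral>\<^sup>+s. \<integral>\<^sup>+t. (\<integral>\<^sup>+x. f s t x \<partial>N) \<partial>lborel \<partial>lborel)"
    unfolding f_def by (subst nn_integral_cmult) auto
  also have "\<dots> = (\<integral>\<^sup>+s. \<integral>\<^sup>+x. (\<integral>\<^sup>+t. f s t x \<partial>lborel) \<partial>N \<partial>lborel)"
    unfolding f_def by (intro nn_integral_cong Fubini') measurable
  also have "\<dots> = (\<integral>\<^sup>+x. \<integral>\<^sup>+s. (\<integral>\<^sup>+t. f s t x \<partial>lborel) \<partial>lborel \<partial>N)"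
    unfolding f_def by (intro Fubini') measurable
  also have "\<dots> = ?R"
  proof (rule nn_integral_cong)
    fix x
    have "(\<integral>\<^sup>+s. (\<integral>\<^sup>+t. f s t x \<partial>lborel) \<partial>lborel)
        = (\<integral>\<^sup>+s. (\<integral>\<^sup>+t. (\<phi> x * (ennreal (mellin_kernel a s) * ennreal (exp (- (s * Y1 x))))) * (ennreal (mellin_kernel b t) * ennreal (exp (- (t * Y2 x)))) \<partial>lborel) \<partial>lborel)"
      unfolding f_def by (intro nn_integral_cong) (simp add: exp_diff exp_minus divide_inverse ennreal_mult mult_ac)
    also have "\<dots> = (\<integral>\<^sup>+s. (\<phi> x * exp_mellin b (Y2 x)) * (ennreal (mellin_kernel a s) * ennreal (exp (- (s * Y1 x)))) \<partial>lborel)"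
      unfolding exp_mellin_def by (subst nn_integral_cmult) (auto simp: mult_ac)
    also have "\<dots> = \<phi> x * exp_mellin a (Y1 x) * exp_mellin b (Y2 x)"
      unfolding exp_mellin_def[of a] by (subst nn_integral_cmult) (auto simp: mult_ac)
    finally show "(\<integral>\<^sup>+s. (\<integral>\<^sup>+t. f s t x \<partial>lborel) \<partial>lborel) = \<phi> x * exp_mellin a (Y1 x) * exp_mellin b (Y2 x)" .
  qed
  finally show ?thesis .
qed

lemma quad_form_Un:
  assumes "finite I" "finite J" "I \<inter> J = {}"
  shows "quad_form (I \<union> J) S w = quad_form I S w + quad_form J S w + (\<Sum>i\<in>I. \<Sum>j\<in>J. w i * w j * (S i j + S j i))"
proof -
  have "(\<Sum>i\<in>J. \<Sum>j\<in>I. w i * w j * S i j) = (\<Sum>i\<in>I. \<Sum>j\<in>J. w i * w j * S j i)"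
    by (subst sum.swap) (simp add: mult_ac)
  thus ?thesis unfolding quad_form_def
    by (simp add: sum.union_disjoint[OF assms] sum.distrib distrib_left)
qed

lemma quad_form_cong: "(\<And>i. i \<in> I \<Longrightarrow> v i = w i) \<Longrightarrow> quad_form I S v = quad_form I S w"
  unfolding quad_form_def by (intro sum.cong refl) simp

lemma cosh_minus_one_le: 
  fixes v :: real shows "(exp v + exp (- v)) / 2 - 1 \<le> v\<^sup>2 * exp \<bar>v\<bar>"
proof -
  have "exp (- v) - 1 + v \<le> v\<^sup>2 * exp \<bar>v\<bar>" "exp v - 1 - v \<le> v\<^sup>2 * exp \<bar>v\<bar>"
    using abs_le_D1[OF exp_minus_taylor1[of v]] abs_le_D1[OF exp_minus_taylor1[of "- v"]] by simp_all
  thus ?thesis by (simp add: field_simps)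
qed

text \<open>The constant \<open>r\<close> bounds the cross-covariance operator between the two blocks.\<close>
locale gaussian_pair = prob_space M for M :: "'a measure" +
  fixes I J :: "'i set" and Z :: "'i \<Rightarrow> 'a \<Rightarrow> real" and S :: "'i \<Rightarrow> 'i \<Rightarrow> real" and c r :: real
  assumes G: "centred_gaussian M (I \<union> J) Z S" and disj: "I \<inter> J = {}" and ne: "I \<noteq> {}" "J \<noteq> {}"
    and c: "0 < c" and r: "0 \<le> r" "r \<le> c / 2"
    and qI: "\<And>w. c * sqnorm I w \<le> quad_form I S w" and qJ: "\<And>w. c * sqnorm J w \<le> quad_form J S w"
    and cross: "\<And>w. \<bar>\<Sum>i\<in>I. \<Sum>j\<in>J. w i * w j * (S i j + S j i)\<bar> \<le> 2 * r * sqrt (sqnorm I w * sqnorm J w)"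
begin

lemma fin: "finite I" "finite J" "finite (I \<union> J)" using G by (auto simp: centred_gaussian_def)
lemma GI: "centred_gaussian M I Z S" and GJ: "centred_gaussian M J Z S"
  by (rule centred_gaussian_subset[OF G], blast)+

abbreviation "YI \<equiv> sum_squares I Z"
abbreviation "YJ \<equiv> sum_squares J Z"
abbreviation "N \<equiv> normal_vec (I \<union> J)"

lemma meas[measurable]: "YI \<in> borel_measurable M" "YJ \<in> borel_measurable M"
  by (rule sum_squares_measurable GI GJ)+

lemma PN: "prob_space N" by (rule prob_space_normal_vec)

lemma form_meas[measurable]: "quad_form I S \<in> borel_measurable N" "quad_form J S \<in> borel_measurable N"
    "sqnorm I \<in> borel_measurable N" "sqnorm J \<in> borel_measurable N"
  unfolding quad_form_def[abs_def] sqnorm_def[abs_def] by measurable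

definition "cr w = (\<Sum>i\<in>I. \<Sum>j\<in>J. w i * w j * (S i j + S j i))"

lemma cr_meas[measurable]: "cr \<in> borel_measurable N"
  unfolding cr_def[abs_def] by measurable

text \<open>The left-hand side does not depend on \<open>\<epsilon>\<close>; averaging over both signs replaces \<open>exp\<close> of the cross
  term by \<open>cosh\<close>.\<close>
lemma laplace_signed:
  assumes "0 \<le> s" "0 \<le> t" "\<epsilon> = 1 \<or> \<epsilon> = -1"
  shows "expectation (\<lambda>x. exp (- (s * YI x) - t * YJ x)) =
    (LINT w|N. exp (- (s * quad_form I S w) - t * quad_form J S w - \<epsilon> * (sqrt s * sqrt t * cr w)))"
proof -
  define \<sigma> where "\<sigma> i = (if i \<in> I then \<epsilon> * sqrt (2 * s) else sqrt (2 * t))" for i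
  have \<epsilon>: "\<epsilon>\<^sup>2 = 1" using assms by auto
  have s1: "(\<Sum>i\<in>I \<union> J. (\<sigma> i)\<^sup>2 * (Z i x)\<^sup>2) = 2 * s * YI x + 2 * t * YJ x" for x
  proof -
    have "(\<Sum>i\<in>I \<union> J. (\<sigma> i)\<^sup>2 * (Z i x)\<^sup>2) = (\<Sum>i\<in>I. (\<sigma> i)\<^sup>2 * (Z i x)\<^sup>2) + (\<Sum>i\<in>J. (\<sigma> i)\<^sup>2 * (Z i x)\<^sup>2)"
      by (rule sum.union_disjoint[OF fin(1,2) disj])
    also have "(\<Sum>i\<in>I. (\<sigma> i)\<^sup>2 * (Z i x)\<^sup>2) = (\<Sum>i\<in>I. 2 * s * (Z i x)\<^sup>2)"
      using assms \<epsilon> by (intro sum.cong refl) (simp add: \<sigma>_def power_mult_distrib)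
    also have "(\<Sum>i\<in>J. (\<sigma> i)\<^sup>2 * (Z i x)\<^sup>2) = (\<Sum>i\<in>J. 2 * t * (Z i x)\<^sup>2)"
      using assms \<epsilon> disj by (intro sum.cong refl) (auto simp add: \<sigma>_def power_mult_distrib)
    finally show ?thesis by (simp add: sum_squares_def sum_distrib_left)
  qed
  have s2: "quad_form (I \<union> J) S (\<lambda>i. \<sigma> i * w i) = 2 * s * quad_form I S w + 2 * t * quad_form J S w + 2 * \<epsilon> * (sqrt s * sqrt t * cr w)" for w
  proof -
    have "quad_form I S (\<lambda>i. \<sigma> i * w i) = quad_form I S (\<lambda>i. \<epsilon> * sqrt (2 * s) * w i)"
      by (rule quad_form_cong) (simp add: \<sigma>_def)
    moreover have "quad_form J S (\<lambda>i. \<sigma> i * w i) = quad_form J S (\<lambda>i. sqrt (2 * t) * w i)"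
      by (rule quad_form_cong) (use disj in \<open>auto simp add: \<sigma>_def\<close>)
    moreover have "(\<Sum>i\<in>I. \<Sum>j\<in>J. \<sigma> i * w i * (\<sigma> j * w j) * (S i j + S j i)) = (\<Sum>i\<in>I. \<Sum>j\<in>J. (\<epsilon> * sqrt (2 * s) * sqrt (2 * t)) * (w i * w j * (S i j + S j i)))"
      using disj by (intro sum.cong refl) (auto simp: \<sigma>_def)
    moreover have "\<dots> = (\<epsilon> * sqrt (2 * s) * sqrt (2 * t)) * cr w"
      by (simp add: cr_def sum_distrib_left)
    moreover have "sqrt (2 * s) * sqrt (2 * t) = 2 * (sqrt s * sqrt t)"
      using assms by (simp add: real_sqrt_mult)
    ultimately show ?thesis using assms \<epsilon>
      by (simp add: quad_form_Un[OF fin(1,2) disj] quad_form_scale power_mult_distrib mult.assoc)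
  qed
  have s1': "- (\<Sum>i\<in>I \<union> J. (\<sigma> i)\<^sup>2 * (Z i x)\<^sup>2) / 2 = - (s * YI x) - t * YJ x" for x
    unfolding s1 by simp
  have s2': "- quad_form (I \<union> J) S (\<lambda>i. \<sigma> i * w i) / 2 = - (s * quad_form I S w) - t * quad_form J S w - \<epsilon> * (sqrt s * sqrt t * cr w)" for w
    unfolding s2 by simp
  show ?thesis using gaussian_laplace[OF prob_space_axioms G, of \<sigma>] unfolding s1' s2' .
qed

text \<open>Without the cross term the integrand factorises, and the two blocks of \<open>w\<close>
  are independent. The product of the Laplace transforms thus differs from the joint one only by the
  cross term inside the same integral.\<close>

lemma laplace_product:
  assumes "0 \<le> s" "0 \<le> t"
  shows "expectation (\<lambda>x. exp (- s * YI x)) * expectation (\<lambda>x. exp (- t * YJ x)) =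
    (LINT w|N. exp (- (s * quad_form I S w) - t * quad_form J S w))"
proof -
  have "integrable N (\<lambda>w. exp (- (s * quad_form I S w) - t * quad_form J S w))"
  proof (rule integrable_bounded_prob[OF PN, of _ 1])
    fix w
    have "0 \<le> s * quad_form I S w" "0 \<le> t * quad_form J S w"
      using assms centred_gaussian_psd[OF prob_space_axioms GI] centred_gaussian_psd[OF prob_space_axioms GJ] by simp_all
    thus "norm (exp (- (s * quad_form I S w) - t * quad_form J S w)) \<le> 1" by simp
  qed measurable
  hence "(LINT w|N. exp (- (s * quad_form I S w) - t * quad_form J S w)) =
     (LINT x|normal_vec I. LINT y|normal_vec J. exp (- (s * quad_form I S (merge I J (x, y))) - t * quad_form J S (merge I J (x, y))))"
    by (rule product_sigma_finite.product_integral_fold[OF product_sigma_finite_normal disj fin(1,2)])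
  also have "\<dots> = (LINT x|normal_vec I. LINT y|normal_vec J. exp (- s * quad_form I S x) * exp (- t * quad_form J S y))"
  proof -
    have "quad_form I S (merge I J (x, y)) = quad_form I S x" for x y
      by (rule quad_form_cong) (simp add: merge_def)
    moreover have "quad_form J S (merge I J (x, y)) = quad_form J S y" for x y
      by (rule quad_form_cong) (use disj in \<open>auto simp: merge_def\<close>)
    ultimately show ?thesis by (simp add: exp_diff exp_minus divide_inverse)
  qed
  also have "\<dots> = (LINT x|normal_vec I. exp (- s * quad_form I S x)) * (LINT y|normal_vec J. exp (- t * quad_form J S y))"
    by simp
  finally show ?thesis
    using laplace_sum_squares[OF prob_space_axioms GI assms(1)] laplace_sum_squares[OF prob_space_axioms GJ assms(2)]
    by simp
qed

text \<open>Integrand bound for the \<open>cosh - 1\<close> correction; half of the quadratic form absorbs the growth of \<open>cosh\<close>.\<close>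
definition "excess s t w = 4 * r\<^sup>2 * (s * sqnorm I w) * (t * sqnorm J w) * exp (- (s * (c / 2 * sqnorm I w)) - t * (c / 2 * sqnorm J w))"

lemma excess_meas[measurable]: "excess s t \<in> borel_measurable N"
  unfolding excess_def[abs_def] by measurable

text \<open>The two signed formulas for the joint transform are averaged, which produces a
  \<open>cosh\<close>. It is at least 1, which gives the lower bound, and at most
  \<open>1 + v\<^sup>2 * exp \<bar>v\<bar>\<close>, which gives the upper one.\<close>

lemma laplace_cov:
  assumes "0 \<le> s" "0 \<le> t"
  shows "expectation (\<lambda>x. exp (- s * YI x)) * expectation (\<lambda>x. exp (- t * YJ x)) \<le> expectation (\<lambda>x. exp (- (s * YI x) - t * YJ x))"
    and "ennreal (expectation (\<lambda>x. exp (- (s * YI x) - t * YJ x))) \<le>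
       ennreal (expectation (\<lambda>x. exp (- s * YI x)) * expectation (\<lambda>x. exp (- t * YJ x))) + (\<integral>\<^sup>+w. ennreal (excess s t w) \<partial>N)"
proof -
  define A where "A w = exp (- (s * quad_form I S w) - t * quad_form J S w)" for w
  define V where "V w = sqrt s * sqrt t * cr w" for w
  define C where "C w = A w * ((exp (V w) + exp (- V w)) / 2)" for w
  define nI where "nI w = s * sqnorm I w" for w
  define nJ where "nJ w = t * sqnorm J w" for w
  have n0: "0 \<le> nI w" "0 \<le> nJ w" for w using assms by (auto simp: nI_def nJ_def sqnorm_nonneg)
  have V2: "(V w)\<^sup>2 \<le> 4 * r\<^sup>2 * nI w * nJ w" and Vabs: "\<bar>V w\<bar> \<le> c / 2 * (nI w + nJ w)" for w
  proof -
    have "\<bar>V w\<bar> = sqrt s * sqrt t * \<bar>cr w\<bar>" using assms by (simp add: V_def abs_mult)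
    also have "\<dots> \<le> sqrt s * sqrt t * (2 * r * sqrt (sqnorm I w * sqnorm J w))"
      using cross[of w] assms by (intro mult_left_mono) (auto simp: cr_def)
    also have "\<dots> = 2 * r * (sqrt (nI w) * sqrt (nJ w))"
      using assms by (simp add: nI_def nJ_def real_sqrt_mult mult_ac)
    finally have *: "\<bar>V w\<bar> \<le> 2 * r * (sqrt (nI w) * sqrt (nJ w))" .
    have "(V w)\<^sup>2 \<le> (2 * r * (sqrt (nI w) * sqrt (nJ w)))\<^sup>2"
      using power_mono[OF *, of 2] by simp
    thus "(V w)\<^sup>2 \<le> 4 * r\<^sup>2 * nI w * nJ w" using n0[of w] by (simp add: power_mult_distrib)
    have "2 * (sqrt (nI w) * sqrt (nJ w)) \<le> nI w + nJ w"
      using sum_squares_bound[of "sqrt (nI w)" "sqrt (nJ w)"] n0[of w] by simp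
    \<comment> \<open>The condition \<open>r \<le> c / 2\<close> enters here: the exponential growth
      of the cross term uses up at most half of the decay rate \<open>c\<close>.\<close>
    hence "r * (2 * (sqrt (nI w) * sqrt (nJ w))) \<le> c / 2 * (nI w + nJ w)"
      using r n0[of w] by (intro mult_mono) auto
    thus "\<bar>V w\<bar> \<le> c / 2 * (nI w + nJ w)" using * by simp
  qed
  have A_le: "A w \<le> exp (- c * (nI w + nJ w))" for w
  proof -
    have "s * (c * sqnorm I w) \<le> s * quad_form I S w" "t * (c * sqnorm J w) \<le> t * quad_form J S w"
      using assms qI[of w] qJ[of w] by (auto intro: mult_left_mono)
    thus ?thesis unfolding A_def nI_def nJ_def by (simp add: algebra_simps)
  qed
  have A0: "0 < A w" for w by (simp add: A_def)
  have C_up: "C w - A w \<le> excess s t w" for w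
  proof -
    have "C w - A w = A w * ((exp (V w) + exp (- V w)) / 2 - 1)" by (simp add: C_def algebra_simps)
    also have "\<dots> \<le> A w * ((V w)\<^sup>2 * exp \<bar>V w\<bar>)"
      using A0[of w] cosh_minus_one_le[of "V w"] by (intro mult_left_mono) auto
    also have "\<dots> \<le> exp (- c * (nI w + nJ w)) * ((4 * r\<^sup>2 * nI w * nJ w) * exp (c / 2 * (nI w + nJ w)))"
      using A0[of w] A_le[of w] V2[of w] Vabs[of w] n0[of w] by (intro mult_mono) (auto intro!: mult_nonneg_nonneg)
    also have "\<dots> = (4 * r\<^sup>2 * nI w * nJ w) * exp (- c * (nI w + nJ w) + c / 2 * (nI w + nJ w))"
      unfolding exp_add by simp
    also have "- c * (nI w + nJ w) + c / 2 * (nI w + nJ w) = - (s * (c / 2 * sqnorm I w)) - t * (c / 2 * sqnorm J w)"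
      by (simp add: nI_def nJ_def field_simps)
    finally show ?thesis by (simp add: excess_def nI_def nJ_def mult_ac)
  qed
  have C_low: "A w \<le> C w" for w
  proof -
    have "1 \<le> (exp (V w) + exp (- V w)) / 2"
      using cosh_real_ge_1[of "V w"] by (simp add: cosh_def)
    from mult_left_mono[OF this, of "A w"] A0[of w] show ?thesis by (simp add: C_def)
  qed
  have Ap: "A w * exp (V w) = exp (- (s * quad_form I S w) - t * quad_form J S w - (-1) * (sqrt s * sqrt t * cr w))"
   and Am: "A w * exp (- V w) = exp (- (s * quad_form I S w) - t * quad_form J S w - 1 * (sqrt s * sqrt t * cr w))" for w
    by (simp_all add: A_def V_def exp_add[symmetric])
  have [measurable]: "A \<in> borel_measurable N" "V \<in> borel_measurable N"
    unfolding A_def[abs_def] V_def[abs_def] by measurable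
  have A1: "A w \<le> 1" for w
  proof -
    have "0 \<le> c * (nI w + nJ w)" using n0[of w] c by (intro mult_nonneg_nonneg) auto
    hence "exp (- c * (nI w + nJ w)) \<le> 1" by simp
    with A_le[of w] show ?thesis by (rule order_trans)
  qed
  have intA: "integrable N A"
    by (rule integrable_bounded_prob[OF PN, of _ 1]) (use A0 A1 in \<open>auto simp: less_imp_le\<close>)
  have AV: "A w * exp (\<epsilon> * V w) \<le> 1" if "\<bar>\<epsilon>\<bar> \<le> 1" for w \<epsilon>
  proof -
    have "\<epsilon> * V w \<le> \<bar>V w\<bar>"
    proof -
      have "\<epsilon> * V w \<le> \<bar>\<epsilon>\<bar> * \<bar>V w\<bar>" by (metis abs_ge_self abs_mult)
      also have "\<dots> \<le> 1 * \<bar>V w\<bar>" using that by (intro mult_right_mono) auto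
      finally show ?thesis by simp
    qed
    also have "\<dots> \<le> c / 2 * (nI w + nJ w)" by (rule Vabs)
    also have "\<dots> \<le> c * (nI w + nJ w)" using c n0[of w] by (intro mult_right_mono) auto
    finally have "exp (\<epsilon> * V w) \<le> exp (c * (nI w + nJ w))" by simp
    hence "A w * exp (\<epsilon> * V w) \<le> exp (- c * (nI w + nJ w)) * exp (c * (nI w + nJ w))"
      using A_le[of w] A0[of w] by (intro mult_mono) auto
    thus ?thesis by (simp add: exp_add[symmetric])
  qed
  have intV: "integrable N (\<lambda>w. A w * exp (\<epsilon> * V w))" if "\<bar>\<epsilon>\<bar> \<le> 1" for \<epsilon>
    by (rule integrable_bounded_prob[OF PN, of _ 1]) (use A0 AV[OF that] in \<open>auto simp: less_imp_le abs_mult\<close>)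
  have intp: "integrable N (\<lambda>w. A w * exp (V w))" "integrable N (\<lambda>w. A w * exp (- V w))"
    using intV[of 1] intV[of "-1"] by auto
  have intC: "integrable N C" unfolding C_def[abs_def] distrib_left add_divide_distrib
    using intp by auto
  have H: "expectation (\<lambda>x. exp (- (s * YI x) - t * YJ x)) = (LINT w|N. C w)"
  proof -
    have "(LINT w|N. C w) = ((LINT w|N. A w * exp (V w)) + (LINT w|N. A w * exp (- V w))) / 2"
      unfolding C_def[abs_def] using intp by (simp add: distrib_left add_divide_distrib)
    thus ?thesis unfolding Ap Am using laplace_signed[OF assms, of 1] laplace_signed[OF assms, of "-1"] by simp
  qed
  have PQ: "expectation (\<lambda>x. exp (- s * YI x)) * expectation (\<lambda>x. exp (- t * YJ x)) = (LINT w|N. A w)"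
    unfolding A_def by (rule laplace_product[OF assms])
  show "expectation (\<lambda>x. exp (- s * YI x)) * expectation (\<lambda>x. exp (- t * YJ x)) \<le> expectation (\<lambda>x. exp (- (s * YI x) - t * YJ x))"
    unfolding PQ H by (intro integral_mono intA intC C_low)
  have "ennreal (LINT w|N. C w) = (\<integral>\<^sup>+w. ennreal (C w) \<partial>N)"
    by (rule nn_integral_eq_integral[symmetric, OF intC]) (intro AE_I2 order_trans[OF less_imp_le[OF A0] C_low])
  also have "\<dots> \<le> (\<integral>\<^sup>+w. ennreal (A w) + ennreal (excess s t w) \<partial>N)"
  proof (rule nn_integral_mono)
    fix w
    have "C w \<le> A w + excess s t w" using C_up[of w] by simp
    hence "ennreal (C w) \<le> ennreal (A w + excess s t w)" by (rule ennreal_leI)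
    also have "\<dots> = ennreal (A w) + ennreal (excess s t w)"
      using A0[of w] C_low[of w] C_up[of w] by (intro ennreal_plus) auto
    finally show "ennreal (C w) \<le> ennreal (A w) + ennreal (excess s t w)" .
  qed
  also have "\<dots> = (\<integral>\<^sup>+w. ennreal (A w) \<partial>N) + (\<integral>\<^sup>+w. ennreal (excess s t w) \<partial>N)"
    by (rule nn_integral_add) measurable
  also have "(\<integral>\<^sup>+w. ennreal (A w) \<partial>N) = ennreal (LINT w|N. A w)"
    by (rule nn_integral_eq_integral[OF intA]) (use A0 in \<open>auto simp: less_imp_le\<close>)
  finally show "ennreal (expectation (\<lambda>x. exp (- (s * YI x) - t * YJ x))) \<le>
       ennreal (expectation (\<lambda>x. exp (- s * YI x)) * expectation (\<lambda>x. exp (- t * YJ x))) + (\<integral>\<^sup>+w. ennreal (excess s t w) \<partial>N)"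
    unfolding H PQ .
qed

lemma card_pos: "0 < card I" "0 < card J"
  using fin ne by (auto simp: card_gt_0_iff)

lemma laplace_le:
  assumes "0 < s"
  shows "expectation (\<lambda>x. exp (- s * YI x)) \<le> (1 + (2 * c) * s) powr (- (real (card I) / 2))"
    "expectation (\<lambda>x. exp (- s * YJ x)) \<le> (1 + (2 * c) * s) powr (- (real (card J) / 2))"
  by (rule laplace_sum_squares_le[OF prob_space_axioms GI assms]; use c qI in simp)
     (rule laplace_sum_squares_le[OF prob_space_axioms GJ assms]; use c qJ in simp)

lemma pos_AE: "AE x in M. 0 < YI x" "AE x in M. 0 < YJ x"
proof -
  show "AE x in M. 0 < YI x"
    by (rule AE_pos_of_laplace[OF prob_space_axioms meas(1) sum_squares_nonneg _ _ laplace_le(1)]) (use card_pos c in auto)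
  show "AE x in M. 0 < YJ x"
    by (rule AE_pos_of_laplace[OF prob_space_axioms meas(2) sum_squares_nonneg _ _ laplace_le(2)]) (use card_pos c in auto)
qed

lemma int_neg_moment:
  assumes "0 < u" "u < 1/2"
  shows "integrable M (\<lambda>x. YI x powr (- u))" "integrable M (\<lambda>x. YJ x powr (- u))"
proof -
  have "u < real (card I) / 2" "u < real (card J) / 2" using assms card_pos by auto
  thus "integrable M (\<lambda>x. YI x powr (- u))" "integrable M (\<lambda>x. YJ x powr (- u))"
    using neg_moment_upper(1)[OF prob_space_axioms meas(1) sum_squares_nonneg assms(1) _ _ laplace_le(1)]
      neg_moment_upper(1)[OF prob_space_axioms meas(2) sum_squares_nonneg assms(1) _ _ laplace_le(2)] c by auto
qed

lemma exp_mellin_expectation: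
  assumes Y: "Y \<in> borel_measurable M" "\<And>x. 0 \<le> Y x" "AE x in M. 0 < Y x" "integrable M (\<lambda>x. Y x powr (- u))" and u: "0 < u"
  shows "(\<integral>\<^sup>+s. ennreal (mellin_kernel u s * expectation (\<lambda>x. exp (- s * Y x))) \<partial>lborel)
     = ennreal (Gamma u * expectation (\<lambda>x. Y x powr (- u)))"
proof -
  have "(\<integral>\<^sup>+s. ennreal (mellin_kernel u s * expectation (\<lambda>x. exp (- s * Y x))) \<partial>lborel)
     = (\<integral>\<^sup>+x. (\<integral>\<^sup>+s. ennreal (mellin_kernel u s * exp (- s * Y x)) \<partial>lborel) \<partial>M)"
    by (rule mellin_expectation[OF prob_space_axioms Y(1,2), symmetric])
  also have "\<dots> = (\<integral>\<^sup>+x. ennreal (Gamma u * Y x powr (- u)) \<partial>M)"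
    by (rule nn_integral_cong_AE) (use Y(3) in eventually_elim, simp add: mellin_exp u)
  also have "\<dots> = ennreal (Gamma u * expectation (\<lambda>x. Y x powr (- u)))"
    using Y(4) Gamma_real_pos[OF u] by (subst nn_integral_eq_integral) auto
  finally show ?thesis .
qed

text \<open>The factor \<open>u\<^sup>2\<close> is \<open>(Gamma (u + 1) / Gamma u)\<^sup>2\<close>;
  it makes the bound of the same order in \<open>u\<close> as the covariance of the two negative
  powers.\<close>

definition "excess_bound u = 4 * r\<^sup>2 * u\<^sup>2 * (c / 2) powr (- (2 * u + 2)) *
   ((gamma_neg_moment (real (card I) / 2) (2 * u) + gamma_neg_moment (real (card J) / 2) (2 * u)) / 2)"

text \<open>Under \<open>N\<close> the squared norm is twice a Gamma variable of shape
  \<open>card K / 2\<close>, and the factor \<open>2 powr (- (2 * u)) \<le> 1\<close> is dropped.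
  The range \<open>u < 1/4\<close> keeps \<open>2 * u\<close> below the shape even for a single
  coordinate.\<close>

lemma sqnorm_neg_moment:
  assumes "K \<subseteq> I \<union> J" "0 < card K" "0 < u" "u < 1/4"
  shows "integrable N (\<lambda>w. sqnorm K w powr (- (2 * u)))"
    "(LINT w|N. sqnorm K w powr (- (2 * u))) \<le> gamma_neg_moment (real (card K) / 2) (2 * u)"
proof -
  have m: "sqnorm K \<in> borel_measurable N" 
    unfolding sqnorm_def[abs_def] using assms(1) by (intro borel_measurable_sum borel_measurable_power measurable_component_singleton[THEN measurable_compose]) auto
  have le: "(LINT w|N. exp (- s * sqnorm K w)) \<le> (1 + 2 * s) powr (- (real (card K) / 2))" if "0 < s" for s
    using integral_normal_vec_exp_sqnorm[OF fin(3) assms(1), of "2 * s"] that by simp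
  have u: "0 < 2 * u" "2 * u < real (card K) / 2" using assms by auto
  note up = neg_moment_upper[OF PN m sqnorm_nonneg u _ le]
  show "integrable N (\<lambda>w. sqnorm K w powr (- (2 * u)))" by (rule up(1)) auto
  have "(LINT w|N. sqnorm K w powr (- (2 * u))) \<le> 2 powr (- (2 * u)) * gamma_neg_moment (real (card K) / 2) (2 * u)"
    unfolding gamma_neg_moment_def by (rule up(2)) auto
  also have "\<dots> \<le> 1 * gamma_neg_moment (real (card K) / 2) (2 * u)"
    using u by (intro mult_right_mono) (auto simp: gamma_neg_moment_def Gamma_real_pos less_imp_le powr_minus field_simps ge_one_powr_ge_zero)
  finally show "(LINT w|N. sqnorm K w powr (- (2 * u))) \<le> gamma_neg_moment (real (card K) / 2) (2 * u)" by simp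
qed

text \<open>The factor \<open>s * t\<close> in \<open>excess\<close> raises the exponent of each
  kernel from \<open>u\<close> to \<open>u + 1\<close>. After the integrations over \<open>s\<close>
  and \<open>t\<close> each squared norm remains to the power \<open>- u\<close>, and the inequality
  of arithmetic and geometric means reduces the product to moments of single blocks.\<close>

lemma excess_total:
  assumes u: "0 < u" "u < 1/4"
  shows "(\<integral>\<^sup>+s. \<integral>\<^sup>+t. ennreal (mellin_kernel u s) * ennreal (mellin_kernel u t) * (\<integral>\<^sup>+w. ennreal (excess s t w) \<partial>N) \<partial>lborel \<partial>lborel)
     \<le> ennreal ((Gamma u)\<^sup>2 * excess_bound u)" (is "?X \<le> _")
proof -
  define \<phi> where "\<phi> w = ennreal (4 * r\<^sup>2 * sqnorm I w * sqnorm J w)" for w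
  have [measurable]: "\<phi> \<in> borel_measurable N" unfolding \<phi>_def[abs_def] by measurable
  have kern: "mellin_kernel (u + 1) s = mellin_kernel u s * s" for s
    by (simp add: mellin_kernel_def indicator_def powr_diff)
  have "?X = (\<integral>\<^sup>+s. \<integral>\<^sup>+t. ennreal (mellin_kernel (u + 1) s) * ennreal (mellin_kernel (u + 1) t) *
       (\<integral>\<^sup>+w. \<phi> w * ennreal (exp (- (s * (c / 2 * sqnorm I w)) - t * (c / 2 * sqnorm J w))) \<partial>N) \<partial>lborel \<partial>lborel)"
  proof (intro nn_integral_cong)
    fix s t :: real
    show "ennreal (mellin_kernel u s) * ennreal (mellin_kernel u t) * (\<integral>\<^sup>+w. ennreal (excess s t w) \<partial>N)
      = ennreal (mellin_kernel (u + 1) s) * ennreal (mellin_kernel (u + 1) t) *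
       (\<integral>\<^sup>+w. \<phi> w * ennreal (exp (- (s * (c / 2 * sqnorm I w)) - t * (c / 2 * sqnorm J w))) \<partial>N)"
    proof (cases "s > 0 \<and> t > 0")
      case True
      have "(\<integral>\<^sup>+w. ennreal (excess s t w) \<partial>N) = (\<integral>\<^sup>+w. ennreal (s * t) * (\<phi> w * ennreal (exp (- (s * (c / 2 * sqnorm I w)) - t * (c / 2 * sqnorm J w)))) \<partial>N)"
        using True unfolding \<phi>_def excess_def
        by (intro nn_integral_cong) (simp add: ennreal_mult[symmetric] sqnorm_nonneg mult_ac)
      also have "\<dots> = ennreal (s * t) * (\<integral>\<^sup>+w. \<phi> w * ennreal (exp (- (s * (c / 2 * sqnorm I w)) - t * (c / 2 * sqnorm J w))) \<partial>N)"
        by (rule nn_integral_cmult) measurable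
      finally show ?thesis using True unfolding kern by (simp add: ennreal_mult mult_ac)
    qed (auto simp: mellin_kernel_def)
  qed
  also have "\<dots> = (\<integral>\<^sup>+w. \<phi> w * exp_mellin (u + 1) (c / 2 * sqnorm I w) * exp_mellin (u + 1) (c / 2 * sqnorm J w) \<partial>N)"
    by (rule double_mellin[OF PN]) measurable
  also have "\<dots> \<le> (\<integral>\<^sup>+w. ennreal (4 * r\<^sup>2 * (Gamma (u + 1) * (c / 2) powr (- (u + 1)))\<^sup>2 *
        ((sqnorm I w powr (- (2 * u)) + sqnorm J w powr (- (2 * u))) / 2)) \<partial>N)"
  proof (rule nn_integral_mono)
    fix w
    show "\<phi> w * exp_mellin (u + 1) (c / 2 * sqnorm I w) * exp_mellin (u + 1) (c / 2 * sqnorm J w) \<le>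
      ennreal (4 * r\<^sup>2 * (Gamma (u + 1) * (c / 2) powr (- (u + 1)))\<^sup>2 * ((sqnorm I w powr (- (2 * u)) + sqnorm J w powr (- (2 * u))) / 2))"
    \<comment> \<open>Where a norm vanishes its Mellin factor is infinite, but
      \<open>\<phi> w\<close> is 0 there and so is the product.\<close>
    proof (cases "sqnorm I w = 0 \<or> sqnorm J w = 0")
      case True
      thus ?thesis by (auto simp: \<phi>_def)
    next
      case False
      define a where "a = sqnorm I w"
      define b where "b = sqnorm J w"
      have ab: "a > 0" "b > 0" using False sqnorm_nonneg[of I w] sqnorm_nonneg[of J w] by (auto simp: a_def b_def)
      have Gu: "0 < Gamma (u + 1)" using u by simp
      have pw: "a * (c / 2 * a) powr (- (u + 1)) = (c / 2) powr (- (u + 1)) * a powr (- u)" if "a > 0" for a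
      proof -
        have "(c / 2 * a) powr (- (u + 1)) = (c / 2) powr (- (u + 1)) * a powr (- (u + 1))"
          by (rule powr_mult)
        moreover have "a * a powr (- (u + 1)) = a powr (- u)"
          using that powr_mult_base[of a "- (u + 1)"] by simp
        ultimately show ?thesis by simp
      qed
      have amgm: "a powr (- u) * b powr (- u) \<le> (a powr (- (2 * u)) + b powr (- (2 * u))) / 2"
        using sum_squares_bound[of "a powr (- u)" "b powr (- u)"] ab by (simp add: power2_eq_square powr_add[symmetric])
      have "\<phi> w * exp_mellin (u + 1) (c / 2 * a) * exp_mellin (u + 1) (c / 2 * b)
         = ennreal (4 * r\<^sup>2 * (Gamma (u + 1))\<^sup>2 * (a * (c / 2 * a) powr (- (u + 1))) * (b * (c / 2 * b) powr (- (u + 1))))"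
      proof -
        define gm where "gm = Gamma (u + 1)"
        have gm: "0 \<le> gm" using Gu by (simp add: gm_def)
        have e: "exp_mellin (u + 1) (c / 2 * a) = ennreal (gm * (c / 2 * a) powr (- (u + 1)))" if "a > 0" for a
          using that u c exp_mellin_eq[of "u + 1" "c / 2 * a"] by (simp add: gm_def)
        show ?thesis using ab gm unfolding \<phi>_def a_def[symmetric] b_def[symmetric] e[OF ab(1)] e[OF ab(2)] gm_def[symmetric]
          by (simp add: ennreal_mult[symmetric]) (simp add: power2_eq_square mult_ac)
      qed
      also have "\<dots> = ennreal (4 * r\<^sup>2 * (Gamma (u + 1) * (c / 2) powr (- (u + 1)))\<^sup>2 * (a powr (- u) * b powr (- u)))"
        unfolding pw[OF ab(1)] pw[OF ab(2)] by (simp add: power2_eq_square mult_ac)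
      also have "\<dots> \<le> ennreal (4 * r\<^sup>2 * (Gamma (u + 1) * (c / 2) powr (- (u + 1)))\<^sup>2 * ((a powr (- (2 * u)) + b powr (- (2 * u))) / 2))"
        by (intro ennreal_leI mult_left_mono amgm) auto
      finally show ?thesis by (simp add: a_def b_def)
    qed
  qed
  also have "\<dots> = ennreal (LINT w|N. 4 * r\<^sup>2 * (Gamma (u + 1) * (c / 2) powr (- (u + 1)))\<^sup>2 *
        ((sqnorm I w powr (- (2 * u)) + sqnorm J w powr (- (2 * u))) / 2))"
    using sqnorm_neg_moment(1)[of I u] sqnorm_neg_moment(1)[of J u] card_pos u
    by (intro nn_integral_eq_integral) auto
  also have "(LINT w|N. 4 * r\<^sup>2 * (Gamma (u + 1) * (c / 2) powr (- (u + 1)))\<^sup>2 *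
        ((sqnorm I w powr (- (2 * u)) + sqnorm J w powr (- (2 * u))) / 2)) =
       4 * r\<^sup>2 * (Gamma (u + 1) * (c / 2) powr (- (u + 1)))\<^sup>2 *
        (((LINT w|N. sqnorm I w powr (- (2 * u))) + (LINT w|N. sqnorm J w powr (- (2 * u)))) / 2)"
    using sqnorm_neg_moment(1)[of I u] sqnorm_neg_moment(1)[of J u] card_pos u by simp
  also have "\<dots> \<le> 4 * r\<^sup>2 * (Gamma (u + 1) * (c / 2) powr (- (u + 1)))\<^sup>2 *
        ((gamma_neg_moment (real (card I) / 2) (2 * u) + gamma_neg_moment (real (card J) / 2) (2 * u)) / 2)"
    using sqnorm_neg_moment(2)[of I u] sqnorm_neg_moment(2)[of J u] card_pos u
    by (intro mult_left_mono divide_right_mono add_mono) auto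
  also have "\<dots> = (Gamma u)\<^sup>2 * excess_bound u"
  proof -
    have "Gamma (u + 1) = u * Gamma u" using u by (intro Gamma_plus1) (auto elim!: nonpos_Ints_cases)
    moreover have "((c / 2) powr (- (u + 1)))\<^sup>2 = (c / 2) powr (- (2 * u + 2))"
      using c by (simp add: power2_eq_square powr_add[symmetric])
    ultimately show ?thesis unfolding excess_bound_def power_mult_distrib by (simp add: power_mult_distrib mult_ac)
  qed
  finally show ?thesis by (simp add: ennreal_leI)
qed

text \<open>Both inequalities of \<open>laplace_cov\<close> are integrated against the two kernels
  and divided by \<open>(Gamma u)\<^sup>2\<close>. The lower one says that negative powers of the
  two sums are never negatively correlated.\<close>

lemma neg_moment_cov:
  assumes u: "0 < u" "u < 1/4"
  shows "integrable M (\<lambda>x. YI x powr (- u) * YJ x powr (- u))"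
    and "expectation (\<lambda>x. YI x powr (- u)) * expectation (\<lambda>x. YJ x powr (- u)) \<le> expectation (\<lambda>x. YI x powr (- u) * YJ x powr (- u))"
    and "expectation (\<lambda>x. YI x powr (- u) * YJ x powr (- u)) \<le> expectation (\<lambda>x. YI x powr (- u)) * expectation (\<lambda>x. YJ x powr (- u)) + excess_bound u"
proof -
  have Gu: "0 < Gamma u" using u by simp
  define a where "a = expectation (\<lambda>x. YI x powr (- u))"
  define b where "b = expectation (\<lambda>x. YJ x powr (- u))"
  have ab0: "0 \<le> a" "0 \<le> b" by (auto simp: a_def b_def)
  define P where "P s = expectation (\<lambda>x. exp (- s * YI x))" for s
  define Q where "Q s = expectation (\<lambda>x. exp (- s * YJ x))" for s
  define H where "H s t = expectation (\<lambda>x. exp (- (s * YI x) - t * YJ x))" for s t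
  have PQ0: "0 \<le> P s" "0 \<le> Q s" for s by (auto simp: P_def Q_def)
  have [measurable]: "P \<in> borel_measurable borel" "Q \<in> borel_measurable borel"
    unfolding P_def[abs_def] Q_def[abs_def] by measurable
  have eP: "(\<integral>\<^sup>+s. ennreal (mellin_kernel u s * P s) \<partial>lborel) = ennreal (Gamma u * a)"
    unfolding P_def a_def by (rule exp_mellin_expectation[OF meas(1) sum_squares_nonneg pos_AE(1)]) (use u int_neg_moment in auto)
  have eQ: "(\<integral>\<^sup>+s. ennreal (mellin_kernel u s * Q s) \<partial>lborel) = ennreal (Gamma u * b)"
    unfolding Q_def b_def by (rule exp_mellin_expectation[OF meas(2) sum_squares_nonneg pos_AE(2)]) (use u int_neg_moment in auto)
  have joint: "(\<integral>\<^sup>+s. \<integral>\<^sup>+t. ennreal (mellin_kernel u s) * ennreal (mellin_kernel u t) * ennreal (H s t) \<partial>lborel \<partial>lborel)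
     = (\<integral>\<^sup>+x. ennreal ((Gamma u)\<^sup>2 * (YI x powr (- u) * YJ x powr (- u))) \<partial>M)" (is "?H = ?E")
  proof -
    have "?H = (\<integral>\<^sup>+s. \<integral>\<^sup>+t. ennreal (mellin_kernel u s) * ennreal (mellin_kernel u t) *
             (\<integral>\<^sup>+x. 1 * ennreal (exp (- (s * YI x) - t * YJ x)) \<partial>M) \<partial>lborel \<partial>lborel)"
    proof (intro nn_integral_cong)
      fix s t :: real
      show "ennreal (mellin_kernel u s) * ennreal (mellin_kernel u t) * ennreal (H s t) =
        ennreal (mellin_kernel u s) * ennreal (mellin_kernel u t) * (\<integral>\<^sup>+x. 1 * ennreal (exp (- (s * YI x) - t * YJ x)) \<partial>M)"
      proof (cases "s > 0 \<and> t > 0")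
        case True
        have "integrable M (\<lambda>x. exp (- (s * YI x) - t * YJ x))"
        proof (rule integrable_bounded_prob[OF prob_space_axioms, of _ 1])
          fix x
          have "0 \<le> s * YI x" "0 \<le> t * YJ x" using True by (simp_all add: sum_squares_nonneg)
          thus "norm (exp (- (s * YI x) - t * YJ x)) \<le> 1" by simp
        qed measurable
        thus ?thesis unfolding H_def by (simp add: nn_integral_eq_integral)
      qed (auto simp: mellin_kernel_def)
    qed
    also have "\<dots> = (\<integral>\<^sup>+x. 1 * exp_mellin u (YI x) * exp_mellin u (YJ x) \<partial>M)"
      by (rule double_mellin[OF prob_space_axioms]) measurable
    also have "\<dots> = ?E"
      by (rule nn_integral_cong_AE, use pos_AE in eventually_elim)
         (simp add: exp_mellin_eq u ennreal_mult[symmetric] power2_eq_square mult_ac less_imp_le[OF Gu])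
    finally show ?thesis .
  qed
  have prod: "(\<integral>\<^sup>+s. \<integral>\<^sup>+t. ennreal (mellin_kernel u s) * ennreal (mellin_kernel u t) * ennreal (P s * Q t) \<partial>lborel \<partial>lborel) = ennreal ((Gamma u)\<^sup>2 * (a * b))"
  proof -
    have "(\<integral>\<^sup>+s. \<integral>\<^sup>+t. ennreal (mellin_kernel u s) * ennreal (mellin_kernel u t) * ennreal (P s * Q t) \<partial>lborel \<partial>lborel)
       = (\<integral>\<^sup>+s. \<integral>\<^sup>+t. ennreal (mellin_kernel u s * P s) * ennreal (mellin_kernel u t * Q t) \<partial>lborel \<partial>lborel)"
      by (intro nn_integral_cong) (simp add: ennreal_mult PQ0 mult_ac)
    also have "\<dots> = ennreal (Gamma u * a) * ennreal (Gamma u * b)"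
      by (simp add: nn_integral_cmult nn_integral_multc eP eQ)
    finally show ?thesis using ab0 Gu by (simp add: ennreal_mult[symmetric] power2_eq_square mult_ac)
  qed
  have low: "ennreal ((Gamma u)\<^sup>2 * (a * b)) \<le> ?E"
    unfolding prod[symmetric] joint[symmetric]
  proof (intro nn_integral_mono)
    fix s t :: real
    show "ennreal (mellin_kernel u s) * ennreal (mellin_kernel u t) * ennreal (P s * Q t) \<le> ennreal (mellin_kernel u s) * ennreal (mellin_kernel u t) * ennreal (H s t)"
    proof (cases "s > 0 \<and> t > 0")
      case True thus ?thesis using laplace_cov(1)[of s t] unfolding P_def Q_def H_def
        by (intro mult_left_mono ennreal_leI) auto
    qed (auto simp: mellin_kernel_def)
  qed
  have "?E \<le> (\<integral>\<^sup>+s. \<integral>\<^sup>+t. ennreal (mellin_kernel u s) * ennreal (mellin_kernel u t) * ennreal (P s * Q t) +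
        ennreal (mellin_kernel u s) * ennreal (mellin_kernel u t) * (\<integral>\<^sup>+w. ennreal (excess s t w) \<partial>N) \<partial>lborel \<partial>lborel)"
    unfolding joint[symmetric]
  proof (intro nn_integral_mono)
    fix s t :: real
    show "ennreal (mellin_kernel u s) * ennreal (mellin_kernel u t) * ennreal (H s t) \<le>
       ennreal (mellin_kernel u s) * ennreal (mellin_kernel u t) * ennreal (P s * Q t) +
        ennreal (mellin_kernel u s) * ennreal (mellin_kernel u t) * (\<integral>\<^sup>+w. ennreal (excess s t w) \<partial>N)"
    proof (cases "s > 0 \<and> t > 0")
      case True thus ?thesis using laplace_cov(2)[of s t] unfolding P_def Q_def H_def distrib_left[symmetric]
        by (intro mult_left_mono) auto
    qed (auto simp: mellin_kernel_def)
  qed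
  also have "\<dots> = ennreal ((Gamma u)\<^sup>2 * (a * b)) + (\<integral>\<^sup>+s. \<integral>\<^sup>+t. ennreal (mellin_kernel u s) * ennreal (mellin_kernel u t) * (\<integral>\<^sup>+w. ennreal (excess s t w) \<partial>N) \<partial>lborel \<partial>lborel)"
  proof -
    interpret N: prob_space N by (rule PN)
    have [measurable]: "(\<lambda>(s, t). \<integral>\<^sup>+w. ennreal (excess s t w) \<partial>N) \<in> borel_measurable (lborel \<Otimes>\<^sub>M lborel)"
      unfolding excess_def split_beta by measurable
    show ?thesis unfolding prod[symmetric]
      by (simp add: nn_integral_add)
  qed
  also have "\<dots> \<le> ennreal ((Gamma u)\<^sup>2 * (a * b)) + ennreal ((Gamma u)\<^sup>2 * excess_bound u)"
    by (intro add_left_mono excess_total u)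
  also have "\<dots> = ennreal ((Gamma u)\<^sup>2 * (a * b + excess_bound u))"
  proof -
    have "0 \<le> excess_bound u" unfolding excess_bound_def gamma_neg_moment_def
      using u card_pos by (intro mult_nonneg_nonneg divide_nonneg_nonneg add_nonneg_nonneg) (auto intro!: less_imp_le Gamma_real_pos)
    thus ?thesis using ab0 by (subst ennreal_plus[symmetric]) (auto simp: distrib_left)
  qed
  finally have up: "?E \<le> ennreal ((Gamma u)\<^sup>2 * (a * b + excess_bound u))" .
  have i1: "integrable M (\<lambda>x. (Gamma u)\<^sup>2 * (YI x powr (- u) * YJ x powr (- u)))"
  proof (rule integrableI_bounded)
    have "(\<integral>\<^sup>+x. ennreal (norm ((Gamma u)\<^sup>2 * (YI x powr (- u) * YJ x powr (- u)))) \<partial>M) = ?E"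
      by (intro nn_integral_cong) simp
    thus "(\<integral>\<^sup>+x. ennreal (norm ((Gamma u)\<^sup>2 * (YI x powr (- u) * YJ x powr (- u)))) \<partial>M) < \<infinity>"
      using le_less_trans[OF up ennreal_less_top] by simp
  qed measurable
  from integrable_mult_right[OF i1, of "1 / (Gamma u)\<^sup>2"] Gu
  show i2: "integrable M (\<lambda>x. YI x powr (- u) * YJ x powr (- u))" by simp
  define e where "e = expectation (\<lambda>x. YI x powr (- u) * YJ x powr (- u))"
  have Ee: "?E = ennreal ((Gamma u)\<^sup>2 * e)"
    using i1 by (subst nn_integral_eq_integral) (auto simp: e_def)
  have e0: "0 \<le> e" by (simp add: e_def)
  have "(Gamma u)\<^sup>2 * (a * b) \<le> (Gamma u)\<^sup>2 * e" using low e0 unfolding Ee by (simp add: ennreal_le_iff)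
  thus "a * b \<le> e" using Gu by (simp add: mult_le_cancel_left_pos)
  have "0 \<le> excess_bound u" unfolding excess_bound_def gamma_neg_moment_def
    using u card_pos by (intro mult_nonneg_nonneg divide_nonneg_nonneg add_nonneg_nonneg) (auto intro!: less_imp_le Gamma_real_pos)
  hence "(Gamma u)\<^sup>2 * e \<le> (Gamma u)\<^sup>2 * (a * b + excess_bound u)"
    using up ab0 unfolding Ee by (subst (asm) ennreal_le_iff) auto
  thus "e \<le> a * b + excess_bound u" using Gu by (simp add: mult_le_cancel_left_pos)
qed

text \<open>The covariance and its bound in \<open>neg_moment_cov\<close> are both of order \<open>u\<^sup>2\<close>; divide by \<open>u\<^sup>2\<close> and let
  \<open>u \<rightarrow> 0\<close>.\<close>
lemma log_cov_le:
  assumes LI: "exp_moments M (\<lambda>x. ln (YI x)) BI" and LJ: "exp_moments M (\<lambda>x. ln (YJ x)) BJ"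
  shows "\<bar>expectation (\<lambda>x. ln (YI x) * ln (YJ x)) - expectation (\<lambda>x. ln (YI x)) * expectation (\<lambda>x. ln (YJ x))\<bar> \<le> 16 * r\<^sup>2 / c\<^sup>2"
proof -
  interpret LI: exp_moments M "\<lambda>x. ln (YI x)" BI by fact
  interpret LJ: exp_moments M "\<lambda>x. ln (YJ x)" BJ by fact
  \<comment> \<open>The sequence starts at \<open>1/16\<close>, so that the square of the dominating
    function \<open>\<bar>y\<bar> * exp (\<bar>y\<bar> / 16)\<close> has the rate \<open>1/8\<close>
    covered by \<open>exp_moments\<close>.\<close>
  define u where "u n = 1 / (16 * (real n + 1))" for n :: nat
  have u: "0 < u n" "u n \<le> 1/16" for n by (auto simp: u_def field_simps)
  have u_lim: "u \<longlonglongrightarrow> 0" unfolding u_def by real_asymp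
  have u_lim': "filterlim u (at_right 0) sequentially"
    using u_lim u less_imp_neq[OF u(1), symmetric] by (auto simp: filterlim_at intro!: always_eventually)
  define F where "F n x = (1 - exp (- u n * ln (YI x))) / u n" for n x
  define G where "G n x = (1 - exp (- u n * ln (YJ x))) / u n" for n x
  have eI: "AE x in M. \<forall>n. exp (- u n * ln (YI x)) = YI x powr (- u n)"
    using pos_AE(1) by eventually_elim (auto simp: powr_def)
  have eJ: "AE x in M. \<forall>n. exp (- u n * ln (YJ x)) = YJ x powr (- u n)"
    using pos_AE(2) by eventually_elim (auto simp: powr_def)
  have EF: "(\<lambda>n. expectation (F n)) \<longlonglongrightarrow> expectation (\<lambda>x. ln (YI x))"
    and EG: "(\<lambda>n. expectation (G n)) \<longlonglongrightarrow> expectation (\<lambda>x. ln (YJ x))"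
  proof -
    have "expectation (F n) = (1 - expectation (\<lambda>x. exp (- u n * ln (YI x)))) / u n" for n
      unfolding F_def using LI.int_exp[of "u n"] u[of n] by (simp add: prob_space)
    thus "(\<lambda>n. expectation (F n)) \<longlonglongrightarrow> expectation (\<lambda>x. ln (YI x))"
      using filterlim_compose[OF LI.exp_moment_deriv u_lim'] by simp
    have "expectation (G n) = (1 - expectation (\<lambda>x. exp (- u n * ln (YJ x)))) / u n" for n
      unfolding G_def using LJ.int_exp[of "u n"] u[of n] by (simp add: prob_space)
    thus "(\<lambda>n. expectation (G n)) \<longlonglongrightarrow> expectation (\<lambda>x. ln (YJ x))"
      using filterlim_compose[OF LJ.exp_moment_deriv u_lim'] by simp
  qed
  have diff_quot_bound: "\<bar>(1 - exp (- v * y)) / v\<bar> \<le> \<bar>y\<bar> * exp (\<bar>y\<bar> / 16)" if v: "0 < v" "v \<le> 1/16" for v y :: real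
  proof -
    have "\<bar>exp (- (v * y)) - 1\<bar> \<le> exp \<bar>v * y\<bar> * \<bar>v * y\<bar>"
      using Taylor_exp_field[of "- (v * y)" 0] by simp
    also have "exp \<bar>v * y\<bar> \<le> exp (\<bar>y\<bar> / 16)"
      using v mult_right_mono[of v "1/16" "\<bar>y\<bar>"] by (simp add: abs_mult)
    finally have "\<bar>exp (- (v * y)) - 1\<bar> \<le> exp (\<bar>y\<bar> / 16) * (v * \<bar>y\<bar>)"
      using v by (simp add: abs_mult mult_right_mono)
    thus ?thesis using v by (simp add: divide_le_eq abs_minus_commute mult_ac)
  qed
  have diff_quot_lim: "(\<lambda>n. (1 - exp (- u n * y)) / u n) \<longlonglongrightarrow> y" for y
  proof -
    have "((\<lambda>v. exp (- v * y)) has_real_derivative - y) (at 0)"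
      by (auto intro!: derivative_eq_intros)
    hence "((\<lambda>v. (exp (- v * y) - 1) / v) \<longlongrightarrow> - y) (at 0)"
      by (simp add: has_field_derivative_iff)
    moreover have "filterlim u (at 0) sequentially"
      using u_lim u by (auto simp: filterlim_at less_imp_neq[symmetric])
    ultimately have "(\<lambda>n. (exp (- u n * y) - 1) / u n) \<longlonglongrightarrow> - y"
      by (rule filterlim_compose)
    from tendsto_minus[OF this] show ?thesis
      by (simp only: minus_divide_left minus_diff_eq minus_minus)
  qed
  have intsq: "integrable M (\<lambda>x. \<bar>ln (YI x)\<bar> ^ 2 * exp (1/8 * \<bar>ln (YI x)\<bar>))" "integrable M (\<lambda>x. \<bar>ln (YJ x)\<bar> ^ 2 * exp (1/8 * \<bar>ln (YJ x)\<bar>))"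
    by (rule LI.int_moment LJ.int_moment; simp)+
  have EFG: "(\<lambda>n. expectation (\<lambda>x. F n x * G n x)) \<longlonglongrightarrow> expectation (\<lambda>x. ln (YI x) * ln (YJ x))"
  proof (rule integral_dominated_convergence)
    show "integrable M (\<lambda>x. (\<bar>ln (YI x)\<bar> ^ 2 * exp (1/8 * \<bar>ln (YI x)\<bar>) + \<bar>ln (YJ x)\<bar> ^ 2 * exp (1/8 * \<bar>ln (YJ x)\<bar>)) / 2)"
      using intsq by auto
    show "AE x in M. (\<lambda>n. F n x * G n x) \<longlonglongrightarrow> ln (YI x) * ln (YJ x)"
      unfolding F_def G_def by (intro AE_I2 tendsto_mult diff_quot_lim)
    show "AE x in M. norm (F n x * G n x) \<le> (\<bar>ln (YI x)\<bar> ^ 2 * exp (1/8 * \<bar>ln (YI x)\<bar>) + \<bar>ln (YJ x)\<bar> ^ 2 * exp (1/8 * \<bar>ln (YJ x)\<bar>)) / 2" for n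
    proof (rule AE_I2)
      fix x
      define p where "p = \<bar>ln (YI x)\<bar> * exp (\<bar>ln (YI x)\<bar> / 16)"
      define q where "q = \<bar>ln (YJ x)\<bar> * exp (\<bar>ln (YJ x)\<bar> / 16)"
      have "norm (F n x * G n x) = \<bar>F n x\<bar> * \<bar>G n x\<bar>" by (simp add: abs_mult)
      also have "\<dots> \<le> p * q" unfolding F_def G_def p_def q_def
        using u[of n] by (intro mult_mono diff_quot_bound) auto
      also have "\<dots> \<le> (p\<^sup>2 + q\<^sup>2) / 2" using sum_squares_bound[of p q] by simp
      also have "p\<^sup>2 = \<bar>ln (YI x)\<bar> ^ 2 * exp (1/8 * \<bar>ln (YI x)\<bar>)"
        by (simp add: p_def power_mult_distrib exp_double[symmetric])
      also have "q\<^sup>2 = \<bar>ln (YJ x)\<bar> ^ 2 * exp (1/8 * \<bar>ln (YJ x)\<bar>)"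
        by (simp add: q_def power_mult_distrib exp_double[symmetric])
      finally show "norm (F n x * G n x) \<le> (\<bar>ln (YI x)\<bar> ^ 2 * exp (1/8 * \<bar>ln (YI x)\<bar>) + \<bar>ln (YJ x)\<bar> ^ 2 * exp (1/8 * \<bar>ln (YJ x)\<bar>)) / 2" .
    qed
  qed (auto simp: F_def G_def)
  have lim: "(\<lambda>n. expectation (\<lambda>x. F n x * G n x) - expectation (F n) * expectation (G n)) \<longlonglongrightarrow>
      expectation (\<lambda>x. ln (YI x) * ln (YJ x)) - expectation (\<lambda>x. ln (YI x)) * expectation (\<lambda>x. ln (YJ x))"
    by (intro tendsto_diff tendsto_mult EFG EF EG)
  have cov: "expectation (\<lambda>x. F n x * G n x) - expectation (F n) * expectation (G n) \<in> {0..excess_bound (u n) / (u n)\<^sup>2}" for n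
  proof -
    define v where "v = u n"
    have v: "0 < v" "v < 1/4" "v < 1/2" using u[of n] by (auto simp: v_def)
    define A where "A x = YI x powr (- v)" for x
    define B where "B x = YJ x powr (- v)" for x
    have iA: "integrable M A" and iB: "integrable M B" and iAB: "integrable M (\<lambda>x. A x * B x)"
      using int_neg_moment[OF v(1,3)] neg_moment_cov(1)[OF v(1,2)] by (auto simp: A_def[abs_def] B_def[abs_def])
    have [measurable]: "A \<in> borel_measurable M" "B \<in> borel_measurable M"
      unfolding A_def[abs_def] B_def[abs_def] by measurable
    have "expectation (F n) = expectation (\<lambda>x. (1 - A x) / v)"
      by (rule integral_cong_AE, (simp add: F_def[abs_def])+, use eI in eventually_elim, simp add: A_def v_def F_def)
    also have "\<dots> = (1 - expectation A) / v" using iA by (simp add: prob_space)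
    finally have 1: "expectation (F n) = (1 - expectation A) / v" .
    have "expectation (G n) = expectation (\<lambda>x. (1 - B x) / v)"
      by (rule integral_cong_AE, (simp add: G_def[abs_def])+, use eJ in eventually_elim, simp add: B_def v_def G_def)
    also have "\<dots> = (1 - expectation B) / v" using iB by (simp add: prob_space)
    finally have 2: "expectation (G n) = (1 - expectation B) / v" .
    have "expectation (\<lambda>x. F n x * G n x) = expectation (\<lambda>x. (1 - A x - B x + A x * B x) / v\<^sup>2)"
    proof (rule integral_cong_AE)
      show "AE x in M. F n x * G n x = (1 - A x - B x + A x * B x) / v\<^sup>2"
        using eI eJ
      proof eventually_elim
        case (elim x)
        have FG: "F n x = (1 - A x) / v" "G n x = (1 - B x) / v"
          using elim by (simp_all add: F_def G_def A_def B_def v_def)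
        show ?case unfolding FG by (simp add: power2_eq_square algebra_simps)
      qed
    qed (auto simp: F_def[abs_def] G_def[abs_def])
    also have "\<dots> = (1 - expectation A - expectation B + expectation (\<lambda>x. A x * B x)) / v\<^sup>2"
      using iA iB iAB by (simp add: prob_space)
    finally have "expectation (\<lambda>x. F n x * G n x) - expectation (F n) * expectation (G n) = (expectation (\<lambda>x. A x * B x) - expectation A * expectation B) / v\<^sup>2"
      unfolding 1 2 by (simp add: power2_eq_square algebra_simps add_divide_distrib diff_divide_distrib)
    thus ?thesis using neg_moment_cov(2,3)[OF v(1,2)] unfolding v_def[symmetric] A_def[symmetric] B_def[symmetric]
      by (auto intro!: divide_right_mono)
  qed
  have glim: "(\<lambda>n. gamma_neg_moment b (2 * u n)) \<longlonglongrightarrow> 1" if "0 < b" for b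
  proof -
    have "isCont (gamma_neg_moment b) 0" using gamma_neg_moment_deriv[of 0 b] that by (auto intro: DERIV_isCont)
    hence "(\<lambda>n. gamma_neg_moment b (2 * u n)) \<longlonglongrightarrow> gamma_neg_moment b 0"
      by (rule isCont_tendsto_compose) (use tendsto_mult_right_zero[OF u_lim, of 2] in simp)
    thus ?thesis using that by (simp add: gamma_neg_moment_0)
  qed
  \<comment> \<open>In the limit the Gamma ratios become 1, which leaves
    \<open>4 * r\<^sup>2 * (c / 2) powr (- 2)\<close>, the bound of the statement.\<close>
  have "(\<lambda>n. 4 * r\<^sup>2 * (c / 2) powr (- (2 * u n + 2)) *
     ((gamma_neg_moment (real (card I) / 2) (2 * u n) + gamma_neg_moment (real (card J) / 2) (2 * u n)) / 2))
     \<longlonglongrightarrow> 4 * r\<^sup>2 * (c / 2) powr (- (2 * 0 + 2)) * ((1 + 1) / 2)"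
    using c card_pos by (intro tendsto_intros u_lim glim) auto
  moreover have "excess_bound (u n) / (u n)\<^sup>2 = 4 * r\<^sup>2 * (c / 2) powr (- (2 * u n + 2)) *
     ((gamma_neg_moment (real (card I) / 2) (2 * u n) + gamma_neg_moment (real (card J) / 2) (2 * u n)) / 2)" for n
    using u[of n] by (simp add: excess_bound_def)
  moreover have "(c / 2) powr (- (2 * 0 + 2)) = 4 / c\<^sup>2"
    using c by (simp add: powr_minus powr_numeral power_divide)
  ultimately have lim2: "(\<lambda>n. excess_bound (u n) / (u n)\<^sup>2) \<longlonglongrightarrow> 16 * r\<^sup>2 / c\<^sup>2"
    by simp
  have "0 \<le> expectation (\<lambda>x. ln (YI x) * ln (YJ x)) - expectation (\<lambda>x. ln (YI x)) * expectation (\<lambda>x. ln (YJ x))"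
    by (rule LIMSEQ_le_const[OF lim]) (use cov in auto)
  moreover have "expectation (\<lambda>x. ln (YI x) * ln (YJ x)) - expectation (\<lambda>x. ln (YI x)) * expectation (\<lambda>x. ln (YJ x)) \<le> 16 * r\<^sup>2 / c\<^sup>2"
    by (rule LIMSEQ_le[OF lim lim2]) (use cov in auto)
  ultimately show ?thesis by simp
qed

end

section \<open>Peak kernels and the variation of a regularly varying function\<close>

lemma nn_integral_powr_from_0:
  fixes p c :: real
  assumes "p < 1" "0 \<le> c"
  shows "(\<integral>\<^sup>+x. ennreal (indicator {0..c} x * x powr (- p)) \<partial>lborel) = ennreal (c powr (1 - p) / (1 - p))"
proof -
  have "((\<lambda>x. x powr (- p)) has_integral (c powr (- p + 1) / (- p + 1))) {0..c}"
    by (rule has_integral_powr_from_0) (use assms in auto)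
  hence "((\<lambda>x. if x \<in> {0..c} then x powr (- p) else 0) has_integral (c powr (- p + 1) / (- p + 1))) UNIV"
    by (simp only: has_integral_restrict_UNIV)
  also have "(\<lambda>x. if x \<in> {0..c} then x powr (- p) else 0) = (\<lambda>x. indicator {0..c} x * x powr (- p))"
    by (auto simp: indicator_def)
  finally show ?thesis
    by (subst nn_integral_has_integral_lborel[of _ "c powr (- p + 1) / (- p + 1)"]) auto
qed

lemma nn_integral_powr_to_inf:
  fixes p c :: real
  assumes "0 < p" "0 < c"
  shows "(\<integral>\<^sup>+x. ennreal (indicator {c..} x * x powr (- p - 1)) \<partial>lborel) = ennreal (c powr (- p) / p)"
proof -
  have "((\<lambda>x. x powr (- p - 1)) has_integral (- (c powr (- p - 1 + 1)) / (- p - 1 + 1))) {c..}"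
    by (rule has_integral_powr_to_inf) (use assms in auto)
  hence "((\<lambda>x. if x \<in> {c..} then x powr (- p - 1) else 0) has_integral (c powr (- p) / p)) UNIV"
    by (simp only: has_integral_restrict_UNIV) simp
  also have "(\<lambda>x. if x \<in> {c..} then x powr (- p - 1) else 0) = (\<lambda>x. indicator {c..} x * x powr (- p - 1))"
    by (auto simp: indicator_def)
  finally show ?thesis
    by (subst nn_integral_has_integral_lborel[of _ "c powr (- p) / p"]) auto
qed

text \<open>A kernel of height \<open>A\<close> and width of order \<open>1 / A\<close> has explicit
  logarithmic antiderivatives on both sides of the peak; this is the origin of the logarithms in the
  covariance bounds.\<close>

lemma nn_integral_peak:
  fixes A :: real
  assumes "0 < A"
  shows "(\<integral>\<^sup>+x. ennreal (indicator {0..2} x * (A / (1 + A * \<bar>x - 1\<bar>))) \<partial>lborel) \<le> ennreal (2 * ln (1 + A))"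
proof -
  define f1 where "f1 x = A / (1 + A * \<bar>1 - x\<bar>)" for x
  define f2 where "f2 x = A / (1 + A * \<bar>x - 1\<bar>)" for x
  have i1: "(\<integral>\<^sup>+x. ennreal (f1 x) * indicator {0..1} x \<partial>lborel) = ennreal ((- ln (1 + A * (1 - 1))) - (- ln (1 + A * (1 - 0))))"
  proof (rule nn_integral_FTC_Icc)
    fix x :: real assume "x \<in> {0..1}"
    hence x: "0 \<le> x" "x \<le> 1" by auto
    have "0 < 1 + A * (1 - x)" using assms x by (intro add_pos_nonneg) auto
    thus "((\<lambda>x. - ln (1 + A * (1 - x))) has_real_derivative f1 x) (at x)"
      unfolding f1_def using x
      by (auto intro!: derivative_eq_intros)
    show "0 \<le> f1 x" using assms by (simp add: f1_def)
  qed (auto simp: f1_def[abs_def])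
  have i2: "(\<integral>\<^sup>+x. ennreal (f2 x) * indicator {1..2} x \<partial>lborel) = ennreal (ln (1 + A * (2 - 1)) - ln (1 + A * (1 - 1)))"
  proof (rule nn_integral_FTC_Icc)
    fix x :: real assume "x \<in> {1..2}"
    hence x: "1 \<le> x" "x \<le> 2" by auto
    have "0 < 1 + A * (x - 1)" using assms x by (intro add_pos_nonneg) auto
    thus "((\<lambda>x. ln (1 + A * (x - 1))) has_real_derivative f2 x) (at x)"
      unfolding f2_def using x
      by (auto intro!: derivative_eq_intros)
    show "0 \<le> f2 x" using assms by (simp add: f2_def)
  qed (auto simp: f2_def[abs_def])
  have "(\<integral>\<^sup>+x. ennreal (indicator {0..2} x * (A / (1 + A * \<bar>x - 1\<bar>))) \<partial>lborel) \<le>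
     (\<integral>\<^sup>+x. ennreal (f1 x) * indicator {0..1} x + ennreal (f2 x) * indicator {1..2} x \<partial>lborel)"
    using assms by (intro nn_integral_mono) (auto simp: f1_def f2_def indicator_def abs_minus_commute)
  also have "\<dots> = (\<integral>\<^sup>+x. ennreal (f1 x) * indicator {0..1} x \<partial>lborel) + (\<integral>\<^sup>+x. ennreal (f2 x) * indicator {1..2} x \<partial>lborel)"
    by (rule nn_integral_add) (auto simp: f1_def[abs_def] f2_def[abs_def])
  also have "\<dots> = ennreal (2 * ln (1 + A))"
    unfolding i1 i2 using assms by (subst ennreal_plus[symmetric]) auto
  finally show ?thesis .
qed

text \<open>The first two summands come from the singularity at 0 and from the tail at infinity, the
  third from the peak at 1.\<close>

definition peak_const :: "real \<Rightarrow> real" where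
  "peak_const p = 2 / (1 - p) + 2 / p + 8"

text \<open>Away from the peak, for \<open>x \<le> 1/2\<close> and for \<open>2 \<le> x\<close>, the
  kernel is at most 2 and \<open>2 / x\<close>; near it the power is at most 2. Convergence at 0
  rests on \<open>p < 1\<close>, at infinity on \<open>0 < p\<close>.\<close>

lemma nn_integral_peak_powr:
  fixes A p :: real
  assumes A: "1 \<le> A" and p: "0 < p" "p < 1"
  shows "(\<integral>\<^sup>+x. ennreal (indicator {0<..} x * x powr (- p) * (A / (1 + A * \<bar>x - 1\<bar>))) \<partial>lborel) \<le> ennreal (peak_const p * (1 + ln A))"
proof -
  have "(\<integral>\<^sup>+x. ennreal (indicator {0<..} x * x powr (- p) * (A / (1 + A * \<bar>x - 1\<bar>))) \<partial>lborel) \<le>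
    (\<integral>\<^sup>+x. ennreal 2 * ennreal (indicator {0..1} x * x powr (- p)) +
       (ennreal 2 * ennreal (indicator {0..2} x * (A / (1 + A * \<bar>x - 1\<bar>))) + ennreal 2 * ennreal (indicator {1..} x * x powr (- p - 1))) \<partial>lborel)"
  proof (rule nn_integral_mono)
    fix x :: real
    have "indicator {0<..} x * x powr (- p) * (A / (1 + A * \<bar>x - 1\<bar>)) \<le>
      2 * (indicator {0..1} x * x powr (- p)) + (2 * (indicator {0..2} x * (A / (1 + A * \<bar>x - 1\<bar>))) + 2 * (indicator {1..} x * x powr (- p - 1)))"
    proof -
      have a: "0 \<le> A / (1 + A * \<bar>x - 1\<bar>)" using A by simp
      consider "x \<le> 0" | "0 < x" "x \<le> 1/2" | "1/2 \<le> x" "x \<le> 2" | "x \<ge> 2" by linarith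
      thus ?thesis
      proof cases
        case 1
        hence "indicator {0<..} x * x powr (- p) * (A / (1 + A * \<bar>x - 1\<bar>)) = 0" by simp
        moreover have "0 \<le> 2 * (indicator {0..1} x * x powr (- p)) + (2 * (indicator {0..2} x * (A / (1 + A * \<bar>x - 1\<bar>))) + 2 * (indicator {1..} x * x powr (- p - 1)))"
          by (intro add_nonneg_nonneg mult_nonneg_nonneg a) auto
        ultimately show ?thesis by linarith
      next
        case 2
        have "A * (1/2) \<le> A * \<bar>x - 1\<bar>" using 2 A by (intro mult_left_mono) auto
        hence "A \<le> 2 * (1 + A * \<bar>x - 1\<bar>)" unfolding distrib_left by linarith
        moreover have "0 < 1 + A * \<bar>x - 1\<bar>" using A by (intro add_pos_nonneg) auto
        ultimately have "A / (1 + A * \<bar>x - 1\<bar>) \<le> 2" by (subst divide_le_eq) auto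
        hence "x powr (- p) * (A / (1 + A * \<bar>x - 1\<bar>)) \<le> x powr (- p) * 2" by (intro mult_left_mono) auto
        thus ?thesis using 2 a by (simp add: indicator_def)
      next
        case 3
        have "x powr (- p) \<le> (1/2) powr (- p)" using 3 p by (intro powr_mono2') auto
        also have "\<dots> = 2 powr p" by (simp add: powr_minus powr_divide)
        also have "\<dots> \<le> 2 powr 1" using p by (intro powr_mono) auto
        finally have "x powr (- p) * (A / (1 + A * \<bar>x - 1\<bar>)) \<le> 2 * (A / (1 + A * \<bar>x - 1\<bar>))"
          using a by (intro mult_right_mono) auto
        thus ?thesis using 3 a by (auto simp add: indicator_def intro: order_trans)
      next
        case 4
        have "A * (x/2) \<le> A * \<bar>x - 1\<bar>" using 4 A by (intro mult_left_mono) auto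
        hence "A * x \<le> 2 * (1 + A * \<bar>x - 1\<bar>)" unfolding distrib_left by linarith
        hence "A / (1 + A * \<bar>x - 1\<bar>) \<le> 2 / x" using A 4
          by (subst divide_le_eq) (auto simp: field_simps intro: add_pos_nonneg)
        hence "x powr (- p) * (A / (1 + A * \<bar>x - 1\<bar>)) \<le> x powr (- p) * (2 / x)" by (intro mult_left_mono) auto
        also have "\<dots> = 2 * x powr (- p - 1)" using 4 by (simp add: powr_diff)
        finally show ?thesis using 4 a by (auto simp add: indicator_def)
      qed
    qed
    hence "ennreal (indicator {0<..} x * x powr (- p) * (A / (1 + A * \<bar>x - 1\<bar>))) \<le> ennreal (2 * (indicator {0..1} x * x powr (- p)) + (2 * (indicator {0..2} x * (A / (1 + A * \<bar>x - 1\<bar>))) + 2 * (indicator {1..} x * x powr (- p - 1))))"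
      by (rule ennreal_leI)
    also have "\<dots> = ennreal 2 * ennreal (indicator {0..1} x * x powr (- p)) +
       (ennreal 2 * ennreal (indicator {0..2} x * (A / (1 + A * \<bar>x - 1\<bar>))) + ennreal 2 * ennreal (indicator {1..} x * x powr (- p - 1)))"
    proof -
      have e: "ennreal (2 * a + (2 * b + 2 * c)) = ennreal 2 * ennreal a + (ennreal 2 * ennreal b + ennreal 2 * ennreal c)"
        if "0 \<le> a" "0 \<le> b" "0 \<le> c" for a b c :: real
        using that by (simp add: ennreal_mult)
      show ?thesis by (rule e) (use A in auto)
    qed
    finally show "ennreal (indicator {0<..} x * x powr (- p) * (A / (1 + A * \<bar>x - 1\<bar>))) \<le>
      ennreal 2 * ennreal (indicator {0..1} x * x powr (- p)) +
       (ennreal 2 * ennreal (indicator {0..2} x * (A / (1 + A * \<bar>x - 1\<bar>))) + ennreal 2 * ennreal (indicator {1..} x * x powr (- p - 1)))" .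
  qed
  also have "\<dots> = ennreal 2 * (\<integral>\<^sup>+x. ennreal (indicator {0..1} x * x powr (- p)) \<partial>lborel) +
     (ennreal 2 * (\<integral>\<^sup>+x. ennreal (indicator {0..2} x * (A / (1 + A * \<bar>x - 1\<bar>))) \<partial>lborel) +
      ennreal 2 * (\<integral>\<^sup>+x. ennreal (indicator {1..} x * x powr (- p - 1)) \<partial>lborel))"
    by (simp add: nn_integral_add nn_integral_cmult)
  also have "\<dots> \<le> ennreal 2 * ennreal (1 / (1 - p)) + (ennreal 2 * ennreal (2 * ln (1 + A)) + ennreal 2 * ennreal (1 / p))"
    using nn_integral_powr_from_0[of p 1] nn_integral_powr_to_inf[of p 1] nn_integral_peak[of A] A p
    by (intro add_mono mult_left_mono) auto
  also have "\<dots> = ennreal (2 / (1 - p) + (4 * ln (1 + A) + 2 / p))"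
  proof -
    have e: "ennreal 2 * ennreal a + (ennreal 2 * ennreal b + ennreal 2 * ennreal c) = ennreal (2 * a + (2 * b + 2 * c))"
      if "0 \<le> a" "0 \<le> b" "0 \<le> c" for a b c :: real
      using that by (simp add: ennreal_mult)
    show ?thesis using e[of "1 / (1 - p)" "2 * ln (1 + A)" "1 / p"] A p by simp
  qed
  also have "\<dots> \<le> ennreal (peak_const p * (1 + ln A))"
  proof (rule ennreal_leI)
    have "ln (1 + A) \<le> ln (2 * A)" using A by simp
    also have "\<dots> = ln 2 + ln A" using A by (simp add: ln_mult)
    also have "\<dots> \<le> 1 + ln A" using ln_2_less_1 by simp
    finally have "ln (1 + A) \<le> 1 + ln A" .
    moreover have "0 \<le> ln A" using A by simp
    moreover have "4 * x \<le> 8 * (1 + y)" if "x \<le> 1 + y" "0 \<le> y" for x y :: real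
      using that by (simp add: algebra_simps)
    ultimately have l: "4 * ln (1 + A) \<le> 8 * (1 + ln A)" by blast
    have "2 / (1 - p) * 1 \<le> 2 / (1 - p) * (1 + ln A)" "2 / p * 1 \<le> 2 / p * (1 + ln A)"
      using p A by (intro mult_left_mono; simp)+
    from add_mono[OF this(1) add_mono[OF l this(2)]]
    show "2 / (1 - p) + (4 * ln (1 + A) + 2 / p) \<le> peak_const p * (1 + ln A)"
      unfolding peak_const_def by (simp add: algebra_simps)
  qed
  finally show ?thesis .
qed

lemma nn_integral_peak_powr_scaled:
  fixes n \<omega> p :: real
  assumes n: "0 < n" and \<omega>: "0 < \<omega>" "1 \<le> n * \<omega>" and p: "0 < p" "p < 1"
  shows "(\<integral>\<^sup>+x. ennreal (indicator {0<..} x * (x / \<omega>) powr (- p) * (n / (1 + n * \<bar>x - \<omega>\<bar>))) \<partial>lborel) \<le> ennreal (peak_const p * (1 + ln (n * \<omega>)))"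
proof -
  have "(\<integral>\<^sup>+x. ennreal (indicator {0<..} x * (x / \<omega>) powr (- p) * (n / (1 + n * \<bar>x - \<omega>\<bar>))) \<partial>lborel)
    = ennreal \<omega> * (\<integral>\<^sup>+x. ennreal (indicator {0<..} (\<omega> * x) * (\<omega> * x / \<omega>) powr (- p) * (n / (1 + n * \<bar>\<omega> * x - \<omega>\<bar>))) \<partial>lborel)"
    using nn_integral_real_affine[of "\<lambda>x. ennreal (indicator {0<..} x * (x / \<omega>) powr (- p) * (n / (1 + n * \<bar>x - \<omega>\<bar>)))" \<omega> 0] \<omega>
    by simp
  also have "\<dots> = (\<integral>\<^sup>+x. ennreal \<omega> * ennreal (indicator {0<..} (\<omega> * x) * (\<omega> * x / \<omega>) powr (- p) * (n / (1 + n * \<bar>\<omega> * x - \<omega>\<bar>))) \<partial>lborel)"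
    by (rule nn_integral_cmult[symmetric]) measurable
  also have "\<dots> = (\<integral>\<^sup>+x. ennreal (indicator {0<..} x * x powr (- p) * ((n * \<omega>) / (1 + (n * \<omega>) * \<bar>x - 1\<bar>))) \<partial>lborel)"
  proof (rule nn_integral_cong)
    fix x :: real
    have "\<bar>\<omega> * x - \<omega>\<bar> = \<omega> * \<bar>x - 1\<bar>"
      using \<omega> abs_mult[of \<omega> "x - 1"] by (simp add: right_diff_distrib)
    thus "ennreal \<omega> * ennreal (indicator {0<..} (\<omega> * x) * (\<omega> * x / \<omega>) powr (- p) * (n / (1 + n * \<bar>\<omega> * x - \<omega>\<bar>))) =
      ennreal (indicator {0<..} x * x powr (- p) * ((n * \<omega>) / (1 + (n * \<omega>) * \<bar>x - 1\<bar>)))"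
      using \<omega> n by (subst ennreal_mult[symmetric]) (auto simp: indicator_def zero_less_mult_iff mult_ac)
  qed
  also have "\<dots> \<le> ennreal (peak_const p * (1 + ln (n * \<omega>)))"
    by (rule nn_integral_peak_powr[OF \<omega>(2) p])
  finally show ?thesis .
qed

text \<open>The derivative \<open>a * z powr (a - 1)\<close> is bounded by \<open>2 powr 2\<close>
  on the interval.\<close>

lemma powr_minus_one_bound:
  fixes a y :: real
  assumes a: "\<bar>a\<bar> < 1" and y: "1/2 \<le> y" "y \<le> 2"
  shows "\<bar>y powr a - 1\<bar> \<le> 4 * \<bar>y - 1\<bar>"
proof -
  have "norm (y powr a - 1 powr a) \<le> 4 * norm (y - 1)"
  proof (rule field_differentiable_bound[where S = "{1/2..2}" and f' = "\<lambda>x. a * x powr (a - 1)"])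
    fix z :: real assume z: "z \<in> {1/2..2}"
    show "((\<lambda>z. z powr a) has_field_derivative a * z powr (a - 1)) (at z within {1/2..2})"
      using z by (auto intro!: derivative_eq_intros simp: powr_diff)
    have "z powr (a - 1) \<le> (1/2) powr (a - 1)" using z a by (intro powr_mono2') auto
    also have "\<dots> = 2 powr (1 - a)" by (simp add: powr_divide powr_minus_divide[symmetric])
    also have "\<dots> \<le> 2 powr 2" using a by (intro powr_mono) auto
    finally have "z powr (a - 1) \<le> 4" by simp
    hence "\<bar>a\<bar> * z powr (a - 1) \<le> 1 * 4" using a by (intro mult_mono) auto
    thus "norm (a * z powr (a - 1)) \<le> 4" by (simp add: abs_mult)
  qed (use y in auto)
  thus ?thesis by simp
qed

text \<open>The factor \<open>|y - 1|\<close> cancels one of two peaks at \<open>y = 1\<close>, and both exponents lie in \<open>(-1, 0)\<close>, so the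
  bound remains integrable against the other peak.\<close>
lemma relative_variation_bound:
  fixes a b y \<mu> D :: real
  assumes a: "\<bar>a\<bar> < b" "b < 1" and y: "0 < y" and \<mu>: "1 \<le> \<mu>"
    and D: "0 \<le> D" "D \<le> 2 * \<mu>" "D \<le> 2 * \<mu> * (\<bar>y - 1\<bar> / min y 1)"
  shows "y powr a * D + \<bar>y powr a - 1\<bar> \<le> (16 * \<mu> + 8) * (\<bar>y - 1\<bar> * (y powr (- b) + y powr (b - 1)))"
proof -
  have b0: "0 < b" using a by simp
  have pp: "0 \<le> y powr (- b)" "0 \<le> y powr (b - 1)" by auto
  consider "y \<le> 1/2" | "1/2 \<le> y" "y \<le> 2" | "2 \<le> y" by linarith
  thus ?thesis
  proof cases
    case 1
    have 1: "y powr a \<le> y powr (- b)" "1 \<le> y powr (- b)"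
      using 1 y a powr_mono'[of "- b" a y] powr_mono'[of "- b" 0 y] by auto
    have "y powr a * D \<le> y powr (- b) * (2 * \<mu>)" using 1 D by (intro mult_mono) auto
    moreover have "\<bar>y powr a - 1\<bar> \<le> y powr (- b)" using 1 powr_ge_zero[of y a] by linarith
    ultimately have "y powr a * D + \<bar>y powr a - 1\<bar> \<le> y powr (- b) * (2 * \<mu> + 1)" by (simp add: algebra_simps)
    also have "\<dots> \<le> ((16 * \<mu> + 8) * (1/2)) * (y powr (- b) + y powr (b - 1))"
      using \<mu> pp by (subst mult.commute, intro mult_mono) auto
    also have "\<dots> \<le> ((16 * \<mu> + 8) * \<bar>y - 1\<bar>) * (y powr (- b) + y powr (b - 1))"
      using \<mu> pp \<open>y \<le> 1/2\<close> by (intro mult_right_mono mult_left_mono) auto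
    finally show ?thesis by (simp add: mult.assoc)
  next
    case 2
    have "y powr a \<le> 2"
    proof (cases "1 \<le> y")
      case True
      have "y powr a \<le> y powr 1" using True a by (intro powr_mono) auto
      thus ?thesis using 2 y by simp
    next
      case False
      have "y powr a \<le> y powr (- 1)" using False a y by (intro powr_mono') auto
      also have "\<dots> = 1 / y" using y by (simp add: powr_minus divide_inverse)
      also have "\<dots> \<le> 2" using 2 y by (simp add: divide_le_eq)
      finally show ?thesis .
    qed
    moreover have "D \<le> 4 * \<mu> * \<bar>y - 1\<bar>"
    proof -
      have "\<bar>y - 1\<bar> / min y 1 \<le> \<bar>y - 1\<bar> / (1/2)" using 2 y by (intro divide_left_mono) auto
      hence "2 * \<mu> * (\<bar>y - 1\<bar> / min y 1) \<le> 2 * \<mu> * (\<bar>y - 1\<bar> / (1/2))" using \<mu> by (intro mult_left_mono) auto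
      thus ?thesis using D by simp
    qed
    ultimately have "y powr a * D \<le> 2 * (4 * \<mu> * \<bar>y - 1\<bar>)" using D by (intro mult_mono) auto
    moreover have "\<bar>y powr a - 1\<bar> \<le> 4 * \<bar>y - 1\<bar>" using a 2 by (intro powr_minus_one_bound) auto
    ultimately have "y powr a * D + \<bar>y powr a - 1\<bar> \<le> ((16 * \<mu> + 8) * \<bar>y - 1\<bar>) * (1/2)" by (simp add: algebra_simps)
    also have "\<dots> \<le> ((16 * \<mu> + 8) * \<bar>y - 1\<bar>) * (y powr (- b) + y powr (b - 1))"
    proof (rule mult_left_mono)
      have "2 powr (- b) \<le> y powr (- b)" using 2 y b0 by (intro powr_mono2') auto
      moreover have "(2::real) powr (- 1) \<le> 2 powr (- b)" using a by (intro powr_mono) auto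
      ultimately have "1/2 \<le> y powr (- b)" by (simp add: powr_minus)
      thus "1/2 \<le> y powr (- b) + y powr (b - 1)" using pp by linarith
    qed (use \<mu> in auto)
    finally show ?thesis by (simp add: mult.assoc)
  next
    case 3
    have 1: "y powr a \<le> y powr b" "1 \<le> y powr b"
      using 3 y a powr_mono[of a b y] powr_mono[of 0 b y] by auto
    have "y powr a * D \<le> y powr b * (2 * \<mu>)" using 1 D by (intro mult_mono) auto
    moreover have "\<bar>y powr a - 1\<bar> \<le> y powr b" using 1 powr_ge_zero[of y a] by linarith
    ultimately have "y powr a * D + \<bar>y powr a - 1\<bar> \<le> (2 * \<mu> + 1) * y powr b" by (simp add: algebra_simps)
    also have "y powr b = y * y powr (b - 1)" using y by (simp add: powr_diff)
    also have "(2 * \<mu> + 1) * (y * y powr (b - 1)) \<le> (2 * \<mu> + 1) * ((2 * \<bar>y - 1\<bar>) * (y powr (- b) + y powr (b - 1)))"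
      using \<mu> pp 3 by (intro mult_left_mono mult_mono) auto
    also have "\<dots> = (2 * (2 * \<mu> + 1)) * (\<bar>y - 1\<bar> * (y powr (- b) + y powr (b - 1)))"
      by (simp only: mult_ac)
    also have "\<dots> \<le> (16 * \<mu> + 8) * (\<bar>y - 1\<bar> * (y powr (- b) + y powr (b - 1)))"
      using \<mu> pp by (intro mult_right_mono) auto
    finally show ?thesis .
  qed
qed

section \<open>Discrete Fourier transforms at Fourier frequencies\<close>

lemma nn_integral_even:
  fixes g :: "real \<Rightarrow> ennreal"
  assumes [measurable]: "g \<in> borel_measurable borel"
  shows "(\<integral>\<^sup>+x. g \<bar>x\<bar> \<partial>lborel) = 2 * (\<integral>\<^sup>+x. indicator {0<..} x * g x \<partial>lborel)"
proof -
  have "AE x in lborel. x \<noteq> (0::real)" by (rule AE_lborel_singleton)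
  hence "(\<integral>\<^sup>+x. g \<bar>x\<bar> \<partial>lborel) = (\<integral>\<^sup>+x. indicator {0<..} x * g x + indicator {0<..} (- x) * g (- x) \<partial>lborel)"
    by (intro nn_integral_cong_AE, elim AE_mp, intro AE_I2) (auto simp: indicator_def abs_if)
  also have "\<dots> = (\<integral>\<^sup>+x. indicator {0<..} x * g x \<partial>lborel) + (\<integral>\<^sup>+x. indicator {0<..} (- x) * g (- x) \<partial>lborel)"
    by (rule nn_integral_add) measurable
  also have "(\<integral>\<^sup>+x. indicator {0<..} (- x) * g (- x) \<partial>lborel) = (\<integral>\<^sup>+x. indicator {0<..} x * g x \<partial>lborel)"
    using nn_integral_real_affine[of "\<lambda>x. indicator {0<..} x * g x" "-1" 0] by simp
  finally show ?thesis by (simp add: mult_2)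
qed

definition dirichlet :: "nat \<Rightarrow> real \<Rightarrow> complex" where
  "dirichlet n \<theta> = (\<Sum>t=1..n. cis (real t * \<theta>))"

lemma dirichlet_geometric: "(1 - cis \<theta>) * dirichlet n \<theta> = cis \<theta> * (1 - cis (real n * \<theta>))"
proof (induction n)
  case (Suc n)
  have "dirichlet (Suc n) \<theta> = dirichlet n \<theta> + cis (real n * \<theta>) * cis \<theta>"
    by (simp add: dirichlet_def cis_mult algebra_simps)
  hence "(1 - cis \<theta>) * dirichlet (Suc n) \<theta> = cis \<theta> * (1 - cis (real n * \<theta>)) + (1 - cis \<theta>) * (cis (real n * \<theta>) * cis \<theta>)"
    using Suc by (simp add: distrib_left)
  also have "\<dots> = cis \<theta> * (1 - cis (real n * \<theta>) * cis \<theta>)" by (simp add: algebra_simps)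
  also have "cis (real n * \<theta>) * cis \<theta> = cis (real (Suc n) * \<theta>)" by (simp add: cis_mult algebra_simps)
  finally show ?case .
qed (simp add: dirichlet_def)

lemma norm_one_minus_cis: "cmod (1 - cis \<theta>) = 2 * \<bar>sin (\<theta> / 2)\<bar>"
proof -
  have "(cmod (1 - cis \<theta>))\<^sup>2 = (1 - cos \<theta>)\<^sup>2 + (sin \<theta>)\<^sup>2"
    by (simp add: cmod_power2)
  also have "\<dots> = 2 - 2 * cos \<theta>"
    using sin_cos_squared_add[of \<theta>] by (simp add: power2_eq_square algebra_simps)
  also have "cos \<theta> = 1 - 2 * (sin (\<theta> / 2))\<^sup>2"
    using cos_double_sin[of "\<theta> / 2"] by simp
  finally have "(cmod (1 - cis \<theta>))\<^sup>2 = (2 * \<bar>sin (\<theta> / 2)\<bar>)\<^sup>2" by (simp add: power_mult_distrib)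
  thus ?thesis by (rule power2_eq_imp_eq) auto
qed

lemma norm_dirichlet_le: "cmod (dirichlet n \<theta>) \<le> real n"
proof -
  have "cmod (dirichlet n \<theta>) \<le> (\<Sum>t=1..n. cmod (cis (real t * \<theta>)))"
    unfolding dirichlet_def by (rule norm_sum)
  thus ?thesis by simp
qed

lemma norm_dirichlet_sin_le: "\<bar>sin (\<theta> / 2)\<bar> * cmod (dirichlet n \<theta>) \<le> 1"
proof -
  have "2 * \<bar>sin (\<theta> / 2)\<bar> * cmod (dirichlet n \<theta>) = cmod (cis \<theta> * (1 - cis (real n * \<theta>)))"
    by (simp only: dirichlet_geometric[symmetric] norm_mult norm_one_minus_cis)
  also have "\<dots> = 2 * \<bar>sin (real n * \<theta> / 2)\<bar>" by (simp add: norm_mult norm_one_minus_cis)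
  also have "\<dots> \<le> 2" by simp
  finally show ?thesis by simp
qed

text \<open>The range up to \<open>3 * pi / 4\<close> is half of \<open>3 * pi / 2\<close>, the
  largest modulus of the sum of a frequency in \<open>{-pi..pi}\<close> and a Fourier frequency of
  at most \<open>pi / 2\<close>. The constant is crude but uniform on that range.\<close>

lemma sin_ge_fifth:
  assumes "0 \<le> x" "x \<le> 3 * pi / 4"
  shows "x / 5 \<le> sin x"
proof (cases "x \<le> pi / 6")
  case True
  show ?thesis
  proof (cases "x = 0")
    case False
    hence x: "0 < x" using assms by simp
    obtain z where z: "0 < z" "z < x" "sin x - sin 0 = (x - 0) * cos z"
      using MVT2[OF x, of sin cos] by auto
    have "cos (pi / 3) \<le> cos z" using z True pi_gt_zero by (intro cos_monotone_0_pi_le) auto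
    hence "1/5 \<le> cos z" by (simp add: cos_60)
    hence "x * (1/5) \<le> x * cos z" using x by (intro mult_left_mono) auto
    thus ?thesis using z by simp
  qed simp
next
  case False
  have "1/2 \<le> sin x"
  proof (cases "x \<le> pi / 2")
    case True
    have "sin (pi / 6) \<le> sin x" using False True by (intro sin_monotone_2pi_le) auto
    thus ?thesis by (simp add: sin_30)
  next
    case False
    have "sin (pi / 6) \<le> sin (pi - x)" using False assms by (intro sin_monotone_2pi_le) auto
    thus ?thesis by (simp add: sin_30)
  qed
  moreover have "pi \<le> 3.2" using pi_approx(2) by simp
  hence "x / 5 \<le> 1/2" using assms by simp
  ultimately show ?thesis by linarith
qed

text \<open>The bounds \<open>D \<le> n\<close> and \<open>v * D \<le> 10\<close> are combined. The
  auxiliary \<open>v\<close> below \<open>\<bar>\<theta>\<bar>\<close> lets both shifted kernels of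
  a taper share one peak.\<close>

lemma norm_dirichlet_peak:
  assumes v: "0 \<le> v" "v \<le> \<bar>\<theta>\<bar>" "\<bar>\<theta>\<bar> \<le> 3 * pi / 2"
  shows "cmod (dirichlet n \<theta>) \<le> 20 * (real n / (1 + real n * v))"
proof -
  define D where "D = cmod (dirichlet n \<theta>)"
  have "\<bar>\<theta>\<bar> / 2 / 5 \<le> sin (\<bar>\<theta>\<bar> / 2)" using v by (intro sin_ge_fifth) auto
  also have "\<dots> \<le> \<bar>sin (\<theta> / 2)\<bar>" by (cases "\<theta> \<ge> 0") auto
  finally have "\<bar>\<theta>\<bar> / 10 * D \<le> \<bar>sin (\<theta> / 2)\<bar> * D" by (intro mult_right_mono) (auto simp: D_def)
  also have "\<dots> \<le> 1" unfolding D_def by (rule norm_dirichlet_sin_le)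
  finally have "\<bar>\<theta>\<bar> * D \<le> 10" by simp
  moreover have "v * D \<le> \<bar>\<theta>\<bar> * D" using v by (intro mult_right_mono) (auto simp: D_def)
  ultimately have "real n * (v * D) \<le> real n * 10" by (intro mult_left_mono) auto
  moreover have "D \<le> real n" unfolding D_def by (rule norm_dirichlet_le)
  ultimately have "D * (1 + real n * v) \<le> 20 * real n" by (simp add: algebra_simps)
  moreover have "0 < 1 + real n * v" using v by (intro add_pos_nonneg) auto
  ultimately show ?thesis unfolding D_def[symmetric] by (simp add: le_divide_eq)
qed

lemma dirichlet_fourier_eq_0:
  assumes "q \<noteq> 0" "\<bar>q\<bar> < int n"
  shows "dirichlet n (2 * pi * real_of_int q / real n) = 0"
proof -
  have n: "n > 0" using assms by auto
  define \<theta> where "\<theta> = 2 * pi * real_of_int q / real n"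
  have "cis (real n * \<theta>) = 1"
    using n cis_multiple_2pi[of "real_of_int q"] by (simp add: \<theta>_def)
  hence "(1 - cis \<theta>) * dirichlet n \<theta> = 0" by (simp add: dirichlet_geometric)
  moreover have "sin (\<theta> / 2) \<noteq> 0"
  proof
    assume "sin (\<theta> / 2) = 0"
    then obtain i :: int where "\<theta> / 2 = of_int i * pi" using sin_zero_iff_int2 by auto
    hence "real_of_int q = real_of_int i * real n" using n by (simp add: \<theta>_def field_simps)
    hence q: "q = i * int n" by (metis of_int_eq_iff of_int_mult of_int_of_nat_eq)
    hence "i \<noteq> 0" using assms by auto
    hence "1 * int n \<le> \<bar>i\<bar> * int n" by (intro mult_right_mono) auto
    thus False using assms q by (simp add: abs_mult)
  qed
  hence "cmod (1 - cis \<theta>) \<noteq> 0" by (simp add: norm_one_minus_cis)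
  ultimately show ?thesis unfolding \<theta>_def[symmetric] by auto
qed

lemma sum_cos_fourier_eq_0:
  assumes "q \<noteq> 0" "\<bar>q\<bar> < int n"
  shows "(\<Sum>t=1..n. cos (real t * (2 * pi * real_of_int q / real n) - \<alpha>)) = 0"
proof -
  have "(\<Sum>t=1..n. cos (real t * (2 * pi * real_of_int q / real n) - \<alpha>)) = Re (cis (- \<alpha>) * dirichlet n (2 * pi * real_of_int q / real n))"
    unfolding dirichlet_def sum_distrib_left Re_sum by (simp add: cis_mult)
  thus ?thesis by (simp add: dirichlet_fourier_eq_0[OF assms])
qed

text \<open>The phases \<open>0\<close> and \<open>pi / 2\<close> select the real and the imaginary part of the discrete Fourier transform.\<close>
definition taper :: "nat \<Rightarrow> nat \<Rightarrow> real \<Rightarrow> nat \<Rightarrow> real" where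
  "taper n k \<phi> t = cos (real t * fourier_freq n k - \<phi>)"

text \<open>Full periods sum to 0. This removes the unknown mean of the process from the
  transforms.\<close>

lemma sum_taper_eq_0:
  assumes "1 \<le> k" "k < n"
  shows "(\<Sum>t=1..n. taper n k \<phi> t) = 0"
  using sum_cos_fourier_eq_0[of "int k" n \<phi>] assms by (simp add: taper_def fourier_freq_def)

text \<open>The product splits into the difference frequency and the sum frequency. The conditions
  \<open>2 * k < n\<close> and \<open>2 * j < n\<close> keep the sum frequency short of a full turn,
  so only the difference can resonate.\<close>

lemma sum_taper_mult:
  assumes k: "1 \<le> k" "2 * k < n" and j: "1 \<le> j" "2 * j < n"
  shows "(\<Sum>t=1..n. taper n k \<phi> t * taper n j \<phi>' t) = (if k = j then real n / 2 * cos (\<phi> - \<phi>') else 0)"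
proof -
  have n: "n > 0" using k by auto
  have "taper n k \<phi> t * taper n j \<phi>' t = (cos (real t * (2 * pi * real_of_int (int k - int j) / real n) - (\<phi> - \<phi>')) +
      cos (real t * (2 * pi * real_of_int (int k + int j) / real n) - (\<phi> + \<phi>'))) / 2" for t
    unfolding taper_def cos_times_cos fourier_freq_def using n
    by (intro arg_cong2[where f="\<lambda>x y. (cos x + cos y) / 2"]) (simp_all add: field_simps)
  hence e: "(\<Sum>t=1..n. taper n k \<phi> t * taper n j \<phi>' t) =
     ((\<Sum>t=1..n. cos (real t * (2 * pi * real_of_int (int k - int j) / real n) - (\<phi> - \<phi>'))) +
      (\<Sum>t=1..n. cos (real t * (2 * pi * real_of_int (int k + int j) / real n) - (\<phi> + \<phi>')))) / 2"
    by (simp add: sum.distrib sum_divide_distrib add_divide_distrib)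
  have z: "(\<Sum>t=1..n. cos (real t * (2 * pi * real_of_int (int k + int j) / real n) - (\<phi> + \<phi>'))) = 0"
    by (rule sum_cos_fourier_eq_0) (use k j in auto)
  show ?thesis
  proof (cases "k = j")
    case True thus ?thesis unfolding e z using cos_minus[of "\<phi> - \<phi>'"] by simp
  next
    case False
    have "(\<Sum>t=1..n. cos (real t * (2 * pi * real_of_int (int k - int j) / real n) - (\<phi> - \<phi>'))) = 0"
      by (rule sum_cos_fourier_eq_0) (use k j False in auto)
    thus ?thesis unfolding e z using False by simp
  qed
qed

definition dft :: "nat \<Rightarrow> (nat \<Rightarrow> real) \<Rightarrow> real \<Rightarrow> complex" where
  "dft n c y = (\<Sum>t=1..n. complex_of_real (c t) * cis (real t * y))"

lemma dft_taper:
  "dft n (taper n k \<phi>) y = (cis (- \<phi>) * dirichlet n (y + fourier_freq n k) + cis \<phi> * dirichlet n (y - fourier_freq n k)) / 2"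
proof -
  have "complex_of_real (cos x) = (cis x + cis (- x)) / 2" for x
    by (simp add: complex_eq_iff)
  hence "complex_of_real (taper n k \<phi> t) * cis (real t * y) =
     (cis (- \<phi>) * cis (real t * (y + fourier_freq n k)) + cis \<phi> * cis (real t * (y - fourier_freq n k))) / 2" for t
    unfolding taper_def by (simp add: cis_mult algebra_simps add_divide_distrib)
  thus ?thesis unfolding dft_def dirichlet_def
    by (simp add: sum.distrib sum_distrib_left sum_divide_distrib add_divide_distrib)
qed

text \<open>Used instead of \<open>min n (1 / |v|)\<close>, so that no division by zero occurs at the peak.\<close>
definition peak :: "nat \<Rightarrow> nat \<Rightarrow> real \<Rightarrow> real" where
  "peak n k y = 20 * (real n / (1 + real n * \<bar>\<bar>y\<bar> - fourier_freq n k\<bar>))"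

lemma norm_dft_taper_le:
  assumes "\<bar>y\<bar> \<le> pi" "fourier_freq n k \<le> pi / 2"
  shows "cmod (dft n (taper n k \<phi>) y) \<le> peak n k y"
proof -
  define w where "w = fourier_freq n k"
  have w: "0 \<le> w" "w \<le> pi / 2" using assms by (auto simp: w_def fourier_freq_def)
  have "cmod (dirichlet n (y + w)) \<le> peak n k y" "cmod (dirichlet n (y - w)) \<le> peak n k y"
  proof -
    have "\<bar>\<bar>y\<bar> - w\<bar> \<le> \<bar>y + w\<bar>" "\<bar>y + w\<bar> \<le> 3 * pi / 2" "\<bar>\<bar>y\<bar> - w\<bar> \<le> \<bar>y - w\<bar>" "\<bar>y - w\<bar> \<le> 3 * pi / 2"
      using w assms by arith+
    thus "cmod (dirichlet n (y + w)) \<le> peak n k y" "cmod (dirichlet n (y - w)) \<le> peak n k y"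
      unfolding peak_def w_def[symmetric] by (auto intro: norm_dirichlet_peak simp del: times_divide_eq_right)
  qed
  moreover have "cmod (dft n (taper n k \<phi>) y) \<le> (cmod (dirichlet n (y + w)) + cmod (dirichlet n (y - w))) / 2"
    unfolding dft_taper w_def[symmetric] norm_divide
    using norm_triangle_ineq[of "cis (- \<phi>) * dirichlet n (y + w)" "cis \<phi> * dirichlet n (y - w)"] by (simp add: norm_mult)
  ultimately show ?thesis by simp
qed

text \<open>Adding both phases cancels the interference between the kernels centred at the two
  frequencies of opposite sign. For this reason the lower variance bound below is stated for the sum
  over the phases.\<close>

lemma norm_dft_taper_sum:
  "(cmod (dft n (taper n k 0) y))\<^sup>2 + (cmod (dft n (taper n k (pi / 2)) y))\<^sup>2 =
   ((cmod (dirichlet n (y + fourier_freq n k)))\<^sup>2 + (cmod (dirichlet n (y - fourier_freq n k)))\<^sup>2) / 2"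
proof -
  have c: "cis (pi / 2) = \<i>" "cis (- (pi / 2)) = - \<i>" by (auto simp: complex_eq_iff)
  show ?thesis unfolding dft_taper c
    by (simp add: cmod_power2 power_divide) (simp add: power2_eq_square field_simps)
qed

text \<open>For \<open>\<bar>\<theta>\<bar>\<close> up to \<open>1 / n\<close> all arguments
  \<open>t * \<theta>\<close> stay below \<open>pi / 3\<close> in modulus, so no cancellation
  occurs.\<close>

lemma norm_dirichlet_ge:
  assumes "real n * \<bar>\<theta>\<bar> \<le> 1"
  shows "real n / 2 \<le> cmod (dirichlet n \<theta>)"
proof -
  have "real n / 2 = (\<Sum>t=1..n. 1 / 2)" by simp
  also have "\<dots> \<le> (\<Sum>t=1..n. cos (real t * \<theta>))"
  proof (rule sum_mono)
    fix t assume t: "t \<in> {1..n}"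
    have "real t * \<bar>\<theta>\<bar> \<le> real n * \<bar>\<theta>\<bar>" using t by (intro mult_right_mono) auto
    hence "\<bar>real t * \<theta>\<bar> \<le> pi / 3" using assms pi_gt3 by (simp add: abs_mult)
    hence "cos (pi / 3) \<le> cos \<bar>real t * \<theta>\<bar>" using pi_gt_zero by (intro cos_monotone_0_pi_le) auto
    thus "1 / 2 \<le> cos (real t * \<theta>)" by (simp add: cos_60)
  qed
  also have "\<dots> = Re (dirichlet n \<theta>)" by (simp add: dirichlet_def)
  also have "\<dots> \<le> cmod (dirichlet n \<theta>)" by (rule complex_Re_le_cmod)
  finally show ?thesis .
qed

lemma set_integral_cos_int:
  "(LINT y:{-pi..pi}|lborel. cos (real_of_int q * y)) = (if q = 0 then 2 * pi else 0)"
proof (cases "q = 0")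
  case False
  have "(LBINT x. cos (real_of_int q * x) * indicator {-pi..pi} x) = sin (real_of_int q * pi) / of_int q - sin (real_of_int q * - pi) / of_int q"
    by (rule integral_FTC_Icc_real) (use False in \<open>auto intro!: derivative_eq_intros continuous_intros\<close>)
  thus ?thesis using False by (simp add: set_lebesgue_integral_def mult.commute sin_zero_iff_int2)
qed (simp add: set_lebesgue_integral_def)

section \<open>Spectral covariances\<close>

text \<open>The bound \<open>low\<close> ties values near 0 to \<open>fs 0\<close> from below. The
  class alone does not: it compares values at nonzero arguments with each other, and with
  \<open>fs 0\<close> only from above. Relative errors of the density make sense because of
  \<open>low\<close>.\<close>

locale spectral_model =
  fixes fs :: "real \<Rightarrow> real" and d \<mu> \<nu> \<eta> :: real
  assumes d: "-1/2 < d" "d < 1/2" and mu: "1 \<le> \<mu>" and nu: "0 < \<nu>"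
    and L: "classL \<mu> \<nu> fs" and pos0: "0 < fs 0" and eta: "0 < \<eta>" "\<eta> \<le> pi / 2"
    and low: "\<And>w. 0 \<le> w \<Longrightarrow> w \<le> \<eta> \<Longrightarrow> fs 0 / 2 \<le> fs w"
begin

definition spec_dens :: "real \<Rightarrow> real" where
  "spec_dens x = \<bar>x\<bar> powr (-2 * d) * fs x"

text \<open>The midpoint between \<open>\<bar>2 * d\<bar>\<close> and 1, so that \<open>bexp\<close>
  and \<open>1 - bexp\<close> both lie strictly between 0 and 1 and both resulting powers are
  integrable against a peak.\<close>

definition bexp :: real where "bexp = (1 + \<bar>2 * d\<bar>) / 2"

lemma bexp: "\<bar>-2 * d\<bar> < bexp" "0 < bexp" "bexp < 1"
  using d by (auto simp: bexp_def)

lemma fs_nonneg: "\<bar>x\<bar> \<le> pi \<Longrightarrow> 0 \<le> fs x" and fs_le: "\<bar>x\<bar> \<le> pi \<Longrightarrow> fs x \<le> \<mu> * fs 0"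
  using L by (auto simp: classL_def abs_le_iff)

lemma fs_lipschitz:
  "\<bar>x\<bar> \<le> pi \<Longrightarrow> \<bar>y\<bar> \<le> pi \<Longrightarrow> x \<noteq> 0 \<Longrightarrow> y \<noteq> 0 \<Longrightarrow> \<bar>fs x - fs y\<bar> \<le> \<mu> * fs 0 * \<bar>x - y\<bar> / min \<bar>x\<bar> \<bar>y\<bar>"
  and fs_holder:
  "\<bar>x\<bar> \<le> pi \<Longrightarrow> \<bar>y\<bar> \<le> pi \<Longrightarrow> x \<noteq> 0 \<Longrightarrow> y \<noteq> 0 \<Longrightarrow> \<bar>fs x - fs y\<bar> \<le> \<mu> * fs 0 * \<bar>\<bar>x\<bar> - \<bar>y\<bar>\<bar> powr \<nu>"
  using L unfolding classL_def by (auto simp: abs_le_iff)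

text \<open>Evenness is hidden in the class: the Hoelder bound is in terms of the difference of the
  absolute values, which is 0 for opposite arguments.\<close>

lemma fs_abs: "\<bar>x\<bar> \<le> pi \<Longrightarrow> fs \<bar>x\<bar> = fs x"
  using fs_holder[of "\<bar>x\<bar>" x] by (cases "x = 0") auto

lemma spec_dens_nonneg: "\<bar>x\<bar> \<le> pi \<Longrightarrow> 0 \<le> spec_dens x"
  by (simp add: spec_dens_def fs_nonneg)

lemma spec_dens_le: "\<bar>x\<bar> \<le> pi \<Longrightarrow> spec_dens x \<le> \<mu> * fs 0 * \<bar>x\<bar> powr (-2 * d)"
  using mult_left_mono[OF fs_le, of x "\<bar>x\<bar> powr (-2 * d)"] by (simp add: spec_dens_def mult_ac)

lemma spec_dens_pos: "0 < w \<Longrightarrow> w \<le> \<eta> \<Longrightarrow> 0 < spec_dens w"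
  using low[of w] pos0 by (simp add: spec_dens_def)

lemma fs_continuous: "continuous_on ({-pi..pi} - {0}) fs"
  unfolding continuous_on_def
proof
  fix x :: real assume x: "x \<in> {-pi..pi} - {0}"
  show "(fs \<longlongrightarrow> fs x) (at x within {-pi..pi} - {0})"
  proof (rule LIM_zero_cancel, rule Lim_null_comparison)
    show "eventually (\<lambda>y. norm (fs y - fs x) \<le> \<mu> * fs 0 * \<bar>\<bar>y\<bar> - \<bar>x\<bar>\<bar> powr \<nu>) (at x within {-pi..pi} - {0})"
      unfolding eventually_at_filter using x by (auto intro!: always_eventually fs_holder)
    have "((\<lambda>y. \<mu> * fs 0 * \<bar>\<bar>y\<bar> - \<bar>x\<bar>\<bar> powr \<nu>) \<longlongrightarrow> \<mu> * fs 0 * \<bar>\<bar>x\<bar> - \<bar>x\<bar>\<bar> powr \<nu>) (at x within {-pi..pi} - {0})"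
      using nu by (intro tendsto_intros tendsto_powr') auto
    thus "((\<lambda>y. \<mu> * fs 0 * \<bar>\<bar>y\<bar> - \<bar>x\<bar>\<bar> powr \<nu>) \<longlongrightarrow> 0) (at x within {-pi..pi} - {0})" by simp
  qed
qed

lemma spec_dens_measurable: "(\<lambda>x. indicator {-pi..pi} x * spec_dens x) \<in> borel_measurable borel"
proof -
  have "(\<lambda>x. indicator ({-pi..pi} - {0}) x *\<^sub>R fs x) \<in> borel_measurable borel"
    by (rule borel_measurable_continuous_on_indicator) (auto intro: fs_continuous)
  hence [measurable]: "(\<lambda>x. indicator ({-pi..pi} - {0}) x * fs x) \<in> borel_measurable borel" by simp
  \<comment> \<open>At 0, where \<open>fs\<close> may be discontinuous, both sides are 0 because
    \<open>0 powr a = 0\<close>.\<close>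
  have "(\<lambda>x. indicator {-pi..pi} x * spec_dens x) = (\<lambda>x. \<bar>x\<bar> powr (-2 * d) * (indicator ({-pi..pi} - {0}) x * fs x))"
    by (auto simp: fun_eq_iff indicator_def spec_dens_def)
  thus ?thesis by simp
qed

lemma spec_dens_integrable: "set_integrable lborel {-pi..pi} spec_dens"
  unfolding set_integrable_def
proof (rule integrableI_bounded)
  show "(\<lambda>x. indicat_real {-pi..pi} x *\<^sub>R spec_dens x) \<in> borel_measurable lborel" using spec_dens_measurable by simp
  have "(\<integral>\<^sup>+x. ennreal (norm (indicat_real {-pi..pi} x *\<^sub>R spec_dens x)) \<partial>lborel)
      \<le> (\<integral>\<^sup>+x. ennreal (\<mu> * fs 0) * ennreal (indicator {0..pi} \<bar>x\<bar> * \<bar>x\<bar> powr (- (2 * d))) \<partial>lborel)"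
  proof (rule nn_integral_mono)
    fix x :: real
    show "ennreal (norm (indicat_real {-pi..pi} x *\<^sub>R spec_dens x)) \<le> ennreal (\<mu> * fs 0) * ennreal (indicator {0..pi} \<bar>x\<bar> * \<bar>x\<bar> powr (- (2 * d)))"
      using spec_dens_le[of x] spec_dens_nonneg[of x] mu pos0
      by (subst ennreal_mult[symmetric]) (auto simp: indicator_def abs_le_iff intro!: ennreal_leI)
  qed
  also have "\<dots> = ennreal (\<mu> * fs 0) * (2 * (\<integral>\<^sup>+x. indicator {0<..} x * ennreal (indicator {0..pi} x * x powr (- (2 * d))) \<partial>lborel))"
    using nn_integral_even[of "\<lambda>x. ennreal (indicator {0..pi} x * x powr (- (2 * d)))"]
    by (subst nn_integral_cmult) auto
  also have "\<dots> \<le> ennreal (\<mu> * fs 0) * (2 * (\<integral>\<^sup>+x. ennreal (indicator {0..pi} x * x powr (- (2 * d))) \<partial>lborel))"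
    by (intro mult_left_mono nn_integral_mono) (auto simp: indicator_def)
  also have "\<dots> < \<infinity>"
    using d by (subst nn_integral_powr_from_0) (auto simp: ennreal_mult_less_top)
  finally show "(\<integral>\<^sup>+x. ennreal (norm (indicat_real {-pi..pi} x *\<^sub>R spec_dens x)) \<partial>lborel) < \<infinity>" .
qed

lemma spec_dens_mult_integrable:
  assumes "continuous_on UNIV g" "\<And>x. \<bar>g x\<bar> \<le> B"
  shows "set_integrable lborel {-pi..pi} (\<lambda>x. spec_dens x * g x)"
  unfolding set_integrable_def
proof (rule Bochner_Integration.integrable_bound)
  have [measurable]: "g \<in> borel_measurable borel" using assms(1) by (rule borel_measurable_continuous_onI)
  show "integrable lborel (\<lambda>x. B * (indicat_real {-pi..pi} x *\<^sub>R spec_dens x))"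
    using spec_dens_integrable unfolding set_integrable_def by (intro integrable_mult_right) auto
  show "(\<lambda>x. indicat_real {-pi..pi} x *\<^sub>R (spec_dens x * g x)) \<in> borel_measurable lborel"
    using borel_measurable_times[OF spec_dens_measurable \<open>g \<in> borel_measurable borel\<close>] by (simp add: mult_ac)
  show "AE x in lborel. norm (indicat_real {-pi..pi} x *\<^sub>R (spec_dens x * g x)) \<le> norm (B * (indicat_real {-pi..pi} x *\<^sub>R spec_dens x))"
  proof (rule AE_I2)
    fix x
    have "\<bar>g x\<bar> \<le> \<bar>B\<bar>" using assms(2)[of x] by linarith
    hence "\<bar>spec_dens x\<bar> * \<bar>g x\<bar> \<le> \<bar>spec_dens x\<bar> * \<bar>B\<bar>" by (rule mult_left_mono) simp
    thus "norm (indicat_real {-pi..pi} x *\<^sub>R (spec_dens x * g x)) \<le> norm (B * (indicat_real {-pi..pi} x *\<^sub>R spec_dens x))"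
      by (simp add: indicator_def abs_mult mult_ac)
  qed
qed

text \<open>The power and the smooth factor vary separately. \<open>D\<close> is the relative
  variation of \<open>fs\<close>; measuring it against \<open>fs w\<close> instead of
  \<open>fs 0\<close> costs a factor 2 by \<open>low\<close>.\<close>

lemma spec_dens_variation:
  assumes x: "x \<noteq> 0" "\<bar>x\<bar> \<le> pi" and w: "0 < w" "w \<le> \<eta>"
  defines "y \<equiv> \<bar>x\<bar> / w"
  shows "\<bar>spec_dens x - spec_dens w\<bar> \<le> (16 * \<mu> + 8) * spec_dens w * (\<bar>y - 1\<bar> * (y powr (- bexp) + y powr (bexp - 1)))"
proof -
  have y: "0 < y" "\<bar>x\<bar> = w * y" using x w by (auto simp: y_def)
  have w': "\<bar>w\<bar> \<le> pi" using w eta pi_gt_zero by linarith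
  have fw: "fs 0 / 2 \<le> fs w" "0 < fs w" using low[of w] w pos0 by auto
  define D where "D = \<bar>fs x - fs w\<bar> / fs w"
  have D0: "0 \<le> D" using fw by (simp add: D_def)
  have mf: "\<mu> * fs 0 \<le> 2 * \<mu> * fs w" using fw mu mult_left_mono[OF fw(1), of \<mu>] by simp
  have D1: "D \<le> 2 * \<mu>"
  proof -
    have "\<bar>fs x - fs w\<bar> \<le> \<mu> * fs 0"
      using fs_nonneg[OF x(2)] fs_nonneg[OF w'] fs_le[OF x(2)] fs_le[OF w'] by linarith
    thus ?thesis using mf fw by (simp add: D_def divide_le_eq)
  qed
  have D2: "D \<le> 2 * \<mu> * (\<bar>y - 1\<bar> / min y 1)"
  proof -
    have "\<bar>fs x - fs w\<bar> = \<bar>fs \<bar>x\<bar> - fs w\<bar>" using x by (simp add: fs_abs)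
    also have "\<dots> \<le> \<mu> * fs 0 * \<bar>\<bar>x\<bar> - w\<bar> / min \<bar>x\<bar> w"
      using fs_lipschitz[of "\<bar>x\<bar>" w] x w w' by simp
    also have "\<bar>\<bar>x\<bar> - w\<bar> / min \<bar>x\<bar> w = \<bar>y - 1\<bar> / min y 1"
    proof -
      have "\<bar>w * y - w\<bar> = w * \<bar>y - 1\<bar>" using w abs_mult[of w "y - 1"] by (simp add: right_diff_distrib)
      moreover have "min (w * y) w = w * min y 1" using w by (simp add: min_def)
      ultimately show ?thesis using w unfolding y(2) by simp
    qed
    hence "\<mu> * fs 0 * \<bar>\<bar>x\<bar> - w\<bar> / min \<bar>x\<bar> w = \<mu> * fs 0 * (\<bar>y - 1\<bar> / min y 1)" by (simp only: times_divide_eq_right[symmetric])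
    also have "\<dots> \<le> 2 * \<mu> * fs w * (\<bar>y - 1\<bar> / min y 1)" using y by (intro mult_right_mono mf) auto
    finally show ?thesis using fw by (simp add: D_def divide_le_eq mult_ac)
  qed
  have "spec_dens x - spec_dens w = w powr (-2 * d) * fs w * (y powr (-2 * d) * ((fs x - fs w) / fs w) + (y powr (-2 * d) - 1))"
    unfolding spec_dens_def y(2) using w y fw by (simp add: powr_mult field_simps)
  hence "\<bar>spec_dens x - spec_dens w\<bar> = spec_dens w * \<bar>y powr (-2 * d) * ((fs x - fs w) / fs w) + (y powr (-2 * d) - 1)\<bar>"
    using w fw by (simp add: spec_dens_def abs_mult)
  also have "\<dots> \<le> spec_dens w * (y powr (-2 * d) * D + \<bar>y powr (-2 * d) - 1\<bar>)"
  proof (rule mult_left_mono)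
    have "\<bar>y powr (-2 * d) * ((fs x - fs w) / fs w)\<bar> = y powr (-2 * d) * D"
      using fw by (simp add: abs_mult D_def)
    thus "\<bar>y powr (-2 * d) * ((fs x - fs w) / fs w) + (y powr (-2 * d) - 1)\<bar> \<le> y powr (-2 * d) * D + \<bar>y powr (-2 * d) - 1\<bar>"
      by (metis abs_triangle_ineq)
  qed (use spec_dens_nonneg[OF w'] in simp)
  also have "\<dots> \<le> spec_dens w * ((16 * \<mu> + 8) * (\<bar>y - 1\<bar> * (y powr (- bexp) + y powr (bexp - 1))))"
    using relative_variation_bound[OF bexp(1,3) y(1) mu D0 D1 D2] spec_dens_nonneg[OF w'] by (rule mult_left_mono)
  finally show ?thesis by (simp add: mult_ac)
qed

text \<open>Origin of the factors: \<open>400\<close> is the product of the constants 20 of two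
  peaks, \<open>16 * \<mu> + 8\<close> comes from the relative variation, the leading 2 from the two
  half-lines, 7 from \<open>1 + ln (2 * pi * j) \<le> 7 * (1 + ln j)\<close>, and the divisor
  \<open>2 * pi\<close> from the frequency \<open>2 * pi * k / n\<close>.\<close>

definition var_const :: real where
  "var_const = 2 * (400 * (16 * \<mu> + 8)) * (peak_const bexp + peak_const (1 - bexp)) * 7 / (2 * pi)"

lemma var_const_nonneg: "0 \<le> var_const"
  using mu bexp unfolding var_const_def peak_const_def by (intro divide_nonneg_nonneg mult_nonneg_nonneg add_nonneg_nonneg) auto

text \<open>The variation vanishes linearly at the frequency \<open>w\<close> of index
  \<open>k\<close> and cancels the peak there, at the price of a factor \<open>1 / w\<close>, which
  is \<open>n / (2 * pi * k)\<close>. One peak, at the higher frequency, remains and contributes the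
  logarithm.\<close>

lemma variation_integral:
  assumes n: "0 < n" and k: "1 \<le> k" "k \<le> j" and j: "fourier_freq n j \<le> \<eta>"
  shows "(\<integral>\<^sup>+x. ennreal (indicator {-pi..pi} x * (\<bar>spec_dens x - spec_dens (fourier_freq n k)\<bar> * (peak n k x * peak n j x))) \<partial>lborel)
     \<le> ennreal (var_const * spec_dens (fourier_freq n k) * real n * (1 + ln (real j)) / real k)"
proof -
  define w where "w = fourier_freq n k"
  define v where "v = fourier_freq n j"
  have wv: "0 < w" "w \<le> v" and v: "0 < v" "v \<le> \<eta>"
    using n k j by (auto simp: w_def v_def fourier_freq_def divide_right_mono)
  have w: "0 < w" "w \<le> v" "w \<le> \<eta>" using wv v by auto
  have sw: "0 < spec_dens w" using w by (intro spec_dens_pos) auto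
  define c where "c = 400 * (16 * \<mu> + 8) * spec_dens w / w"
  have c0: "0 \<le> c" using mu sw w by (simp add: c_def)
  define g where "g p x = (x / v) powr (- p) * (real n / (1 + real n * \<bar>x - v\<bar>))" for p x
  have g0: "0 \<le> g p x" if "0 \<le> x" for p x unfolding g_def by auto
  have [measurable]: "g p \<in> borel_measurable borel" for p unfolding g_def[abs_def] by measurable
  have pw: "indicator {-pi..pi} x * (\<bar>spec_dens x - spec_dens w\<bar> * (peak n k x * peak n j x)) \<le> c * (g bexp \<bar>x\<bar> + g (1 - bexp) \<bar>x\<bar>)" if "x \<noteq> 0" for x
  proof (cases "\<bar>x\<bar> \<le> pi")
    case True
    define y where "y = \<bar>x\<bar> / w"
    have y: "0 < y" "\<bar>x\<bar> = w * y" using that w by (auto simp: y_def)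
    define q where "q = real n / (1 + real n * \<bar>\<bar>x\<bar> - v\<bar>)"
    have q: "0 \<le> q" by (simp add: q_def)
    have xw: "\<bar>\<bar>x\<bar> - w\<bar> = w * \<bar>y - 1\<bar>" unfolding y(2) using w abs_mult[of w "y - 1"] by (simp add: right_diff_distrib)
    have pk: "\<bar>y - 1\<bar> * (real n / (1 + real n * \<bar>\<bar>x\<bar> - w\<bar>)) \<le> 1 / w"
    proof -
      have "0 < 1 + real n * (w * \<bar>y - 1\<bar>)" using w by (intro add_pos_nonneg) auto
      thus ?thesis unfolding xw using w by (simp add: field_simps)
    qed
    \<comment> \<open>Since \<open>w \<le> v\<close> and the exponents are negative, the powers may
      be rescaled from \<open>w\<close> to \<open>v\<close>, where the remaining peak sits; then the
      scaled peak integral applies.\<close>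
    have pooled: "y powr (- p) \<le> (\<bar>x\<bar> / v) powr (- p)" if "0 < p" for p
      using that \<open>x \<noteq> 0\<close> w v unfolding y_def by (intro powr_mono2') (auto intro: divide_left_mono)
    have "\<bar>spec_dens x - spec_dens w\<bar> * (peak n k x * peak n j x) \<le>
       ((16 * \<mu> + 8) * spec_dens w * (\<bar>y - 1\<bar> * (y powr (- bexp) + y powr (bexp - 1)))) * (peak n k x * peak n j x)"
      using spec_dens_variation[OF that True w(1,3)] unfolding y_def by (intro mult_right_mono) (auto simp: peak_def)
    also have "\<dots> = 400 * (16 * \<mu> + 8) * spec_dens w * (y powr (- bexp) + y powr (bexp - 1)) * (\<bar>y - 1\<bar> * (real n / (1 + real n * \<bar>\<bar>x\<bar> - w\<bar>))) * q"
      unfolding peak_def w_def[symmetric] v_def[symmetric] q_def[symmetric] by (simp add: mult_ac)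
    also have "\<dots> \<le> 400 * (16 * \<mu> + 8) * spec_dens w * (y powr (- bexp) + y powr (bexp - 1)) * (1 / w) * q"
      using mu sw by (intro mult_right_mono[OF _ q] mult_left_mono pk) auto
    also have "\<dots> = c * ((y powr (- bexp) + y powr (- (1 - bexp))) * q)" by (simp add: c_def)
    also have "\<dots> \<le> c * (((\<bar>x\<bar> / v) powr (- bexp) + (\<bar>x\<bar> / v) powr (- (1 - bexp))) * q)"
      using bexp by (intro mult_left_mono[OF _ c0] mult_right_mono[OF _ q] add_mono pooled) auto
    also have "\<dots> = c * (g bexp \<bar>x\<bar> + g (1 - bexp) \<bar>x\<bar>)" by (simp add: g_def q_def distrib_right add_divide_distrib)
    finally show ?thesis using True by (simp add: indicator_def abs_le_iff)
  next
    case False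
    hence "x \<notin> {-pi..pi}" by auto
    thus ?thesis using c0 g0[of "\<bar>x\<bar>"] by simp
  qed
  have "(\<integral>\<^sup>+x. ennreal (indicator {-pi..pi} x * (\<bar>spec_dens x - spec_dens w\<bar> * (peak n k x * peak n j x))) \<partial>lborel)
     \<le> (\<integral>\<^sup>+x. ennreal c * (ennreal (g bexp \<bar>x\<bar>) + ennreal (g (1 - bexp) \<bar>x\<bar>)) \<partial>lborel)"
  proof (rule nn_integral_mono_AE)
    have "AE x in lborel. x \<noteq> (0::real)" by (rule AE_lborel_singleton)
    thus "AE x in lborel. ennreal (indicator {-pi..pi} x * (\<bar>spec_dens x - spec_dens w\<bar> * (peak n k x * peak n j x))) \<le> ennreal c * (ennreal (g bexp \<bar>x\<bar>) + ennreal (g (1 - bexp) \<bar>x\<bar>))"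
    proof eventually_elim
      case (elim x)
      have "ennreal (c * (g bexp \<bar>x\<bar> + g (1 - bexp) \<bar>x\<bar>)) = ennreal c * (ennreal (g bexp \<bar>x\<bar>) + ennreal (g (1 - bexp) \<bar>x\<bar>))"
        using c0 g0[of "\<bar>x\<bar>"] by (simp add: ennreal_mult)
      thus ?case using ennreal_leI[OF pw[OF elim]] by simp
    qed
  qed
  also have "\<dots> = ennreal c * ((\<integral>\<^sup>+x. ennreal (g bexp \<bar>x\<bar>) \<partial>lborel) + (\<integral>\<^sup>+x. ennreal (g (1 - bexp) \<bar>x\<bar>) \<partial>lborel))"
    by (simp add: nn_integral_cmult nn_integral_add)
  also have "\<dots> \<le> ennreal c * (ennreal (2 * (peak_const bexp * (1 + ln (real n * v)))) + ennreal (2 * (peak_const (1 - bexp) * (1 + ln (real n * v)))))"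
  proof (intro mult_left_mono add_mono)
    have nv: "1 \<le> real n * v"
    proof -
      have "real n * v = 2 * pi * real j" using n by (simp add: v_def fourier_freq_def)
      moreover have "1 * 1 \<le> 2 * pi * real j" using k pi_gt3 by (intro mult_mono) auto
      ultimately show ?thesis by simp
    qed
    have "(\<integral>\<^sup>+x. ennreal (g p \<bar>x\<bar>) \<partial>lborel) \<le> ennreal (2 * (peak_const p * (1 + ln (real n * v))))" if p: "0 < p" "p < 1" for p
    proof -
      have "(\<integral>\<^sup>+x. ennreal (g p \<bar>x\<bar>) \<partial>lborel) = 2 * (\<integral>\<^sup>+x. indicator {0<..} x * ennreal (g p x) \<partial>lborel)"
        using nn_integral_even[of "\<lambda>x. ennreal (g p x)"] by simp
      also have "(\<integral>\<^sup>+x. indicator {0<..} x * ennreal (g p x) \<partial>lborel) = (\<integral>\<^sup>+x. ennreal (indicator {0<..} x * (x / v) powr (- p) * (real n / (1 + real n * \<bar>x - v\<bar>))) \<partial>lborel)"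
        unfolding g_def by (intro nn_integral_cong) (auto simp: indicator_def)
      also have "2 * \<dots> \<le> 2 * ennreal (peak_const p * (1 + ln (real n * v)))"
        using n v nv p by (intro mult_left_mono nn_integral_peak_powr_scaled) auto
      also have "\<dots> = ennreal (2 * (peak_const p * (1 + ln (real n * v))))"
        using p nv by (simp add: ennreal_mult peak_const_def)
      finally show ?thesis .
    qed
    thus "(\<integral>\<^sup>+x. ennreal (g bexp \<bar>x\<bar>) \<partial>lborel) \<le> ennreal (2 * (peak_const bexp * (1 + ln (real n * v))))"
      "(\<integral>\<^sup>+x. ennreal (g (1 - bexp) \<bar>x\<bar>) \<partial>lborel) \<le> ennreal (2 * (peak_const (1 - bexp) * (1 + ln (real n * v))))"
      using bexp by auto
  qed auto
  also have "\<dots> = ennreal (c * (2 * (peak_const bexp + peak_const (1 - bexp)) * (1 + ln (real n * v))))"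
  proof -
    have "0 \<le> peak_const bexp" "0 \<le> peak_const (1 - bexp)" using bexp by (auto simp: peak_const_def)
    moreover have "0 \<le> ln (real n * v)"
    proof -
      have "real n * v = 2 * pi * real j" using n by (simp add: v_def fourier_freq_def)
      moreover have "1 * 1 \<le> 2 * pi * real j" using k pi_gt3 by (intro mult_mono) auto
      ultimately show ?thesis by simp
    qed
    ultimately show ?thesis using c0
      by (subst ennreal_plus[symmetric], simp, simp, subst ennreal_mult[symmetric]) (auto simp: algebra_simps)
  qed
  also have "\<dots> \<le> ennreal (var_const * spec_dens w * real n * (1 + ln (real j)) / real k)"
  proof (rule ennreal_leI)
    have P: "0 \<le> peak_const bexp + peak_const (1 - bexp)" using bexp by (auto simp: peak_const_def)
    have "real n * v = 2 * pi * real j" using n by (simp add: v_def fourier_freq_def)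
    hence "ln (real n * v) = ln (2 * pi) + ln (real j)" using k by (simp add: ln_mult)
    moreover have "ln (2 * pi) \<le> 2 * pi - 1" by (rule ln_le_minus_one) simp
    moreover have "pi \<le> 3.5" using pi_approx(2) by simp
    moreover have "0 \<le> ln (real j)" using k by simp
    ultimately have "1 + ln (real n * v) \<le> 7 * (1 + ln (real j))" by simp
    hence "c * (2 * (peak_const bexp + peak_const (1 - bexp)) * (1 + ln (real n * v))) \<le>
       c * (2 * (peak_const bexp + peak_const (1 - bexp)) * (7 * (1 + ln (real j))))"
      using c0 P by (intro mult_left_mono) auto
    also have "\<dots> = var_const * spec_dens w * real n * (1 + ln (real j)) / real k"
    proof -
      have ceq: "c = 400 * (16 * \<mu> + 8) * spec_dens w * (real n / (2 * pi * real k))"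
        using n k by (simp add: c_def w_def fourier_freq_def)
      have "400 * E * s * (N / (2 * pi * K)) * (2 * P * (7 * l)) = 2 * (400 * E) * P * 7 / (2 * pi) * s * N * l / K"
        for E s N K P l :: real by (simp add: mult_ac)
      thus ?thesis unfolding ceq var_const_def .
    qed
    finally show "c * (2 * (peak_const bexp + peak_const (1 - bexp)) * (1 + ln (real n * v))) \<le> var_const * spec_dens w * real n * (1 + ln (real j)) / real k" .
  qed
  finally show ?thesis by (simp add: w_def)
qed

section \<open>Covariances of tapered blocks\<close>

definition acov :: "real \<Rightarrow> real" where
  "acov h = (LINT x:{-pi..pi}|lborel. spec_dens x * cos (h * x))"

definition block_cov :: "nat \<Rightarrow> (nat \<Rightarrow> real) \<Rightarrow> nat \<Rightarrow> (nat \<Rightarrow> real) \<Rightarrow> nat \<Rightarrow> real" where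
  "block_cov n c l c' l' = (\<Sum>s=1..n. \<Sum>t=1..n. c s * c' t * acov (real (s + l * n) - real (t + l' * n)))"

definition block_ker :: "nat \<Rightarrow> (nat \<Rightarrow> real) \<Rightarrow> nat \<Rightarrow> (nat \<Rightarrow> real) \<Rightarrow> nat \<Rightarrow> real \<Rightarrow> real" where
  "block_ker n c l c' l' x = (\<Sum>s=1..n. \<Sum>t=1..n. c s * c' t * cos ((real (s + l * n) - real (t + l' * n)) * x))"

text \<open>Shifting blocks by whole epochs multiplies the product of the transforms by a number of
  modulus 1, so bounds on the transforms serve all pairs of epochs alike.\<close>

lemma block_ker_dft:
  "block_ker n c l c' l' x = Re (dft n c x * cnj (dft n c' x) * cis ((real (l * n) - real (l' * n)) * x))"
proof -
  have "dft n c x * cnj (dft n c' x) * cis ((real (l * n) - real (l' * n)) * x) =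
     (\<Sum>s=1..n. \<Sum>t=1..n. complex_of_real (c s * c' t) * cis ((real (s + l * n) - real (t + l' * n)) * x))"
    unfolding dft_def cnj_sum sum_product unfolding sum_distrib_right
  proof (intro sum.cong refl)
    fix s t
    have "cis (real s * x) * cis (- (real t * x)) * cis ((real (l * n) - real (l' * n)) * x) = cis ((real (s + l * n) - real (t + l' * n)) * x)"
      by (simp add: cis_mult algebra_simps)
    thus "complex_of_real (c s) * cis (real s * x) * cnj (complex_of_real (c' t) * cis (real t * x)) * cis ((real (l * n) - real (l' * n)) * x)
       = complex_of_real (c s * c' t) * cis ((real (s + l * n) - real (t + l' * n)) * x)"
      by (simp add: cis_cnj) (metis (no_types, opaque_lifting) mult.assoc mult.commute)
  qed
  thus ?thesis unfolding block_ker_def Re_sum by (simp add: Re_sum)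
qed

lemma block_ker_abs_le: "\<bar>block_ker n c l c' l' x\<bar> \<le> cmod (dft n c x) * cmod (dft n c' x)"
  unfolding block_ker_dft by (rule order_trans[OF abs_Re_le_cmod]) (simp add: norm_mult)

lemma block_ker_continuous: "continuous_on UNIV (block_ker n c l c' l')"
  unfolding block_ker_def by (intro continuous_intros)

lemma cos_spec_dens_integrable: "set_integrable lborel {-pi..pi} (\<lambda>x. spec_dens x * cos (h * x))"
  by (rule spec_dens_mult_integrable[of _ 1]) (auto intro!: continuous_intros)

lemma block_cov_eq: "block_cov n c l c' l' = (LINT x:{-pi..pi}|lborel. spec_dens x * block_ker n c l c' l' x)"
proof -
  have "(LINT x:{-pi..pi}|lborel. spec_dens x * block_ker n c l c' l' x) =
     (LINT x|lborel. (\<Sum>s=1..n. (\<Sum>t=1..n. (c s * c' t) * (indicator {-pi..pi} x *\<^sub>R (spec_dens x * cos ((real (s + l * n) - real (t + l' * n)) * x))))))"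
    unfolding set_lebesgue_integral_def block_ker_def
    by (intro Bochner_Integration.integral_cong refl) (simp add: sum_distrib_left mult_ac)
  also have "\<dots> = (\<Sum>s=1..n. \<Sum>t=1..n. (c s * c' t) * acov (real (s + l * n) - real (t + l' * n)))"
    unfolding acov_def set_lebesgue_integral_def
    using cos_spec_dens_integrable unfolding set_integrable_def
    by (subst Bochner_Integration.integral_sum, (intro Bochner_Integration.integrable_sum integrable_mult_right; blast), intro sum.cong refl)+ simp
  finally show ?thesis by (simp add: block_cov_def)
qed

text \<open>Integer frequencies are orthogonal over a full period, and different epochs share no
  time index.\<close>

lemma block_ker_integral:
  "(LINT x:{-pi..pi}|lborel. block_ker n c l c' l' x) = (if l = l' then 2 * pi * (\<Sum>t=1..n. c t * c' t) else 0)"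
proof -
  have ci: "integrable lborel (\<lambda>x. indicator {-pi..pi} x *\<^sub>R cos (h * x))" for h :: real
    by (rule borel_integrable_compact) (auto intro!: continuous_intros)
  have "(LINT x:{-pi..pi}|lborel. block_ker n c l c' l' x) =
     (LINT x|lborel. (\<Sum>s=1..n. (\<Sum>t=1..n. (c s * c' t) * (indicator {-pi..pi} x *\<^sub>R (cos ((real (s + l * n) - real (t + l' * n)) * x))))))"
    unfolding set_lebesgue_integral_def block_ker_def
    by (intro Bochner_Integration.integral_cong refl) (simp add: sum_distrib_left mult_ac)
  also have "\<dots> = (\<Sum>s=1..n. \<Sum>t=1..n. (c s * c' t) * (LINT x:{-pi..pi}|lborel. cos ((real (s + l * n) - real (t + l' * n)) * x)))"
    unfolding set_lebesgue_integral_def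
    using ci
    by (subst Bochner_Integration.integral_sum, (intro Bochner_Integration.integrable_sum integrable_mult_right; blast), intro sum.cong refl)+ simp
  also have "\<dots> = (\<Sum>s=1..n. \<Sum>t=1..n. if s = t \<and> l = l' then 2 * pi * (c t * c' t) else 0)"
  proof (intro sum.cong refl)
    fix s t assume st: "s \<in> {1..n}" "t \<in> {1..n}"
    define q where "q = int (s + l * n) - int (t + l' * n)"
    have q: "real (s + l * n) - real (t + l' * n) = real_of_int q" by (simp add: q_def)
    have q0: "q = 0 \<longleftrightarrow> s = t \<and> l = l'"
    proof
      assume "q = 0"
      hence e: "s + l * n = t + l' * n" by (simp add: q_def flip: of_nat_add of_nat_mult)
      \<comment> \<open>Indices run from 1 to \<open>n\<close>; lowered by 1 they are remainders
        modulo \<open>n\<close>, so division recovers the epoch.\<close>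
      have "(s - 1) + l * n = (t - 1) + l' * n" using e st by auto
      hence "((s - 1) + l * n) div n = ((t - 1) + l' * n) div n" by simp
      moreover have "(s - 1) < n" "(t - 1) < n" using st by auto
      ultimately have "l = l'" by simp
      thus "s = t \<and> l = l'" using e by simp
    qed (simp add: q_def)
    show "c s * c' t * (LINT x:{-pi..pi}|lborel. cos ((real (s + l * n) - real (t + l' * n)) * x)) = (if s = t \<and> l = l' then 2 * pi * (c t * c' t) else 0)"
      unfolding q set_integral_cos_int q0 by auto
  qed
  also have "\<dots> = (if l = l' then 2 * pi * (\<Sum>t=1..n. c t * c' t) else 0)"
    by (auto simp: sum.delta sum_distrib_left)
  finally show ?thesis .
qed

lemma taper_cov_bound:
  assumes n: "0 < n" and k: "1 \<le> k" "k \<le> j" and j: "fourier_freq n j \<le> \<eta>"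
  shows "\<bar>block_cov n (taper n k \<phi>) l (taper n j \<phi>') l' - spec_dens (fourier_freq n k) * (if k = j \<and> l = l' then pi * real n * cos (\<phi> - \<phi>') else 0)\<bar>
     \<le> var_const * spec_dens (fourier_freq n k) * real n * (1 + ln (real j)) / real k"
proof -
  define w where "w = fourier_freq n k"
  define P where "P = block_ker n (taper n k \<phi>) l (taper n j \<phi>') l'"
  have jn: "4 * j \<le> n"
  proof -
    have "2 * pi * real j / real n \<le> pi / 2" using j eta by (simp add: fourier_freq_def)
    hence "4 * real j \<le> real n" using n by (simp add: field_simps)
    thus ?thesis by linarith
  qed
  have wj: "fourier_freq n k \<le> fourier_freq n j" using k n by (simp add: fourier_freq_def divide_right_mono)
  have Pc: "continuous_on UNIV P" unfolding P_def by (rule block_ker_continuous)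
  have Pb: "\<bar>P x\<bar> \<le> peak n k x * peak n j x" if "\<bar>x\<bar> \<le> pi" for x
    unfolding P_def
    by (rule order_trans[OF block_ker_abs_le], intro mult_mono norm_dft_taper_le) (use that wj j eta in \<open>auto simp: peak_def\<close>)
  have peak_le: "peak n i x \<le> 20 * real n" for i x
    using n by (auto simp: peak_def divide_le_eq add_pos_nonneg algebra_simps)
  \<comment> \<open>Integrability against the spectral density was proved for globally bounded
    factors, while the peaks bound \<open>P\<close> only on \<open>{-pi..pi}\<close>; hence the
    clipping, which changes nothing there.\<close>
  define Q where "Q x = max (- (20 * real n)\<^sup>2) (min ((20 * real n)\<^sup>2) (P x))" for x
  have PQ: "P x = Q x" if "\<bar>x\<bar> \<le> pi" for x
  proof -
    have "peak n k x * peak n j x \<le> (20 * real n) * (20 * real n)" by (intro mult_mono peak_le) (auto simp: peak_def)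
    hence "\<bar>P x\<bar> \<le> (20 * real n)\<^sup>2" using Pb[OF that] by (simp add: power2_eq_square)
    thus ?thesis by (auto simp: Q_def abs_le_iff)
  qed
  have Qc: "continuous_on UNIV Q" unfolding Q_def[abs_def] by (intro continuous_intros Pc)
  have Qb: "\<bar>Q x\<bar> \<le> (20 * real n)\<^sup>2" for x unfolding Q_def by (auto simp: abs_le_iff)
  have i1: "set_integrable lborel {-pi..pi} (\<lambda>x. spec_dens x * P x)"
  proof -
    have "set_integrable lborel {-pi..pi} (\<lambda>x. spec_dens x * Q x)" by (rule spec_dens_mult_integrable[OF Qc Qb])
    thus ?thesis by (rule set_integrable_cong[THEN iffD1, rotated -1]) (auto simp: PQ abs_le_iff)
  qed
  have i2: "set_integrable lborel {-pi..pi} P"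
    unfolding set_integrable_def by (rule borel_integrable_compact) (auto intro: continuous_on_subset[OF Pc])
  have tap: "(if l = l' then 2 * pi * (\<Sum>t=1..n. taper n k \<phi> t * taper n j \<phi>' t) else 0) = (if k = j \<and> l = l' then pi * real n * cos (\<phi> - \<phi>') else 0)"
    using k jn by (subst sum_taper_mult) auto
  have "block_cov n (taper n k \<phi>) l (taper n j \<phi>') l' - spec_dens w * (if k = j \<and> l = l' then pi * real n * cos (\<phi> - \<phi>') else 0)
      = (LINT x:{-pi..pi}|lborel. spec_dens x * P x) - spec_dens w * (LINT x:{-pi..pi}|lborel. P x)"
    unfolding P_def block_cov_eq block_ker_integral tap ..
  also have "\<dots> = (LINT x:{-pi..pi}|lborel. spec_dens x * P x - spec_dens w * P x)"
    using i1 i2 by simp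
  also have "\<dots> = (LINT x|lborel. indicator {-pi..pi} x * ((spec_dens x - spec_dens w) * P x))"
    by (simp add: set_lebesgue_integral_def left_diff_distrib)
  finally have eq: "block_cov n (taper n k \<phi>) l (taper n j \<phi>') l' - spec_dens w * (if k = j \<and> l = l' then pi * real n * cos (\<phi> - \<phi>') else 0)
      = (LINT x|lborel. indicator {-pi..pi} x * ((spec_dens x - spec_dens w) * P x))" .
  define R where "R = var_const * spec_dens w * real n * (1 + ln (real j)) / real k"
  have R0: "0 \<le> R"
  proof -
    have "\<bar>w\<bar> \<le> pi" using wj j eta pi_gt_zero k by (simp add: w_def fourier_freq_def)
    hence "0 \<le> spec_dens w" by (rule spec_dens_nonneg)
    thus ?thesis using var_const_nonneg k by (simp add: R_def)
  qed
  have "ennreal \<bar>LINT x|lborel. indicator {-pi..pi} x * ((spec_dens x - spec_dens w) * P x)\<bar> \<le> (\<integral>\<^sup>+x. norm (indicator {-pi..pi} x * ((spec_dens x - spec_dens w) * P x)) \<partial>lborel)"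
    unfolding real_norm_def[symmetric] by (rule integral_norm_bound_ennreal)
      (use set_integral_diff(1)[OF i1 set_integrable_mult_right[OF i2, of "spec_dens w"]] in \<open>simp add: set_integrable_def left_diff_distrib\<close>)
  also have "\<dots> \<le> (\<integral>\<^sup>+x. ennreal (indicator {-pi..pi} x * (\<bar>spec_dens x - spec_dens w\<bar> * (peak n k x * peak n j x))) \<partial>lborel)"
  proof (intro nn_integral_mono ennreal_leI)
    fix x
    show "norm (indicator {-pi..pi} x * ((spec_dens x - spec_dens w) * P x)) \<le> indicator {-pi..pi} x * (\<bar>spec_dens x - spec_dens w\<bar> * (peak n k x * peak n j x))"
      using Pb[of x] by (auto simp: indicator_def abs_mult abs_le_iff intro!: mult_left_mono)
  qed
  also have "\<dots> \<le> ennreal R" unfolding R_def w_def by (rule variation_integral[OF n k j])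
  finally have "\<bar>LINT x|lborel. indicator {-pi..pi} x * ((spec_dens x - spec_dens w) * P x)\<bar> \<le> R"
    using R0 by (simp add: ennreal_le_iff)
  thus ?thesis unfolding w_def[symmetric] eq R_def .
qed

lemma powr_half_bound:
  fixes y a :: real
  assumes "1/2 \<le> y" "y \<le> 2" "\<bar>a\<bar> \<le> 1"
  shows "1/2 \<le> y powr a"
proof (cases "1 \<le> y")
  case True
  have "y powr (-1) \<le> y powr a" using True assms by (intro powr_mono) auto
  moreover have "1 / 2 \<le> y powr (-1)" using True assms by (simp add: powr_minus field_simps)
  ultimately show ?thesis by linarith
next
  case False
  have "y powr 1 \<le> y powr a" using False assms by (intro powr_mono') auto
  thus ?thesis using False assms by simp
qed

text \<open>For the first few \<open>k\<close> the covariance matrix need not be close to a multiple of the identity; this bound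
  still keeps one coordinate nondegenerate.\<close>
lemma taper_var_lower:
  assumes n: "0 < n" and k: "1 \<le> k" and w: "2 * fourier_freq n k \<le> \<eta>"
  shows "spec_dens (fourier_freq n k) * real n / (16 * \<mu>) \<le>
     block_cov n (taper n k 0) l (taper n k 0) l + block_cov n (taper n k (pi/2)) l (taper n k (pi/2)) l"
proof -
  define w where "w = fourier_freq n k"
  have w0: "0 < w" "2 * w \<le> \<eta>" using n k w by (auto simp: w_def fourier_freq_def)
  have nw: "1 / real n \<le> w / 2"
  proof -
    have "1 * 1 \<le> pi * real k" using k pi_gt3 by (intro mult_mono) auto
    thus ?thesis using n by (simp add: w_def fourier_freq_def divide_right_mono)
  qed
  \<comment> \<open>On this interval of radius \<open>1 / n\<close> the shifted Dirichlet kernel is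
    at least \<open>n / 2\<close>. The constant 16 of the statement results from its length
    \<open>2 / n\<close>, the density loss \<open>4 * \<mu>\<close> and the kernel bound
    \<open>n\<^sup>2 / 8\<close>.\<close>
  define A where "A = {w - 1 / real n..w + 1 / real n}"
  have Asub: "x \<in> {-pi..pi}" "w / 2 \<le> x" "x \<le> 2 * w" "x \<le> \<eta>" "0 < x" if "x \<in> A" for x
  proof -
    have "w / 2 \<le> x" "x \<le> w + w / 2" using that nw unfolding A_def by auto
    thus "x \<in> {-pi..pi}" "w / 2 \<le> x" "x \<le> 2 * w" "x \<le> \<eta>" "0 < x" using w0 eta pi_gt_zero by auto
  qed
  have sw: "0 < spec_dens w" using w0 by (intro spec_dens_pos) auto
  define T where "T x = (cmod (dft n (taper n k 0) x))\<^sup>2 + (cmod (dft n (taper n k (pi/2)) x))\<^sup>2" for x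
  have ker: "block_ker n (taper n k \<phi>) l (taper n k \<phi>) l x = (cmod (dft n (taper n k \<phi>) x))\<^sup>2" for \<phi> x
    unfolding block_ker_dft by (simp add: cmod_power2) (simp add: power2_eq_square)
  have cont: "continuous_on UNIV (\<lambda>x. (cmod (dft n (taper n k \<phi>) x))\<^sup>2)" for \<phi>
    using block_ker_continuous[of n "taper n k \<phi>" l "taper n k \<phi>" l] unfolding ker .
  have dn: "(cmod (dft n (taper n k \<phi>) x))\<^sup>2 \<le> (real n)\<^sup>2" for \<phi> x
  proof (rule power_mono)
    have "cmod (dft n (taper n k \<phi>) x) \<le> (\<Sum>t=1..n. cmod (complex_of_real (taper n k \<phi> t) * cis (real t * x)))"
      unfolding dft_def by (rule norm_sum)
    also have "\<dots> \<le> (\<Sum>t=1..n. 1)" by (intro sum_mono) (simp add: norm_mult taper_def)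
    finally show "cmod (dft n (taper n k \<phi>) x) \<le> real n" by simp
  qed simp
  have int: "set_integrable lborel {-pi..pi} (\<lambda>x. spec_dens x * (cmod (dft n (taper n k \<phi>) x))\<^sup>2)" for \<phi>
    by (rule spec_dens_mult_integrable[OF cont, of _ "(real n)\<^sup>2"]) (use dn in simp)
  have sum_eq: "block_cov n (taper n k 0) l (taper n k 0) l + block_cov n (taper n k (pi/2)) l (taper n k (pi/2)) l = (LINT x:{-pi..pi}|lborel. spec_dens x * T x)"
    unfolding block_cov_eq ker T_def distrib_left by (rule set_integral_add(2)[OF int int, symmetric])
  have Tl: "(real n)\<^sup>2 / 8 \<le> T x" if "x \<in> A" for x
  proof -
    have "\<bar>x - w\<bar> \<le> 1 / real n" using that unfolding A_def by auto
    hence "real n * \<bar>x - w\<bar> \<le> 1" using n by (simp add: field_simps)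
    hence "real n / 2 \<le> cmod (dirichlet n (x - w))" by (rule norm_dirichlet_ge)
    hence "(real n / 2)\<^sup>2 \<le> (cmod (dirichlet n (x - w)))\<^sup>2" by (intro power_mono) auto
    hence b: "(real n)\<^sup>2 / 4 \<le> (cmod (dirichlet n (x - w)))\<^sup>2" by (simp add: power_divide)
    have "a / 8 \<le> (p + b) / 2" if "a / 4 \<le> b" "0 \<le> p" for a b p :: real using that by simp
    from this[OF b] show ?thesis unfolding T_def norm_dft_taper_sum w_def[symmetric] by simp
  qed
  \<comment> \<open>On the interval \<open>x / w\<close> lies between \<open>1/2\<close> and 2, so
    the power with exponent of modulus below 1 loses at most a factor 2; the smooth factor loses at
    most \<open>2 * \<mu>\<close>.\<close>
  have sl: "spec_dens w / (4 * \<mu>) \<le> spec_dens x" if "x \<in> A" for x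
  proof -
    have "1/2 \<le> (x / w) powr (-2 * d)" using Asub[OF that] w0 d by (intro powr_half_bound) (auto simp: field_simps)
    hence 1: "w powr (-2 * d) / 2 \<le> x powr (-2 * d)"
      using Asub[OF that] w0 by (simp add: powr_divide field_simps)
    have "fs w \<le> \<mu> * fs 0" using w0 eta pi_gt_zero by (intro fs_le) auto
    hence "fs w / (2 * \<mu>) \<le> fs 0 / 2" using mu by (simp add: field_simps)
    also have "\<dots> \<le> fs x" using Asub[OF that] by (intro low) auto
    finally have 2: "fs w / (2 * \<mu>) \<le> fs x" .
    have fw: "0 \<le> fs w" using low[of w] pos0 w0 by auto
    have "w powr (-2 * d) / 2 * (fs w / (2 * \<mu>)) \<le> x powr (-2 * d) * fs x"
      using fw mu by (intro mult_mono 1 2) auto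
    thus ?thesis using Asub[OF that] w0 by (simp add: spec_dens_def)
  qed
  have "spec_dens w * real n / (16 * \<mu>) = (LINT x|lborel. indicator A x * (spec_dens w / (4 * \<mu>) * ((real n)\<^sup>2 / 8)))"
  proof -
    have mA: "measure lborel A = 2 / real n" unfolding A_def by simp
    have "(LINT x|lborel. indicator A x * (spec_dens w / (4 * \<mu>) * ((real n)\<^sup>2 / 8))) = measure lborel A * (spec_dens w / (4 * \<mu>) * ((real n)\<^sup>2 / 8))"
      by simp
    also have "\<dots> = spec_dens w * real n / (16 * \<mu>)" unfolding mA using n by (simp add: power2_eq_square)
    finally show ?thesis ..
  qed
  also have "\<dots> \<le> (LINT x|lborel. indicator {-pi..pi} x *\<^sub>R (spec_dens x * T x))"
  proof (rule integral_mono)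
    show "integrable lborel (\<lambda>x. indicator A x * (spec_dens w / (4 * \<mu>) * ((real n)\<^sup>2 / 8)))"
      unfolding A_def by (intro integrable_mult_left integrable_real_indicator) auto
    show "integrable lborel (\<lambda>x. indicator {-pi..pi} x *\<^sub>R (spec_dens x * T x))"
      using set_integral_add(1)[OF int[of 0] int[of "pi/2"]] unfolding T_def distrib_left set_integrable_def .
    fix x
    show "indicator A x * (spec_dens w / (4 * \<mu>) * ((real n)\<^sup>2 / 8)) \<le> indicator {-pi..pi} x *\<^sub>R (spec_dens x * T x)"
    proof (cases "x \<in> A")
      case True
      have "spec_dens w / (4 * \<mu>) * ((real n)\<^sup>2 / 8) \<le> spec_dens x * T x"
        using sl[OF True] Tl[OF True] sw mu by (intro mult_mono) (auto intro: order_trans[of 0 "spec_dens w / (4 * \<mu>)"])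
      thus ?thesis using True Asub(1)[OF True] by simp
    next
      case False
      thus ?thesis using spec_dens_nonneg[of x] by (auto simp: indicator_def T_def abs_le_iff)
    qed
  qed
  also have "\<dots> = (LINT x:{-pi..pi}|lborel. spec_dens x * T x)" by (simp add: set_lebesgue_integral_def)
  finally show ?thesis unfolding sum_eq w_def .
qed

text \<open>The covariance error is relative to the density at the lower frequency, whereas the
  normalisation uses the geometric mean of both. This quotient is the origin of the factor
  \<open>(j / k) powr \<bar>d\<bar>\<close>.\<close>

lemma spec_dens_ratio_bound:
  assumes w: "0 < w" "w \<le> v" "v \<le> \<eta>"
  shows "spec_dens w / sqrt (spec_dens w * spec_dens v) \<le> sqrt (2 * \<mu>) * (v / w) powr \<bar>d\<bar>"
proof -
  have sv: "0 < spec_dens v" "0 < spec_dens w" using w by (auto intro: spec_dens_pos)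
  have v: "0 < v" using w by simp
  have fw: "fs w \<le> 2 * \<mu> * fs v"
  proof -
    have "fs w \<le> \<mu> * fs 0" using w eta pi_gt_zero by (intro fs_le) auto
    also have "\<dots> \<le> \<mu> * (2 * fs v)" using low[of v] w mu by (intro mult_left_mono) auto
    finally show ?thesis by simp
  qed
  have fv: "0 < fs v" using low[of v] pos0 w by auto
  have "spec_dens w / spec_dens v = (w / v) powr (-2 * d) * (fs w / fs v)"
    using w v by (simp add: spec_dens_def powr_divide)
  also have "(w / v) powr (-2 * d) = (v / w) powr (2 * d)"
    using w v by (simp add: powr_divide powr_minus_divide)
  also have "(v / w) powr (2 * d) * (fs w / fs v) \<le> (v / w) powr (2 * \<bar>d\<bar>) * (2 * \<mu>)"
  proof (rule mult_mono)
    show "(v / w) powr (2 * d) \<le> (v / w) powr (2 * \<bar>d\<bar>)" using w by (intro powr_mono) auto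
    show "fs w / fs v \<le> 2 * \<mu>" using fw fv by (simp add: divide_le_eq)
    show "0 \<le> fs w / fs v" using fv low[of w] w pos0 by auto
  qed simp
  finally have r: "spec_dens w / spec_dens v \<le> 2 * \<mu> * (v / w) powr (2 * \<bar>d\<bar>)" by (simp only: mult.commute)
  have "spec_dens w / sqrt (spec_dens w * spec_dens v) = sqrt (spec_dens w / spec_dens v)"
    using sv by (simp add: real_sqrt_mult real_sqrt_divide field_simps)
  also have "\<dots> \<le> sqrt (2 * \<mu> * (v / w) powr (2 * \<bar>d\<bar>))" using r by simp
  also have "\<dots> = sqrt (2 * \<mu>) * (v / w) powr \<bar>d\<bar>"
  proof -
    have "(v / w) powr (2 * \<bar>d\<bar>) = ((v / w) powr \<bar>d\<bar>)\<^sup>2" by (simp add: power2_eq_square powr_add[symmetric])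
    thus ?thesis by (simp add: real_sqrt_mult)
  qed
  finally show ?thesis .
qed

end

section \<open>The pooled periodogram\<close>

lemma gaussian_rv_char:
  assumes P: "prob_space M" and Y[measurable]: "Y \<in> borel_measurable M" and G: "gaussian_rv M Y"
    and E0: "prob_space.expectation M Y = 0"
  shows "(CLINT x|M. iexp (Y x)) = complex_of_real (exp (- prob_space.expectation M (\<lambda>x. (Y x)\<^sup>2) / 2))"
proof -
  interpret prob_space M by fact
  from G consider (normal) m \<sigma> where "\<sigma> > 0" "distributed M lborel Y (normal_density m \<sigma>)"
    | (const) m where "AE x in M. Y x = m"
    unfolding gaussian_rv_def by blast
  thus ?thesis
  proof cases
    case normal
    have m: "m = 0" using normal_distributed_expectation[OF normal(1,2)] E0 by simp
    have v: "expectation (\<lambda>x. (Y x)\<^sup>2) = \<sigma>\<^sup>2"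
      using normal_distributed_variance[OF normal(1,2)] E0 by simp
    define W where "W x = Y x / \<sigma>" for x
    have [measurable]: "W \<in> borel_measurable M" unfolding W_def[abs_def] by measurable
    have W: "distributed M lborel W std_normal_density"
      using normal normal_standard_normal_convert[of \<sigma> Y m] m unfolding W_def[abs_def] by simp
    have "(CLINT x|M. iexp (Y x)) = (CLINT x|M. iexp (\<sigma> * W x))" using normal(1) by (simp add: W_def)
    also have "\<dots> = (CLINT w|distr M lborel W. iexp (\<sigma> * w))"
      by (subst integral_distr) auto
    also have "distr M lborel W = std_normal_distribution"
      using W by (simp add: distributed_def)
    also have "(CLINT w|std_normal_distribution. iexp (\<sigma> * w)) = complex_of_real (exp (- \<sigma>\<^sup>2 / 2))"
      using fun_cong[OF char_std_normal_distribution, of \<sigma>] by (simp add: char_def)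
    finally show ?thesis by (simp add: v)
  next
    case const
    have "expectation Y = expectation (\<lambda>x. m)" by (rule integral_cong_AE) (use const in auto)
    hence m: "m = 0" using E0 by (simp add: prob_space)
    have "expectation (\<lambda>x. (Y x)\<^sup>2) = expectation (\<lambda>x. 0)"
      by (rule integral_cong_AE) (use const m in auto)
    moreover have "(CLINT x|M. iexp (Y x)) = (CLINT x|M. 1)"
      by (rule integral_cong_AE) (use const m in auto)
    ultimately show ?thesis by (simp add: prob_space)
  qed
qed

lemma gaussian_rv_square_integrable:
  assumes P: "prob_space M" and Y[measurable]: "Y \<in> borel_measurable M" and G: "gaussian_rv M Y"
  shows "integrable M (\<lambda>x. (Y x)\<^sup>2)"
proof -
  interpret prob_space M by fact
  from G consider (normal) m \<sigma> where "\<sigma> > 0" "distributed M lborel Y (normal_density m \<sigma>)"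
    | (const) m where "AE x in M. Y x = m"
    unfolding gaussian_rv_def by blast
  thus ?thesis
  proof cases
    case normal
    have mom: "integrable M (\<lambda>x. (Y x - m) ^ k)" for k
      using integrable_normal_moment[OF normal(1), of m k] distributed_integrable[OF normal(2), of "\<lambda>x. (x - m) ^ k"] by simp
    have "(\<lambda>x. (Y x)\<^sup>2) = (\<lambda>x. (Y x - m) ^ 2 + 2 * m * (Y x - m) ^ 1 + m\<^sup>2)"
      by (simp add: fun_eq_iff power2_eq_square algebra_simps)
    thus ?thesis using mom[of 2] mom[of 1] by simp
  next
    case const
    hence "AE x in M. (Y x)\<^sup>2 = m\<^sup>2" by auto
    thus ?thesis by (subst integrable_cong_AE[where g = "\<lambda>_. m\<^sup>2"]) auto
  qed
qed

text \<open>Transforms at several frequencies use the same observations, so \<open>h\<close> may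
  repeat times; coefficients at equal times are added up.\<close>

lemma gaussian_process_linear:
  assumes G: "gaussian_process M X" and fin: "finite A"
  shows "gaussian_rv M (\<lambda>x. \<Sum>p\<in>A. a p * X (h p) x)"
proof -
  have "(\<Sum>p\<in>A. a p * X (h p) x) = (\<Sum>t\<in>h ` A. (\<Sum>p\<in>{p \<in> A. h p = t}. a p) * X t x)" for x
  proof -
    have "(\<Sum>t\<in>h ` A. (\<Sum>p\<in>{p \<in> A. h p = t}. a p) * X t x) = (\<Sum>t\<in>h ` A. \<Sum>p\<in>{p \<in> A. h p = t}. a p * X (h p) x)"
      by (intro sum.cong refl) (simp add: sum_distrib_right)
    also have "\<dots> = (\<Sum>p\<in>A. a p * X (h p) x)" by (rule sum.image_gen[OF fin, symmetric])
    finally show ?thesis by simp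
  qed
  thus ?thesis using G fin unfolding gaussian_process_def by simp
qed

lemma integrable_mult_of_squares:
  fixes U V :: "'a \<Rightarrow> real"
  assumes [measurable]: "U \<in> borel_measurable M" "V \<in> borel_measurable M"
    and "integrable M (\<lambda>x. (U x)\<^sup>2)" "integrable M (\<lambda>x. (V x)\<^sup>2)"
  shows "integrable M (\<lambda>x. U x * V x)"
proof (rule Bochner_Integration.integrable_bound)
  show "integrable M (\<lambda>x. (U x)\<^sup>2 + (V x)\<^sup>2)" using assms by simp
  show "AE x in M. norm (U x * V x) \<le> norm ((U x)\<^sup>2 + (V x)\<^sup>2)"
  proof (rule AE_I2)
    fix x
    have "2 * (\<bar>U x\<bar> * \<bar>V x\<bar>) \<le> (U x)\<^sup>2 + (V x)\<^sup>2"
      using sum_squares_bound[of "\<bar>U x\<bar>" "\<bar>V x\<bar>"] by (simp add: mult.assoc)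
    moreover have "0 \<le> \<bar>U x\<bar> * \<bar>V x\<bar>" by simp
    moreover have "p \<le> \<bar>s\<bar>" if "2 * p \<le> s" "0 \<le> p" for p s :: real using that by simp
    ultimately show "norm (U x * V x) \<le> norm ((U x)\<^sup>2 + (V x)\<^sup>2)" unfolding real_norm_def abs_mult by blast
  qed
qed simp

text \<open>A coordinate consists of a frequency index, an epoch and a phase.\<close>
type_synonym coord = "nat \<times> nat \<times> real"

locale lp_model = spectral_model fs d \<mu> \<nu> \<eta> + prob_space M
  for fs d \<mu> \<nu> \<eta> and M :: "'a measure" +
  fixes X :: "nat \<Rightarrow> 'a \<Rightarrow> real" and c0 :: real and g :: nat
  assumes gp: "gaussian_process M X" and mean: "\<And>t. expectation (X t) = c0"
    and cov: "\<And>s t. expectation (\<lambda>x. (X s x - c0) * (X t x - c0)) = acov (real s - real t)"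
    and g: "1 \<le> g"
begin

lemma X_meas[measurable]: "X t \<in> borel_measurable M"
  using gp by (simp add: gaussian_process_def)

lemma X_sq: "integrable M (\<lambda>x. (X t x)\<^sup>2)"
proof -
  have "gaussian_rv M (X t)"
    using gaussian_process_linear[OF gp, of "{t}" "\<lambda>_. 1" "\<lambda>t. t"] by simp
  thus ?thesis by (rule gaussian_rv_square_integrable[OF prob_space_axioms X_meas])
qed

lemma X_int: "integrable M (X t)"
  using integrable_mult_of_squares[of "X t" M "\<lambda>_. 1"] X_sq[of t] by simp

lemma X_prod_int: "integrable M (\<lambda>x. (X s x - c0) * (X t x - c0))"
proof -
  have sq: "integrable M (\<lambda>x. (X t x - c0)\<^sup>2)" for t
    using X_sq[of t] X_int[of t] by (simp add: power2_diff)
  show ?thesis by (rule integrable_mult_of_squares) (use sq in auto)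
qed

text \<open>The factor 2 makes the white-noise variance of each coordinate \<open>1/2\<close>, and
  hence the pooled sum comparable with a Gamma variable of scale 1.\<close>

definition dft_scale :: "nat \<Rightarrow> nat \<Rightarrow> real" where
  "dft_scale n k = sqrt (2 * pi * real n * spec_dens (fourier_freq n k))"

definition dft_coord :: "nat \<Rightarrow> coord \<Rightarrow> 'a \<Rightarrow> real" where
  "dft_coord n i x = (case i of (k, l, \<phi>) \<Rightarrow> (\<Sum>t=1..n. taper n k \<phi> t * X (t + l * n) x) / dft_scale n k)"

definition dft_cov :: "nat \<Rightarrow> coord \<Rightarrow> coord \<Rightarrow> real" where
  "dft_cov n i j = (case i of (k, l, \<phi>) \<Rightarrow> case j of (k', l', \<phi>') \<Rightarrow>
     block_cov n (taper n k \<phi>) l (taper n k' \<phi>') l' / (dft_scale n k * dft_scale n k'))"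

lemma dft_coord_measurable[measurable]: "dft_coord n i \<in> borel_measurable M"
  unfolding dft_coord_def[abs_def] by (cases i) simp

lemma linear_dft_coord:
  assumes fin: "finite I" and I: "\<And>k l \<phi>. (k, l, \<phi>) \<in> I \<Longrightarrow> 1 \<le> k \<and> k < n"
  shows "gaussian_rv M (\<lambda>x. \<Sum>i\<in>I. c i * dft_coord n i x)"
    and "expectation (\<lambda>x. \<Sum>i\<in>I. c i * dft_coord n i x) = 0"
    and "expectation (\<lambda>x. (\<Sum>i\<in>I. c i * dft_coord n i x)\<^sup>2) = quad_form I (dft_cov n) c"
    and "integrable M (\<lambda>x. (\<Sum>i\<in>I. c i * dft_coord n i x)\<^sup>2)"
proof -
  define A where "A = I \<times> {1..n}"
  define a where "a p = (case p of ((k, l, \<phi>), t) \<Rightarrow> c (k, l, \<phi>) * (taper n k \<phi> t / dft_scale n k))" for p :: "coord \<times> nat"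
  define h where "h p = (case p of ((k, l, \<phi>), t) \<Rightarrow> t + l * n)" for p :: "coord \<times> nat"
  have finA: "finite A" using fin by (simp add: A_def)
  have e: "(\<Sum>i\<in>I. c i * dft_coord n i x) = (\<Sum>p\<in>A. a p * X (h p) x)" for x
    unfolding A_def sum.cartesian_product'
    by (intro sum.cong refl) (auto simp: dft_coord_def a_def h_def sum_divide_distrib sum_distrib_left mult.assoc split: prod.splits)
  \<comment> \<open>The coefficients sum to 0 because every taper does; hence each \<open>X\<close>
    may be replaced by \<open>X - c0\<close>, and the mean disappears from the second
    moments.\<close>
  have a0: "(\<Sum>p\<in>A. a p) = 0"
    unfolding A_def sum.cartesian_product'
  proof (rule sum.neutral, rule ballI)
    fix i assume i: "i \<in> I"
    obtain k l \<phi> where i_eq: "i = (k, l, \<phi>)" by (cases i)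
    have "(\<Sum>t=1..n. a (i, t)) = c i * ((\<Sum>t=1..n. taper n k \<phi> t) / dft_scale n k)"
      by (simp add: a_def i_eq sum_distrib_left sum_divide_distrib)
    thus "(\<Sum>t=1..n. a (i, t)) = 0" using I[of k l \<phi>] i sum_taper_eq_0[of k n \<phi>] by (simp add: i_eq)
  qed
  show "gaussian_rv M (\<lambda>x. \<Sum>i\<in>I. c i * dft_coord n i x)" unfolding e by (rule gaussian_process_linear[OF gp finA])
  have "expectation (\<lambda>x. \<Sum>i\<in>I. c i * dft_coord n i x) = (\<Sum>p\<in>A. a p * c0)"
    unfolding e using X_int by (simp add: mean)
  also have "\<dots> = 0" using a0 by (simp add: sum_distrib_right[symmetric])
  finally show "expectation (\<lambda>x. \<Sum>i\<in>I. c i * dft_coord n i x) = 0" .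
  have e2: "(\<Sum>i\<in>I. c i * dft_coord n i x)\<^sup>2 = (\<Sum>p\<in>A. \<Sum>q\<in>A. (a p * a q) * ((X (h p) x - c0) * (X (h q) x - c0)))" for x
  proof -
    have "(\<Sum>p\<in>A. a p * X (h p) x) = (\<Sum>p\<in>A. a p * (X (h p) x - c0))"
      using a0 by (simp add: right_diff_distrib sum_subtractf sum_distrib_right[symmetric])
    thus ?thesis unfolding e by (simp add: power2_eq_square sum_product mult_ac)
  qed
  show "integrable M (\<lambda>x. (\<Sum>i\<in>I. c i * dft_coord n i x)\<^sup>2)" unfolding e2
    by (intro Bochner_Integration.integrable_sum integrable_mult_right X_prod_int)
  have "expectation (\<lambda>x. (\<Sum>i\<in>I. c i * dft_coord n i x)\<^sup>2) = (\<Sum>p\<in>A. \<Sum>q\<in>A. (a p * a q) * acov (real (h p) - real (h q)))"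
    unfolding e2 using X_prod_int by (simp add: cov)
  also have "\<dots> = (\<Sum>i\<in>I. \<Sum>s=1..n. \<Sum>j\<in>I. \<Sum>t=1..n. (a (i, s) * a (j, t)) * acov (real (h (i, s)) - real (h (j, t))))"
    unfolding A_def sum.cartesian_product' ..
  also have "\<dots> = (\<Sum>i\<in>I. \<Sum>j\<in>I. \<Sum>s=1..n. \<Sum>t=1..n. (a (i, s) * a (j, t)) * acov (real (h (i, s)) - real (h (j, t))))"
    by (intro sum.cong refl sum.swap)
  also have "\<dots> = quad_form I (dft_cov n) c"
    unfolding quad_form_def
  proof (intro sum.cong refl)
    fix i j :: coord
    obtain k l \<phi> where i_eq: "i = (k, l, \<phi>)" by (cases i)
    obtain k' l' \<phi>' where j_eq: "j = (k', l', \<phi>')" by (cases j)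
    show "(\<Sum>s=1..n. \<Sum>t=1..n. (a (i, s) * a (j, t)) * acov (real (h (i, s)) - real (h (j, t)))) = c i * c j * dft_cov n i j"
      by (simp add: a_def h_def dft_cov_def block_cov_def i_eq j_eq sum_distrib_left sum_divide_distrib mult_ac)
  qed
  finally show "expectation (\<lambda>x. (\<Sum>i\<in>I. c i * dft_coord n i x)\<^sup>2) = quad_form I (dft_cov n) c" .
qed

lemma centred_gaussian_dft_coord:
  assumes fin: "finite I" and I: "\<And>k l \<phi>. (k, l, \<phi>) \<in> I \<Longrightarrow> 1 \<le> k \<and> k < n"
  shows "centred_gaussian M I (dft_coord n) (dft_cov n)"
  unfolding centred_gaussian_def
proof (intro conjI allI ballI fin)
  fix c :: "coord \<Rightarrow> real"
  note lz = linear_dft_coord[OF fin I, where c = c]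
  show "(CLINT x|M. iexp (\<Sum>i\<in>I. c i * dft_coord n i x)) = complex_of_real (exp (- quad_form I (dft_cov n) c / 2))"
    using gaussian_rv_char[OF prob_space_axioms _ lz(1) lz(2)] lz(3) by simp
qed simp

lemma dft_coord_second_moment:
  assumes "1 \<le> k" "k < n"
  shows "expectation (\<lambda>x. (dft_coord n (k, l, \<phi>) x)\<^sup>2) = dft_cov n (k, l, \<phi>) (k, l, \<phi>)" "integrable M (\<lambda>x. (dft_coord n (k, l, \<phi>) x)\<^sup>2)"
  using linear_dft_coord(3,4)[of "{(k, l, \<phi>)}" n "\<lambda>_. 1"] assms by (auto simp: quad_form_def)

definition coords :: "nat \<Rightarrow> coord set" where
  "coords k = {k} \<times> {..<g} \<times> {0, pi / 2}"

lemma finite_coords: "finite (coords k)" and card_coords: "card (coords k) = 2 * g"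
  and coords_disjoint: "k \<noteq> j \<Longrightarrow> coords k \<inter> coords j = {}" and coords_ne: "coords k \<noteq> {}"
  using g by (auto simp: coords_def card_cartesian_product lessThan_empty_iff)

abbreviation pooled :: "nat \<Rightarrow> nat \<Rightarrow> 'a \<Rightarrow> real" where
  "pooled n k \<equiv> sum_squares (coords k) (dft_coord n)"

lemma avg_periodogram_eq:
  assumes "0 < n" "0 < spec_dens (fourier_freq n k)"
  shows "avg_periodogram X g n (fourier_freq n k) x = spec_dens (fourier_freq n k) / real g * pooled n k x"
proof -
  define w where "w = fourier_freq n k"
  have sc: "0 < dft_scale n k" "(dft_scale n k)\<^sup>2 = 2 * pi * real n * spec_dens w"
    using assms by (auto simp: dft_scale_def w_def)
  have ep: "epoch_periodogram X n l w x = spec_dens w * ((dft_coord n (k, l, 0) x)\<^sup>2 + (dft_coord n (k, l, pi/2) x)\<^sup>2)" for l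
  proof -
    have "(cmod (\<Sum>t=1..n. complex_of_real (X (t + l * n) x) * cis (real t * w)))\<^sup>2 =
       (\<Sum>t=1..n. taper n k 0 t * X (t + l * n) x)\<^sup>2 + (\<Sum>t=1..n. taper n k (pi / 2) t * X (t + l * n) x)\<^sup>2"
      unfolding cmod_power2 Re_sum Im_sum taper_def w_def by (simp add: cos_diff mult_ac)
    also have "\<dots> = (dft_scale n k)\<^sup>2 * ((dft_coord n (k, l, 0) x)\<^sup>2 + (dft_coord n (k, l, pi/2) x)\<^sup>2)"
      using sc(1) by (simp add: dft_coord_def power_divide field_simps)
    finally show ?thesis using assms(1) unfolding epoch_periodogram_def sc(2) by simp
  qed
  have "pooled n k x = (\<Sum>l<g. (dft_coord n (k, l, 0) x)\<^sup>2 + (dft_coord n (k, l, pi/2) x)\<^sup>2)"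
  proof -
    have "pooled n k x = (\<Sum>i\<in>{k}. \<Sum>l<g. \<Sum>\<phi>\<in>{0, pi/2}. (dft_coord n (i, l, \<phi>) x)\<^sup>2)"
      unfolding sum_squares_def coords_def sum.cartesian_product' ..
    thus ?thesis by simp
  qed
  thus ?thesis unfolding avg_periodogram_def w_def[symmetric] ep by (simp add: sum_distrib_left sum_divide_distrib)
qed

end

section \<open>Closeness of the covariance matrix to half the identity\<close>

lemma sum_abs_square_le:
  fixes w :: "'i \<Rightarrow> real"
  shows "(\<Sum>i\<in>I. \<bar>w i\<bar>)\<^sup>2 \<le> real (card I) * sqnorm I w"
  using sum_squared_le_sum_of_squares[of "\<lambda>i. \<bar>w i\<bar>" I]
  by (cases "finite I") (auto simp: sqnorm_def mult.commute)

text \<open>Cauchy-Schwarz turns an entrywise bound into an operator bound. The loss of a factor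
  \<open>c\<close> is harmless since \<open>c\<close> will be \<open>2 * g\<close> with
  \<open>g\<close> fixed.\<close>

lemma bilinear_bound:
  fixes w :: "'i \<Rightarrow> real"
  assumes T: "\<And>i j. i \<in> I \<Longrightarrow> j \<in> J \<Longrightarrow> \<bar>T i j\<bar> \<le> \<rho>" and c: "card I = c" "card J = c"
  shows "\<bar>\<Sum>i\<in>I. \<Sum>j\<in>J. w i * w j * T i j\<bar> \<le> \<rho> * real c * sqrt (sqnorm I w * sqnorm J w)"
proof (cases "I = {} \<or> J = {}")
  case True thus ?thesis by (auto simp: sqnorm_def)
next
  case False
  then obtain i0 j0 where "i0 \<in> I" "j0 \<in> J" by auto
  hence \<rho>: "0 \<le> \<rho>" using T[of i0 j0] by linarith
  define a where "a = (\<Sum>i\<in>I. \<bar>w i\<bar>)"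
  define b where "b = (\<Sum>i\<in>J. \<bar>w i\<bar>)"
  have "\<bar>\<Sum>i\<in>I. \<Sum>j\<in>J. w i * w j * T i j\<bar> \<le> (\<Sum>i\<in>I. \<bar>\<Sum>j\<in>J. w i * w j * T i j\<bar>)" by (rule sum_abs)
  also have "\<dots> \<le> (\<Sum>i\<in>I. \<Sum>j\<in>J. \<bar>w i * w j * T i j\<bar>)" by (intro sum_mono sum_abs)
  also have "\<dots> \<le> (\<Sum>i\<in>I. \<Sum>j\<in>J. \<bar>w i\<bar> * \<bar>w j\<bar> * \<rho>)"
    using T by (intro sum_mono) (auto simp: abs_mult intro!: mult_left_mono)
  also have "\<dots> = a * b * \<rho>" unfolding a_def b_def sum_product by (simp add: sum_distrib_right)
  also have "a * b \<le> sqrt (real c * sqnorm I w) * sqrt (real c * sqnorm J w)"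
    using sum_abs_square_le[of w I] sum_abs_square_le[of w J] unfolding a_def b_def c
    by (intro mult_mono real_le_rsqrt) (auto intro: sum_nonneg real_sqrt_ge_zero simp: sqnorm_nonneg)
  also have "\<dots> = real c * sqrt (sqnorm I w * sqnorm J w)"
    by (simp add: real_sqrt_mult)
  finally show ?thesis using \<rho> by (simp add: mult_right_mono mult_ac)
qed

lemma quad_form_near_half:
  assumes fin: "finite I" and S: "\<And>i j. i \<in> I \<Longrightarrow> j \<in> I \<Longrightarrow> \<bar>S i j - (if i = j then 1/2 else 0)\<bar> \<le> \<rho>"
  shows "\<bar>quad_form I S w - sqnorm I w / 2\<bar> \<le> \<rho> * real (card I) * sqnorm I w"
proof -
  have "(\<Sum>i\<in>I. \<Sum>j\<in>I. w i * w j * (S i j - (if i = j then 1/2 else 0))) = quad_form I S w - (\<Sum>i\<in>I. \<Sum>j\<in>I. w i * w j * (if i = j then 1/2 else 0))"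
    by (simp add: quad_form_def right_diff_distrib sum_subtractf)
  also have "(\<Sum>i\<in>I. \<Sum>j\<in>I. w i * w j * (if i = j then 1/2 else 0)) = sqnorm I w / 2"
    unfolding sqnorm_def sum_divide_distrib
  proof (intro sum.cong refl)
    fix i assume i: "i \<in> I"
    have "(\<Sum>j\<in>I. w i * w j * (if i = j then 1/2 else 0)) = (\<Sum>j\<in>I. if i = j then w i * w i / 2 else 0)"
      by (intro sum.cong refl) auto
    thus "(\<Sum>j\<in>I. w i * w j * (if i = j then 1/2 else 0)) = (w i)\<^sup>2 / 2" using fin i by (simp add: power2_eq_square)
  qed
  finally show ?thesis
    using bilinear_bound[of I I "\<lambda>i j. S i j - (if i = j then 1/2 else 0)" \<rho> "card I" w, OF S refl refl] sqnorm_nonneg[of I w]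
    by simp
qed

lemma ln_one_minus_ge: 
  fixes \<delta> :: real assumes "0 \<le> \<delta>" "\<delta> \<le> 1/2" shows "- 2 * \<delta> \<le> ln (1 - \<delta>)"
proof -
  have "ln (1 / (1 - \<delta>)) \<le> 1 / (1 - \<delta>) - 1" using assms by (intro ln_le_minus_one) auto
  also have "\<dots> = \<delta> / (1 - \<delta>)" using assms by (simp add: field_simps)
  also have "\<dots> \<le> \<delta> / (1/2)" using assms by (intro divide_left_mono) auto
  finally show ?thesis using assms by (simp add: ln_div)
qed

context lp_model
begin

text \<open>Here \<open>var_const\<close> stems from the covariance bound, the root from the ratio
  of the spectral densities, and \<open>2 * pi\<close> from the normalisation by
  \<open>dft_scale\<close>.\<close>

definition \<rho>c :: real where "\<rho>c = var_const * sqrt (2 * \<mu>) / (2 * pi)"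

definition \<rho> :: "nat \<Rightarrow> nat \<Rightarrow> real" where
  "\<rho> k j = \<rho>c * (real j / real k) powr \<bar>d\<bar> * (1 + ln (real j)) / real k"

lemma \<rho>c_nonneg: "0 \<le> \<rho>c"
  using var_const_nonneg mu by (simp add: \<rho>c_def)

lemma \<rho>_nonneg: "1 \<le> j \<Longrightarrow> 0 \<le> \<rho> k j"
  using \<rho>c_nonneg by (simp add: \<rho>_def)

text \<open>Twice the frequency is bounded because the lower variance bound looks at a neighbourhood
  reaching beyond the frequency itself, which must stay in the range of \<open>low\<close>.\<close>

definition in_band :: "nat \<Rightarrow> nat \<Rightarrow> bool" where
  "in_band n k \<longleftrightarrow> 0 < n \<and> 1 \<le> k \<and> 2 * fourier_freq n k \<le> \<eta>"

lemma in_band_spec_dens: "in_band n k \<Longrightarrow> 0 < spec_dens (fourier_freq n k)" and in_band_freq: "in_band n k \<Longrightarrow> 0 < fourier_freq n k \<and> fourier_freq n k \<le> \<eta>"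
  and in_band_scale: "in_band n k \<Longrightarrow> 0 < dft_scale n k" and in_band_less: "in_band n k \<Longrightarrow> k < n"
proof -
  assume in_band: "in_band n k"
  have f0: "0 < fourier_freq n k" using in_band by (auto simp: in_band_def fourier_freq_def)
  show f: "0 < fourier_freq n k \<and> fourier_freq n k \<le> \<eta>" using in_band f0 unfolding in_band_def by linarith
  thus s: "0 < spec_dens (fourier_freq n k)" by (intro spec_dens_pos) auto
  thus "0 < dft_scale n k" using in_band by (auto simp: dft_scale_def in_band_def)
  have "2 * pi * real k / real n \<le> pi / 2" using f eta by (simp add: fourier_freq_def)
  hence "4 * real k \<le> real n" using in_band by (simp add: in_band_def field_simps)
  thus "k < n" using in_band by (simp add: in_band_def)
qed

lemma in_band_mono: "in_band n j \<Longrightarrow> 1 \<le> k \<Longrightarrow> k \<le> j \<Longrightarrow> in_band n k"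
proof -
  assume in_band: "in_band n j" and k: "1 \<le> k" "k \<le> j"
  have "fourier_freq n k \<le> fourier_freq n j"
    unfolding fourier_freq_def using k by (intro divide_right_mono mult_left_mono) auto
  thus "in_band n k" using in_band k unfolding in_band_def by linarith
qed

text \<open>Division by the two scales turns the white-noise term into \<open>1/2\<close> on the
  diagonal. Distinct phases of one transform are uncorrelated in white noise because the cosine of
  \<open>pi / 2\<close> is 0.\<close>

lemma dft_cov_bound:
  assumes in_band: "in_band n j" and k: "1 \<le> k" "k \<le> j" and i: "i \<in> coords k" and i': "i' \<in> coords j"
  shows "\<bar>dft_cov n i i' - (if i = i' then 1/2 else 0)\<bar> \<le> \<rho> k j"
proof -
  obtain l \<phi> where i_eq: "i = (k, l, \<phi>)" "\<phi> \<in> {0, pi/2}" using i unfolding coords_def by blast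
  obtain l' \<phi>' where i'_eq: "i' = (j, l', \<phi>')" "\<phi>' \<in> {0, pi/2}" using i' unfolding coords_def by blast
  have okk: "in_band n k" by (rule in_band_mono[OF in_band k])
  have n: "0 < n" using in_band by (simp add: in_band_def)
  define s where "s = spec_dens (fourier_freq n k)"
  define s' where "s' = spec_dens (fourier_freq n j)"
  have s0: "0 < s" "0 < s'" using in_band_spec_dens[OF in_band] in_band_spec_dens[OF okk] by (auto simp: s_def s'_def)
  define D where "D = dft_scale n k * dft_scale n j"
  have D: "D = 2 * pi * real n * sqrt (s * s')"
  proof -
    have "D = sqrt ((2 * pi * real n) * (2 * pi * real n) * (s * s'))"
      unfolding D_def dft_scale_def s_def s'_def by (simp only: real_sqrt_mult[symmetric] mult_ac)
    also have "\<dots> = sqrt ((2 * pi * real n)\<^sup>2) * sqrt (s * s')" by (simp only: real_sqrt_mult power2_eq_square)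
    finally show ?thesis by simp
  qed
  have D0: "0 < D" using in_band_scale[OF in_band] in_band_scale[OF okk] by (simp add: D_def)
  define main where "main = s * (if k = j \<and> l = l' then pi * real n * cos (\<phi> - \<phi>') else 0)"
  have main_eq: "main / D = (if i = i' then 1/2 else 0)"
  proof (cases "k = j \<and> l = l'")
    case True
    hence "s' = s" by (simp add: s_def s'_def)
    hence "D = 2 * pi * real n * s" using D s0 by simp
    hence "main / D = cos (\<phi> - \<phi>') / 2" using True s0 n by (simp add: main_def)
    also have "cos (\<phi> - \<phi>') = (if \<phi> = \<phi>' then 1 else 0)"
    proof -
      consider "\<phi> = \<phi>'" | "\<phi> = 0" "\<phi>' = pi / 2" | "\<phi> = pi / 2" "\<phi>' = 0" using i_eq(2) i'_eq(2) by blast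
      thus ?thesis
      proof cases
        case 1 thus ?thesis by simp
      next
        case 2 show ?thesis unfolding 2 by simp
      next
        case 3 show ?thesis unfolding 3 by simp
      qed
    qed
    finally show ?thesis using True i_eq(1) i'_eq(1) by (cases "\<phi> = \<phi>'") simp_all
  qed (auto simp: main_def i_eq i'_eq)
  define B where "B = block_cov n (taper n k \<phi>) l (taper n j \<phi>') l'"
  have "\<bar>B - main\<bar> \<le> var_const * s * real n * (1 + ln (real j)) / real k"
    unfolding B_def main_def s_def using in_band_freq[OF in_band] by (intro taper_cov_bound n k) auto
  hence "\<bar>B - main\<bar> / D \<le> (var_const * s * real n * (1 + ln (real j)) / real k) / D"
    using D0 by (intro divide_right_mono) auto
  also have "\<dots> = var_const / (2 * pi) * ((1 + ln (real j)) / real k) * (s / sqrt (s * s'))"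
    unfolding D using n by (simp add: mult_ac)
  also have "\<dots> \<le> var_const / (2 * pi) * ((1 + ln (real j)) / real k) * (sqrt (2 * \<mu>) * (real j / real k) powr \<bar>d\<bar>)"
  proof (rule mult_left_mono)
    have "fourier_freq n j / fourier_freq n k = real j / real k" using n k by (simp add: fourier_freq_def)
    thus "s / sqrt (s * s') \<le> sqrt (2 * \<mu>) * (real j / real k) powr \<bar>d\<bar>"
      using spec_dens_ratio_bound[of "fourier_freq n k" "fourier_freq n j"] in_band_freq[OF in_band] in_band_freq[OF okk] k
      by (auto simp: s_def s'_def fourier_freq_def divide_right_mono)
    show "0 \<le> var_const / (2 * pi) * ((1 + ln (real j)) / real k)"
      using var_const_nonneg k by auto
  qed
  also have "\<dots> = \<rho> k j" by (simp add: \<rho>_def \<rho>c_def mult_ac)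
  finally have *: "\<bar>B - main\<bar> / D \<le> \<rho> k j" .
  have "dft_cov n i i' - (if i = i' then 1/2 else 0) = (B - main) / D"
    unfolding main_eq[symmetric] by (simp add: dft_cov_def i_eq(1) i'_eq(1) B_def D_def diff_divide_distrib)
  hence "\<bar>dft_cov n i i' - (if i = i' then 1/2 else 0)\<bar> = \<bar>B - main\<bar> / D" using D0 by simp
  thus ?thesis using * by simp
qed

lemma acov_minus: "acov (- h) = acov h"
  unfolding acov_def by simp

lemma dft_cov_sym: "dft_cov n i j = dft_cov n j i"
proof -
  obtain k l \<phi> where i: "i = (k, l, \<phi>)" by (cases i)
  obtain k' l' \<phi>' where j: "j = (k', l', \<phi>')" by (cases j)
  have "acov (real (s + l * n) - real (t + l' * n)) = acov (real (t + l' * n) - real (s + l * n))" for s t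
    using acov_minus[of "real (s + l * n) - real (t + l' * n)"] by simp
  hence "block_cov n (taper n k \<phi>) l (taper n k' \<phi>') l' = block_cov n (taper n k' \<phi>') l' (taper n k \<phi>) l"
    unfolding block_cov_def by (subst sum.swap) (simp add: mult_ac)
  thus ?thesis by (simp add: dft_cov_def i j mult.commute)
qed

lemma centred_gaussian_coords:
  assumes "in_band n k" shows "centred_gaussian M (coords k) (dft_coord n) (dft_cov n)"
  by (rule centred_gaussian_dft_coord[OF finite_coords]) (use assms in_band_less[OF assms] in \<open>auto simp: coords_def in_band_def\<close>)

text \<open>The operator bound for \<open>2 * g\<close> coordinates is
  \<open>2 * g * \<rho> k k\<close>; it is doubled because the forms are compared with half the
  squared norm.\<close>

definition \<delta> :: "nat \<Rightarrow> real" where "\<delta> k = 4 * real g * \<rho> k k"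

lemma \<delta>_nonneg: "1 \<le> k \<Longrightarrow> 0 \<le> \<delta> k"
  using \<rho>_nonneg[of k k] by (simp add: \<delta>_def)

lemma \<rho>_diag: "1 \<le> k \<Longrightarrow> \<rho> k k = \<rho>c * (1 + ln (real k)) / real k"
  by (simp add: \<rho>_def)

lemma quad_form_coords:
  assumes in_band: "in_band n k"
  shows "(1 - \<delta> k) * sqnorm (coords k) w / 2 \<le> quad_form (coords k) (dft_cov n) w"
    "quad_form (coords k) (dft_cov n) w \<le> (1 + \<delta> k) * sqnorm (coords k) w / 2"
proof -
  have k: "1 \<le> k" using in_band by (simp add: in_band_def)
  have "\<bar>quad_form (coords k) (dft_cov n) w - sqnorm (coords k) w / 2\<bar> \<le> \<rho> k k * real (card (coords k)) * sqnorm (coords k) w"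
    by (rule quad_form_near_half[OF finite_coords]) (rule dft_cov_bound[OF in_band k order_refl])
  also have "\<dots> = \<delta> k * sqnorm (coords k) w / 2" by (simp add: card_coords \<delta>_def)
  finally have "\<bar>quad_form (coords k) (dft_cov n) w - sqnorm (coords k) w / 2\<bar> \<le> \<delta> k * sqnorm (coords k) w / 2" .
  thus "(1 - \<delta> k) * sqnorm (coords k) w / 2 \<le> quad_form (coords k) (dft_cov n) w"
    "quad_form (coords k) (dft_cov n) w \<le> (1 + \<delta> k) * sqnorm (coords k) w / 2"
  proof -
    have e: "(1 - a) * s / 2 = s / 2 - a * s / 2" "(1 + a) * s / 2 = s / 2 + a * s / 2" for a s :: real
      by (simp_all add: field_simps)
    assume "\<bar>quad_form (coords k) (dft_cov n) w - sqnorm (coords k) w / 2\<bar> \<le> \<delta> k * sqnorm (coords k) w / 2"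
    thus "(1 - \<delta> k) * sqnorm (coords k) w / 2 \<le> quad_form (coords k) (dft_cov n) w"
      "quad_form (coords k) (dft_cov n) w \<le> (1 + \<delta> k) * sqnorm (coords k) w / 2"
      unfolding e by linarith+
  qed
qed

lemma one_plus_ln_le: "1 \<le> k \<Longrightarrow> (1 + ln (real k)) / real k \<le> 1"
  using ln_le_minus_one[of "real k"] by simp

lemma pooled_measurable[measurable]: "pooled n k \<in> borel_measurable M"
  unfolding sum_squares_def[abs_def] by measurable

text \<open>The first two summands bound the mean of \<open>1 + Y\<close> for the pooled sum
  \<open>Y\<close>, which dominates \<open>Y powr (1/4)\<close>. The last bounds the moment of order
  \<open>- 1/4\<close> of one squared coordinate whose variance is at least
  \<open>1 / (64 * pi * \<mu>)\<close>.\<close>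

definition Bq :: real where
  "Bq = 1 + 2 * real g * (1/2 + \<rho>c) + (1 / (32 * pi * \<mu>)) powr (- (1/4)) * (Gamma (1/4) / Gamma (1/2))"

text \<open>One bound for all \<open>n\<close> and all frequencies of the band, including small
  \<open>k\<close> where the covariance matrix is not controlled. Positive moments follow from the
  mean of the pooled sum. For negative ones the sum is bounded below by one squared coordinate: by
  \<open>taper_var_lower\<close> the variances of the two phases of epoch 0 add up to at least
  \<open>2 * c\<close>, so one of them is at least \<open>c\<close>.\<close>

lemma pooled_exp_moments:
  assumes in_band: "in_band n k"
  shows "exp_moments M (\<lambda>x. ln (pooled n k x)) Bq" "AE x in M. 0 < pooled n k x"
proof -
  have k: "1 \<le> k" "k < n" and n: "0 < n" using in_band in_band_less[OF in_band] by (auto simp: in_band_def)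
  define c where "c = 1 / (64 * pi * \<mu>)"
  have c0: "0 < c" using mu by (simp add: c_def)
  define V where "V \<phi> = dft_cov n (k, 0, \<phi>) (k, 0, \<phi>)" for \<phi>
  have s0: "0 < spec_dens (fourier_freq n k)" by (rule in_band_spec_dens[OF in_band])
  have "2 * c \<le> V 0 + V (pi / 2)"
  proof -
    have sc: "dft_scale n k * dft_scale n k = 2 * pi * real n * spec_dens (fourier_freq n k)"
      using s0 n by (simp add: dft_scale_def)
    have "spec_dens (fourier_freq n k) * real n / (16 * \<mu>) / (dft_scale n k * dft_scale n k) \<le>
       (block_cov n (taper n k 0) 0 (taper n k 0) 0 + block_cov n (taper n k (pi/2)) 0 (taper n k (pi/2)) 0) / (dft_scale n k * dft_scale n k)"
      using in_band by (intro divide_right_mono taper_var_lower) (auto simp: in_band_def)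
    moreover have "spec_dens (fourier_freq n k) * real n / (16 * \<mu>) / (dft_scale n k * dft_scale n k) = 2 * c"
      unfolding sc c_def using s0 n by simp
    ultimately show ?thesis by (simp add: V_def dft_cov_def add_divide_distrib)
  qed
  hence "c \<le> V 0 \<or> c \<le> V (pi / 2)" by linarith
  then obtain \<phi> where \<phi>: "\<phi> \<in> {0, pi/2}" "c \<le> V \<phi>" by blast
  define i where "i = (k, 0::nat, \<phi>)"
  have ic: "i \<in> coords k" using \<phi> g by (auto simp: coords_def i_def)
  have Gi: "centred_gaussian M {i} (dft_coord n) (dft_cov n)"
    by (rule centred_gaussian_subset[OF centred_gaussian_coords[OF in_band]]) (use ic in simp)
  have yi: "sum_squares {i} (dft_coord n) x \<le> pooled n k x" for x
    unfolding sum_squares_def by (rule sum_mono2[OF finite_coords]) (use ic in auto)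
  have lap: "expectation (\<lambda>x. exp (- s * sum_squares {i} (dft_coord n) x)) \<le> (1 + (2 * c) * s) powr (- (real (card {i}) / 2))" if "0 < s" for s
  proof (rule laplace_sum_squares_le[OF prob_space_axioms Gi that])
    fix w :: "coord \<Rightarrow> real"
    have "c * (w i)\<^sup>2 \<le> V \<phi> * (w i)\<^sup>2" using \<phi> by (intro mult_right_mono) auto
    thus "2 * c * sqnorm {i} w / 2 \<le> quad_form {i} (dft_cov n) w"
      by (simp add: sqnorm_def quad_form_def V_def i_def power2_eq_square mult_ac)
  qed (use c0 in simp)
  have yim: "sum_squares {i} (dft_coord n) \<in> borel_measurable M" by (rule sum_squares_measurable[OF Gi])
  have posi: "AE x in M. 0 < sum_squares {i} (dft_coord n) x"
    by (rule AE_pos_of_laplace[OF prob_space_axioms yim sum_squares_nonneg _ _ lap]) (use c0 in auto)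
  thus pos: "AE x in M. 0 < pooled n k x" by eventually_elim (use yi in \<open>auto intro: less_le_trans\<close>)
  note nm = neg_moment_upper[OF prob_space_axioms yim sum_squares_nonneg, of "1/4" "1/2" "2 * c"]
  have nmi: "integrable M (\<lambda>x. sum_squares {i} (dft_coord n) x powr (- (1/4)))"
    by (rule nm) (use c0 lap in auto)
  have nme: "expectation (\<lambda>x. sum_squares {i} (dft_coord n) x powr (- (1/4))) \<le> (2 * c) powr (- (1/4)) * (Gamma (1/2 - 1/4) / Gamma (1/2))"
    by (rule nm) (use c0 lap in auto)
  have yi_int: "integrable M (pooled n k)" and yi_exp: "expectation (pooled n k) \<le> 2 * real g * (1/2 + \<rho>c)"
  proof -
    have ind: "i \<in> coords k \<Longrightarrow> \<exists>l \<phi>. i = (k, l, \<phi>)" for i by (auto simp: coords_def)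
    have int: "integrable M (\<lambda>x. (dft_coord n i x)\<^sup>2)" and ev: "expectation (\<lambda>x. (dft_coord n i x)\<^sup>2) = dft_cov n i i" if "i \<in> coords k" for i
      using ind[OF that] dft_coord_second_moment[OF k] by auto
    show "integrable M (pooled n k)" unfolding sum_squares_def[abs_def] using int by auto
    have "expectation (pooled n k) = (\<Sum>i\<in>coords k. dft_cov n i i)"
      unfolding sum_squares_def[abs_def] using int ev by simp
    also have "\<dots> \<le> (\<Sum>i\<in>coords k. 1/2 + \<rho>c)"
    proof (rule sum_mono)
      fix i assume i: "i \<in> coords k"
      have "\<bar>dft_cov n i i - 1/2\<bar> \<le> \<rho> k k" using dft_cov_bound[OF in_band k(1) order_refl i i] by simp
      also have "\<dots> \<le> \<rho>c" using mult_left_mono[OF one_plus_ln_le[OF k(1)] \<rho>c_nonneg] k by (simp add: \<rho>_diag)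
      finally show "dft_cov n i i \<le> 1/2 + \<rho>c" by linarith
    qed
    also have "\<dots> = 2 * real g * (1/2 + \<rho>c)" by (simp add: card_coords)
    finally show "expectation (pooled n k) \<le> 2 * real g * (1/2 + \<rho>c)" .
  qed
  have b1: "AE x in M. exp (ln (pooled n k x) / 4) \<le> 1 + pooled n k x"
    using pos
  proof eventually_elim
    case (elim x)
    have "exp (ln (pooled n k x) / 4) = pooled n k x powr (1/4)" using elim by (simp add: powr_def)
    also have "\<dots> \<le> 1 + pooled n k x"
    proof (cases "pooled n k x \<le> 1")
      case True
      have "pooled n k x powr (1/4) \<le> 1 powr (1/4)" using True elim by (intro powr_mono2) auto
      thus ?thesis using elim by simp
    next
      case False
      have "pooled n k x powr (1/4) \<le> pooled n k x powr 1" using False by (intro powr_mono) auto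
      thus ?thesis using elim by simp
    qed
    finally show ?case .
  qed
  have b2: "AE x in M. exp (- ln (pooled n k x) / 4) \<le> sum_squares {i} (dft_coord n) x powr (- (1/4))"
    using posi
  proof eventually_elim
    case (elim x)
    have "exp (- ln (pooled n k x) / 4) = pooled n k x powr (- (1/4))" using elim yi[of x] by (simp add: powr_def)
    also have "\<dots> \<le> sum_squares {i} (dft_coord n) x powr (- (1/4))" using elim yi[of x] by (intro powr_mono2') auto
    finally show ?case .
  qed
  have i1: "integrable M (\<lambda>x. exp (ln (pooled n k x) / 4))"
    by (rule Bochner_Integration.integrable_bound[where f = "\<lambda>x. 1 + pooled n k x"])
       (use yi_int b1 in \<open>auto simp: sum_squares_nonneg add_nonneg_nonneg\<close>)
  have i2: "integrable M (\<lambda>x. exp (- ln (pooled n k x) / 4))"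
    by (rule Bochner_Integration.integrable_bound[OF nmi]) (use b2 in auto)
  have "expectation (\<lambda>x. exp (ln (pooled n k x) / 4)) \<le> expectation (\<lambda>x. 1 + pooled n k x)"
    by (rule integral_mono_AE) (use i1 yi_int b1 in auto)
  also have "\<dots> \<le> 1 + 2 * real g * (1/2 + \<rho>c)" using yi_int yi_exp by (simp add: prob_space)
  finally have e1: "expectation (\<lambda>x. exp (ln (pooled n k x) / 4)) \<le> 1 + 2 * real g * (1/2 + \<rho>c)" .
  have "expectation (\<lambda>x. exp (- ln (pooled n k x) / 4)) \<le> expectation (\<lambda>x. sum_squares {i} (dft_coord n) x powr (- (1/4)))"
    by (rule integral_mono_AE[OF i2 nmi b2])
  also have "\<dots> \<le> (1 / (32 * pi * \<mu>)) powr (- (1/4)) * (Gamma (1/4) / Gamma (1/2))"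
    using nme by (simp add: c_def mult.assoc)
  finally have e2: "expectation (\<lambda>x. exp (- ln (pooled n k x) / 4)) \<le> (1 / (32 * pi * \<mu>)) powr (- (1/4)) * (Gamma (1/4) / Gamma (1/2))" .
  show "exp_moments M (\<lambda>x. ln (pooled n k x)) Bq"
    by unfold_locales (use i1 i2 e1 e2 in \<open>auto simp: Bq_def\<close>)
qed

abbreviation log_pooled :: "nat \<Rightarrow> nat \<Rightarrow> 'a \<Rightarrow> real" where
  "log_pooled n k \<equiv> (\<lambda>x. ln (pooled n k x))"

text \<open>The form bounds with \<open>1 - \<delta> k\<close> and \<open>1 + \<delta> k\<close> are
  fed into the Mellin comparison with shape \<open>card (coords k) / 2\<close>, which is
  \<open>g\<close>. The range \<open>u < 1\<close> lies below the shape because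
  \<open>1 \<le> g\<close>.\<close>

lemma exp_log_pooled_sandwich:
  assumes in_band: "in_band n k" and dl: "\<delta> k < 1" and u: "0 < u" "u < 1"
  shows "(1 + \<delta> k) powr (- u) * gamma_neg_moment (real g) u \<le> expectation (\<lambda>x. exp (- u * log_pooled n k x)) \<and>
      expectation (\<lambda>x. exp (- u * log_pooled n k x)) \<le> (1 - \<delta> k) powr (- u) * gamma_neg_moment (real g) u"
proof -
  have k: "1 \<le> k" using in_band by (simp add: in_band_def)
  note G = centred_gaussian_coords[OF in_band]
  have b: "real (card (coords k)) / 2 = real g" by (simp add: card_coords)
  have ug: "u < real g" using u g by simp
  have le: "expectation (\<lambda>x. exp (- s * pooled n k x)) \<le> (1 + (1 - \<delta> k) * s) powr (- real g)" if "0 < s" for s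
    using laplace_sum_squares_le[OF prob_space_axioms G that _ quad_form_coords(1)[OF in_band]] dl unfolding b by simp
  have ge: "(1 + (1 + \<delta> k) * s) powr (- real g) \<le> expectation (\<lambda>x. exp (- s * pooled n k x))" if "0 < s" for s
    using laplace_sum_squares_ge[OF prob_space_axioms G that _ quad_form_coords(2)[OF in_band]] \<delta>_nonneg[OF k] unfolding b by simp
  note up = neg_moment_upper[OF prob_space_axioms pooled_measurable sum_squares_nonneg u(1) ug _ le]
  have pos: "AE x in M. 0 < pooled n k x" by (rule pooled_exp_moments(2)[OF in_band])
  have int: "integrable M (\<lambda>x. pooled n k x powr (- u))" by (rule up) (use dl in auto)
  have 1: "expectation (\<lambda>x. pooled n k x powr (- u)) \<le> (1 - \<delta> k) powr (- u) * gamma_neg_moment (real g) u"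
    unfolding gamma_neg_moment_def by (rule up) (use dl in auto)
  have 2: "(1 + \<delta> k) powr (- u) * gamma_neg_moment (real g) u \<le> expectation (\<lambda>x. pooled n k x powr (- u))"
    unfolding gamma_neg_moment_def
    by (rule neg_moment_lower[OF prob_space_axioms pooled_measurable sum_squares_nonneg pos int u(1) ug _ ge]) (use \<delta>_nonneg[OF k] in auto)
  have "expectation (\<lambda>x. exp (- u * log_pooled n k x)) = expectation (\<lambda>x. pooled n k x powr (- u))"
    by (rule integral_cong_AE, simp, simp, use pos in eventually_elim, simp add: powr_def)
  thus ?thesis using 1 2 by simp
qed

lemma abs_mean_log_pooled_le:
  assumes "in_band n k" shows "\<bar>expectation (log_pooled n k)\<bar> \<le> 13824 * Bq"
proof -
  interpret exp_moments M "log_pooled n k" Bq by (rule pooled_exp_moments(1)[OF assms])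
  have "\<bar>expectation (log_pooled n k)\<bar> \<le> expectation (\<lambda>x. \<bar>log_pooled n k x\<bar>)" by (rule integral_abs_bound)
  also have "\<dots> \<le> 13824 * Bq" using moment_le[of 1 0] by simp
  finally show ?thesis .
qed

lemma Bq_nonneg: "0 \<le> Bq"
  unfolding Bq_def using \<rho>c_nonneg
  by (intro add_nonneg_nonneg mult_nonneg_nonneg divide_nonneg_nonneg) (auto intro!: less_imp_le Gamma_real_pos)

definition mean_const :: real where
  "mean_const = 8 * real g * \<rho>c * (1 + 13824 * Bq + \<bar>Digamma (real g)\<bar>)"

text \<open>For \<open>\<delta> k \<le> 1/2\<close> the sandwich gives an error of at most
  \<open>2 * \<delta> k\<close>. Otherwise \<open>2 * \<delta> k\<close> exceeds 1 and the uniform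
  moment bound, built into \<open>mean_const\<close>, suffices; so no index of the band has to be
  excluded.\<close>

lemma mean_log_pooled_bound:
  assumes in_band: "in_band n k"
  shows "\<bar>expectation (log_pooled n k) - Digamma (real g)\<bar> \<le> mean_const * ((1 + ln (real k)) / real k)"
proof -
  have k: "1 \<le> k" using in_band by (simp add: in_band_def)
  define c1 where "c1 = 1 + 13824 * Bq + \<bar>Digamma (real g)\<bar>"
  have c1: "1 \<le> c1" using Bq_nonneg by (simp add: c1_def)
  have eq: "mean_const * ((1 + ln (real k)) / real k) = 2 * \<delta> k * c1"
    using k by (simp add: mean_const_def \<delta>_def \<rho>_diag c1_def)
  have d0: "0 \<le> \<delta> k" by (rule \<delta>_nonneg[OF k])
  show ?thesis
  proof (cases "\<delta> k \<le> 1/2")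
    case True
    interpret exp_moments M "log_pooled n k" Bq by (rule pooled_exp_moments(1)[OF in_band])
    have "Digamma (real g) + ln (1 - \<delta> k) \<le> expectation (log_pooled n k)" "expectation (log_pooled n k) \<le> Digamma (real g) + ln (1 + \<delta> k)"
      by (rule mean_log_sandwich[where ?u0.0 = 1 and c = "1 - \<delta> k" and c' = "1 + \<delta> k"]; use exp_log_pooled_sandwich[OF in_band] True d0 g in auto)+
    moreover have "ln (1 + \<delta> k) \<le> \<delta> k" using d0 by (rule ln_add_one_self_le_self)
    moreover have "- 2 * \<delta> k \<le> ln (1 - \<delta> k)" by (rule ln_one_minus_ge[OF d0 True])
    ultimately have "\<bar>expectation (log_pooled n k) - Digamma (real g)\<bar> \<le> 2 * \<delta> k" using d0 by linarith
    also have "\<dots> = 2 * \<delta> k * 1" by simp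
    also have "\<dots> \<le> 2 * \<delta> k * c1" using c1 d0 by (intro mult_left_mono) auto
    finally show ?thesis unfolding eq .
  next
    case False
    have "\<bar>expectation (log_pooled n k) - Digamma (real g)\<bar> \<le> 1 * c1"
      using abs_mean_log_pooled_le[OF in_band] by (simp add: c1_def)
    also have "\<dots> \<le> 2 * \<delta> k * c1" using False c1 by (intro mult_right_mono) auto
    finally show ?thesis unfolding eq .
  qed
qed

lemma \<delta>_tendsto: "\<delta> \<longlonglongrightarrow> 0"
proof -
  have "(\<lambda>k. 4 * real g * (\<rho>c * ((1 + ln (real k)) / real k))) \<longlonglongrightarrow> 4 * real g * (\<rho>c * 0)"
    by (intro tendsto_mult_left) real_asymp
  moreover have "eventually (\<lambda>k. 4 * real g * (\<rho>c * ((1 + ln (real k)) / real k)) = \<delta> k) sequentially"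
    using eventually_ge_at_top[of 1] by eventually_elim (simp add: \<delta>_def \<rho>_diag)
  ultimately show ?thesis by (simp add: tendsto_cong)
qed

text \<open>\<open>K\<close> is independent of \<open>n\<close>: the threshold for
  \<open>\<delta>\<close> is uniform over all variables with exponential moments bounded by
  \<open>Bq\<close>, and \<open>\<delta> k\<close> depends on \<open>k\<close> only. The variance
  then follows from the second moment and the mean.\<close>

lemma var_log_pooled_limit:
  assumes \<epsilon>: "0 < \<epsilon>"
  obtains K where "1 \<le> K" "\<And>n k. in_band n k \<Longrightarrow> K \<le> k \<Longrightarrow>
     \<bar>expectation (\<lambda>x. (log_pooled n k x)\<^sup>2) - (expectation (log_pooled n k))\<^sup>2 - Polygamma 1 (real g)\<bar> < \<epsilon>"
proof -
  define \<psi> where "\<psi> = Digamma (real g)"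
  have e2: "0 < \<epsilon> / 2" using \<epsilon> by simp
  have g0: "0 < real g" using g by simp
  obtain \<delta>0 where \<delta>0: "0 < \<delta>0" "\<delta>0 < 1"
    "\<And>(M :: 'a measure) L \<delta>. exp_moments M L Bq \<Longrightarrow> 0 \<le> \<delta> \<Longrightarrow> \<delta> \<le> \<delta>0 \<Longrightarrow>
       (\<And>u. 0 < u \<Longrightarrow> u < 1 \<Longrightarrow> (1 + \<delta>) powr (- u) * gamma_neg_moment (real g) u \<le> (LINT x|M. exp (- u * L x)) \<and>
         (LINT x|M. exp (- u * L x)) \<le> (1 - \<delta>) powr (- u) * gamma_neg_moment (real g) u) \<Longrightarrow>
       \<bar>(LINT x|M. (L x)\<^sup>2) - (Polygamma 1 (real g) + (Digamma (real g))\<^sup>2)\<bar> < \<epsilon> / 2"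
    using second_moment_log_limit[OF g0 e2 zero_less_one Bq_nonneg] by blast
  \<comment> \<open>A bound for the modulus of the mean plus its limit, so that the difference of
    their squares is controlled by their difference.\<close>
  define D where "D = 13824 * Bq + \<bar>\<psi>\<bar> + 1"
  have D: "1 \<le> D" using Bq_nonneg by (simp add: D_def)
  have "(\<lambda>k. mean_const * ((1 + ln (real k)) / real k)) \<longlonglongrightarrow> mean_const * 0"
    by (intro tendsto_mult_left) real_asymp
  hence "eventually (\<lambda>k. dist (mean_const * ((1 + ln (real k)) / real k)) 0 < \<epsilon> / (2 * D)) sequentially"
    using \<epsilon> D by (intro tendstoD) auto
  moreover have "eventually (\<lambda>k. dist (\<delta> k) 0 < \<delta>0) sequentially"
    by (rule tendstoD[OF \<delta>_tendsto \<delta>0(1)])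
  ultimately have "eventually (\<lambda>k. mean_const * ((1 + ln (real k)) / real k) < \<epsilon> / (2 * D) \<and> \<delta> k < \<delta>0) sequentially"
    unfolding dist_real_def diff_0_right by eventually_elim (blast intro: le_less_trans[OF abs_ge_self])
  then obtain K where K: "\<And>k. K \<le> k \<Longrightarrow> mean_const * ((1 + ln (real k)) / real k) < \<epsilon> / (2 * D) \<and> \<delta> k < \<delta>0"
    unfolding eventually_sequentially by blast
  show thesis
  proof (rule that[of "max 1 K"])
    fix n k assume in_band: "in_band n k" and k: "max 1 K \<le> k"
    have k1: "1 \<le> k" "K \<le> k" using k by auto
    define e where "e = expectation (log_pooled n k)"
    have "\<bar>expectation (\<lambda>x. (log_pooled n k x)\<^sup>2) - (Polygamma 1 (real g) + \<psi>\<^sup>2)\<bar> < \<epsilon> / 2"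
      unfolding \<psi>_def
      by (rule \<delta>0(3)[OF pooled_exp_moments(1)[OF in_band], of "\<delta> k"])
         (use K[OF k1(2)] \<delta>0 \<delta>_nonneg[OF k1(1)] exp_log_pooled_sandwich[OF in_band] in auto)
    moreover have "\<bar>e\<^sup>2 - \<psi>\<^sup>2\<bar> \<le> \<epsilon> / 2"
    proof -
      have "\<bar>e - \<psi>\<bar> \<le> \<epsilon> / (2 * D)" using mean_log_pooled_bound[OF in_band] K[OF k1(2)] by (simp add: e_def \<psi>_def)
      moreover have "\<bar>e + \<psi>\<bar> \<le> D" using abs_mean_log_pooled_le[OF in_band] by (simp add: D_def e_def)
      ultimately have "\<bar>e - \<psi>\<bar> * \<bar>e + \<psi>\<bar> \<le> \<epsilon> / (2 * D) * D" using \<epsilon> D by (intro mult_mono) auto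
      also have "\<dots> = \<epsilon> / 2" using D by simp
      finally show ?thesis unfolding abs_mult[symmetric] by (simp add: power2_eq_square algebra_simps)
    qed
    ultimately show "\<bar>expectation (\<lambda>x. (log_pooled n k x)\<^sup>2) - (expectation (log_pooled n k))\<^sup>2 - Polygamma 1 (real g)\<bar> < \<epsilon>"
      unfolding e_def[symmetric] by linarith
  qed simp
qed

text \<open>The pair argument with \<open>c = 1/4\<close>, which is what
  \<open>\<delta> \<le> 1/2\<close> leaves of half the identity, and
  \<open>r = 2 * g * \<rho> k j\<close>. Then \<open>16 / c\<^sup>2\<close> is 256, and the
  condition \<open>r \<le> c / 2\<close> becomes \<open>r \<le> 1/8\<close>.\<close>

lemma cov_log_pooled_bound:
  assumes in_band: "in_band n j" and kj: "1 \<le> k" "k < j" and dl: "\<delta> k \<le> 1/2" "\<delta> j \<le> 1/2" and r: "2 * real g * \<rho> k j \<le> 1/8"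
  shows "\<bar>expectation (\<lambda>x. log_pooled n k x * log_pooled n j x) - expectation (log_pooled n k) * expectation (log_pooled n j)\<bar> \<le> 256 * (2 * real g * \<rho> k j)\<^sup>2"
proof -
  have okk: "in_band n k" by (rule in_band_mono[OF in_band]) (use kj in auto)
  define r' where "r' = 2 * real g * \<rho> k j"
  have r0: "0 \<le> r'" using \<rho>_nonneg[of j k] kj by (simp add: r'_def)
  have qb: "1/4 * sqnorm (coords i) w \<le> quad_form (coords i) (dft_cov n) w" if "in_band n i" "\<delta> i \<le> 1/2" for i w
  proof -
    have "(1/2) * sqnorm (coords i) w \<le> (1 - \<delta> i) * sqnorm (coords i) w"
      using that by (intro mult_right_mono) (auto simp: sqnorm_nonneg)
    thus ?thesis using quad_form_coords(1)[OF that(1), of w] by simp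
  qed
  interpret gp: gaussian_pair M "coords k" "coords j" "dft_coord n" "dft_cov n" "1/4" r'
  proof unfold_locales
    show "centred_gaussian M (coords k \<union> coords j) (dft_coord n) (dft_cov n)"
      by (rule centred_gaussian_dft_coord) (use finite_coords in_band okk in_band_less[OF in_band] in_band_less[OF okk] in \<open>auto simp: coords_def in_band_def\<close>)
    show "coords k \<inter> coords j = {}" using kj by (intro coords_disjoint) auto
    show "r' \<le> 1/4 / 2" using r by (simp add: r'_def)
    show "1/4 * sqnorm (coords k) w \<le> quad_form (coords k) (dft_cov n) w" for w by (rule qb[OF okk dl(1)])
    show "1/4 * sqnorm (coords j) w \<le> quad_form (coords j) (dft_cov n) w" for w by (rule qb[OF in_band dl(2)])
    fix w :: "coord \<Rightarrow> real"
    have "\<bar>\<Sum>i\<in>coords k. \<Sum>j\<in>coords j. w i * w j * (dft_cov n i j + dft_cov n j i)\<bar> \<le> (2 * \<rho> k j) * real (2 * g) * sqrt (sqnorm (coords k) w * sqnorm (coords j) w)"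
    proof (rule bilinear_bound)
      fix i i' assume i: "i \<in> coords k" "i' \<in> coords j"
      have "i \<noteq> i'" using i kj by (auto simp: coords_def)
      hence "\<bar>dft_cov n i i'\<bar> \<le> \<rho> k j" using dft_cov_bound[OF in_band kj(1) less_imp_le[OF kj(2)] i] by simp
      thus "\<bar>dft_cov n i i' + dft_cov n i' i\<bar> \<le> 2 * \<rho> k j" using dft_cov_sym[of n i' i] by simp
    qed (simp_all add: card_coords)
    thus "\<bar>\<Sum>i\<in>coords k. \<Sum>j\<in>coords j. w i * w j * (dft_cov n i j + dft_cov n j i)\<bar> \<le> 2 * r' * sqrt (sqnorm (coords k) w * sqnorm (coords j) w)"
      by (simp add: r'_def mult_ac)
  qed (use r0 coords_ne in auto)
  have "16 * r'\<^sup>2 / (1/4)\<^sup>2 = 256 * r'\<^sup>2" by (simp add: power2_eq_square)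
  thus ?thesis using gp.log_cov_le[OF pooled_exp_moments(1)[OF okk] pooled_exp_moments(1)[OF in_band]] unfolding r'_def by simp
qed

end

section \<open>Regression weights\<close>

text \<open>On each unit interval the increment of \<open>F\<close> lies between the values of the
  increasing \<open>h\<close> at the end points: the comparison of sum and integral, phrased with an
  antiderivative.\<close>

lemma sum_antiderivative_bounds:
  fixes h F :: "real \<Rightarrow> real"
  assumes F: "\<And>x. 1 \<le> x \<Longrightarrow> (F has_real_derivative h x) (at x)"
    and mono: "\<And>x y. 1 \<le> x \<Longrightarrow> x \<le> y \<Longrightarrow> h x \<le> h y" and m: "1 \<le> m"
  shows "h 1 + F (real m) - F 1 \<le> (\<Sum>k=1..m. h (real k))"
    and "(\<Sum>k=1..m. h (real k)) \<le> h (real m) + F (real m) - F 1"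
proof -
  have inc: "h (real k) \<le> F (real (Suc k)) - F (real k) \<and> F (real (Suc k)) - F (real k) \<le> h (real (Suc k))" if "1 \<le> k" for k
  proof -
    obtain z where z: "real k < z" "z < real (Suc k)" "F (real (Suc k)) - F (real k) = (real (Suc k) - real k) * h z"
    proof -
      have "(F has_real_derivative h x) (at x)" if "real k \<le> x" for x
        using F[of x] that \<open>1 \<le> k\<close> by simp
      thus ?thesis using MVT2[of "real k" "real (Suc k)" F h] that by auto
    qed
    have "h (real k) \<le> h z" "h z \<le> h (real (Suc k))" using z that by (auto intro!: mono)
    thus ?thesis using z by simp
  qed
  show "h 1 + F (real m) - F 1 \<le> (\<Sum>k=1..m. h (real k))"
    using m
  proof (induction m rule: dec_induct)
    case (step n)
    thus ?case using inc[of n] by simp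
  qed simp
  show "(\<Sum>k=1..m. h (real k)) \<le> h (real m) + F (real m) - F 1"
    using m
  proof (induction m rule: dec_induct)
    case (step n)
    thus ?case using inc[of n] by simp
  qed simp
qed

definition lnmean :: "nat \<Rightarrow> real" where "lnmean m = (\<Sum>i=1..m. ln (real i)) / real m"
definition lnvar :: "nat \<Rightarrow> real" where "lnvar m = (\<Sum>i=1..m. (ln (real i) - lnmean m)\<^sup>2)"
definition lnsq :: "nat \<Rightarrow> real" where "lnsq m = (\<Sum>i=1..m. (ln (real i) - lnmean m) * (real i)\<^sup>2)"

lemma sum_ln_error:
  assumes "1 \<le> m"
  shows "\<bar>(\<Sum>i=1..m. ln (real i)) - (real m * ln (real m) - real m)\<bar> \<le> 1 + ln (real m)"
proof -
  have "((\<lambda>x. x * ln x - x) has_real_derivative ln x) (at x)" if "1 \<le> x" for x :: real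
    using that by (auto intro!: derivative_eq_intros)
  from sum_antiderivative_bounds[OF this _ assms] have
    "0 + (real m * ln (real m) - real m) - (-1) \<le> (\<Sum>i=1..m. ln (real i))"
    "(\<Sum>i=1..m. ln (real i)) \<le> ln (real m) + (real m * ln (real m) - real m) - (-1)"
    by auto
  thus ?thesis using assms ln_ge_zero[of "real m"] by linarith
qed

lemma sum_ln_sq_error:
  assumes "1 \<le> m"
  shows "\<bar>(\<Sum>i=1..m. (ln (real i))\<^sup>2) - (real m * (ln (real m))\<^sup>2 - 2 * real m * ln (real m) + 2 * real m)\<bar> \<le> 2 + (ln (real m))\<^sup>2"
proof -
  have "((\<lambda>x. x * (ln x)\<^sup>2 - 2 * x * ln x + 2 * x) has_real_derivative (ln x)\<^sup>2) (at x)" if "1 \<le> x" for x :: real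
    using that by (auto intro!: derivative_eq_intros simp: power2_eq_square)
  from sum_antiderivative_bounds[OF this _ assms] have
    "0 + (real m * (ln (real m))\<^sup>2 - 2 * real m * ln (real m) + 2 * real m) - 2 \<le> (\<Sum>i=1..m. (ln (real i))\<^sup>2)"
    "(\<Sum>i=1..m. (ln (real i))\<^sup>2) \<le> (ln (real m))\<^sup>2 + (real m * (ln (real m))\<^sup>2 - 2 * real m * ln (real m) + 2 * real m) - 2"
    by (auto simp: power_mono)
  thus ?thesis using zero_le_power2[of "ln (real m)"] by linarith
qed

lemma sum_sq_ln_error:
  assumes "1 \<le> m"
  shows "\<bar>(\<Sum>i=1..m. (real i)\<^sup>2 * ln (real i)) - ((real m) ^ 3 / 3 * ln (real m) - (real m) ^ 3 / 9)\<bar> \<le> 1 + (real m)\<^sup>2 * ln (real m)"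
proof -
  have d: "((\<lambda>x. x ^ 3 / 3 * ln x - x ^ 3 / 9) has_real_derivative x\<^sup>2 * ln x) (at x)" if "1 \<le> x" for x :: real
    using that by (auto intro!: derivative_eq_intros simp: power2_eq_square power3_eq_cube field_simps)
  have mono: "x\<^sup>2 * ln x \<le> y\<^sup>2 * ln y" if "1 \<le> x" "x \<le> y" for x y :: real
    using that by (intro mult_mono power_mono) auto
  from sum_antiderivative_bounds[OF d mono assms] have
    "0 + ((real m) ^ 3 / 3 * ln (real m) - (real m) ^ 3 / 9) - (- (1/9)) \<le> (\<Sum>i=1..m. (real i)\<^sup>2 * ln (real i))"
    "(\<Sum>i=1..m. (real i)\<^sup>2 * ln (real i)) \<le> (real m)\<^sup>2 * ln (real m) + ((real m) ^ 3 / 3 * ln (real m) - (real m) ^ 3 / 9) - (- (1/9))"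
    by auto
  moreover have "0 \<le> (real m)\<^sup>2 * ln (real m)" using assms by simp
  ultimately show ?thesis by linarith
qed

lemma sum_inverse_le:
  assumes "1 \<le> m" shows "(\<Sum>i=1..m. 1 / real i) \<le> 1 + ln (real m)"
  using assms
proof (induction m rule: dec_induct)
  case (step n)
  have "1 / real (Suc n) = - (real n / real (Suc n) - 1)" by (simp add: field_simps)
  also have "\<dots> \<le> - ln (real n / real (Suc n))"
    using ln_le_minus_one[of "real n / real (Suc n)"] step by simp
  also have "\<dots> = ln (real (Suc n)) - ln (real n)" using step by (simp add: ln_div)
  finally show ?case using step by simp
qed simp

lemma sum_ln_dev: "1 \<le> m \<Longrightarrow> (\<Sum>i=1..m. ln (real i) - lnmean m) = 0"
  by (simp add: sum_subtractf lnmean_def)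

lemma lnvar_eq: "1 \<le> m \<Longrightarrow> lnvar m = (\<Sum>i=1..m. (ln (real i))\<^sup>2) - (\<Sum>i=1..m. ln (real i))\<^sup>2 / real m"
proof -
  assume m: "1 \<le> m"
  define A where "A = lnmean m"
  have S: "(\<Sum>i=1..m. ln (real i)) = real m * A" using m by (simp add: A_def lnmean_def)
  have "lnvar m = (\<Sum>i=1..m. (ln (real i))\<^sup>2 - 2 * A * ln (real i) + A\<^sup>2)"
    unfolding lnvar_def A_def[symmetric] by (intro sum.cong refl) (simp add: power2_diff)
  also have "\<dots> = (\<Sum>i=1..m. (ln (real i))\<^sup>2) - 2 * A * (\<Sum>i=1..m. ln (real i)) + real m * A\<^sup>2"
    by (simp add: sum.distrib sum_subtractf sum_distrib_left)
  finally show ?thesis using m unfolding S by (simp add: power2_eq_square)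
qed

text \<open>With \<open>M = m\<close> and \<open>l = ln m\<close>, the terms in
  \<open>M * l\<^sup>2\<close> and \<open>M * l\<close> cancel between the sum of squares and the
  squared sum divided by \<open>M\<close>; \<open>2 * M - M = M\<close> survives.\<close>

lemma lnvar_asymp: "(\<lambda>m. lnvar m / real m) \<longlonglongrightarrow> 1"
proof (rule LIM_zero_cancel, rule Lim_null_comparison)
  show "eventually (\<lambda>m. norm (lnvar m / real m - 1) \<le>
     (2 + (ln (real m))\<^sup>2) / real m + 2 * (1 + ln (real m)) * (1 + ln (real m)) / real m + (1 + ln (real m))\<^sup>2 / (real m)\<^sup>2) sequentially"
    using eventually_ge_at_top[of 1]
  proof eventually_elim
    case (elim m)
    define l where "l = ln (real m)"
    define M where "M = real m"
    have M: "1 \<le> M" and l: "0 \<le> l" using elim by (auto simp: M_def l_def)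
    define e1 where "e1 = (\<Sum>i=1..m. ln (real i)) - (M * l - M)"
    define e2 where "e2 = (\<Sum>i=1..m. (ln (real i))\<^sup>2) - (M * l\<^sup>2 - 2 * M * l + 2 * M)"
    have e1: "\<bar>e1\<bar> \<le> 1 + l" using sum_ln_error[OF elim] by (simp add: e1_def M_def l_def)
    have e2: "\<bar>e2\<bar> \<le> 2 + l\<^sup>2" using sum_ln_sq_error[OF elim] by (simp add: e2_def M_def l_def)
    have "lnvar m = (e2 + (M * l\<^sup>2 - 2 * M * l + 2 * M)) - (e1 + (M * l - M))\<^sup>2 / M"
      unfolding lnvar_eq[OF elim] e1_def e2_def M_def by simp
    also have "\<dots> = M + e2 - 2 * e1 * (l - 1) - e1\<^sup>2 / M"
      using M by (simp add: power2_eq_square field_simps)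
    finally have "lnvar m / M - 1 = e2 / M - 2 * e1 * (l - 1) / M - e1\<^sup>2 / M\<^sup>2"
      using M by (simp add: diff_divide_distrib add_divide_distrib power2_eq_square)
    also have "\<bar>\<dots>\<bar> \<le> \<bar>e2 / M\<bar> + \<bar>2 * e1 * (l - 1) / M\<bar> + \<bar>e1\<^sup>2 / M\<^sup>2\<bar>" by linarith
    also have "\<dots> \<le> (2 + l\<^sup>2) / M + 2 * (1 + l) * (1 + l) / M + (1 + l)\<^sup>2 / M\<^sup>2"
    proof (intro add_mono)
      show "\<bar>e2 / M\<bar> \<le> (2 + l\<^sup>2) / M" using e2 M by (simp add: divide_right_mono)
      have "\<bar>2 * e1 * (l - 1)\<bar> \<le> 2 * (1 + l) * (1 + l)" unfolding abs_mult using e1 l by (intro mult_mono) auto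
      thus "\<bar>2 * e1 * (l - 1) / M\<bar> \<le> 2 * (1 + l) * (1 + l) / M" using M by (simp add: divide_right_mono)
      have "e1\<^sup>2 \<le> (1 + l)\<^sup>2" using power_mono[OF e1, of 2] by simp
      thus "\<bar>e1\<^sup>2 / M\<^sup>2\<bar> \<le> (1 + l)\<^sup>2 / M\<^sup>2" by (simp add: divide_right_mono)
    qed
    finally show ?case by (simp add: l_def M_def)
  qed
  show "(\<lambda>m. (2 + (ln (real m))\<^sup>2) / real m + 2 * (1 + ln (real m)) * (1 + ln (real m)) / real m + (1 + ln (real m))\<^sup>2 / (real m)\<^sup>2) \<longlonglongrightarrow> 0"
    by real_asymp
qed

lemma sum_sq: "(\<Sum>i=1..m. (real i)\<^sup>2) = real m ^ 3 / 3 + (real m)\<^sup>2 / 2 + real m / 6"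
  by (induction m) (simp_all add: power2_eq_square power3_eq_cube field_simps)

text \<open>The leading logarithmic terms cancel because the mean logarithm is about
  \<open>ln m - 1\<close>; what remains is \<open>m ^ 3\<close> times
  \<open>1/3 - 1/9 = 2/9\<close>.\<close>

lemma lnsq_asymp: "(\<lambda>m. lnsq m / real m ^ 3) \<longlonglongrightarrow> 2/9"
proof (rule LIM_zero_cancel, rule Lim_null_comparison)
  show "eventually (\<lambda>m. norm (lnsq m / real m ^ 3 - 2/9) \<le>
     (1 + (real m)\<^sup>2 * ln (real m)) / real m ^ 3 + (1 + ln (real m)) * ((real m)\<^sup>2 / 2 + real m / 6) / real m ^ 3
      + (1 + ln (real m)) / real m * (real m ^ 3 / 3 + (real m)\<^sup>2 / 2 + real m / 6) / real m ^ 3) sequentially"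
    using eventually_ge_at_top[of 1]
  proof eventually_elim
    case (elim m)
    define l where "l = ln (real m)"
    define M where "M = real m"
    have M: "1 \<le> M" and l: "0 \<le> l" using elim by (auto simp: M_def l_def)
    define e1 where "e1 = (\<Sum>i=1..m. ln (real i)) - (M * l - M)"
    define e3 where "e3 = (\<Sum>i=1..m. (real i)\<^sup>2 * ln (real i)) - (M ^ 3 / 3 * l - M ^ 3 / 9)"
    define r where "r = M\<^sup>2 / 2 + M / 6"
    have r: "0 \<le> r" using M by (simp add: r_def)
    have e1: "\<bar>e1\<bar> \<le> 1 + l" using sum_ln_error[OF elim] by (simp add: e1_def M_def l_def)
    have e3: "\<bar>e3\<bar> \<le> 1 + M\<^sup>2 * l" using sum_sq_ln_error[OF elim] by (simp add: e3_def M_def l_def)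
    have A: "lnmean m = l - 1 + e1 / M"
      using M unfolding lnmean_def M_def[symmetric] e1_def by (simp add: field_simps)
    have "lnsq m = (\<Sum>i=1..m. (real i)\<^sup>2 * ln (real i)) - lnmean m * (\<Sum>i=1..m. (real i)\<^sup>2)"
      unfolding lnsq_def by (simp add: left_diff_distrib sum_subtractf sum_distrib_left mult.commute)
    also have "\<dots> = (e3 + (M ^ 3 / 3 * l - M ^ 3 / 9)) - (l - 1 + e1 / M) * (M ^ 3 / 3 + r)"
      unfolding A sum_sq e3_def r_def M_def by simp
    also have "\<dots> = 2/9 * M ^ 3 + e3 - (l - 1) * r - e1 / M * (M ^ 3 / 3 + r)"
    proof -
      have "(e3 + (c / 3 * l - c / 9)) - (l - 1 + q) * (c / 3 + r) = 2/9 * c + e3 - (l - 1) * r - q * (c / 3 + r)" for c q :: real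
        by (simp add: field_simps)
      thus ?thesis .
    qed
    finally have "lnsq m / M ^ 3 - 2/9 = e3 / M ^ 3 - (l - 1) * r / M ^ 3 - e1 / M * (M ^ 3 / 3 + r) / M ^ 3"
      using M by (simp add: diff_divide_distrib add_divide_distrib)
    also have "\<bar>\<dots>\<bar> \<le> \<bar>e3 / M ^ 3\<bar> + \<bar>(l - 1) * r / M ^ 3\<bar> + \<bar>e1 / M * (M ^ 3 / 3 + r) / M ^ 3\<bar>" by linarith
    also have "\<dots> \<le> (1 + M\<^sup>2 * l) / M ^ 3 + (1 + l) * r / M ^ 3 + (1 + l) / M * (M ^ 3 / 3 + r) / M ^ 3"
    proof (intro add_mono)
      show "\<bar>e3 / M ^ 3\<bar> \<le> (1 + M\<^sup>2 * l) / M ^ 3" using e3 M by (simp add: divide_right_mono)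
      have "\<bar>(l - 1) * r\<bar> \<le> (1 + l) * r" unfolding abs_mult using l r by (intro mult_mono) auto
      thus "\<bar>(l - 1) * r / M ^ 3\<bar> \<le> (1 + l) * r / M ^ 3" using M by (simp add: divide_right_mono)
      have "\<bar>e1 / M\<bar> \<le> (1 + l) / M" using e1 M by (simp add: divide_right_mono)
      hence "\<bar>e1 / M * (M ^ 3 / 3 + r)\<bar> \<le> (1 + l) / M * (M ^ 3 / 3 + r)" unfolding abs_mult[of "e1 / M"] using M r l by (intro mult_mono) auto
      moreover have "\<bar>t / M ^ 3\<bar> = \<bar>t\<bar> / M ^ 3" for t using M by (simp add: abs_divide)
      ultimately show "\<bar>e1 / M * (M ^ 3 / 3 + r) / M ^ 3\<bar> \<le> (1 + l) / M * (M ^ 3 / 3 + r) / M ^ 3"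
        using M by (simp only:) (rule divide_right_mono, auto)
    qed
    finally show ?case by (simp add: l_def M_def r_def add.assoc)
  qed
  show "(\<lambda>m. (1 + (real m)\<^sup>2 * ln (real m)) / real m ^ 3 + (1 + ln (real m)) * ((real m)\<^sup>2 / 2 + real m / 6) / real m ^ 3
      + (1 + ln (real m)) / real m * (real m ^ 3 / 3 + (real m)\<^sup>2 / 2 + real m / 6) / real m ^ 3) \<longlonglongrightarrow> 0"
    by real_asymp
qed

lemma fourier_ln: "0 < n \<Longrightarrow> 1 \<le> k \<Longrightarrow> ln (fourier_freq n k) = ln (2 * pi / real n) + ln (real k)"
proof -
  assume "0 < n" "1 \<le> k"
  moreover have "fourier_freq n k = (2 * pi / real n) * real k" by (simp add: fourier_freq_def)
  ultimately show ?thesis using ln_mult[of "2 * pi / real n" "real k"] by simp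
qed

text \<open>The factor \<open>2 * pi / n\<close> is common to all frequencies and drops out on
  centring, so the weights depend on \<open>k\<close> and \<open>m\<close> only.\<close>

lemma centred_regressor:
  assumes "0 < n" "1 \<le> m" "1 \<le> k"
  shows "- 2 * ln (fourier_freq n k) - cbar n m = - 2 * (ln (real k) - lnmean m)"
proof -
  have "cbar n m = (\<Sum>i=1..m. - 2 * ln (2 * pi / real n) - 2 * ln (real i)) / real m"
    unfolding cbar_def using assms by (intro arg_cong2[where f="(/)"] sum.cong refl) (simp add: fourier_ln)
  also have "\<dots> = - 2 * ln (2 * pi / real n) - 2 * lnmean m"
    using assms by (simp add: sum_subtractf sum_distrib_left[symmetric] lnmean_def diff_divide_distrib)
  finally show ?thesis using assms by (simp add: fourier_ln)
qed

lemma lp_weight_eq: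
  assumes "0 < n" "1 \<le> m" "1 \<le> k"
  shows "lp_weight n m k = - (ln (real k) - lnmean m) / (2 * lnvar m)"
proof -
  have "(\<Sum>i=1..m. (- 2 * ln (fourier_freq n i) - cbar n m)\<^sup>2) = (\<Sum>i=1..m. 4 * (ln (real i) - lnmean m)\<^sup>2)"
  proof (intro sum.cong refl)
    fix i assume "i \<in> {1..m}"
    hence "- 2 * ln (fourier_freq n i) - cbar n m = - 2 * (ln (real i) - lnmean m)"
      using assms by (intro centred_regressor) auto
    thus "(- 2 * ln (fourier_freq n i) - cbar n m)\<^sup>2 = 4 * (ln (real i) - lnmean m)\<^sup>2"
      by (simp only: power_mult_distrib) simp
  qed
  also have "\<dots> = 4 * lnvar m" by (simp add: lnvar_def sum_distrib_left)
  finally show ?thesis unfolding lp_weight_def centred_regressor[OF assms] by (cases "lnvar m = 0") (simp_all add: field_simps)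
qed

lemma abs_lp_weight_le:
  assumes "0 < n" "1 \<le> k" "k \<le> m" "0 < lnvar m"
  shows "\<bar>lp_weight n m k\<bar> \<le> ln (real m) / (2 * lnvar m)"
proof -
  have m: "1 \<le> m" using assms by simp
  have r: "0 \<le> ln (real i) \<and> ln (real i) \<le> ln (real m)" if "i \<in> {1..m}" for i using that by auto
  have "0 \<le> lnmean m" unfolding lnmean_def using r by (intro divide_nonneg_nonneg sum_nonneg) auto
  moreover have "lnmean m \<le> ln (real m)"
  proof -
    have "(\<Sum>i=1..m. ln (real i)) \<le> (\<Sum>i=1..m. ln (real m))" using r by (intro sum_mono) auto
    thus ?thesis using m by (simp add: lnmean_def divide_le_eq mult.commute)
  qed
  moreover have "0 \<le> ln (real k)" "ln (real k) \<le> ln (real m)" using r[of k] assms by auto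
  ultimately have "\<bar>ln (real k) - lnmean m\<bar> \<le> ln (real m)" by linarith
  thus ?thesis unfolding lp_weight_eq[OF assms(1) m assms(2)] using assms(4)
    by (simp add: divide_right_mono)
qed

text \<open>The first identity annihilates constants, the second reproduces \<open>d\<close>, the
  third is the variance for uncorrelated logarithms of variance 1, and the fourth gives the
  contribution of the quadratic term of \<open>ln fs\<close>.\<close>

lemma sum_lp_weight:
  assumes "0 < n" "1 \<le> m" "0 < lnvar m"
  shows "(\<Sum>k=1..m. lp_weight n m k) = 0" "(\<Sum>k=1..m. lp_weight n m k * (-2 * ln (fourier_freq n k))) = 1"
    "(\<Sum>k=1..m. (lp_weight n m k)\<^sup>2) = 1 / (4 * lnvar m)"
    "(\<Sum>k=1..m. lp_weight n m k * (fourier_freq n k)\<^sup>2) = - (4 * pi\<^sup>2 / (real n)\<^sup>2) * (lnsq m / (2 * lnvar m))"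
proof -
  have w: "lp_weight n m k = - (ln (real k) - lnmean m) / (2 * lnvar m)" if "k \<in> {1..m}" for k
    using that assms by (intro lp_weight_eq) auto
  have "(\<Sum>k=1..m. lp_weight n m k) = - (\<Sum>k=1..m. ln (real k) - lnmean m) / (2 * lnvar m)"
    by (simp add: w sum_divide_distrib sum_negf[symmetric])
  also have "\<dots> = 0" unfolding sum_ln_dev[OF assms(2)] by simp
  finally show z: "(\<Sum>k=1..m. lp_weight n m k) = 0" .
  have "(\<Sum>k=1..m. lp_weight n m k * (-2 * ln (fourier_freq n k)))
      = (\<Sum>k=1..m. lp_weight n m k * (- 2 * (ln (real k) - lnmean m)) + cbar n m * lp_weight n m k)"
  proof (intro sum.cong refl)
    fix k assume "k \<in> {1..m}"
    hence "-2 * ln (fourier_freq n k) = - 2 * (ln (real k) - lnmean m) + cbar n m"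
      using centred_regressor[of n m k] assms by simp
    thus "lp_weight n m k * (-2 * ln (fourier_freq n k)) = lp_weight n m k * (- 2 * (ln (real k) - lnmean m)) + cbar n m * lp_weight n m k"
      by (simp only: distrib_left mult.commute[of "cbar n m"])
  qed
  also have "\<dots> = (\<Sum>k=1..m. (ln (real k) - lnmean m)\<^sup>2 / lnvar m) + cbar n m * (\<Sum>k=1..m. lp_weight n m k)"
    unfolding sum.distrib sum_distrib_left[symmetric]
  proof (intro arg_cong2[where f="(+)"] sum.cong refl)
    fix k assume k: "k \<in> {1..m}"
    have "- t / (2 * v) * (- 2 * t) = t\<^sup>2 / v" for t v :: real by (simp add: power2_eq_square)
    thus "lp_weight n m k * (- 2 * (ln (real k) - lnmean m)) = (ln (real k) - lnmean m)\<^sup>2 / lnvar m"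
      unfolding w[OF k] .
  qed
  also have "\<dots> = 1" using assms unfolding z sum_divide_distrib[symmetric] lnvar_def[symmetric] by simp
  finally show "(\<Sum>k=1..m. lp_weight n m k * (-2 * ln (fourier_freq n k))) = 1" .
  have "(\<Sum>k=1..m. (lp_weight n m k)\<^sup>2) = (\<Sum>k=1..m. (ln (real k) - lnmean m)\<^sup>2 / (2 * lnvar m)\<^sup>2)"
    by (intro sum.cong refl) (simp add: w power_divide power2_commute)
  also have "\<dots> = lnvar m / (2 * lnvar m)\<^sup>2" unfolding sum_divide_distrib[symmetric] lnvar_def[symmetric] ..
  also have "\<dots> = 1 / (4 * lnvar m)" using assms by (simp add: power2_eq_square)
  finally show "(\<Sum>k=1..m. (lp_weight n m k)\<^sup>2) = 1 / (4 * lnvar m)" .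
  have "(\<Sum>k=1..m. lp_weight n m k * (fourier_freq n k)\<^sup>2) = (\<Sum>k=1..m. - (4 * pi\<^sup>2 / (real n)\<^sup>2) * ((ln (real k) - lnmean m) * (real k)\<^sup>2 / (2 * lnvar m)))"
  proof (intro sum.cong refl)
    fix k assume k: "k \<in> {1..m}"
    have "- t / (2 * v) * (2 * p * q / N)\<^sup>2 = - (4 * p\<^sup>2 / N\<^sup>2) * (t * q\<^sup>2 / (2 * v))" for t v p q N :: real
      by (simp add: power2_eq_square)
    thus "lp_weight n m k * (fourier_freq n k)\<^sup>2 = - (4 * pi\<^sup>2 / (real n)\<^sup>2) * ((ln (real k) - lnmean m) * (real k)\<^sup>2 / (2 * lnvar m))"
      unfolding w[OF k] fourier_freq_def .
  qed
  also have "\<dots> = - (4 * pi\<^sup>2 / (real n)\<^sup>2) * (lnsq m / (2 * lnvar m))"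
    by (simp only: sum_distrib_left[symmetric] sum_divide_distrib[symmetric] lnsq_def)
  finally show "(\<Sum>k=1..m. lp_weight n m k * (fourier_freq n k)\<^sup>2) = - (4 * pi\<^sup>2 / (real n)\<^sup>2) * (lnsq m / (2 * lnvar m))" .
qed

text \<open>Cauchy-Schwarz avoids the factor \<open>ln m\<close> of the pointwise weight bound, with
  which the cubic remainder of \<open>ln fs\<close> could fail to be negligible against
  \<open>m\<^sup>2 / n\<^sup>2\<close>.\<close>

lemma sum_abs_lp_weight_le:
  assumes "0 < n" "1 \<le> m" "0 < lnvar m"
  shows "(\<Sum>k=1..m. \<bar>lp_weight n m k\<bar>)\<^sup>2 \<le> real m / (4 * lnvar m)"
proof -
  have "(\<Sum>k=1..m. \<bar>lp_weight n m k\<bar>)\<^sup>2 \<le> (\<Sum>k=1..m. \<bar>lp_weight n m k\<bar>\<^sup>2) * real (card {1..m})"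
    by (rule sum_squared_le_sum_of_squares)
  thus ?thesis using sum_lp_weight(3)[OF assms] by simp
qed

lemma powr_real_at_top:
  fixes p :: real assumes "0 < p" shows "filterlim (\<lambda>m. real m powr p) at_top sequentially"
  using assms by real_asymp

lemma powr_ln_null:
  fixes p :: real assumes "p < 0" shows "(\<lambda>m. real m powr p * (1 + ln (real m)) ^ q) \<longlonglongrightarrow> 0"
  using assms by real_asymp

section \<open>Bias and variance of the estimator\<close>

text \<open>\<open>\<beta>\<close> will be \<open>fs2 0 / (2 * fs 0)\<close>, the coefficient of the
  quadratic term of \<open>ln fs\<close> at 0; a linear term is absent because the first derivative
  vanishes there.\<close>

locale lp_asymp = lp_model fs d \<mu> \<nu> \<eta> M X c0 g
  for fs d \<mu> \<nu> \<eta> and M :: "'a measure" and X c0 g +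
  fixes m :: "nat \<Rightarrow> nat" and \<beta> CR :: real
  assumes m_inf: "filterlim m at_top sequentially"
    and m_o: "(\<lambda>n. real (m n) / real n) \<longlonglongrightarrow> 0"
    and expan: "\<And>w. 0 < w \<Longrightarrow> w \<le> \<eta> \<Longrightarrow> \<bar>ln (fs w) - ln (fs 0) - \<beta> * w\<^sup>2\<bar> \<le> CR * w ^ 3"
begin

text \<open>The bound \<open>3 \<le> m n\<close> ensures \<open>1 \<le> ln (m n)\<close>. The last
  condition holds eventually because \<open>lnvar m\<close> is asymptotic to \<open>m\<close>; it
  turns quotients by \<open>lnvar\<close> into quotients by \<open>m\<close>.\<close>

definition admissible :: "nat \<Rightarrow> bool" where
  "admissible n \<longleftrightarrow> 3 \<le> m n \<and> in_band n (m n) \<and> real (m n) / 2 \<le> lnvar (m n)"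

abbreviation weight :: "nat \<Rightarrow> nat \<Rightarrow> real" where "weight n k \<equiv> lp_weight n (m n) k"

lemma CR_nonneg: "0 \<le> CR"
proof -
  have "0 \<le> CR * \<eta> ^ 3" using expan[of \<eta>] eta by (meson abs_ge_zero order_refl order_trans)
  thus ?thesis using eta by (simp add: zero_le_mult_iff)
qed

lemma lnvar_lim: "(\<lambda>n. lnvar (m n) / real (m n)) \<longlonglongrightarrow> 1"
  by (rule filterlim_compose[OF lnvar_asymp m_inf])

lemma eventually_admissible: "eventually admissible sequentially"
proof -
  have 1: "eventually (\<lambda>n. 3 \<le> m n) sequentially" using m_inf by (auto simp: filterlim_at_top)
  have 2: "eventually (\<lambda>n. 1/2 < lnvar (m n) / real (m n)) sequentially"
    by (rule order_tendstoD[OF lnvar_lim]) simp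
  have "(\<lambda>n. 4 * pi * (real (m n) / real n)) \<longlonglongrightarrow> 4 * pi * 0" by (intro tendsto_mult_left m_o)
  hence 3: "eventually (\<lambda>n. 4 * pi * (real (m n) / real n) < \<eta>) sequentially"
    by (rule order_tendstoD) (use eta in simp)
  show ?thesis using 1 2 3 eventually_gt_at_top[of 0]
  proof eventually_elim
    case (elim n)
    have "real (m n) / 2 \<le> lnvar (m n)" using elim by (simp add: less_divide_eq)
    thus ?case using elim by (simp add: admissible_def in_band_def fourier_freq_def)
  qed
qed

lemma admissibleD:
  assumes "admissible n"
  shows "0 < n" "1 \<le> m n" "0 < lnvar (m n)" "\<And>k. k \<in> {1..m n} \<Longrightarrow> in_band n k" "1 \<le> ln (real (m n))"
    "\<And>k. k \<in> {1..m n} \<Longrightarrow> \<bar>weight n k\<bar> \<le> ln (real (m n)) / real (m n)"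
proof -
  have n: "3 \<le> m n" "in_band n (m n)" "real (m n) / 2 \<le> lnvar (m n)" using assms by (auto simp: admissible_def)
  show n0: "0 < n" using n by (simp add: in_band_def)
  show "1 \<le> m n" using n by simp
  show V: "0 < lnvar (m n)" using n by simp
  show "\<And>k. k \<in> {1..m n} \<Longrightarrow> in_band n k" using n in_band_mono by auto
  have "exp 1 \<le> real (m n)" using exp_le n by linarith
  thus "1 \<le> ln (real (m n))" using n by (simp add: ln_ge_iff)
  fix k assume k: "k \<in> {1..m n}"
  have "\<bar>weight n k\<bar> \<le> ln (real (m n)) / (2 * lnvar (m n))" using k by (intro abs_lp_weight_le n0 V) auto
  also have "\<dots> \<le> ln (real (m n)) / real (m n)" using n V by (intro divide_left_mono) auto
  finally show "\<bar>weight n k\<bar> \<le> ln (real (m n)) / real (m n)" .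
qed

lemma d_hat_eq:
  assumes "admissible n"
  shows "d_hat X g n (m n) x = (\<Sum>k=1..m n. weight n k * ln (spec_dens (fourier_freq n k) / real g * pooled n k x))"
  unfolding d_hat_def
  by (intro sum.cong refl) (use admissibleD(1,4)[OF assms] in_band_spec_dens in \<open>simp add: avg_periodogram_eq\<close>)

lemma d_hat_meas: "admissible n \<Longrightarrow> d_hat X g n (m n) \<in> borel_measurable M"
  by (subst measurable_cong[OF d_hat_eq]) auto

text \<open>The identity holds almost everywhere, since the logarithm of the product splits where
  the pooled sums are positive. Constants such as \<open>ln g\<close> vanish because the weights sum
  to 0, and the logarithms of the frequencies give exactly \<open>d\<close>.\<close>

lemma d_hat_AE:
  assumes gd: "admissible n"
  shows "AE x in M. d_hat X g n (m n) x = d + (\<Sum>k=1..m n. weight n k * (ln (fs (fourier_freq n k)) - ln (fs 0))) + (\<Sum>k=1..m n. weight n k * log_pooled n k x)"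
proof -
  have "AE x in M. \<forall>k\<in>{1..m n}. 0 < pooled n k x"
    by (intro AE_finite_allI pooled_exp_moments(2) admissibleD(4)[OF gd]) auto
  thus ?thesis
  proof eventually_elim
    case (elim x)
    have t: "ln (spec_dens (fourier_freq n k) / real g * pooled n k x) =
       d * (-2 * ln (fourier_freq n k)) + (ln (fs 0) - ln (real g)) + (ln (fs (fourier_freq n k)) - ln (fs 0)) + log_pooled n k x" if k: "k \<in> {1..m n}" for k
    proof -
      define w where "w = fourier_freq n k"
      have w: "0 < w" "w \<le> \<eta>" "0 < spec_dens w" using in_band_freq[OF admissibleD(4)[OF gd k]] in_band_spec_dens[OF admissibleD(4)[OF gd k]] by (auto simp: w_def)
      have fw: "0 < fs w" using low[of w] w pos0 by simp
      have y: "0 < pooled n k x" using elim k by blast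
      have "ln (spec_dens w / real g * pooled n k x) = ln (spec_dens w) - ln (real g) + ln (pooled n k x)"
        using w y g by (simp add: ln_mult ln_div)
      also have "ln (spec_dens w) = -2 * d * ln w + ln (fs w)"
        using w fw by (simp add: spec_dens_def ln_mult ln_powr)
      finally show ?thesis by (simp add: w_def algebra_simps)
    qed
    have s1: "(\<Sum>k=1..m n. weight n k * (-2 * ln (fourier_freq n k))) = 1" and s0: "(\<Sum>k=1..m n. weight n k) = 0"
      using sum_lp_weight(1,2)[OF admissibleD(1-3)[OF gd]] by auto
    have "d_hat X g n (m n) x = (\<Sum>k=1..m n. d * (weight n k * (-2 * ln (fourier_freq n k))) + (ln (fs 0) - ln (real g)) * weight n k
        + weight n k * (ln (fs (fourier_freq n k)) - ln (fs 0)) + weight n k * log_pooled n k x)"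
      unfolding d_hat_eq[OF gd]
    proof (intro sum.cong refl)
      fix k assume k: "k \<in> {1..m n}"
      show "weight n k * ln (spec_dens (fourier_freq n k) / real g * pooled n k x) = d * (weight n k * (-2 * ln (fourier_freq n k))) + (ln (fs 0) - ln (real g)) * weight n k
        + weight n k * (ln (fs (fourier_freq n k)) - ln (fs 0)) + weight n k * log_pooled n k x"
        unfolding t[OF k] by (simp add: algebra_simps)
    qed
    also have "\<dots> = d * 1 + (ln (fs 0) - ln (real g)) * 0 + (\<Sum>k=1..m n. weight n k * (ln (fs (fourier_freq n k)) - ln (fs 0))) + (\<Sum>k=1..m n. weight n k * log_pooled n k x)"
      unfolding sum.distrib sum_distrib_left[symmetric] s1 s0 ..
    finally show ?case by simp
  qed
qed

lemma log_pooled_integrable: "in_band n k \<Longrightarrow> integrable M (log_pooled n k)" and log_pooled_square_integrable: "in_band n k \<Longrightarrow> integrable M (\<lambda>x. (log_pooled n k x)\<^sup>2)"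
  and log_pooled_square_le: "in_band n k \<Longrightarrow> expectation (\<lambda>x. (log_pooled n k x)\<^sup>2) \<le> 13824 * Bq"
proof -
  assume in_band: "in_band n k"
  interpret exp_moments M "log_pooled n k" Bq by (rule pooled_exp_moments(1)[OF in_band])
  show "integrable M (log_pooled n k)" "integrable M (\<lambda>x. (log_pooled n k x)\<^sup>2)" "expectation (\<lambda>x. (log_pooled n k x)\<^sup>2) \<le> 13824 * Bq"
    by (rule int_L int_L2 second_moment_le)+
qed

definition centred_log :: "nat \<Rightarrow> nat \<Rightarrow> 'a \<Rightarrow> real" where
  "centred_log n k x = log_pooled n k x - expectation (log_pooled n k)"

definition log_cov :: "nat \<Rightarrow> nat \<Rightarrow> nat \<Rightarrow> real" where
  "log_cov n k j = expectation (\<lambda>x. centred_log n k x * centred_log n j x)"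

lemma centred_log_measurable[measurable]: "centred_log n k \<in> borel_measurable M"
  unfolding centred_log_def[abs_def] by measurable

lemma centred_log_square_integrable: "in_band n k \<Longrightarrow> integrable M (\<lambda>x. (centred_log n k x)\<^sup>2)"
  unfolding centred_log_def power2_diff using log_pooled_integrable[of n k] log_pooled_square_integrable[of n k] by simp

lemma centred_log_prod_integrable: "in_band n k \<Longrightarrow> in_band n j \<Longrightarrow> integrable M (\<lambda>x. centred_log n k x * centred_log n j x)"
  by (intro integrable_mult_of_squares centred_log_square_integrable) auto

lemma log_cov_eq:
  assumes "in_band n k" "in_band n j"
  shows "log_cov n k j = expectation (\<lambda>x. log_pooled n k x * log_pooled n j x) - expectation (log_pooled n k) * expectation (log_pooled n j)"
proof -
  have p: "integrable M (\<lambda>x. log_pooled n k x * log_pooled n j x)" by (intro integrable_mult_of_squares log_pooled_square_integrable assms) auto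
  have "log_cov n k j = expectation (\<lambda>x. log_pooled n k x * log_pooled n j x - expectation (log_pooled n k) * log_pooled n j x - expectation (log_pooled n j) * log_pooled n k x + expectation (log_pooled n k) * expectation (log_pooled n j))"
    unfolding log_cov_def centred_log_def by (intro Bochner_Integration.integral_cong refl) (simp add: algebra_simps)
  also have "\<dots> = expectation (\<lambda>x. log_pooled n k x * log_pooled n j x) - expectation (log_pooled n k) * expectation (log_pooled n j)"
    using p log_pooled_integrable[OF assms(1)] log_pooled_integrable[OF assms(2)] by (simp add: prob_space)
  finally show ?thesis .
qed

lemma log_cov_diag: "in_band n k \<Longrightarrow> log_cov n k k = expectation (\<lambda>x. (log_pooled n k x)\<^sup>2) - (expectation (log_pooled n k))\<^sup>2"
  by (simp add: log_cov_eq power2_eq_square)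

lemma log_cov_diag_bounds: "in_band n k \<Longrightarrow> 0 \<le> log_cov n k k \<and> log_cov n k k \<le> 13824 * Bq"
proof -
  assume in_band: "in_band n k"
  have "0 \<le> log_cov n k k" by (simp add: log_cov_def)
  moreover have "log_cov n k k \<le> 13824 * Bq"
    using log_pooled_square_le[OF in_band] log_cov_diag[OF in_band] zero_le_power2[of "expectation (log_pooled n k)"] by linarith
  ultimately show ?thesis ..
qed

lemma log_cov_abs_le:
  assumes "in_band n k" "in_band n j" shows "\<bar>log_cov n k j\<bar> \<le> 13824 * Bq"
proof -
  have "\<bar>log_cov n k j\<bar> \<le> expectation (\<lambda>x. \<bar>centred_log n k x * centred_log n j x\<bar>)" unfolding log_cov_def by (rule integral_abs_bound)
  also have "\<dots> \<le> expectation (\<lambda>x. ((centred_log n k x)\<^sup>2 + (centred_log n j x)\<^sup>2) / 2)"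
  proof (rule integral_mono)
    fix x show "\<bar>centred_log n k x * centred_log n j x\<bar> \<le> ((centred_log n k x)\<^sup>2 + (centred_log n j x)\<^sup>2) / 2"
      using sum_squares_bound[of "\<bar>centred_log n k x\<bar>" "\<bar>centred_log n j x\<bar>"] by (simp add: abs_mult)
  qed (use centred_log_prod_integrable[OF assms] centred_log_square_integrable[OF assms(1)] centred_log_square_integrable[OF assms(2)] in auto)
  also have "\<dots> = (log_cov n k k + log_cov n j j) / 2"
    using centred_log_square_integrable[OF assms(1)] centred_log_square_integrable[OF assms(2)] by (simp add: log_cov_def power2_eq_square)
  also have "\<dots> \<le> 13824 * Bq" using log_cov_diag_bounds[OF assms(1)] log_cov_diag_bounds[OF assms(2)] by simp
  finally show ?thesis .
qed

lemma sum_centred_log_square: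
  assumes "finite T" "\<And>k. k \<in> T \<Longrightarrow> in_band n k"
  shows "integrable M (\<lambda>x. (\<Sum>k\<in>T. a k * centred_log n k x)\<^sup>2)"
    "expectation (\<lambda>x. (\<Sum>k\<in>T. a k * centred_log n k x)\<^sup>2) = (\<Sum>k\<in>T. \<Sum>j\<in>T. a k * a j * log_cov n k j)"
proof -
  have e: "(\<Sum>k\<in>T. a k * centred_log n k x)\<^sup>2 = (\<Sum>k\<in>T. \<Sum>j\<in>T. (a k * a j) * (centred_log n k x * centred_log n j x))" for x
    by (simp add: power2_eq_square sum_product mult_ac)
  show "integrable M (\<lambda>x. (\<Sum>k\<in>T. a k * centred_log n k x)\<^sup>2)" unfolding e
    by (intro Bochner_Integration.integrable_sum integrable_mult_right centred_log_prod_integrable assms)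
  show "expectation (\<lambda>x. (\<Sum>k\<in>T. a k * centred_log n k x)\<^sup>2) = (\<Sum>k\<in>T. \<Sum>j\<in>T. a k * a j * log_cov n k j)"
    unfolding e log_cov_def using centred_log_prod_integrable assms
    by (subst Bochner_Integration.integral_sum, force, intro sum.cong refl)+ simp
qed

lemma d_hat_centred:
  assumes gd: "admissible n"
  shows "integrable M (d_hat X g n (m n))" "integrable M (\<lambda>x. (d_hat X g n (m n) x)\<^sup>2)"
    "expectation (d_hat X g n (m n)) - d = (\<Sum>k=1..m n. weight n k * (ln (fs (fourier_freq n k)) - ln (fs 0))) + (\<Sum>k=1..m n. weight n k * (expectation (log_pooled n k) - Digamma (real g)))"
    "variance (d_hat X g n (m n)) = expectation (\<lambda>x. (\<Sum>k=1..m n. weight n k * centred_log n k x)\<^sup>2)"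
proof -
  define b where "b = d + (\<Sum>k=1..m n. weight n k * (ln (fs (fourier_freq n k)) - ln (fs 0)))"
  define W where "W x = (\<Sum>k=1..m n. weight n k * log_pooled n k x)" for x
  define w where "w = (\<Sum>k=1..m n. weight n k * expectation (log_pooled n k))"
  have ae: "AE x in M. d_hat X g n (m n) x = b + W x" unfolding b_def W_def by (rule d_hat_AE[OF gd])
  have [measurable]: "d_hat X g n (m n) \<in> borel_measurable M" by (rule d_hat_meas[OF gd])
  have [measurable]: "W \<in> borel_measurable M" unfolding W_def[abs_def] by measurable
  have Wi: "integrable M W" unfolding W_def using log_pooled_integrable admissibleD(4)[OF gd] by auto
  have We: "expectation W = w" unfolding W_def w_def using log_pooled_integrable admissibleD(4)[OF gd] by simp
  have cen: "W x - w = (\<Sum>k=1..m n. weight n k * centred_log n k x)" for x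
    by (simp add: W_def w_def centred_log_def right_diff_distrib sum_subtractf)
  have sqi: "integrable M (\<lambda>x. (W x - w)\<^sup>2)"
    unfolding cen by (rule sum_centred_log_square) (use admissibleD(4)[OF gd] in auto)
  have "(W x)\<^sup>2 = (W x - w)\<^sup>2 + 2 * w * W x - w\<^sup>2" for x by (simp add: power2_eq_square algebra_simps)
  hence W2: "integrable M (\<lambda>x. (W x)\<^sup>2)" using sqi Wi by simp
  show "integrable M (d_hat X g n (m n))"
    by (subst integrable_cong_AE[OF _ _ ae]) (use Wi in auto)
  have "integrable M (\<lambda>x. (b + W x)\<^sup>2)" unfolding power2_sum using Wi W2 by simp
  moreover have "AE x in M. (d_hat X g n (m n) x)\<^sup>2 = (b + W x)\<^sup>2" using ae by eventually_elim simp
  ultimately show "integrable M (\<lambda>x. (d_hat X g n (m n) x)\<^sup>2)"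
    by (subst integrable_cong_AE[where g = "\<lambda>x. (b + W x)\<^sup>2"]) auto
  have ed: "expectation (d_hat X g n (m n)) = b + w"
  proof -
    have "expectation (d_hat X g n (m n)) = expectation (\<lambda>x. b + W x)" by (rule integral_cong_AE[OF _ _ ae]) auto
    thus ?thesis using Wi We by (simp add: prob_space)
  qed
  \<comment> \<open>\<open>Digamma\<close> may be inserted since the weights sum to 0; the limit of
    the mean of each logarithm thus causes no bias.\<close>
  have "w = (\<Sum>k=1..m n. weight n k * (expectation (log_pooled n k) - Digamma (real g)))"
    using sum_lp_weight(1)[OF admissibleD(1-3)[OF gd]]
    by (simp add: w_def right_diff_distrib sum_subtractf sum_distrib_right[symmetric])
  thus "expectation (d_hat X g n (m n)) - d = (\<Sum>k=1..m n. weight n k * (ln (fs (fourier_freq n k)) - ln (fs 0))) + (\<Sum>k=1..m n. weight n k * (expectation (log_pooled n k) - Digamma (real g)))"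
    unfolding ed b_def by simp
  have "variance (d_hat X g n (m n)) = expectation (\<lambda>x. (W x - w)\<^sup>2)"
    unfolding ed
  proof (rule integral_cong_AE)
    show "AE x in M. (d_hat X g n (m n) x - (b + w))\<^sup>2 = (W x - w)\<^sup>2"
      using ae by eventually_elim simp
  qed auto
  thus "variance (d_hat X g n (m n)) = expectation (\<lambda>x. (\<Sum>k=1..m n. weight n k * centred_log n k x)\<^sup>2)" unfolding cen .
qed

section \<open>Bias from the smooth factor and from the noise\<close>

definition smooth_bias :: "nat \<Rightarrow> real" where
  "smooth_bias n = (\<Sum>k=1..m n. weight n k * (ln (fs (fourier_freq n k)) - ln (fs 0)))"

definition noise_bias :: "nat \<Rightarrow> real" where
  "noise_bias n = (\<Sum>k=1..m n. weight n k * (expectation (log_pooled n k) - Digamma (real g)))"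

text \<open>The main term is \<open>\<beta>\<close> times the weighted sum of squared frequencies,
  which is \<open>- 2 * pi\<^sup>2 / n\<^sup>2\<close> times \<open>lnsq / lnvar\<close>, and that
  quotient is asymptotic to \<open>2/9 * m\<^sup>2\<close>. The cubic remainder is smaller by a
  factor of order \<open>m / n\<close>, as the absolute weights sum to at most 1.\<close>

lemma smooth_bias_asymp:
  "(\<lambda>n. smooth_bias n / ((real (m n))\<^sup>2 / (real n)\<^sup>2)) \<longlonglongrightarrow> - (4 * pi\<^sup>2 * \<beta> / 9)"
proof -
  define R where "R n k = ln (fs (fourier_freq n k)) - ln (fs 0) - \<beta> * (fourier_freq n k)\<^sup>2" for n k
  define main where "main n = - 2 * pi\<^sup>2 * \<beta> * ((lnsq (m n) / real (m n) ^ 3) / (lnvar (m n) / real (m n)))" for n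
  define rest where "rest n = (\<Sum>k=1..m n. weight n k * R n k) / ((real (m n))\<^sup>2 / (real n)\<^sup>2)" for n
  have split: "eventually (\<lambda>n. main n + rest n = smooth_bias n / ((real (m n))\<^sup>2 / (real n)\<^sup>2)) sequentially"
    using eventually_admissible
  proof eventually_elim
    case (elim n)
    note gd = admissibleD[OF elim]
    have "smooth_bias n = \<beta> * (\<Sum>k=1..m n. weight n k * (fourier_freq n k)\<^sup>2) + (\<Sum>k=1..m n. weight n k * R n k)"
      unfolding smooth_bias_def R_def sum_distrib_left sum.distrib[symmetric]
      by (intro sum.cong refl) (simp add: algebra_simps)
    also have "(\<Sum>k=1..m n. weight n k * (fourier_freq n k)\<^sup>2) = - (4 * pi\<^sup>2 / (real n)\<^sup>2) * (lnsq (m n) / (2 * lnvar (m n)))"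
      by (rule sum_lp_weight(4)[OF gd(1-3)])
    finally have sb: "smooth_bias n = \<beta> * (- (4 * pi\<^sup>2 / (real n)\<^sup>2) * (lnsq (m n) / (2 * lnvar (m n)))) + (\<Sum>k=1..m n. weight n k * R n k)" .
    have "\<beta> * (- (4 * pi\<^sup>2 / N\<^sup>2) * (s / (2 * v))) / (q\<^sup>2 / N\<^sup>2) = - 2 * pi\<^sup>2 * \<beta> * ((s / q ^ 3) / (v / q))"
      if "N \<noteq> 0" "q \<noteq> 0" "v \<noteq> 0" for N s v q :: real
      using that by (simp add: field_simps power2_eq_square power3_eq_cube)
    from this[of "real n" "real (m n)" "lnvar (m n)" "lnsq (m n)"] gd(1-3)
    have "\<beta> * (- (4 * pi\<^sup>2 / (real n)\<^sup>2) * (lnsq (m n) / (2 * lnvar (m n)))) / ((real (m n))\<^sup>2 / (real n)\<^sup>2) = main n"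
      unfolding main_def by auto
    thus ?case unfolding sb add_divide_distrib rest_def by simp
  qed
  have "(\<lambda>n. (lnsq (m n) / real (m n) ^ 3) / (lnvar (m n) / real (m n))) \<longlonglongrightarrow> (2/9) / 1"
    by (intro tendsto_divide lnvar_lim filterlim_compose[OF lnsq_asymp m_inf]) simp
  hence main: "main \<longlonglongrightarrow> - 2 * pi\<^sup>2 * \<beta> * ((2/9) / 1)" unfolding main_def by (rule tendsto_mult_left)
  have rest: "rest \<longlonglongrightarrow> 0"
  proof (rule Lim_null_comparison)
    show "eventually (\<lambda>n. norm (rest n) \<le> CR * (8 * pi ^ 3) * (real (m n) / real n)) sequentially"
      using eventually_admissible
    proof eventually_elim
      case (elim n)
      note gd = admissibleD[OF elim]
      define wm where "wm = fourier_freq n (m n)"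
      have Rb: "\<bar>R n k\<bar> \<le> CR * wm ^ 3" if "k \<in> {1..m n}" for k
      proof -
        have w: "0 < fourier_freq n k" "fourier_freq n k \<le> \<eta>" using in_band_freq[OF gd(4)[OF that]] by auto
        have "\<bar>R n k\<bar> \<le> CR * (fourier_freq n k) ^ 3" unfolding R_def by (rule expan[OF w])
        also have "\<dots> \<le> CR * wm ^ 3"
        proof (intro mult_left_mono power_mono CR_nonneg)
          show "fourier_freq n k \<le> wm" unfolding wm_def fourier_freq_def using that
            by (intro divide_right_mono mult_left_mono) auto
        qed (use w in simp)
        finally show ?thesis .
      qed
      have "(\<Sum>k=1..m n. \<bar>weight n k\<bar>)\<^sup>2 \<le> real (m n) / (4 * lnvar (m n))" by (rule sum_abs_lp_weight_le[OF gd(1-3)])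
      also have "\<dots> \<le> 1\<^sup>2" using elim gd(3) by (simp add: admissible_def divide_le_eq)
      finally have a1: "(\<Sum>k=1..m n. \<bar>weight n k\<bar>) \<le> 1" by (rule power2_le_imp_le) simp
      have "\<bar>\<Sum>k=1..m n. weight n k * R n k\<bar> \<le> (\<Sum>k=1..m n. \<bar>weight n k\<bar> * \<bar>R n k\<bar>)"
        by (rule order_trans[OF sum_abs]) (simp add: abs_mult)
      also have "\<dots> \<le> (\<Sum>k=1..m n. \<bar>weight n k\<bar> * (CR * wm ^ 3))" by (intro sum_mono mult_left_mono Rb) auto
      also have "\<dots> = (\<Sum>k=1..m n. \<bar>weight n k\<bar>) * (CR * wm ^ 3)" by (simp add: sum_distrib_right)
      also have "\<dots> \<le> 1 * (CR * wm ^ 3)" using CR_nonneg by (intro mult_right_mono a1) (simp add: wm_def fourier_freq_def)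
      finally have "\<bar>\<Sum>k=1..m n. weight n k * R n k\<bar> \<le> CR * wm ^ 3" by simp
      hence "norm (rest n) \<le> CR * wm ^ 3 / ((real (m n))\<^sup>2 / (real n)\<^sup>2)"
        unfolding rest_def norm_divide using gd(1,2) by (intro frac_le) auto
      also have "\<dots> = CR * (8 * pi ^ 3) * (real (m n) / real n)"
      proof -
        have "CR * (2 * p * q / N) ^ 3 / (q\<^sup>2 / N\<^sup>2) = CR * (8 * p ^ 3) * (q / N)" if "N \<noteq> 0" "q \<noteq> 0" for N q p :: real
          using that by (simp add: field_simps power2_eq_square power3_eq_cube)
        thus ?thesis using gd(1,2) unfolding wm_def fourier_freq_def by simp
      qed
      finally show ?case .
    qed
    show "(\<lambda>n. CR * (8 * pi ^ 3) * (real (m n) / real n)) \<longlonglongrightarrow> 0"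
      using tendsto_mult_left[OF m_o, of "CR * (8 * pi ^ 3)"] by simp
  qed
  have "(\<lambda>n. main n + rest n) \<longlonglongrightarrow> - 2 * pi\<^sup>2 * \<beta> * ((2/9) / 1) + 0" by (intro tendsto_add main rest)
  also have "- 2 * pi\<^sup>2 * \<beta> * ((2/9) / 1) + 0 = - (4 * pi\<^sup>2 * \<beta> / 9)" by simp
  finally show ?thesis using tendsto_cong[OF split] by simp
qed

lemma mean_const_nonneg: "0 \<le> mean_const"
  unfolding mean_const_def using \<rho>c_nonneg Bq_nonneg by (intro mult_nonneg_nonneg add_nonneg_nonneg) auto

text \<open>The three logarithms come from the weights, from the bound on a single mean and from the
  harmonic sum.\<close>

lemma noise_bias_bound:
  assumes "admissible n"
  shows "\<bar>noise_bias n\<bar> \<le> 4 * mean_const * (ln (real (m n)) ^ 3 / real (m n))"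
proof -
  note gd = admissibleD[OF assms]
  define l where "l = ln (real (m n))"
  have l: "1 \<le> l" using gd(5) by (simp add: l_def)
  have "\<bar>noise_bias n\<bar> \<le> (\<Sum>k=1..m n. \<bar>weight n k\<bar> * \<bar>expectation (log_pooled n k) - Digamma (real g)\<bar>)"
    unfolding noise_bias_def by (rule order_trans[OF sum_abs]) (simp add: abs_mult)
  also have "\<dots> \<le> (\<Sum>k=1..m n. (l / real (m n)) * (mean_const * ((1 + l) * (1 / real k))))"
  proof (intro sum_mono mult_mono)
    fix k assume k: "k \<in> {1..m n}"
    show "\<bar>weight n k\<bar> \<le> l / real (m n)" unfolding l_def by (rule gd(6)[OF k])
    have "\<bar>expectation (log_pooled n k) - Digamma (real g)\<bar> \<le> mean_const * ((1 + ln (real k)) / real k)"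
      by (rule mean_log_pooled_bound[OF gd(4)[OF k]])
    also have "\<dots> \<le> mean_const * ((1 + l) / real k)"
      using k unfolding l_def by (intro mult_left_mono divide_right_mono mean_const_nonneg) auto
    finally show "\<bar>expectation (log_pooled n k) - Digamma (real g)\<bar> \<le> mean_const * ((1 + l) * (1 / real k))" by simp
  qed (use l in auto)
  also have "\<dots> = (l / real (m n)) * (mean_const * ((1 + l) * (\<Sum>k=1..m n. 1 / real k)))"
    by (simp only: sum_distrib_left)
  also have "\<dots> \<le> (l / real (m n)) * (mean_const * ((1 + l) * (1 + l)))"
    using l mean_const_nonneg sum_inverse_le[OF gd(2)] unfolding l_def[symmetric] by (intro mult_left_mono) auto
  also have "\<dots> \<le> (l / real (m n)) * (mean_const * ((2 * l) * (2 * l)))"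
    using l mean_const_nonneg by (intro mult_left_mono mult_mono) auto
  also have "\<dots> = 4 * mean_const * (l ^ 3 / real (m n))" by (simp add: power3_eq_cube mult_ac)
  finally show ?thesis unfolding l_def .
qed

section \<open>Variance: the lowest frequencies and the rest\<close>

definition \<theta> :: real where "\<theta> = (1/2 + 1 / (1 + 2 * \<bar>d\<bar>)) / 2"

text \<open>\<open>\<theta>\<close> is the midpoint of the interval between \<open>1/2\<close> and
  \<open>1 / (1 + 2 * \<bar>d\<bar>)\<close>, which is nonempty because
  \<open>\<bar>d\<bar> < 1/2\<close>. The last inequality makes the cross covariances above the cut
  tend to 0.\<close>

lemma \<theta>: "1/2 < \<theta>" "\<theta> < 1" "\<theta> * (1 + 2 * \<bar>d\<bar>) < 1" "\<theta> * (1 + \<bar>d\<bar>) < 1"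
proof -
  have d2: "2 * \<bar>d\<bar> < 1" using d by linarith
  hence "1/2 < 1 / (1 + 2 * \<bar>d\<bar>)" "1 / (1 + 2 * \<bar>d\<bar>) \<le> 1" by (auto simp: field_simps)
  hence "1 < 1/2 + 1 / (1 + 2 * \<bar>d\<bar>)" "1/2 + 1 / (1 + 2 * \<bar>d\<bar>) < 2" by linarith+
  thus t: "1/2 < \<theta>" "\<theta> < 1" unfolding \<theta>_def by auto
  have "\<theta> * (1 + 2 * \<bar>d\<bar>) = ((1 + 2 * \<bar>d\<bar>) / 2 + 1) / 2" unfolding \<theta>_def by (simp add: field_simps)
  also have "\<dots> < 1" using d2 by simp
  finally show "\<theta> * (1 + 2 * \<bar>d\<bar>) < 1" .
  moreover have "\<theta> * (1 + \<bar>d\<bar>) \<le> \<theta> * (1 + 2 * \<bar>d\<bar>)" using t by (intro mult_left_mono) auto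
  ultimately show "\<theta> * (1 + \<bar>d\<bar>) < 1" by linarith
qed

text \<open>Rounding up gives the direction used for the covariances above the cut; the factor 2
  lost in the other direction affects only the count of the frequencies below it.\<close>

definition low_cut :: "nat \<Rightarrow> nat" where "low_cut n = nat \<lceil>real (m n) powr (1 - \<theta>)\<rceil>"
definition lowf :: "nat \<Rightarrow> nat set" where "lowf n = {k \<in> {1..m n}. k < low_cut n}"
definition highf :: "nat \<Rightarrow> nat set" where "highf n = {k \<in> {1..m n}. low_cut n \<le> k}"

lemma low_cut_bounds:
  assumes "1 \<le> m n"
  shows "real (m n) powr (1 - \<theta>) \<le> real (low_cut n)" "real (low_cut n) \<le> 2 * real (m n) powr (1 - \<theta>)" "1 \<le> low_cut n"
    "real (m n) / real (low_cut n) \<le> real (m n) powr \<theta>" "1 / real (low_cut n) \<le> real (m n) powr (\<theta> - 1)"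
proof -
  have p: "1 \<le> real (m n) powr (1 - \<theta>)" using assms \<theta> by (intro ge_one_powr_ge_zero) auto
  have c: "real (low_cut n) = of_int \<lceil>real (m n) powr (1 - \<theta>)\<rceil>" using p by (simp add: low_cut_def)
  show 1: "real (m n) powr (1 - \<theta>) \<le> real (low_cut n)" unfolding c by linarith
  show "real (low_cut n) \<le> 2 * real (m n) powr (1 - \<theta>)" unfolding c using p by linarith
  show "1 \<le> low_cut n" using 1 p by linarith
  have "1 / real (low_cut n) \<le> 1 / real (m n) powr (1 - \<theta>)" using 1 less_le_trans[OF zero_less_one p] by (intro frac_le) auto
  also have "\<dots> = real (m n) powr (\<theta> - 1)" using powr_minus_divide[of "real (m n)" "1 - \<theta>"] by simp
  finally show i: "1 / real (low_cut n) \<le> real (m n) powr (\<theta> - 1)" .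
  have "real (m n) * (1 / real (low_cut n)) \<le> real (m n) * real (m n) powr (\<theta> - 1)" by (intro mult_left_mono i) auto
  also have "\<dots> = real (m n) powr \<theta>" using assms powr_mult_base[of "real (m n)" "\<theta> - 1"] by simp
  finally show "real (m n) / real (low_cut n) \<le> real (m n) powr \<theta>" by simp
qed

lemma low_cut_at_top: "filterlim low_cut at_top sequentially"
proof -
  have "filterlim (\<lambda>n. real (m n) powr (1 - \<theta>)) at_top sequentially"
    using \<theta> by (intro filterlim_compose[OF powr_real_at_top m_inf]) auto
  hence "filterlim (\<lambda>n. real (low_cut n)) at_top sequentially"
    by (rule filterlim_at_top_mono) (use eventually_admissible in eventually_elim, use low_cut_bounds admissibleD in blast)
  thus ?thesis by (simp add: filterlim_sequentially_iff_filterlim_real)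
qed

lemma in_band_sets: "admissible n \<Longrightarrow> k \<in> lowf n \<Longrightarrow> in_band n k" "admissible n \<Longrightarrow> k \<in> highf n \<Longrightarrow> in_band n k"
  by (auto simp: lowf_def highf_def intro: admissibleD(4))

lemma fin_sets: "finite (lowf n)" "finite (highf n)" "lowf n \<inter> highf n = {}" "lowf n \<union> highf n = {1..m n}"
  by (auto simp: lowf_def highf_def)

lemma card_lowf: "card (lowf n) \<le> low_cut n"
proof -
  have "card (lowf n) \<le> card {0..< low_cut n}" by (rule card_mono) (auto simp: lowf_def)
  thus ?thesis by simp
qed

definition vlow :: "nat \<Rightarrow> real" where "vlow n = expectation (\<lambda>x. (\<Sum>k\<in>lowf n. weight n k * centred_log n k x)\<^sup>2)"
definition vhigh :: "nat \<Rightarrow> real" where "vhigh n = expectation (\<lambda>x. (\<Sum>k\<in>highf n. weight n k * centred_log n k x)\<^sup>2)"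

lemma sum_abs_low:
  assumes "admissible n"
  shows "(\<Sum>k\<in>lowf n. \<bar>weight n k\<bar>) \<le> 2 * real (m n) powr (- \<theta>) * ln (real (m n))"
proof -
  note gd = admissibleD[OF assms]
  have "(\<Sum>k\<in>lowf n. \<bar>weight n k\<bar>) \<le> (\<Sum>k\<in>lowf n. ln (real (m n)) / real (m n))"
    by (intro sum_mono gd(6)) (auto simp: lowf_def)
  also have "\<dots> = real (card (lowf n)) * (ln (real (m n)) / real (m n))" by simp
  also have "\<dots> \<le> (2 * real (m n) powr (1 - \<theta>)) * (ln (real (m n)) / real (m n))"
    using card_lowf[of n] low_cut_bounds(2)[OF gd(2)] gd(2) by (intro mult_right_mono) auto
  also have "\<dots> = 2 * (real (m n) powr (1 - \<theta>) / real (m n)) * ln (real (m n))" by simp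
  also have "real (m n) powr (1 - \<theta>) / real (m n) = real (m n) powr (- \<theta>)"
    using gd(2) powr_diff[of "real (m n)" "1 - \<theta>" 1] by simp
  finally show ?thesis .
qed

text \<open>With no decay of correlations at hand for low frequencies, all covariances are bounded
  by the same constant and the absolute weights are squared as a whole: of order
  \<open>m powr (1 - \<theta>)\<close> many, each at most \<open>ln m / m\<close>.\<close>

lemma vlow_bound:
  assumes gd0: "admissible n"
  shows "0 \<le> vlow n" "real (m n) * vlow n \<le> 4 * (13824 * Bq) * (real (m n) powr (1 - 2 * \<theta>) * (1 + ln (real (m n))) ^ 2)"
proof -
  note gd = admissibleD[OF gd0]
  define l where "l = ln (real (m n))"
  have l: "1 \<le> l" using gd(5) by (simp add: l_def)
  show "0 \<le> vlow n" by (simp add: vlow_def)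
  have "vlow n = (\<Sum>k\<in>lowf n. \<Sum>j\<in>lowf n. weight n k * weight n j * log_cov n k j)"
    unfolding vlow_def by (rule sum_centred_log_square) (use fin_sets in_band_sets gd0 in auto)
  also have "\<dots> \<le> (\<Sum>k\<in>lowf n. \<Sum>j\<in>lowf n. \<bar>weight n k\<bar> * \<bar>weight n j\<bar> * (13824 * Bq))"
  proof (intro sum_mono)
    fix k j assume "k \<in> lowf n" "j \<in> lowf n"
    hence "\<bar>log_cov n k j\<bar> \<le> 13824 * Bq" by (intro log_cov_abs_le in_band_sets gd0)
    hence "\<bar>weight n k * weight n j * log_cov n k j\<bar> \<le> \<bar>weight n k\<bar> * \<bar>weight n j\<bar> * (13824 * Bq)" by (simp add: abs_mult mult_left_mono)
    thus "weight n k * weight n j * log_cov n k j \<le> \<bar>weight n k\<bar> * \<bar>weight n j\<bar> * (13824 * Bq)" by linarith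
  qed
  also have "\<dots> = (\<Sum>k\<in>lowf n. \<bar>weight n k\<bar>)\<^sup>2 * (13824 * Bq)"
    unfolding power2_eq_square sum_product by (simp add: sum_distrib_right)
  also have "\<dots> \<le> (2 * real (m n) powr (- \<theta>) * l)\<^sup>2 * (13824 * Bq)"
    using sum_abs_low[OF gd0] Bq_nonneg unfolding l_def by (intro mult_right_mono power_mono) (auto intro: sum_nonneg)
  finally have "real (m n) * vlow n \<le> real (m n) * ((2 * real (m n) powr (- \<theta>) * l)\<^sup>2 * (13824 * Bq))"
    by (intro mult_left_mono) auto
  also have "\<dots> = 4 * (13824 * Bq) * ((real (m n) * (real (m n) powr (- \<theta>))\<^sup>2) * l\<^sup>2)"
    by (simp add: power_mult_distrib)
  also have "real (m n) * (real (m n) powr (- \<theta>))\<^sup>2 = real (m n) powr (1 - 2 * \<theta>)"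
    using gd(2) powr_mult_base[of "real (m n)" "- 2 * \<theta>"] by (simp add: power2_eq_square powr_add[symmetric])
  also have "4 * (13824 * Bq) * (real (m n) powr (1 - 2 * \<theta>) * l\<^sup>2) \<le> 4 * (13824 * Bq) * (real (m n) powr (1 - 2 * \<theta>) * (1 + l)\<^sup>2)"
    using l Bq_nonneg by (intro mult_left_mono power_mono) auto
  finally show "real (m n) * vlow n \<le> 4 * (13824 * Bq) * (real (m n) powr (1 - 2 * \<theta>) * (1 + ln (real (m n))) ^ 2)"
    by (simp add: l_def)
qed

lemma null_seq: "p < 0 \<Longrightarrow> (\<lambda>n. real (m n) powr p * (1 + ln (real (m n))) ^ q) \<longlonglongrightarrow> 0"
  by (rule filterlim_compose[OF powr_ln_null m_inf])

definition rho_bar :: "nat \<Rightarrow> real" where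
  "rho_bar n = \<rho>c * (real (m n) powr (\<theta> * \<bar>d\<bar>) * (1 + ln (real (m n))))"

text \<open>Above the cut \<open>j / k\<close> is at most \<open>m / low_cut\<close>, hence at most
  \<open>m powr \<theta>\<close>. The first bound keeps the decay in \<open>k\<close>; the second is
  uniform and tends to 0.\<close>

lemma \<rho>_high:
  assumes gd0: "admissible n" and k: "k \<in> highf n" "j \<in> highf n" "k < j"
  shows "\<rho> k j \<le> rho_bar n / real k" "\<rho> k j \<le> \<rho>c * (real (m n) powr (\<theta> * (1 + \<bar>d\<bar>) - 1) * (1 + ln (real (m n))) ^ 1)"
proof -
  note gd = admissibleD[OF gd0]
  have kj: "1 \<le> k" "low_cut n \<le> k" "1 \<le> j" "j \<le> m n" using k by (auto simp: highf_def)
  note cb = low_cut_bounds[OF gd(2)]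
  have "real j / real k \<le> real (m n) / real (low_cut n)" using kj cb(3) by (intro frac_le) auto
  also have "\<dots> \<le> real (m n) powr \<theta>" by (rule cb)
  finally have "(real j / real k) powr \<bar>d\<bar> \<le> (real (m n) powr \<theta>) powr \<bar>d\<bar>" by (intro powr_mono2) auto
  hence 1: "(real j / real k) powr \<bar>d\<bar> \<le> real (m n) powr (\<theta> * \<bar>d\<bar>)" by (simp add: powr_powr)
  have "\<rho> k j = \<rho>c * ((real j / real k) powr \<bar>d\<bar> * (1 + ln (real j))) / real k" by (simp add: \<rho>_def mult.assoc)
  also have "\<dots> \<le> \<rho>c * (real (m n) powr (\<theta> * \<bar>d\<bar>) * (1 + ln (real (m n)))) / real k"
    using 1 kj \<rho>c_nonneg by (intro divide_right_mono mult_left_mono mult_mono) auto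
  finally show A: "\<rho> k j \<le> rho_bar n / real k" by (simp add: rho_bar_def)
  have "rho_bar n / real k \<le> rho_bar n * (1 / real (low_cut n))"
    using kj cb(3) \<rho>c_nonneg gd(5) unfolding rho_bar_def divide_inverse by (intro mult_left_mono) (auto intro: le_imp_inverse_le)
  also have "\<dots> \<le> rho_bar n * real (m n) powr (\<theta> - 1)"
    using cb(5) \<rho>c_nonneg gd(5) unfolding rho_bar_def by (intro mult_left_mono) auto
  also have "\<dots> = \<rho>c * ((real (m n) powr (\<theta> * \<bar>d\<bar>) * real (m n) powr (\<theta> - 1)) * (1 + ln (real (m n))))"
    by (simp add: rho_bar_def)
  also have "real (m n) powr (\<theta> * \<bar>d\<bar>) * real (m n) powr (\<theta> - 1) = real (m n) powr (\<theta> * (1 + \<bar>d\<bar>) - 1)"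
    unfolding powr_add[symmetric] by (simp add: algebra_simps)
  finally show "\<rho> k j \<le> \<rho>c * (real (m n) powr (\<theta> * (1 + \<bar>d\<bar>) - 1) * (1 + ln (real (m n))) ^ 1)" using A by simp
qed

text \<open>Beyond admissibility, the hypotheses of the covariance bound for all pairs of
  frequencies above the cut.\<close>

definition settled :: "nat \<Rightarrow> bool" where
  "settled n \<longleftrightarrow> admissible n \<and> (\<forall>k\<in>highf n. \<delta> k \<le> 1/2) \<and> (\<forall>k\<in>highf n. \<forall>j\<in>highf n. k < j \<longrightarrow> 2 * real g * \<rho> k j \<le> 1/8)"

lemma eventually_settled: "eventually settled sequentially"
proof -
  have "eventually (\<lambda>k. \<delta> k < 1/2) sequentially" by (rule order_tendstoD[OF \<delta>_tendsto]) simp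
  then obtain K where K: "\<And>k. K \<le> k \<Longrightarrow> \<delta> k < 1/2" unfolding eventually_sequentially by blast
  have 1: "eventually (\<lambda>n. K \<le> low_cut n) sequentially" using low_cut_at_top by (auto simp: filterlim_at_top)
  have "(\<lambda>n. 2 * real g * (\<rho>c * (real (m n) powr (\<theta> * (1 + \<bar>d\<bar>) - 1) * (1 + ln (real (m n))) ^ 1))) \<longlonglongrightarrow> 2 * real g * (\<rho>c * 0)"
    using \<theta> by (intro tendsto_mult_left null_seq) auto
  hence 2: "eventually (\<lambda>n. 2 * real g * (\<rho>c * (real (m n) powr (\<theta> * (1 + \<bar>d\<bar>) - 1) * (1 + ln (real (m n))) ^ 1)) < 1/8) sequentially"
    by (rule order_tendstoD) simp
  show ?thesis using 1 2 eventually_admissible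
  proof eventually_elim
    case (elim n)
    have "\<delta> k \<le> 1/2" if "k \<in> highf n" for k
      using K[of k] elim that by (auto simp: highf_def intro: less_imp_le)
    moreover have "2 * real g * \<rho> k j \<le> 1/8" if kj: "k \<in> highf n" "j \<in> highf n" "k < j" for k j
    proof -
      have "2 * real g * \<rho> k j \<le> 2 * real g * (\<rho>c * (real (m n) powr (\<theta> * (1 + \<bar>d\<bar>) - 1) * (1 + ln (real (m n))) ^ 1))"
        using \<rho>_high(2)[OF elim(3) kj] by (intro mult_left_mono) auto
      thus ?thesis using elim by linarith
    qed
    ultimately show ?case using elim by (auto simp: settled_def)
  qed
qed

lemma log_cov_sym: "log_cov n k j = log_cov n j k"
  by (simp add: log_cov_def mult.commute)

text \<open>One factor \<open>1 / k\<close> of the square is traded for \<open>1 / low_cut\<close>,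
  the other is kept for a harmonic sum. The estimate has the smaller index in the denominator; the
  sum \<open>1 / k + 1 / j\<close> makes it symmetric. The constant is
  \<open>256 * 2\<^sup>2\<close>.\<close>

lemma log_cov_high:
  assumes f: "settled n" and kj: "k \<in> highf n" "j \<in> highf n" "k \<noteq> j"
  shows "\<bar>log_cov n k j\<bar> \<le> 1024 * (real g * rho_bar n)\<^sup>2 * (1 / real (low_cut n)) * (1 / real k + 1 / real j)"
proof -
  have gd0: "admissible n" using f by (simp add: settled_def)
  note gd = admissibleD[OF gd0]
  have main: "\<bar>log_cov n k j\<bar> \<le> 1024 * (real g * rho_bar n)\<^sup>2 * (1 / real (low_cut n)) * (1 / real k)"
    if kj: "k \<in> highf n" "j \<in> highf n" "k < j" for k j
  proof -
    have k1: "1 \<le> k" "low_cut n \<le> k" using kj by (auto simp: highf_def)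
    have "\<bar>log_cov n k j\<bar> \<le> 256 * (2 * real g * \<rho> k j)\<^sup>2"
      unfolding log_cov_eq[OF in_band_sets(2)[OF gd0 kj(1)] in_band_sets(2)[OF gd0 kj(2)]]
      by (rule cov_log_pooled_bound[OF in_band_sets(2)[OF gd0 kj(2)] k1(1) kj(3)]) (use f kj in \<open>auto simp: settled_def\<close>)
    also have "\<dots> \<le> 256 * (2 * real g * (rho_bar n / real k))\<^sup>2"
      using \<rho>_high(1)[OF gd0 kj] \<rho>_nonneg[of j k] kj k1 by (intro mult_left_mono power_mono mult_nonneg_nonneg) auto
    also have "\<dots> = 1024 * (real g * rho_bar n)\<^sup>2 * ((1 / real k) * (1 / real k))"
      by (simp add: power2_eq_square)
    also have "\<dots> \<le> 1024 * (real g * rho_bar n)\<^sup>2 * ((1 / real (low_cut n)) * (1 / real k))"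
      using k1 low_cut_bounds(3)[OF gd(2)] by (intro mult_left_mono mult_right_mono divide_left_mono) auto
    finally show ?thesis by (simp add: mult.assoc)
  qed
  have pos: "0 \<le> 1024 * (real g * rho_bar n)\<^sup>2 * (1 / real (low_cut n))" by simp
  consider "k < j" | "j < k" using kj by linarith
  thus ?thesis
  proof cases
    case 1
    have "\<bar>log_cov n k j\<bar> \<le> 1024 * (real g * rho_bar n)\<^sup>2 * (1 / real (low_cut n)) * (1 / real k)" by (rule main[OF kj(1,2) 1])
    also have "\<dots> \<le> 1024 * (real g * rho_bar n)\<^sup>2 * (1 / real (low_cut n)) * (1 / real k + 1 / real j)"
      by (intro mult_left_mono[OF _ pos]) simp
    finally show ?thesis .
  next
    case 2
    have "\<bar>log_cov n k j\<bar> \<le> 1024 * (real g * rho_bar n)\<^sup>2 * (1 / real (low_cut n)) * (1 / real j)"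
      unfolding log_cov_sym[of n k j] by (rule main[OF kj(2,1) 2])
    also have "\<dots> \<le> 1024 * (real g * rho_bar n)\<^sup>2 * (1 / real (low_cut n)) * (1 / real k + 1 / real j)"
      by (intro mult_left_mono[OF _ pos]) simp
    finally show ?thesis .
  qed
qed

definition diag_part :: "nat \<Rightarrow> real" where "diag_part n = (\<Sum>k\<in>highf n. (weight n k)\<^sup>2 * log_cov n k k)"

text \<open>Counting exponents of \<open>m\<close>: two weights give \<open>- 2\<close>, the free
  summation index 1, the multiplication by \<open>m\<close> another 1, the square of
  \<open>rho_bar\<close> gives \<open>2 * \<theta> * \<bar>d\<bar>\<close> and the cut
  \<open>\<theta> - 1\<close>. Of the five logarithms two come from the weights, two from
  \<open>rho_bar\<close> and one from the harmonic sum.\<close>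

lemma vhigh_diag:
  assumes f: "settled n"
  shows "\<bar>real (m n) * vhigh n - real (m n) * diag_part n\<bar> \<le> 2048 * (real g * \<rho>c)\<^sup>2 * (real (m n) powr (\<theta> * (1 + 2 * \<bar>d\<bar>) - 1) * (1 + ln (real (m n))) ^ 5)"
proof -
  have gd0: "admissible n" using f by (simp add: settled_def)
  note gd = admissibleD[OF gd0]
  define l where "l = ln (real (m n))"
  have l: "1 \<le> l" using gd(5) by (simp add: l_def)
  define q where "q = real (m n)"
  have q: "1 \<le> q" using gd(2) by (simp add: q_def)
  define E where "E = 1024 * (real g * rho_bar n)\<^sup>2 * (1 / real (low_cut n))"
  have E: "0 \<le> E" by (simp add: E_def)
  define H where "H = highf n"
  have finH: "finite H" by (simp add: H_def fin_sets)
  have HS: "H \<subseteq> {1..m n}" by (auto simp: H_def highf_def)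
  have "vhigh n = (\<Sum>k\<in>H. \<Sum>j\<in>H. weight n k * weight n j * log_cov n k j)"
    unfolding vhigh_def H_def by (rule sum_centred_log_square) (use fin_sets in_band_sets gd0 in auto)
  also have "\<dots> = (\<Sum>k\<in>H. (weight n k)\<^sup>2 * log_cov n k k + (\<Sum>j\<in>H - {k}. weight n k * weight n j * log_cov n k j))"
  proof (intro sum.cong refl)
    fix k assume k: "k \<in> H"
    show "(\<Sum>j\<in>H. weight n k * weight n j * log_cov n k j) = (weight n k)\<^sup>2 * log_cov n k k + (\<Sum>j\<in>H - {k}. weight n k * weight n j * log_cov n k j)"
      using sum.remove[OF finH k, of "\<lambda>j. weight n k * weight n j * log_cov n k j"] by (simp add: power2_eq_square)
  qed
  finally have split: "vhigh n - diag_part n = (\<Sum>k\<in>H. \<Sum>j\<in>H - {k}. weight n k * weight n j * log_cov n k j)"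
    by (simp add: diag_part_def H_def sum.distrib)
  have "\<bar>vhigh n - diag_part n\<bar> \<le> (\<Sum>k\<in>H. \<Sum>j\<in>H - {k}. \<bar>weight n k * weight n j * log_cov n k j\<bar>)"
    unfolding split by (rule order_trans[OF sum_abs]) (intro sum_mono sum_abs)
  also have "\<dots> \<le> (\<Sum>k\<in>H. \<Sum>j\<in>H - {k}. (l / q) * (l / q) * (E * (1 / real k + 1 / real j)))"
  proof (intro sum_mono)
    fix k j assume kj: "k \<in> H" "j \<in> H - {k}"
    have kH: "k \<in> highf n" "j \<in> highf n" "k \<noteq> j" using kj unfolding H_def by blast+
    have kS: "k \<in> {1..m n}" "j \<in> {1..m n}" using kj HS by blast+
    have C: "\<bar>log_cov n k j\<bar> \<le> E * (1 / real k + 1 / real j)"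
      unfolding E_def by (rule log_cov_high[OF f kH])
    have a: "\<bar>weight n k\<bar> \<le> l / q" "\<bar>weight n j\<bar> \<le> l / q" unfolding l_def q_def by (rule gd(6)[OF kS(1)], rule gd(6)[OF kS(2)])
    have lq: "0 \<le> l / q" using l q by simp
    have "\<bar>weight n k\<bar> * \<bar>weight n j\<bar> \<le> (l / q) * (l / q)" by (rule mult_mono[OF a lq abs_ge_zero])
    from mult_mono[OF this C mult_nonneg_nonneg[OF lq lq] abs_ge_zero]
    show "\<bar>weight n k * weight n j * log_cov n k j\<bar> \<le> (l / q) * (l / q) * (E * (1 / real k + 1 / real j))"
      unfolding abs_mult .
  qed
  also have "\<dots> \<le> (\<Sum>k\<in>{1..m n}. \<Sum>j\<in>{1..m n}. (l / q) * (l / q) * (E * (1 / real k + 1 / real j)))"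
  proof -
    have nn: "0 \<le> (l / q) * (l / q) * (E * (1 / real k + 1 / real j))" for k j
      using l q E by (intro mult_nonneg_nonneg add_nonneg_nonneg) auto
    have "(\<Sum>k\<in>H. \<Sum>j\<in>H - {k}. (l / q) * (l / q) * (E * (1 / real k + 1 / real j))) \<le> (\<Sum>k\<in>H. \<Sum>j\<in>{1..m n}. (l / q) * (l / q) * (E * (1 / real k + 1 / real j)))"
      using HS nn by (intro sum_mono sum_mono2) auto
    also have "\<dots> \<le> (\<Sum>k\<in>{1..m n}. \<Sum>j\<in>{1..m n}. (l / q) * (l / q) * (E * (1 / real k + 1 / real j)))"
      using HS nn by (intro sum_mono2 sum_nonneg) auto
    finally show ?thesis .
  qed
  also have "\<dots> = (l / q) * (l / q) * (E * (2 * (q * (\<Sum>k=1..m n. 1 / real k))))"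
  proof -
    define S where "S = (\<Sum>k=1..m n. 1 / real k)"
    have "(\<Sum>k\<in>{1..m n}. \<Sum>j\<in>{1..m n}. 1 / real k + 1 / real j) = (\<Sum>k\<in>{1..m n}. q * (1 / real k) + S)"
      by (simp add: sum.distrib S_def q_def)
    also have "\<dots> = q * S + q * S" unfolding sum.distrib sum_distrib_left[symmetric] S_def[symmetric] by (simp add: q_def)
    finally have "(\<Sum>k\<in>{1..m n}. \<Sum>j\<in>{1..m n}. 1 / real k + 1 / real j) = 2 * (q * S)" by simp
    thus ?thesis unfolding sum_distrib_left[symmetric] S_def by simp
  qed
  also have "\<dots> \<le> (l / q) * (l / q) * (E * (2 * (q * (1 + l))))"
    using l q E sum_inverse_le[OF gd(2)] unfolding l_def[symmetric] by (intro mult_left_mono mult_nonneg_nonneg) auto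
  finally have "\<bar>vhigh n - diag_part n\<bar> \<le> (l / q) * (l / q) * (E * (2 * (q * (1 + l))))" .
  hence "q * \<bar>vhigh n - diag_part n\<bar> \<le> q * ((l / q) * (l / q) * (E * (2 * (q * (1 + l)))))"
    using q by (intro mult_left_mono) auto
  also have "\<dots> = 2 * E * (l\<^sup>2 * (1 + l))" using q by (simp add: power2_eq_square)
  also have "\<dots> \<le> 2 * (1024 * (real g * \<rho>c)\<^sup>2 * (q powr (\<theta> * (1 + 2 * \<bar>d\<bar>) - 1) * (1 + l)\<^sup>2)) * ((1 + l)\<^sup>2 * (1 + l))"
  proof (intro mult_mono power_mono)
    have "E \<le> 1024 * (real g * rho_bar n)\<^sup>2 * q powr (\<theta> - 1)"
      unfolding E_def q_def by (intro mult_left_mono low_cut_bounds gd) auto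
    also have "\<dots> = 1024 * (real g * \<rho>c)\<^sup>2 * ((q powr (\<theta> * \<bar>d\<bar>) * q powr (\<theta> * \<bar>d\<bar>) * q powr (\<theta> - 1)) * (1 + l)\<^sup>2)"
      unfolding rho_bar_def l_def[symmetric] unfolding q_def[symmetric] by (simp add: power2_eq_square mult_ac)
    also have "q powr (\<theta> * \<bar>d\<bar>) * q powr (\<theta> * \<bar>d\<bar>) * q powr (\<theta> - 1) = q powr (\<theta> * (1 + 2 * \<bar>d\<bar>) - 1)"
      unfolding powr_add[symmetric] by (simp add: algebra_simps)
    finally show "E \<le> 1024 * (real g * \<rho>c)\<^sup>2 * (q powr (\<theta> * (1 + 2 * \<bar>d\<bar>) - 1) * (1 + l)\<^sup>2)" .
  qed (use l E in auto)
  also have "\<dots> = 2048 * (real g * \<rho>c)\<^sup>2 * (q powr (\<theta> * (1 + 2 * \<bar>d\<bar>) - 1) * (1 + l) ^ 5)"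
    by (simp add: power2_eq_square numeral_eq_Suc mult_ac)
  finally show ?thesis using q unfolding q_def l_def right_diff_distrib[symmetric] abs_mult by simp
qed

text \<open>All squares together sum to \<open>1 / (4 * lnvar)\<close>, asymptotically
  \<open>1 / (4 * m)\<close>. After multiplication by \<open>m\<close> those below the cut
  contribute at most \<open>m powr (- \<theta>)\<close> up to logarithms.\<close>

lemma sum_sq_high: "(\<lambda>n. real (m n) * (\<Sum>k\<in>highf n. (weight n k)\<^sup>2)) \<longlonglongrightarrow> 1/4"
proof -
  have low0: "(\<lambda>n. real (m n) * (\<Sum>k\<in>lowf n. (weight n k)\<^sup>2)) \<longlonglongrightarrow> 0"
  proof (rule Lim_null_comparison)
    show "eventually (\<lambda>n. norm (real (m n) * (\<Sum>k\<in>lowf n. (weight n k)\<^sup>2)) \<le> 2 * (real (m n) powr (- \<theta>) * (1 + ln (real (m n))) ^ 2)) sequentially"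
      using eventually_admissible
    proof eventually_elim
      case (elim n)
      note gd = admissibleD[OF elim]
      define l where "l = ln (real (m n))"
      have l: "1 \<le> l" using gd(5) by (simp add: l_def)
      have "(\<Sum>k\<in>lowf n. (weight n k)\<^sup>2) \<le> (\<Sum>k\<in>lowf n. \<bar>weight n k\<bar> * (l / real (m n)))"
      proof (rule sum_mono)
        fix k assume "k \<in> lowf n"
        hence "\<bar>weight n k\<bar> \<le> l / real (m n)" unfolding l_def by (intro gd(6)) (auto simp: lowf_def)
        hence "\<bar>weight n k\<bar> * \<bar>weight n k\<bar> \<le> \<bar>weight n k\<bar> * (l / real (m n))" by (intro mult_left_mono) auto
        thus "(weight n k)\<^sup>2 \<le> \<bar>weight n k\<bar> * (l / real (m n))" by (simp add: power2_eq_square)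
      qed
      also have "\<dots> = (\<Sum>k\<in>lowf n. \<bar>weight n k\<bar>) * (l / real (m n))" by (simp only: sum_distrib_right)
      also have "\<dots> \<le> (2 * real (m n) powr (- \<theta>) * l) * (l / real (m n))"
        using sum_abs_low[OF elim] l unfolding l_def by (intro mult_right_mono) auto
      finally have "real (m n) * (\<Sum>k\<in>lowf n. (weight n k)\<^sup>2) \<le> real (m n) * ((2 * real (m n) powr (- \<theta>) * l) * (l / real (m n)))"
        by (intro mult_left_mono) auto
      also have "\<dots> = 2 * (real (m n) powr (- \<theta>) * l\<^sup>2)" using gd(2) by (simp add: power2_eq_square)
      also have "\<dots> \<le> 2 * (real (m n) powr (- \<theta>) * (1 + l)\<^sup>2)" using l by (intro mult_left_mono power_mono) auto
      finally show ?case by (simp add: l_def sum_nonneg abs_mult)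
    qed
    show "(\<lambda>n. 2 * (real (m n) powr (- \<theta>) * (1 + ln (real (m n))) ^ 2)) \<longlonglongrightarrow> 0"
      using tendsto_mult_left[OF null_seq[of "- \<theta>" 2], of 2] \<theta> by simp
  qed
  have "(\<lambda>n. 1 / (4 * (lnvar (m n) / real (m n))) - real (m n) * (\<Sum>k\<in>lowf n. (weight n k)\<^sup>2)) \<longlonglongrightarrow> 1 / (4 * 1) - 0"
    by (intro tendsto_diff low0 tendsto_divide tendsto_mult_left lnvar_lim tendsto_const) simp
  moreover have "eventually (\<lambda>n. 1 / (4 * (lnvar (m n) / real (m n))) - real (m n) * (\<Sum>k\<in>lowf n. (weight n k)\<^sup>2) = real (m n) * (\<Sum>k\<in>highf n. (weight n k)\<^sup>2)) sequentially"
    using eventually_admissible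
  proof eventually_elim
    case (elim n)
    note gd = admissibleD[OF elim]
    have "(\<Sum>k\<in>lowf n. (weight n k)\<^sup>2) + (\<Sum>k\<in>highf n. (weight n k)\<^sup>2) = (\<Sum>k=1..m n. (weight n k)\<^sup>2)"
      using sum.union_disjoint[OF fin_sets(1-3), of "\<lambda>k. (weight n k)\<^sup>2" n] unfolding fin_sets(4) by simp
    also have "\<dots> = 1 / (4 * lnvar (m n))" by (rule sum_lp_weight(3)[OF gd(1-3)])
    finally have "(\<Sum>k\<in>highf n. (weight n k)\<^sup>2) = 1 / (4 * lnvar (m n)) - (\<Sum>k\<in>lowf n. (weight n k)\<^sup>2)" by linarith
    thus ?case using gd(2,3) by (simp add: right_diff_distrib)
  qed
  ultimately show ?thesis using tendsto_cong by fastforce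
qed

text \<open>The cut eventually exceeds the \<open>K\<close> of \<open>var_log_pooled_limit\<close>,
  so all diagonal variances above it are uniformly close to the trigamma value.\<close>

lemma diag_part_lim: "(\<lambda>n. real (m n) * diag_part n) \<longlonglongrightarrow> Polygamma 1 (real g) / 4"
proof -
  define P where "P = Polygamma 1 (real g)"
  define s where "s n = real (m n) * (\<Sum>k\<in>highf n. (weight n k)\<^sup>2)" for n
  have s: "s \<longlonglongrightarrow> 1/4" unfolding s_def by (rule sum_sq_high)
  have "(\<lambda>n. real (m n) * diag_part n - P * s n) \<longlonglongrightarrow> 0"
  proof (rule tendstoI)
    fix \<epsilon> :: real assume \<epsilon>: "0 < \<epsilon>"
    obtain K where K: "1 \<le> K" "\<And>n k. in_band n k \<Longrightarrow> K \<le> k \<Longrightarrow>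
     \<bar>expectation (\<lambda>x. (log_pooled n k x)\<^sup>2) - (expectation (log_pooled n k))\<^sup>2 - Polygamma 1 (real g)\<bar> < \<epsilon>"
      using var_log_pooled_limit[OF \<epsilon>] by blast
    have 1: "eventually (\<lambda>n. K \<le> low_cut n) sequentially" using low_cut_at_top by (auto simp: filterlim_at_top)
    have 2: "eventually (\<lambda>n. s n < 1) sequentially" by (rule order_tendstoD[OF s]) simp
    show "eventually (\<lambda>n. dist (real (m n) * diag_part n - P * s n) 0 < \<epsilon>) sequentially"
      using 1 2 eventually_admissible
    proof eventually_elim
      case (elim n)
      have "real (m n) * diag_part n - P * s n = real (m n) * (\<Sum>k\<in>highf n. (weight n k)\<^sup>2 * (log_cov n k k - P))"
        by (simp add: diag_part_def s_def right_diff_distrib sum_subtractf sum_distrib_left mult_ac)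
      also have "\<bar>\<dots>\<bar> \<le> real (m n) * (\<Sum>k\<in>highf n. (weight n k)\<^sup>2 * \<epsilon>)"
        unfolding abs_mult abs_of_nat
      proof (intro mult_left_mono order_trans[OF sum_abs] sum_mono)
        fix k assume k: "k \<in> highf n"
        have "\<bar>log_cov n k k - P\<bar> \<le> \<epsilon>" unfolding log_cov_diag[OF in_band_sets(2)[OF elim(3) k]] P_def
          using K(2)[OF in_band_sets(2)[OF elim(3) k]] k elim(1) by (auto simp: highf_def intro: less_imp_le)
        thus "\<bar>(weight n k)\<^sup>2 * (log_cov n k k - P)\<bar> \<le> (weight n k)\<^sup>2 * \<epsilon>" by (simp add: abs_mult mult_left_mono)
      qed auto
      also have "\<dots> = s n * \<epsilon>" by (simp add: s_def sum_distrib_right)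
      also have "\<dots> < 1 * \<epsilon>" using elim \<epsilon> by (intro mult_strict_right_mono) auto
      finally show ?case by simp
    qed
  qed
  from tendsto_add[OF this tendsto_mult_left[OF s, of P]] show ?thesis by (simp add: P_def)
qed

lemma vhigh_lim: "(\<lambda>n. real (m n) * vhigh n) \<longlonglongrightarrow> Polygamma 1 (real g) / 4"
proof -
  have "(\<lambda>n. real (m n) * vhigh n - real (m n) * diag_part n) \<longlonglongrightarrow> 0"
  proof (rule Lim_null_comparison)
    show "eventually (\<lambda>n. norm (real (m n) * vhigh n - real (m n) * diag_part n) \<le> 2048 * (real g * \<rho>c)\<^sup>2 * (real (m n) powr (\<theta> * (1 + 2 * \<bar>d\<bar>) - 1) * (1 + ln (real (m n))) ^ 5)) sequentially"
      using eventually_settled by eventually_elim (use vhigh_diag in simp)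
    show "(\<lambda>n. 2048 * (real g * \<rho>c)\<^sup>2 * (real (m n) powr (\<theta> * (1 + 2 * \<bar>d\<bar>) - 1) * (1 + ln (real (m n))) ^ 5)) \<longlonglongrightarrow> 0"
      using tendsto_mult_left[OF null_seq[of "\<theta> * (1 + 2 * \<bar>d\<bar>) - 1" 5], of "2048 * (real g * \<rho>c)\<^sup>2"] \<theta> by simp
  qed
  from tendsto_add[OF this diag_part_lim] show ?thesis by simp
qed

text \<open>The mixed term between the parts below and above the cut is bounded by a weighted
  inequality of arithmetic and geometric means instead of single covariances; this suffices because
  the lower part is small in mean square.\<close>

lemma variance_lim: "(\<lambda>n. real (m n) * variance (d_hat X g n (m n))) \<longlonglongrightarrow> Polygamma 1 (real g) / 4"
proof -
  define v where "v n = variance (d_hat X g n (m n))" for n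
  \<comment> \<open>The AM-GM weight \<open>t n\<close> tends to infinity, but slowly enough that \<open>t n * x n\<close> still vanishes.\<close>
  define t where "t n = real (m n) powr (\<theta> - 1/2)" for n
  define x where "x n = 4 * (13824 * Bq) * (real (m n) powr (1 - 2 * \<theta>) * (1 + ln (real (m n))) ^ 2)" for n
  have cross: "eventually (\<lambda>n. norm (real (m n) * v n - real (m n) * vhigh n) \<le> x n + (t n * x n + (real (m n) * vhigh n) * (1 / t n))) sequentially"
    using eventually_admissible
  proof eventually_elim
    case (elim n)
    note gd = admissibleD[OF elim]
    define A where "A y = (\<Sum>k\<in>lowf n. weight n k * centred_log n k y)" for y
    define B where "B y = (\<Sum>k\<in>highf n. weight n k * centred_log n k y)" for y
    have [measurable]: "A \<in> borel_measurable M" "B \<in> borel_measurable M"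
      unfolding A_def[abs_def] B_def[abs_def] by measurable
    have iA: "integrable M (\<lambda>y. (A y)\<^sup>2)" and iB: "integrable M (\<lambda>y. (B y)\<^sup>2)"
      unfolding A_def B_def using sum_centred_log_square(1) fin_sets in_band_sets[OF elim] by auto
    have iAB: "integrable M (\<lambda>y. A y * B y)" by (rule integrable_mult_of_squares[OF _ _ iA iB]) auto
    have eA: "vlow n = expectation (\<lambda>y. (A y)\<^sup>2)" and eB: "vhigh n = expectation (\<lambda>y. (B y)\<^sup>2)"
      by (simp_all add: vlow_def vhigh_def A_def B_def)
    have tp: "0 < t n" using gd(2) by (simp add: t_def)
    have "(\<Sum>k=1..m n. weight n k * centred_log n k y) = A y + B y" for y
      using sum.union_disjoint[OF fin_sets(1-3), of "\<lambda>k. weight n k * centred_log n k y" n] unfolding fin_sets(4) A_def B_def by simp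
    hence "v n = expectation (\<lambda>y. (A y)\<^sup>2 + (B y)\<^sup>2 + 2 * (A y * B y))"
      unfolding v_def d_hat_centred(4)[OF elim] by (simp add: power2_sum mult.assoc)
    also have "\<dots> = vlow n + vhigh n + 2 * expectation (\<lambda>y. A y * B y)"
      using iA iB iAB by (simp add: eA eB)
    finally have v: "v n - vhigh n = vlow n + 2 * expectation (\<lambda>y. A y * B y)" by simp
    have "\<bar>2 * e\<bar> = 2 * \<bar>e\<bar>" for e :: real by simp
    hence "\<bar>2 * expectation (\<lambda>y. A y * B y)\<bar> = 2 * \<bar>expectation (\<lambda>y. A y * B y)\<bar>" .
    also have "\<dots> \<le> 2 * expectation (\<lambda>y. \<bar>A y * B y\<bar>)"
      by (intro mult_left_mono integral_abs_bound) simp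
    also have "\<dots> = expectation (\<lambda>y. 2 * \<bar>A y * B y\<bar>)" by simp
    also have "\<dots> \<le> expectation (\<lambda>y. t n * (A y)\<^sup>2 + (B y)\<^sup>2 * (1 / t n))"
    proof (rule integral_mono)
      fix y
      have "2 * (sqrt (t n) * \<bar>A y\<bar>) * (\<bar>B y\<bar> / sqrt (t n)) \<le> (sqrt (t n) * \<bar>A y\<bar>)\<^sup>2 + (\<bar>B y\<bar> / sqrt (t n))\<^sup>2"
        by (rule sum_squares_bound)
      thus "2 * \<bar>A y * B y\<bar> \<le> t n * (A y)\<^sup>2 + (B y)\<^sup>2 * (1 / t n)"
        using tp by (simp add: power_mult_distrib power_divide abs_mult)
    qed (use iA iB iAB in auto)
    also have "\<dots> = t n * vlow n + vhigh n * (1 / t n)" using iA iB by (simp add: eA eB)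
    finally have c: "\<bar>2 * expectation (\<lambda>y. A y * B y)\<bar> \<le> t n * vlow n + vhigh n * (1 / t n)" .
    note vl = vlow_bound[OF elim]
    have "\<bar>v n - vhigh n\<bar> \<le> vlow n + (t n * vlow n + vhigh n * (1 / t n))" unfolding v using c vl(1) by linarith
    hence "real (m n) * \<bar>v n - vhigh n\<bar> \<le> real (m n) * (vlow n + (t n * vlow n + vhigh n * (1 / t n)))" by (intro mult_left_mono) auto
    also have "\<dots> = real (m n) * vlow n + (t n * (real (m n) * vlow n) + (real (m n) * vhigh n) * (1 / t n))"
      by (simp add: distrib_left mult_ac)
    also have "\<dots> \<le> x n + (t n * x n + (real (m n) * vhigh n) * (1 / t n))"
      using vl(2) tp unfolding x_def by (intro add_mono mult_left_mono order_refl) auto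
    finally show ?case unfolding real_norm_def right_diff_distrib[symmetric] abs_mult by simp
  qed
  have x: "x \<longlonglongrightarrow> 0"
    using tendsto_mult_left[OF null_seq[of "1 - 2 * \<theta>" 2], of "4 * (13824 * Bq)"] \<theta> unfolding x_def by simp
  have "(\<lambda>n. 4 * (13824 * Bq) * (real (m n) powr (1/2 - \<theta>) * (1 + ln (real (m n))) ^ 2)) \<longlonglongrightarrow> 0"
    using tendsto_mult_left[OF null_seq[of "1/2 - \<theta>" 2], of "4 * (13824 * Bq)"] \<theta> by simp
  moreover have "4 * (13824 * Bq) * (real (m n) powr (1/2 - \<theta>) * (1 + ln (real (m n))) ^ 2) = t n * x n" for n
  proof -
    have "real (m n) powr (1/2 - \<theta>) = real (m n) powr (\<theta> - 1/2) * real (m n) powr (1 - 2 * \<theta>)"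
      unfolding powr_add[symmetric] by (simp add: algebra_simps)
    thus ?thesis by (simp add: t_def x_def)
  qed
  ultimately have tx: "(\<lambda>n. t n * x n) \<longlonglongrightarrow> 0" by simp
  have ti: "(\<lambda>n. 1 / t n) \<longlonglongrightarrow> 0"
  proof -
    have "1 / t n = real (m n) powr (1/2 - \<theta>) * (1 + ln (real (m n))) ^ 0" for n
      using powr_minus_divide[of "real (m n)" "\<theta> - 1/2"] by (simp add: t_def)
    thus ?thesis using null_seq[of "1/2 - \<theta>" 0] \<theta> by simp
  qed
  have "(\<lambda>n. x n + (t n * x n + (real (m n) * vhigh n) * (1 / t n))) \<longlonglongrightarrow> 0 + (0 + Polygamma 1 (real g) / 4 * 0)"
    by (intro tendsto_add tendsto_mult x tx vhigh_lim ti)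
  hence "(\<lambda>n. real (m n) * v n - real (m n) * vhigh n) \<longlonglongrightarrow> 0"
    using Lim_null_comparison[OF cross] by simp
  from tendsto_add[OF this vhigh_lim] show ?thesis by (simp add: v_def)
qed

end

section \<open>Expansion of the logarithm of the smooth factor, and the theorem\<close>

lemma abs_bound_from_derivative:
  fixes F F' :: "real \<Rightarrow> real"
  assumes F: "\<And>x. 0 \<le> x \<Longrightarrow> x \<le> r \<Longrightarrow> (F has_real_derivative F' x) (at x within {0..r})"
    and F': "\<And>x. 0 \<le> x \<Longrightarrow> x \<le> r \<Longrightarrow> \<bar>F' x\<bar> \<le> B * x ^ p" and F0: "F 0 = 0"
    and B: "0 \<le> B" and x: "0 \<le> x" "x \<le> r"
  shows "\<bar>F x\<bar> \<le> B * x ^ Suc p"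
proof -
  have "norm (F x - F 0) \<le> (B * x ^ p) * norm (x - 0)"
  proof (rule field_differentiable_bound[where S = "{0..x}" and f' = F'])
    fix z assume z: "z \<in> {0..x}"
    show "(F has_field_derivative F' z) (at z within {0..x})"
      using z x by (intro DERIV_subset[OF F]) auto
    have "\<bar>F' z\<bar> \<le> B * z ^ p" using z x by (intro F') auto
    also have "\<dots> \<le> B * x ^ p" using z B by (intro mult_left_mono power_mono) auto
    finally show "norm (F' z) \<le> B * x ^ p" by simp
  qed (use x in auto)
  thus ?thesis using x F0 by (simp add: mult_ac)
qed

text \<open>The third derivative is only bounded, so bounds are raised one order at a time, from
  \<open>fs2\<close> to \<open>fs1\<close> to \<open>fs\<close>, by the mean value inequality. The
  relative deviation \<open>z\<close> of \<open>fs\<close> from \<open>fs 0\<close> is of order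
  \<open>x\<^sup>2\<close>, hence the quadratic remainder of the logarithm is of order
  \<open>x ^ 4\<close>, within the cubic error.\<close>

lemma taylor_log_expansion:
  fixes fs fs1 fs2 fs3 :: "real \<Rightarrow> real"
  assumes r: "0 < r"
    and der1: "\<And>x. 0 \<le> x \<Longrightarrow> x \<le> r \<Longrightarrow> (fs has_real_derivative fs1 x) (at x within {0..r})"
    and der2: "\<And>x. 0 \<le> x \<Longrightarrow> x \<le> r \<Longrightarrow> (fs1 has_real_derivative fs2 x) (at x within {0..r})"
    and der3: "\<And>x. 0 \<le> x \<Longrightarrow> x \<le> r \<Longrightarrow> (fs2 has_real_derivative fs3 x) (at x within {0..r})"
    and z: "fs1 0 = 0" and pos: "0 < fs 0"
    and B: "\<And>x. 0 \<le> x \<Longrightarrow> x \<le> r \<Longrightarrow> \<bar>fs2 x\<bar> \<le> B \<and> \<bar>fs3 x\<bar> \<le> B"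
  obtains \<eta> C where "0 < \<eta>" "\<eta> \<le> r" "\<And>x. 0 \<le> x \<Longrightarrow> x \<le> \<eta> \<Longrightarrow> fs 0 / 2 \<le> fs x"
    "\<And>x. 0 < x \<Longrightarrow> x \<le> \<eta> \<Longrightarrow> \<bar>ln (fs x) - ln (fs 0) - fs2 0 / (2 * fs 0) * x\<^sup>2\<bar> \<le> C * x ^ 3"
proof -
  have B0: "0 \<le> B" using B[of 0] r by force
  have 2: "\<bar>fs2 x - fs2 0\<bar> \<le> B * x ^ 1" if "0 \<le> x" "x \<le> r" for x
  proof -
    have "((\<lambda>x. fs2 x - fs2 0) has_real_derivative fs3 x) (at x within {0..r})" if "0 \<le> x" "x \<le> r" for x
      using DERIV_diff[OF der3[OF that] DERIV_const[of "fs2 0"]] by simp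
    thus ?thesis using abs_bound_from_derivative[of r "\<lambda>x. fs2 x - fs2 0" fs3 B 0 x] B that B0 by simp
  qed
  have 1: "\<bar>fs1 x - fs2 0 * x\<bar> \<le> B * x ^ 2" if "0 \<le> x" "x \<le> r" for x
  proof -
    have "((\<lambda>x. fs1 x - fs2 0 * x) has_real_derivative fs2 x - fs2 0) (at x within {0..r})" if "0 \<le> x" "x \<le> r" for x
      by (rule DERIV_diff[OF der2[OF that]]) (auto intro!: derivative_eq_intros)
    thus ?thesis using abs_bound_from_derivative[of r "\<lambda>x. fs1 x - fs2 0 * x" "\<lambda>x. fs2 x - fs2 0" B 1 x] 2 that B0 z
      by (simp add: numeral_2_eq_2)
  qed
  have 0: "\<bar>fs x - fs 0 - fs2 0 * x\<^sup>2 / 2\<bar> \<le> B * x ^ 3" if "0 \<le> x" "x \<le> r" for x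
  proof -
    have "((\<lambda>x. fs x - fs 0 - fs2 0 * x\<^sup>2 / 2) has_real_derivative fs1 x - 0 - fs2 0 * x) (at x within {0..r})" if "0 \<le> x" "x \<le> r" for x
      by (rule DERIV_diff[OF DERIV_diff[OF der1[OF that] DERIV_const]]) (auto intro!: derivative_eq_intros)
    thus ?thesis using abs_bound_from_derivative[of r "\<lambda>x. fs x - fs 0 - fs2 0 * x\<^sup>2 / 2" "\<lambda>x. fs1 x - fs2 0 * x" B 2 x] 1 that B0
      by (simp add: numeral_3_eq_3 numeral_2_eq_2)
  qed
  define a where "a = fs 0"
  have a: "0 < a" using pos by (simp add: a_def)
  \<comment> \<open>From \<open>\<bar>fs2 0\<bar> / 2 \<le> B\<close> and
    \<open>x ^ 3 \<le> r * x\<^sup>2\<close>: the relative deviation of \<open>fs\<close> from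
    \<open>fs 0\<close> is at most \<open>D * x\<^sup>2\<close>.\<close>
  define D where "D = B * (1 + r) / a"
  have D0: "0 \<le> D" using B0 r a by (simp add: D_def)
  define z where "z x = (fs x - a) / a" for x
  have zb: "\<bar>z x\<bar> \<le> D * x\<^sup>2" if "0 \<le> x" "x \<le> r" for x
  proof -
    have "\<bar>fs x - a\<bar> \<le> \<bar>fs2 0\<bar> * x\<^sup>2 / 2 + B * x ^ 3"
      using 0[OF that] abs_mult[of "fs2 0" "x\<^sup>2"] by (simp add: a_def abs_le_iff) linarith
    also have "\<dots> \<le> B * x\<^sup>2 + (B * x\<^sup>2) * r"
    proof (rule add_mono)
      have "\<bar>fs2 0\<bar> * x\<^sup>2 \<le> B * x\<^sup>2" using B[of 0] r by (intro mult_right_mono) auto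
      moreover have "0 \<le> \<bar>fs2 0\<bar> * x\<^sup>2" by simp
      ultimately show "\<bar>fs2 0\<bar> * x\<^sup>2 / 2 \<le> B * x\<^sup>2" by linarith
      have "B * x ^ 3 = (B * x\<^sup>2) * x" by (simp add: power2_eq_square power3_eq_cube)
      also have "\<dots> \<le> (B * x\<^sup>2) * r" using that B0 by (intro mult_left_mono) auto
      finally show "B * x ^ 3 \<le> (B * x\<^sup>2) * r" .
    qed
    also have "\<dots> = D * a * x\<^sup>2"
    proof -
      have Da: "D * a = B * (1 + r)" using a by (simp add: D_def)
      show ?thesis unfolding Da by (simp add: algebra_simps)
    qed
    finally show ?thesis using a by (simp add: z_def divide_le_eq mult_ac)
  qed
  \<comment> \<open>Small enough for \<open>\<eta> \<le> 1\<close> and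
    \<open>D * \<eta> \<le> 1/2\<close>, hence \<open>\<bar>z x\<bar> \<le> 1/2\<close>, where the
    bound on the logarithm applies; the added units serve the case of small
    \<open>D\<close>.\<close>
  define \<eta> where "\<eta> = min r (1 / (2 * (D + 1) + 1))"
  have \<eta>: "0 < \<eta>" "\<eta> \<le> r" "\<eta> \<le> 1" "D * \<eta> \<le> 1/2"
  proof -
    show "0 < \<eta>" "\<eta> \<le> r" using r D0 by (auto simp: \<eta>_def)
    have le: "\<eta> \<le> 1 / (2 * (D + 1) + 1)" by (simp add: \<eta>_def)
    have "1 / (2 * (D + 1) + 1) \<le> 1" using D0 by simp
    thus "\<eta> \<le> 1" using le by linarith
    have "D * \<eta> \<le> D * (1 / (2 * (D + 1) + 1))" using D0 le by (intro mult_left_mono) auto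
    also have "\<dots> \<le> 1/2" using D0 by (simp add: divide_le_eq)
    finally show "D * \<eta> \<le> 1/2" .
  qed
  have z_half: "\<bar>z x\<bar> \<le> 1/2" if "0 \<le> x" "x \<le> \<eta>" for x
  proof -
    have "\<bar>z x\<bar> \<le> D * x\<^sup>2" using that \<eta> by (intro zb) auto
    also have "\<dots> = (D * x) * x" by (simp add: power2_eq_square)
    also have "\<dots> \<le> (D * \<eta>) * 1" using that \<eta> D0 by (intro mult_mono mult_left_mono) auto
    finally show ?thesis using \<eta> by simp
  qed
  have fsz: "fs x = a * (1 + z x)" for x using a by (simp add: z_def field_simps)
  show thesis
  proof (rule that[OF \<eta>(1,2)])
    fix x assume x: "0 \<le> x" "x \<le> \<eta>"
    have "- (1/2) \<le> z x" using z_half[OF x] by (simp add: abs_le_iff)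
    hence "a * (1/2) \<le> a * (1 + z x)" using a by (intro mult_left_mono) auto
    thus "fs 0 / 2 \<le> fs x" by (simp add: fsz[of x] a_def[symmetric])
  next
    fix x assume x: "0 < x" "x \<le> \<eta>"
    have zh: "\<bar>z x\<bar> \<le> 1/2" using x by (intro z_half) auto
    have "ln (fs x) = ln a + ln (1 + z x)" unfolding fsz using a zh by (intro ln_mult_pos) (auto simp: abs_le_iff)
    hence e: "ln (fs x) - ln (fs 0) - fs2 0 / (2 * fs 0) * x\<^sup>2 = (ln (1 + z x) - z x) + (z x - fs2 0 / (2 * a) * x\<^sup>2)"
      by (simp add: a_def)
    have 1: "\<bar>ln (1 + z x) - z x\<bar> \<le> 2 * (z x)\<^sup>2" by (rule abs_ln_one_plus_x_minus_x_bound[OF zh])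
    have "(z x)\<^sup>2 \<le> (D * x\<^sup>2)\<^sup>2" using zb[of x] x \<eta> power_mono[of "\<bar>z x\<bar>" "D * x\<^sup>2" 2] by simp
    also have "\<dots> = D\<^sup>2 * x ^ 3 * x" by (simp add: power2_eq_square power3_eq_cube)
    also have "\<dots> \<le> D\<^sup>2 * x ^ 3 * 1" using x \<eta> by (intro mult_left_mono) auto
    finally have 2: "(z x)\<^sup>2 \<le> D\<^sup>2 * x ^ 3" by simp
    have "z x - fs2 0 / (2 * a) * x\<^sup>2 = (fs x - fs 0 - fs2 0 * x\<^sup>2 / 2) / a" using a by (simp add: z_def a_def field_simps)
    hence 3: "\<bar>z x - fs2 0 / (2 * a) * x\<^sup>2\<bar> \<le> B * x ^ 3 / a"
      using 0[of x] x \<eta> a by (simp add: divide_right_mono)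
    have "\<bar>ln (fs x) - ln (fs 0) - fs2 0 / (2 * fs 0) * x\<^sup>2\<bar> \<le> 2 * (D\<^sup>2 * x ^ 3) + B * x ^ 3 / a"
      unfolding e using 1 2 3 abs_triangle_ineq[of "ln (1 + z x) - z x" "z x - fs2 0 / (2 * a) * x\<^sup>2"] by linarith
    also have "\<dots> = (2 * D\<^sup>2 + B / a) * x ^ 3" by (simp add: algebra_simps)
    finally show "\<bar>ln (fs x) - ln (fs 0) - fs2 0 / (2 * fs 0) * x\<^sup>2\<bar> \<le> (2 * D\<^sup>2 + B / a) * x ^ 3" .
  qed
qed

text \<open>Square integrability is part of the conclusion because expectations of nonintegrable
  functions are 0 by convention, so that the formulas alone would say little. It holds eventually,
  once all frequencies used lie in the band where the spectral density is controlled.\<close>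

theorem theorem4:
  fixes M :: "'a measure" and X :: "nat \<Rightarrow> 'a \<Rightarrow> real"
    and g :: nat and d \<mu> \<nu> \<Omega>0 :: real
    and fs fs1 fs2 fs3 :: "real \<Rightarrow> real" and m :: "nat \<Rightarrow> nat"
  assumes "prob_space M"
    and "g \<ge> 1"
    and gauss: "gaussian_process M X"
    and stat: "\<exists>c. \<forall>s t. prob_space.expectation M (X t) = c \<and>
               prob_space.expectation M (\<lambda>x. (X s x - c) * (X t x - c)) =
               (LINT \<omega>:{-pi..pi}|lborel. \<bar>\<omega>\<bar> powr (-2 * d) * fs \<omega> * cos ((real s - real t) * \<omega>))"
    and d: "-1/2 < d" "d < 1/2"
    and mu: "\<mu> \<ge> 1" and nu: "0 < \<nu>" "\<nu> \<le> 1"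
    and L: "classL \<mu> \<nu> fs"
    and pos0: "fs 0 > 0"
    and Om: "0 < \<Omega>0" "\<Omega>0 \<le> pi"
    and der1: "\<forall>\<omega>\<in>{-\<Omega>0..\<Omega>0}. (fs has_real_derivative fs1 \<omega>) (at \<omega> within {-\<Omega>0..\<Omega>0})"
    and der2: "\<forall>\<omega>\<in>{-\<Omega>0..\<Omega>0}. (fs1 has_real_derivative fs2 \<omega>) (at \<omega> within {-\<Omega>0..\<Omega>0})"
    and der3: "\<forall>\<omega>\<in>{-\<Omega>0..\<Omega>0}. (fs2 has_real_derivative fs3 \<omega>) (at \<omega> within {-\<Omega>0..\<Omega>0})"
    and d1zero: "fs1 0 = 0"
    and bdd: "\<exists>B. \<forall>\<omega>\<in>{-\<Omega>0..\<Omega>0}. \<bar>fs2 \<omega>\<bar> \<le> B \<and> \<bar>fs3 \<omega>\<bar> \<le> B"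
    and m_inf: "filterlim m at_top sequentially"
    and m_o: "(\<lambda>n. real (m n) / real n) \<longlonglongrightarrow> 0"
  shows "eventually (\<lambda>n. integrable M (d_hat X g n (m n)) \<and>
                          integrable M (\<lambda>x. (d_hat X g n (m n) x)\<^sup>2)) sequentially \<and>
          (\<exists>r1 r2. r1 \<in> o(\<lambda>n. real (m n) ^ 2 / real n ^ 2) \<and>
                 r2 \<in> O(\<lambda>n. ln (real (m n)) ^ 3 / real (m n)) \<and>
                 (\<forall>n. prob_space.expectation M (d_hat X g n (m n)) - d =
                    - (2 * pi\<^sup>2 * fs2 0 * real (m n) ^ 2) / (9 * fs 0 * real n ^ 2)
                    + r1 n + r2 n)) \<and>
          (\<exists>r. r \<in> o(\<lambda>n. 1 / real (m n)) \<and>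
             (\<forall>n. prob_space.variance M (d_hat X g n (m n)) =
                    Polygamma 1 (real g) / (4 * real (m n)) + r n))"
proof -
  from bdd obtain B where B: "\<And>w. w \<in> {-\<Omega>0..\<Omega>0} \<Longrightarrow> \<bar>fs2 w\<bar> \<le> B \<and> \<bar>fs3 w\<bar> \<le> B" by blast
  \<comment> \<open>The cap \<open>pi / 2\<close> keeps shifted frequencies within the range of the
    lower bound on the sine.\<close>
  define r where "r = min \<Omega>0 (pi / 2)"
  have r: "0 < r" "r \<le> \<Omega>0" "r \<le> pi / 2" using Om by (auto simp: r_def)
  have sub: "{0..r} \<subseteq> {-\<Omega>0..\<Omega>0}" using r Om by auto
  have "\<exists>\<eta> C. 0 < \<eta> \<and> \<eta> \<le> r \<and> (\<forall>x. 0 \<le> x \<longrightarrow> x \<le> \<eta> \<longrightarrow> fs 0 / 2 \<le> fs x) \<and>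
    (\<forall>x. 0 < x \<longrightarrow> x \<le> \<eta> \<longrightarrow> \<bar>ln (fs x) - ln (fs 0) - fs2 0 / (2 * fs 0) * x\<^sup>2\<bar> \<le> C * x ^ 3)"
  proof -
    have in_dom: "x \<in> {-\<Omega>0..\<Omega>0}" if "0 \<le> x" "x \<le> r" for x using that r Om by auto
    show ?thesis
    proof (rule taylor_log_expansion[OF r(1), of fs fs1 fs2 fs3 B])
      fix x assume x: "0 \<le> x" "x \<le> r"
      show "(fs has_real_derivative fs1 x) (at x within {0..r})" "(fs1 has_real_derivative fs2 x) (at x within {0..r})"
        "(fs2 has_real_derivative fs3 x) (at x within {0..r})" "\<bar>fs2 x\<bar> \<le> B \<and> \<bar>fs3 x\<bar> \<le> B"
        using der1 der2 der3 B in_dom[OF x] DERIV_subset[OF _ sub] by blast+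
    qed (use d1zero pos0 in blast)+
  qed
  then obtain \<eta> CR where \<eta>: "0 < \<eta>" "\<eta> \<le> r" and low: "\<And>x. 0 \<le> x \<Longrightarrow> x \<le> \<eta> \<Longrightarrow> fs 0 / 2 \<le> fs x"
    and expan: "\<And>x. 0 < x \<Longrightarrow> x \<le> \<eta> \<Longrightarrow> \<bar>ln (fs x) - ln (fs 0) - fs2 0 / (2 * fs 0) * x\<^sup>2\<bar> \<le> CR * x ^ 3"
    by blast
  interpret S: spectral_model fs d \<mu> \<nu> \<eta>
    by unfold_locales (use d mu nu L pos0 \<eta> r low in auto)
  from stat obtain c0 where c0: "\<And>t. prob_space.expectation M (X t) = c0"
    "\<And>s t. prob_space.expectation M (\<lambda>x. (X s x - c0) * (X t x - c0)) =
       (LINT \<omega>:{-pi..pi}|lborel. \<bar>\<omega>\<bar> powr (-2 * d) * fs \<omega> * cos ((real s - real t) * \<omega>))"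
    by blast
  interpret P: prob_space M by fact
  interpret lp_asymp fs d \<mu> \<nu> \<eta> M X c0 g m "fs2 0 / (2 * fs 0)" CR
    by unfold_locales (use gauss c0 \<open>g \<ge> 1\<close> m_inf m_o expan in \<open>auto simp: S.acov_def S.spec_dens_def\<close>)
  \<comment> \<open>The value 0 is a default for the finitely many inadmissible \<open>n\<close>.
    \<open>r1\<close> is then defined as what is missing, so the decomposition holds for every
    \<open>n\<close> and only the orders remain to be proved.\<close>
  define r2 where "r2 n = (if admissible n then noise_bias n else 0)" for n
  define r1 where "r1 n = P.expectation (d_hat X g n (m n)) - d + (2 * pi\<^sup>2 * fs2 0 * real (m n) ^ 2) / (9 * fs 0 * real n ^ 2) - r2 n" for n
  have r1: "r1 \<in> o(\<lambda>n. real (m n) ^ 2 / real n ^ 2)"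
  proof (rule smalloI_tendsto)
    show "eventually (\<lambda>n. real (m n) ^ 2 / real n ^ 2 \<noteq> 0) sequentially"
      using eventually_admissible by eventually_elim (use admissibleD(1,2) in fastforce)
    have "(\<lambda>n. smooth_bias n / ((real (m n))\<^sup>2 / (real n)\<^sup>2) + 4 * pi\<^sup>2 * (fs2 0 / (2 * fs 0)) / 9) \<longlonglongrightarrow>
       - (4 * pi\<^sup>2 * (fs2 0 / (2 * fs 0)) / 9) + 4 * pi\<^sup>2 * (fs2 0 / (2 * fs 0)) / 9"
      by (intro tendsto_add smooth_bias_asymp tendsto_const)
    moreover have "eventually (\<lambda>n. smooth_bias n / ((real (m n))\<^sup>2 / (real n)\<^sup>2) + 4 * pi\<^sup>2 * (fs2 0 / (2 * fs 0)) / 9 = r1 n / (real (m n) ^ 2 / real n ^ 2)) sequentially"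
      using eventually_admissible
    proof eventually_elim
      case (elim n)
      have e: "r1 n = smooth_bias n + (2 * pi\<^sup>2 * fs2 0 * real (m n) ^ 2) / (9 * fs 0 * real n ^ 2)"
        unfolding r1_def r2_def using d_hat_centred(3)[OF elim] elim by (simp add: smooth_bias_def noise_bias_def)
      have "4 * p * (s / (2 * f)) / 9 = 2 * p * s * q / (9 * f * N) / (q / N)" if "q \<noteq> 0" "N \<noteq> 0" "f \<noteq> 0" for p s f q N :: real
        using that by (simp add: field_simps)
      from this[of "(real (m n))\<^sup>2" "(real n)\<^sup>2" "fs 0" "pi\<^sup>2" "fs2 0"] admissibleD(1,2)[OF elim] pos0
      show ?case unfolding e add_divide_distrib by simp
    qed
    ultimately show "(\<lambda>n. r1 n / (real (m n) ^ 2 / real n ^ 2)) \<longlonglongrightarrow> 0"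
      using tendsto_cong by fastforce
  qed
  have r2: "r2 \<in> O(\<lambda>n. ln (real (m n)) ^ 3 / real (m n))"
  proof (rule bigoI)
    show "eventually (\<lambda>n. norm (r2 n) \<le> (4 * mean_const) * norm (ln (real (m n)) ^ 3 / real (m n))) sequentially"
      using eventually_admissible
    proof eventually_elim
      case (elim n)
      have "0 \<le> ln (real (m n)) ^ 3 / real (m n)" using admissibleD(5)[OF elim] by simp
      hence "norm (ln (real (m n)) ^ 3 / real (m n)) = ln (real (m n)) ^ 3 / real (m n)" by (simp only: real_norm_def abs_of_nonneg)
      moreover have "norm (r2 n) = \<bar>noise_bias n\<bar>" using elim by (simp add: r2_def)
      ultimately show ?case using noise_bias_bound[OF elim] by (simp only:)
    qed
  qed
  define v where "v n = P.variance (d_hat X g n (m n)) - Polygamma 1 (real g) / (4 * real (m n))" for n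
  have v: "v \<in> o(\<lambda>n. 1 / real (m n))"
  proof (rule smalloI_tendsto)
    show "eventually (\<lambda>n. 1 / real (m n) \<noteq> 0) sequentially"
      using eventually_admissible by eventually_elim (use admissibleD(2) in fastforce)
    have "(\<lambda>n. real (m n) * P.variance (d_hat X g n (m n)) - Polygamma 1 (real g) / 4) \<longlonglongrightarrow> Polygamma 1 (real g) / 4 - Polygamma 1 (real g) / 4"
      by (intro tendsto_diff variance_lim tendsto_const)
    moreover have "eventually (\<lambda>n. real (m n) * P.variance (d_hat X g n (m n)) - Polygamma 1 (real g) / 4 = v n / (1 / real (m n))) sequentially"
      using eventually_admissible
    proof eventually_elim
      case (elim n)
      have "q * V - p / 4 = (V - p / (4 * q)) / (1 / q)" if "q \<noteq> 0" for q V p :: real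
        using that by (simp add: field_simps)
      thus ?case unfolding v_def using admissibleD(2)[OF elim] by simp
    qed
    ultimately show "(\<lambda>n. v n / (1 / real (m n))) \<longlonglongrightarrow> 0"
      using tendsto_cong by fastforce
  qed
  show ?thesis
  proof (intro conjI)
    show "eventually (\<lambda>n. integrable M (d_hat X g n (m n)) \<and> integrable M (\<lambda>x. (d_hat X g n (m n) x)\<^sup>2)) sequentially"
      using eventually_admissible by eventually_elim (use d_hat_centred(1,2) in blast)
    show "\<exists>r1 r2. r1 \<in> o(\<lambda>n. real (m n) ^ 2 / real n ^ 2) \<and>
                 r2 \<in> O(\<lambda>n. ln (real (m n)) ^ 3 / real (m n)) \<and>
                 (\<forall>n. prob_space.expectation M (d_hat X g n (m n)) - d =
                    - (2 * pi\<^sup>2 * fs2 0 * real (m n) ^ 2) / (9 * fs 0 * real n ^ 2)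
                    + r1 n + r2 n)"
      by (intro exI[of _ r1] exI[of _ r2] conjI r1 r2 allI) (simp add: r1_def)
    show "\<exists>r. r \<in> o(\<lambda>n. 1 / real (m n)) \<and>
             (\<forall>n. prob_space.variance M (d_hat X g n (m n)) =
                    Polygamma 1 (real g) / (4 * real (m n)) + r n)"
      by (intro exI[of _ v] conjI v allI) (simp add: v_def)
  qed
qed

end
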